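(* The invariant $\mathrm{ct}(f)+\mathrm{st}(f)$ of a line arrangement $f=0$ in $\mathbb{P}^2$ is not combinatorially determined, i.e. there are two line arrangements in $\mathbb{P}^2$ with isomorphic intersection lattices but different values of this invariant. More precisely, consider the line arrangements $$\mathcal{A}: f=xy(x-y-z)(x-y+z)(2x+y-2z)(x+3y-3z)(3x+2y+3z)(x+5y+5z)(7x-4y-z)=0,$$ $$\mathcal{A}': f'=xy(4x-5y-5z)(x-y+z)(16x+13y-20z)(x+3y-3z)(3x+2y+3z)(x+5y+5z)(7x-4y-z)=0,$$ and let $\mathcal{A}_1:f_1=0$ (resp. $\mathcal{A}_1':f_1'=0$) be the arrangement of 10 lines obtained by adding a generic line to $\mathcal{A}$ (resp. to $\mathcal{A}'$). Then $\mathcal{A}_1$ and $\mathcal{A}_1'$ have isomorphic intersection lattices, while $$\mathrm{ct}(f_1)=14,\quad \mathrm{st}(f_1)=16,\quad \mathrm{ct}(f_1')=15,\quad \mathrm{st}(f_1')=16.$$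
   Context: Let $S=\mathbb{C}[x,y,z]$. For a reduced homogeneous polynomial $f\in S$ of degree $d$ defining the curve $C:f=0$ in $\mathbb{P}^2$, let $J_f=(f_x,f_y,f_z)$ be the Jacobian ideal, $M(f)=S/J_f$ the graded Milnor algebra, and $\tau(C)$ the total Tjurina number of $C$ (the sum of the Tjurina numbers of all singular points of $C$). The coincidence threshold is $$\mathrm{ct}(f)=\max\{q:\dim M(f)_k=\dim M(f_s)_k\text{ for all }k\le q\},$$ where $f_s\in S$ is any homogeneous polynomial of the same degree $d$ such that $f_s=0$ is a smooth curve in $\mathbb{P}^2$. The stability threshold is $$\mathrm{st}(f)=\min\{q:\dim M(f)_k=\tau(C)\text{ for all }k\ge q\}.$$ The intersection lattice of a line arrangement records its lines and their intersection points, with incidence. A generic line means a line outside a suitable proper Zariski closed subset of the dual projective plane; in particular it is not a line of the arrangement and passes through no multiple point of it. *)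

theory Defs
  imports
    Complex_Main
    "HOL-Library.Poly_Mapping"
    "HOL-Library.Product_Plus"
    "HOL-Computational_Algebra.Formal_Power_Series"
    "HOL-Algebra.Embedded_Algebras"
    "HOL-Algebra.QuotRing"
begin

section \<open>The polynomial ring \<open>S = \<complex>[x,y,z]\<close>\<close>

text \<open>The key \<open>(i,j,k)\<close> stands for the monomial \<open>x\<^sup>i y\<^sup>j z\<^sup>k\<close>; multiplication in
  \<^typ>\<open>'a \<Rightarrow>\<^sub>0 'b\<close> is convolution, so this is exactly the polynomial ring in three variables.\<close>

type_synonym poly3 = "(nat \<times> nat \<times> nat) \<Rightarrow>\<^sub>0 complex"

definition const3 :: "complex \<Rightarrow> poly3"
  where "const3 c = Poly_Mapping.single (0, 0, 0) c"

definition poly_x :: poly3 where "poly_x = Poly_Mapping.single (1, 0, 0) 1"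
definition poly_y :: poly3 where "poly_y = Poly_Mapping.single (0, 1, 0) 1"
definition poly_z :: poly3 where "poly_z = Poly_Mapping.single (0, 0, 1) 1"

definition homogeneous3 :: "nat \<Rightarrow> poly3 \<Rightarrow> bool"
  where "homogeneous3 d f \<longleftrightarrow> (\<forall>(i, j, k) \<in> Poly_Mapping.keys f. i + j + k = d)"

definition partial_x :: "poly3 \<Rightarrow> poly3"
  where "partial_x f = (\<Sum>(i, j, k) \<in> Poly_Mapping.keys f.
    Poly_Mapping.single (i - 1, j, k) (of_nat i * Poly_Mapping.lookup f (i, j, k)))"

definition partial_y :: "poly3 \<Rightarrow> poly3"
  where "partial_y f = (\<Sum>(i, j, k) \<in> Poly_Mapping.keys f.
    Poly_Mapping.single (i, j - 1, k) (of_nat j * Poly_Mapping.lookup f (i, j, k)))"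

definition partial_z :: "poly3 \<Rightarrow> poly3"
  where "partial_z f = (\<Sum>(i, j, k) \<in> Poly_Mapping.keys f.
    Poly_Mapping.single (i, j, k - 1) (of_nat k * Poly_Mapping.lookup f (i, j, k)))"

text \<open>Evaluation at a triple in a \<open>\<complex>\<close>-algebra with structure map \<open>\<iota>\<close>.\<close>

definition eval_in :: "(complex \<Rightarrow> 'b::comm_ring_1) \<Rightarrow> poly3 \<Rightarrow> 'b \<times> 'b \<times> 'b \<Rightarrow> 'b"
  where "eval_in \<iota> f = (\<lambda>(a, b, c). \<Sum>(i, j, k) \<in> Poly_Mapping.keys f.
    \<iota> (Poly_Mapping.lookup f (i, j, k)) * a ^ i * b ^ j * c ^ k)"

abbreviation eval3 :: "poly3 \<Rightarrow> complex \<times> complex \<times> complex \<Rightarrow> complex"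
  where "eval3 \<equiv> eval_in (\<lambda>c. c)"


section \<open>Dimensions of pieces of quotient algebras\<close>

definition class_ring_ops :: "'a::comm_ring_1 ring"
  where "class_ring_ops = \<lparr>carrier = UNIV, mult = (*), one = 1, zero = 0, add = (+)\<rparr>"

text \<open>For a \<open>\<complex>\<close>-algebra \<open>R\<close> with structure map \<open>\<iota>\<close>, the ideal \<open>I\<close> generated by \<open>G\<close>, and a
  subspace \<open>V\<close> of \<open>R\<close>: the dimension over \<open>\<complex>\<close> of the image of \<open>V\<close> in \<open>R/I\<close>. The scalars are the
  classes of the constants, which form a field isomorphic to \<open>\<complex>\<close> unless \<open>I = R\<close>; in that case
  \<open>R/I\<close> is the zero ring and the value is \<open>0\<close>.\<close>

definition quot_dim :: "(complex \<Rightarrow> 'a::comm_ring_1) \<Rightarrow> 'a set \<Rightarrow> 'a set \<Rightarrow> nat"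
  where "quot_dim \<iota> G V = (let R = class_ring_ops; I = Idl\<^bsub>R\<^esub> G in
    ring.dim (R Quot I) (range (\<lambda>c. I +>\<^bsub>R\<^esub> \<iota> c)) ((\<lambda>p. I +>\<^bsub>R\<^esub> p) ` V))"

definition milnor_dim :: "poly3 \<Rightarrow> nat \<Rightarrow> nat"
  where "milnor_dim f k =
    quot_dim const3 {partial_x f, partial_y f, partial_z f} {p. homogeneous3 k p}"


section \<open>The projective plane\<close>

type_synonym vec3 = "complex \<times> complex \<times> complex"
type_synonym point = "vec3 set"

text \<open>A point is the set of all its homogeneous coordinate vectors. The dual plane is modelled by
  the same type: the vector \<open>(a,b,c)\<close> stands for the line \<open>ax + by + cz = 0\<close>.\<close>

definition proj_point :: "vec3 \<Rightarrow> point"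
  where "proj_point = (\<lambda>(a, b, c). {(t * a, t * b, t * c) | t. t \<noteq> 0})"

definition proj_plane :: "point set"
  where "proj_plane = proj_point ` {p. p \<noteq> (0, 0, 0)}"

definition zariski_closed :: "point set \<Rightarrow> bool"
  where "zariski_closed Z \<longleftrightarrow> (\<exists>G. (\<forall>g \<in> G. \<exists>d. homogeneous3 d g) \<and>
    Z = {P \<in> proj_plane. \<forall>p \<in> P. \<forall>g \<in> G. eval3 g p = 0})"


section \<open>Singularities and Tjurina numbers\<close>

definition singular_points :: "poly3 \<Rightarrow> point set"
  where "singular_points f = {P \<in> proj_plane. \<forall>p \<in> P. eval3 f p = 0 \<and>
    eval3 (partial_x f) p = 0 \<and> eval3 (partial_y f) p = 0 \<and> eval3 (partial_z f) p = 0}"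

definition smooth_form :: "nat \<Rightarrow> poly3 \<Rightarrow> bool"
  where "smooth_form d f \<longleftrightarrow> homogeneous3 d f \<and> singular_points f = {}"

text \<open>\<^typ>\<open>complex fps fps\<close> is the completed local ring \<open>\<complex>[[u,v]]\<close> of the plane at a point, where
  \<open>u\<close> is the variable of the inner and \<open>v\<close> that of the outer power series.\<close>

definition const_uv :: "complex \<Rightarrow> complex fps fps"
  where "const_uv c = fps_const (fps_const c)"

definition var_u :: "complex fps fps" where "var_u = fps_const fps_X"
definition var_v :: "complex fps fps" where "var_v = fps_X"

definition deriv_u :: "complex fps fps \<Rightarrow> complex fps fps"
  where "deriv_u g = Abs_fps (\<lambda>n. fps_deriv (fps_nth g n))"

definition deriv_v :: "complex fps fps \<Rightarrow> complex fps fps"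
  where "deriv_v g = fps_deriv g"

text \<open>The equation of \<open>f = 0\<close> in a standard affine chart around \<open>P\<close>, with \<open>P\<close> moved to the origin.
  Only ratios of coordinates occur, so the chosen representative does not matter.\<close>

definition local_equation :: "poly3 \<Rightarrow> point \<Rightarrow> complex fps fps"
  where "local_equation f P = (case SOME p. p \<in> P of (a, b, c) \<Rightarrow>
    if c \<noteq> 0 then eval_in const_uv f (const_uv (a / c) + var_u, const_uv (b / c) + var_v, 1)
    else if b \<noteq> 0 then eval_in const_uv f (const_uv (a / b) + var_u, 1, const_uv (c / b) + var_v)
    else eval_in const_uv f (1, const_uv (b / a) + var_u, const_uv (c / a) + var_v))"

definition tjurina_number :: "poly3 \<Rightarrow> point \<Rightarrow> nat"
  where "tjurina_number f P = (let g = local_equation f P in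
    quot_dim const_uv {g, deriv_u g, deriv_v g} UNIV)"

text \<open>A reduced curve has only finitely many singular points, so the sum below is a genuine one.\<close>

definition total_tjurina :: "poly3 \<Rightarrow> nat"
  where "total_tjurina f = (\<Sum>P \<in> singular_points f. tjurina_number f P)"


section \<open>The two thresholds\<close>

text \<open>The smooth comparison form \<open>fs\<close> is kept as a parameter; statements quantify over all
  smooth forms of the same degree as \<open>f\<close>.\<close>

definition ct :: "poly3 \<Rightarrow> poly3 \<Rightarrow> nat"
  where "ct fs f = Max {q. \<forall>k \<le> q. milnor_dim f k = milnor_dim fs k}"

definition st :: "poly3 \<Rightarrow> nat"
  where "st f = (LEAST q. \<forall>k \<ge> q. milnor_dim f k = total_tjurina f)"


section \<open>Line arrangements\<close>

text \<open>An arrangement is given by the list of the coefficient vectors of its lines.\<close>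

definition linear_form :: "vec3 \<Rightarrow> poly3"
  where "linear_form = (\<lambda>(a, b, c). const3 a * poly_x + const3 b * poly_y + const3 c * poly_z)"

definition line :: "vec3 \<Rightarrow> point set"
  where "line l = {P \<in> proj_plane. \<forall>p \<in> P. eval3 (linear_form l) p = 0}"

definition line_arrangement :: "vec3 list \<Rightarrow> bool"
  where "line_arrangement ls \<longleftrightarrow>
    ls \<noteq> [] \<and> (\<forall>l \<in> set ls. l \<noteq> (0, 0, 0)) \<and> distinct (map line ls)"

definition defining_poly :: "vec3 list \<Rightarrow> poly3"
  where "defining_poly ls = prod_list (map linear_form ls)"

definition multiple_points :: "vec3 list \<Rightarrow> point set"
  where "multiple_points ls = \<Union>{L \<inter> L' | L L'. L \<in> line ` set ls \<and> L' \<in> line ` set ls \<and> L \<noteq> L'}"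

text \<open>All intersections of lines of the arrangement: the plane itself (empty intersection), the
  lines, the multiple points (as singletons) and possibly the empty set, which corresponds to the
  origin in the lattice of the central arrangement in \<open>\<complex>\<^sup>3\<close>.\<close>

definition intersection_lattice :: "vec3 list \<Rightarrow> point set set"
  where "intersection_lattice ls = {proj_plane \<inter> \<Inter>(line ` B) | B. B \<subseteq> set ls}"

definition isomorphic_lattices :: "vec3 list \<Rightarrow> vec3 list \<Rightarrow> bool"
  where "isomorphic_lattices ls ls' \<longleftrightarrow>
    (\<exists>\<phi>. bij_betw \<phi> (intersection_lattice ls) (intersection_lattice ls') \<and>
      (\<forall>X \<in> intersection_lattice ls. \<forall>Y \<in> intersection_lattice ls. X \<supseteq> Y \<longleftrightarrow> \<phi> X \<supseteq> \<phi> Y))"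

definition arr_A :: "vec3 list"
  where "arr_A = [(1, 0, 0), (0, 1, 0), (1, -1, -1), (1, -1, 1), (2, 1, -2), (1, 3, -3),
    (3, 2, 3), (1, 5, 5), (7, -4, -1)]"

definition arr_A' :: "vec3 list"
  where "arr_A' = [(1, 0, 0), (0, 1, 0), (4, -5, -5), (1, -1, 1), (16, 13, -20), (1, 3, -3),
    (3, 2, 3), (1, 5, 5), (7, -4, -1)]"

end

theory Submission
  imports Defs "HOL-Computational_Algebra.Computational_Algebra"
begin

text \<open>
  Modulo multiples of the Euler derivation, a syzygy of degree \<open>j\<close> between the partial derivatives of the
  defining polynomial is a derivation of degree \<open>j\<close> tangent to every line. A smooth form of degree \<open>d\<close> has
  no syzygy of degree below \<open>d - 1\<close>, so \<open>ct\<close> is \<open>d - 2\<close> plus the least degree of a syzygy, and in large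
  degrees the dimension of the Milnor algebra is read off that of the space of tangent derivations.
  The latter follows by adding the lines one at a time and restricting to the new line; it depends only on
  the number of triple points, which is six for both arrangements.

  What remains is whether there is a syzygy of degree six. The dimension of that space is at most the corank
  of a matrix of linear relations between the six triple points, one for each line, evaluated where the
  generic line meets the nine others. The lines are the edges of a complete bipartite graph on the triple
  points, so the rank drops only if the ratios around cycles multiply to one. For \<open>\<A>'\<close> and a generic line
  they do not. For \<open>\<A>\<close> there is a derivation of degree five tangent to the nine lines, and its product
  with the equation of the tenth line is a syzygy of degree six.
\<close>

section \<open>Linear algebra in possibly infinite-dimensional spaces\<close>

text \<open>Degree six decides everything. There the derivations tangent to the nine lines have
  dimension 27 and the Euler multiples take up 21, so restriction to the tenth line gives dim syz_6
  = 6 - rank. Each triple point supplies one explicit derivation for the rank: the product of the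
  six lines that miss it, times the constant field pointing to it. Since \<tau> = 45 + 6 = 51 while
  dim M_15 = 52 + dim syz_6, the stability threshold cannot see whether such a syzygy exists, and
  only \<open>ct\<close> separates the two arrangements.

  The comparison with smooth forms is the other obstacle: three forms of equal degree without a
  common zero have no syzygy below that degree. The argument is elementary. Modulo y it concerns
  coprime univariate polynomials; and a zero divisor modulo two of the forms would yield a common
  eigenvector of multiplication by x/y and z/y, whose eigenvalues are the coordinates of a common
  zero.\<close>

locale lin_space = vector_space scale
  for scale :: "'a::field \<Rightarrow> 'b::ab_group_add \<Rightarrow> 'b"
begin

text \<open>Polynomials, triples and power series form infinite-dimensional spaces in which only the
  graded pieces are finite-dimensional, so finiteness is a property of the subset and not of the
  space.\<close>

definition fin_dim :: "'b set \<Rightarrow> bool"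
  where "fin_dim V \<longleftrightarrow> (\<exists>B. finite B \<and> V \<subseteq> span B)"

lemma fin_dim_mono: "fin_dim V \<Longrightarrow> U \<subseteq> V \<Longrightarrow> fin_dim U"
  unfolding fin_dim_def by blast

lemma finite_independent_fin_dim:
  assumes "fin_dim V" "independent B" "B \<subseteq> V"
  shows "finite B"
  using assms independent_span_bound unfolding fin_dim_def by (metis subset_trans)

lemma fin_dim_basis:
  assumes "fin_dim V"
  obtains B where "B \<subseteq> V" "finite B" "independent B" "V \<subseteq> span B" "card B = dim V"
  using basis_exists[of V] finite_independent_fin_dim[OF assms] by metis

lemma dim_mono_fin_dim:
  assumes "fin_dim V" "U \<subseteq> span V"
  shows "dim U \<le> dim V"
proof -
  obtain B where B: "B \<subseteq> V" "finite B" "V \<subseteq> span B" "card B = dim V"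
    using fin_dim_basis[OF assms(1)] by metis
  have "U \<subseteq> span B" using assms(2) B(3) by (metis span_minimal subspace_span subset_trans)
  with B dim_le_card show ?thesis by metis
qed

lemma dim_subset_fin_dim: "fin_dim V \<Longrightarrow> U \<subseteq> V \<Longrightarrow> dim U \<le> dim V"
  using dim_mono_fin_dim span_superset by (meson subset_trans)

lemma dim_zero_fin_dim: "fin_dim V \<Longrightarrow> dim V = 0 \<longleftrightarrow> V \<subseteq> {0}"
proof
  assume "fin_dim V" "dim V = 0"
  then obtain B where "finite B" "V \<subseteq> span B" "card B = 0" using fin_dim_basis by metis
  then show "V \<subseteq> {0}" by simp
next
  assume "V \<subseteq> {0}"
  then have "V \<subseteq> span {}" by simp
  then show "dim V = 0" using dim_le_card[of V "{}"] by simp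
qed

text \<open>Indexing the family by \<open>A\<close> lets independence be tested on coefficients
  alone; injectivity of \<open>e\<close> follows, since \<open>e i = e j\<close> would be a relation
  with coefficients 1 and -1.\<close>

lemma dim_family:
  fixes e :: "'i \<Rightarrow> 'b"
  assumes "finite A" "V = span (e ` A)"
    and ind: "\<And>c. (\<Sum>i\<in>A. scale (c i) (e i)) = 0 \<Longrightarrow> \<forall>i\<in>A. c i = 0"
  shows "dim V = card A"
proof -
  have inj: "inj_on e A"
  proof (rule inj_onI, rule ccontr)
    fix i j assume ij: "i \<in> A" "j \<in> A" "e i = e j" "i \<noteq> j"
    define c where "c k = (if k = i then 1 else if k = j then -1 else (0::'a))" for k
    have "(\<Sum>k\<in>A. scale (c k) (e k)) = (\<Sum>k\<in>{i,j}. scale (c k) (e k))"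
      using ij assms(1) by (intro sum.mono_neutral_right) (auto simp: c_def)
    also have "\<dots> = 0" using ij by (simp add: c_def)
    finally have "c i = 0" using ind ij by blast
    then show False by (simp add: c_def)
  qed
  have "independent (e ` A)"
  proof (rule independent_if_scalars_zero)
    show "finite (e ` A)" using assms by simp
    fix f x assume s: "(\<Sum>x\<in>e ` A. scale (f x) x) = 0" and x: "x \<in> e ` A"
    have "(\<Sum>i\<in>A. scale (f (e i)) (e i)) = 0" using s by (simp add: sum.reindex[OF inj])
    then show "f x = 0" using ind[of "f \<circ> e"] x by auto
  qed
  then show ?thesis using assms(2) card_image[OF inj]
    by (simp add: dim_eq_card_independent)
qed

lemma fin_dim_span: "finite B \<Longrightarrow> fin_dim (span B)"
  unfolding fin_dim_def by blast

lemma card_family_le_dim: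
  fixes e :: "'i \<Rightarrow> 'b"
  assumes "fin_dim V" "finite A" "e ` A \<subseteq> V"
    and ind: "\<And>c. (\<Sum>i\<in>A. scale (c i) (e i)) = 0 \<Longrightarrow> \<forall>i\<in>A. c i = 0"
  shows "card A \<le> dim V"
proof -
  have "dim (span (e ` A)) = card A" by (rule dim_family[OF assms(2) refl ind])
  moreover have "span (e ` A) \<subseteq> span V" by (rule span_mono[OF assms(3)])
  ultimately show ?thesis using dim_mono_fin_dim[OF assms(1)] by metis
qed

lemma dependent_family:
  fixes e :: "'i \<Rightarrow> 'b"
  assumes "fin_dim V" "finite A" "e ` A \<subseteq> V" "dim V < card A"
  obtains c i where "(\<Sum>i\<in>A. scale (c i) (e i)) = 0" "i \<in> A" "c i \<noteq> 0"
  using card_family_le_dim[OF assms(1-3)] assms(4) by (meson not_le)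

end

locale lin_space_pair = vs1: lin_space s1 + vs2: lin_space s2
  for s1 :: "'a::field \<Rightarrow> 'b::ab_group_add \<Rightarrow> 'b" and s2 :: "'a \<Rightarrow> 'c::ab_group_add \<Rightarrow> 'c"

lemma (in lin_space_pair) fin_dim_image:
  assumes "Vector_Spaces.linear s1 s2 f" "vs1.fin_dim V"
  shows "vs2.fin_dim (f ` V)"
proof -
  interpret f: Vector_Spaces.linear s1 s2 f by fact
  obtain B where "finite B" "V \<subseteq> vs1.span B" using assms(2) vs1.fin_dim_def by blast
  then have "finite (f ` B)" "f ` V \<subseteq> vs2.span (f ` B)" using f.spans_image by auto
  then show ?thesis unfolding vs2.fin_dim_def by blast
qed

lemma (in lin_space_pair) rank_nullity:
  assumes lin: "Vector_Spaces.linear s1 s2 f" and V: "vs1.subspace V" and fin: "vs1.fin_dim V"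
  shows "vs1.dim V = vs2.dim (f ` V) + vs1.dim {x \<in> V. f x = 0}"
proof -
  interpret f: Vector_Spaces.linear s1 s2 f by fact
  let ?K = "{x \<in> V. f x = 0}"
  have K: "vs1.subspace ?K"
    using V by (auto intro!: vs1.subspaceI simp: f.add f.scale vs1.subspace_0 vs1.subspace_add vs1.subspace_scale)
  obtain B where B: "B \<subseteq> ?K" "finite B" "vs1.independent B" "?K \<subseteq> vs1.span B" "card B = vs1.dim ?K"
    using vs1.fin_dim_basis[OF vs1.fin_dim_mono[OF fin, of ?K]] by auto
  obtain C where C: "B \<subseteq> C" "C \<subseteq> V" "vs1.independent C" "V \<subseteq> vs1.span C"
    using vs1.maximal_independent_subset_extend[OF _ B(3), of V] B(1) by auto
  have finC: "finite C" using vs1.finite_independent_fin_dim[OF fin C(3,2)] .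
  have spanC: "vs1.span C = V" using C V by (simp add: vs1.span_subspace)
  let ?D = "C - B"
  have spD: "vs1.span ?D \<subseteq> V" using vs1.span_mono[of ?D C] spanC by auto
  have inj: "inj_on f (vs1.span ?D)"
  proof (subst f.inj_on_iff_eq_0[OF vs1.subspace_span], intro ballI impI)
    fix x assume x: "x \<in> vs1.span ?D" "f x = 0"
    then have xB: "x \<in> vs1.span B" using spD B by blast
    \<comment> \<open>Coordinates with respect to \<open>C\<close> are unique, and those of a common
      element are supported both on \<open>C - B\<close> and on \<open>B\<close>.\<close>
    have "vs1.span ?D \<inter> vs1.span B = {0}"
    proof -
      { fix y assume yD: "y \<in> vs1.span ?D" and yB: "y \<in> vs1.span B"
        have "vs1.representation C y = vs1.representation ?D y"
          by (rule vs1.representation_extend[OF C(3) yD]) auto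
        moreover have "vs1.representation C y = vs1.representation B y"
          by (rule vs1.representation_extend[OF C(3) yB]) (use C in auto)
        moreover have "vs1.representation ?D y b = 0" if "b \<notin> ?D" for b
          using vs1.representation_ne_zero that by blast
        moreover have "vs1.representation B y b = 0" if "b \<notin> B" for b
          using vs1.representation_ne_zero that by blast
        ultimately have r0: "vs1.representation B y b = 0" for b by (metis DiffE)
        have "(\<Sum>b\<in>B. s1 (vs1.representation B y b) b) = y"
          by (rule vs1.sum_representation_eq[OF B(3) yB B(2)]) auto
        then have "y = 0" using r0 by simp }
      then show ?thesis using vs1.span_zero by blast
    qed
    then show "x = 0" using x xB by blast
  qed
  have indD: "vs1.independent ?D" using C(3) vs1.independent_mono by blast
  have "vs2.independent (f ` ?D)"
    by (rule f.independent_injective_image[OF indD inj])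
  moreover have "f ` V = vs2.span (f ` ?D)"
  proof
    show "vs2.span (f ` ?D) \<subseteq> f ` V" using spD by (simp add: f.span_image image_mono)
    show "f ` V \<subseteq> vs2.span (f ` ?D)"
    proof
      fix y assume "y \<in> f ` V"
      then obtain x where x: "x \<in> vs1.span (B \<union> ?D)" "y = f x"
        using spanC C(1) by (metis Un_Diff_cancel Un_absorb1 imageE)
      then obtain u v where uv: "x = u + v" "u \<in> vs1.span B" "v \<in> vs1.span ?D"
        unfolding vs1.span_Un by blast
      have "vs1.span B \<subseteq> ?K" using B K by (simp add: vs1.span_minimal)
      then have "f u = 0" using uv by blast
      then have "y = f v" using x uv by (simp add: f.add)
      then show "y \<in> vs2.span (f ` ?D)" using uv by (simp add: f.span_image)
    qed
  qed
  ultimately have "vs2.dim (f ` V) = card (f ` ?D)"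
    by (simp add: vs2.dim_eq_card_independent)
  also have "\<dots> = card ?D" using inj vs1.span_superset by (metis card_image inj_on_subset)
  also have "\<dots> = card C - card B" using B C finC by (simp add: card_Diff_subset)
  finally have "vs2.dim (f ` V) = card C - card B" .
  moreover have "vs1.dim V = card C" using C spanC by (metis vs1.dim_eq_card_independent vs1.dim_span)
  moreover have "card B \<le> card C" using C finC by (simp add: card_mono)
  ultimately show ?thesis using B by simp
qed

lemma (in lin_space_pair) dim_image_inj:
  assumes lin: "Vector_Spaces.linear s1 s2 f" and V: "vs1.subspace V" and fin: "vs1.fin_dim V"
    and inj: "\<And>x. x \<in> V \<Longrightarrow> f x = 0 \<Longrightarrow> x = 0"
  shows "vs2.dim (f ` V) = vs1.dim V"
proof -
  have "{x \<in> V. f x = 0} \<subseteq> {0}" using inj by blast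
  then have "vs1.dim {x \<in> V. f x = 0} = 0"
    using vs1.dim_zero_fin_dim[OF vs1.fin_dim_mono[OF fin]] by blast
  with rank_nullity[OF lin V fin] show ?thesis by simp
qed

section \<open>Dimensions of pieces of quotient algebras via bases\<close>

lemma ring_class_ring_ops: "cring (class_ring_ops :: 'a::comm_ring_1 ring)"
proof (rule cringI)
  show "abelian_group (class_ring_ops :: 'a ring)"
    by (rule abelian_groupI) (auto simp: class_ring_ops_def algebra_simps intro: exI[of _ "- _"])
  show "comm_monoid (class_ring_ops :: 'a ring)"
    by (rule comm_monoidI) (auto simp: class_ring_ops_def algebra_simps)
qed (auto simp: class_ring_ops_def algebra_simps)

lemma field_class_ring_ops: "field (class_ring_ops :: 'a::field ring)"
proof (rule cring.cring_fieldI2[OF ring_class_ring_ops])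
  show "\<zero>\<^bsub>class_ring_ops :: 'a ring\<^esub> \<noteq> \<one>\<^bsub>class_ring_ops\<^esub>" by (simp add: class_ring_ops_def)
  fix a :: 'a assume "a \<noteq> \<zero>\<^bsub>class_ring_ops\<^esub>"
  then have "a * inverse a = 1" by (simp add: class_ring_ops_def)
  then show "\<exists>b\<in>carrier class_ring_ops. a \<otimes>\<^bsub>class_ring_ops\<^esub> b = \<one>\<^bsub>class_ring_ops\<^esub>"
    by (auto simp: class_ring_ops_def)
qed

text \<open>All ideals of the development have at most three generators; the explicit form of the
  elements replaces the closure operator \<open>Idl\<close>.\<close>

definition ideal3 :: "'a::comm_ring_1 \<Rightarrow> 'a \<Rightarrow> 'a \<Rightarrow> 'a set"
  where "ideal3 f g h = {a * f + b * g + c * h | a b c. True}"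

lemma ideal3_iff: "p \<in> ideal3 f g h \<longleftrightarrow> (\<exists>a b c. p = a * f + b * g + c * h)"
  by (simp add: ideal3_def)

lemma ideal3_gens: "f \<in> ideal3 f g h" "g \<in> ideal3 f g h" "h \<in> ideal3 f g h"
proof -
  have "f = 1 * f + 0 * g + 0 * h" "g = 0 * f + 1 * g + 0 * h" "h = 0 * f + 0 * g + 1 * h" by simp_all
  then show "f \<in> ideal3 f g h" "g \<in> ideal3 f g h" "h \<in> ideal3 f g h" unfolding ideal3_iff by blast+
qed

lemma ideal3_0: "0 \<in> ideal3 f g h"
  unfolding ideal3_iff by (rule exI[of _ 0], rule exI[of _ 0], rule exI[of _ 0]) simp

lemma ideal3_add: "p \<in> ideal3 f g h \<Longrightarrow> q \<in> ideal3 f g h \<Longrightarrow> p + q \<in> ideal3 f g h"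
proof -
  assume "p \<in> ideal3 f g h" "q \<in> ideal3 f g h"
  then obtain a b c a' b' c' where "p = a * f + b * g + c * h" "q = a' * f + b' * g + c' * h"
    unfolding ideal3_iff by blast
  then have "p + q = (a + a') * f + (b + b') * g + (c + c') * h" by (simp add: algebra_simps)
  then show ?thesis unfolding ideal3_iff by blast
qed

lemma ideal3_mult: "p \<in> ideal3 f g h \<Longrightarrow> q * p \<in> ideal3 f g h"
proof -
  assume "p \<in> ideal3 f g h"
  then obtain a b c where "p = a * f + b * g + c * h" unfolding ideal3_iff by blast
  then have "q * p = (q * a) * f + (q * b) * g + (q * c) * h" by (simp add: algebra_simps)
  then show ?thesis unfolding ideal3_iff by blast
qed

lemma ideal3_uminus: "p \<in> ideal3 f g h \<Longrightarrow> - p \<in> ideal3 f g h"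
  using ideal3_mult[of p f g h "-1"] by simp

lemma ideal3_diff: "p \<in> ideal3 f g h \<Longrightarrow> q \<in> ideal3 f g h \<Longrightarrow> p - q \<in> ideal3 f g h"
  using ideal3_add[of p f g h "- q"] ideal3_uminus[of q] by simp

lemma genideal_eq_ideal3: "Idl\<^bsub>class_ring_ops\<^esub> {f, g, h} = ideal3 f g h"
proof -
  interpret R: cring "class_ring_ops :: 'a ring" by (rule ring_class_ring_ops)
  have carr: "carrier (class_ring_ops :: 'a ring) = UNIV" by (simp add: class_ring_ops_def)
  have id: "ideal (ideal3 f g h) class_ring_ops"
  proof (rule idealI)
    show "ring (class_ring_ops :: 'a ring)" by (rule R.ring_axioms)
    show "subgroup (ideal3 f g h) (add_monoid class_ring_ops)"
    proof (rule group.subgroupI[OF R.add.is_group])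
      fix a assume "a \<in> ideal3 f g h"
      then have m: "- a \<in> ideal3 f g h" by (rule ideal3_uminus)
      have "inv\<^bsub>add_monoid class_ring_ops\<^esub> a = - a"
        using R.minus_equality[of "- a" a] unfolding a_inv_def by (simp add: class_ring_ops_def)
      then show "inv\<^bsub>add_monoid class_ring_ops\<^esub> a \<in> ideal3 f g h" using m by simp
    next
      show "ideal3 f g h \<noteq> {}" using ideal3_0 by blast
    qed (use ideal3_add in \<open>auto simp: class_ring_ops_def\<close>)
  qed (use ideal3_mult in \<open>auto simp: class_ring_ops_def mult.commute\<close>)
  have sub: "ideal3 f g h \<subseteq> J" if J: "ideal J class_ring_ops" "{f, g, h} \<subseteq> J" for J
  proof
    fix p assume "p \<in> ideal3 f g h"
    then obtain a b c where p: "p = a * f + b * g + c * h" unfolding ideal3_iff by blast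
    have m: "x * y \<in> J" if "y \<in> J" for x y
      using ideal.I_l_closed[OF J(1) that, of x] by (simp add: class_ring_ops_def)
    have ad: "x + y \<in> J" if "x \<in> J" "y \<in> J" for x y
      using additive_subgroup.a_closed[OF ideal.axioms(1)[OF J(1)] that] by (simp add: class_ring_ops_def)
    show "p \<in> J" unfolding p using J(2) by (auto intro!: m ad)
  qed
  show ?thesis
  proof
    show "Idl\<^bsub>class_ring_ops\<^esub> {f, g, h} \<subseteq> ideal3 f g h"
      by (rule R.genideal_minimal[OF id]) (use ideal3_gens in auto)
    show "ideal3 f g h \<subseteq> Idl\<^bsub>class_ring_ops\<^esub> {f, g, h}"
      by (rule sub) (use R.genideal_ideal R.genideal_self carr in auto)
  qed
qed

locale complex_algebra =
  fixes \<iota> :: "complex \<Rightarrow> 'a::comm_ring_1"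
  assumes \<iota>_add: "\<iota> (a + b) = \<iota> a + \<iota> b"
    and \<iota>_mult: "\<iota> (a * b) = \<iota> a * \<iota> b"
    and \<iota>_1: "\<iota> 1 = 1"
begin

lemma \<iota>_0: "\<iota> 0 = 0" using \<iota>_add[of 0 0] by simp

lemma \<iota>_minus: "\<iota> (- a) = - \<iota> a"
  using \<iota>_add[of a "- a"] \<iota>_0 by (simp add: minus_unique)

end

locale complex_algebra_space = complex_algebra
begin

sublocale vs: lin_space "\<lambda>c p. \<iota> c * p"
  by unfold_locales (simp_all add: \<iota>_add \<iota>_mult \<iota>_1 algebra_simps)

text \<open>The bridge to the abstract quotient ring: a list in \<open>V\<close> that spans
  \<open>V\<close> and is independent modulo the ideal is a basis of the image. Lists and
  coefficient lists match the way \<open>Span\<close> and \<open>independent\<close> are defined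
  there, and 1 outside the ideal makes the classes of the constants a field.\<close>

lemma quot_dim_eqI:
  fixes f g h :: 'a
  assumes one: "1 \<notin> ideal3 f g h"
    and V: "vs.subspace V" and bs: "set bs \<subseteq> V"
    and span: "\<And>v. v \<in> V \<Longrightarrow> \<exists>cs. length cs = length bs \<and> v - (\<Sum>(c, b)\<leftarrow>zip cs bs. \<iota> c * b) \<in> ideal3 f g h"
    and ind: "\<And>cs. length cs = length bs \<Longrightarrow> (\<Sum>(c, b)\<leftarrow>zip cs bs. \<iota> c * b) \<in> ideal3 f g h
        \<Longrightarrow> set cs \<subseteq> {0}"
  shows "quot_dim \<iota> {f, g, h} V = length bs"
proof -
  let ?R = "class_ring_ops :: 'a ring" and ?I = "ideal3 f g h"
  interpret R: cring ?R by (rule ring_class_ring_ops)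
  have carr: "carrier ?R = UNIV" by (simp add: class_ring_ops_def)
  interpret I: ideal ?I ?R
    using R.genideal_ideal[of "{f, g, h}"] carr by (simp add: genideal_eq_ideal3)
  let ?Q = "?R Quot ?I" and ?h = "\<lambda>p. ?I +>\<^bsub>?R\<^esub> p"
  interpret Q: ring ?Q by (rule I.quotient_is_ring)
  interpret h: ring_hom_ring ?R ?Q ?h by (rule I.rcos_ring_hom_ring)
  have eq: "?h p = ?h q \<longleftrightarrow> p - q \<in> ?I" for p q
  proof -
    have "p \<ominus>\<^bsub>?R\<^esub> q = p - q"
    proof -
      have "\<ominus>\<^bsub>?R\<^esub> q = - q" by (rule R.minus_equality) (auto simp: class_ring_ops_def)
      then show ?thesis by (simp add: a_minus_def class_ring_ops_def)
    qed
    then show ?thesis using R.quotient_eq_iff_same_a_r_cos[OF I.ideal_axioms, of p q] carr by simp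
  qed
  have h0: "?h p = \<zero>\<^bsub>?Q\<^esub> \<longleftrightarrow> p \<in> ?I" for p
  proof -
    have "\<zero>\<^bsub>?Q\<^esub> = ?h 0" using h.hom_zero by (simp add: class_ring_ops_def)
    then show ?thesis using eq[of p 0] by simp
  qed
  have hadd: "?h p \<oplus>\<^bsub>?Q\<^esub> ?h q = ?h (p + q)" for p q
    using h.hom_add[of p q] carr by (simp add: class_ring_ops_def)
  have hmult: "?h p \<otimes>\<^bsub>?Q\<^esub> ?h q = ?h (p * q)" for p q
    using h.hom_mult[of p q] carr by (simp add: class_ring_ops_def)
  let ?C = "class_ring_ops :: complex ring"
  interpret C: field ?C by (rule field_class_ring_ops)
  \<comment> \<open>The field of scalars is the image of \<complex> under this homomorphism, a
    subfield because the quotient is not the zero ring.\<close>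
  have hom\<iota>: "(\<lambda>c. ?h (\<iota> c)) \<in> ring_hom ?C ?Q"
  proof (rule ring_hom_memI)
    show "?h (\<iota> \<one>\<^bsub>?C\<^esub>) = \<one>\<^bsub>?Q\<^esub>"
      using h.hom_one by (simp add: class_ring_ops_def \<iota>_1)
    fix x y :: complex
    show "?h (\<iota> x) \<in> carrier ?Q" using h.hom_closed carr by simp
    show "?h (\<iota> (x \<otimes>\<^bsub>?C\<^esub> y)) = ?h (\<iota> x) \<otimes>\<^bsub>?Q\<^esub> ?h (\<iota> y)"
      by (simp add: hmult \<iota>_mult[symmetric]) (simp add: class_ring_ops_def)
    show "?h (\<iota> (x \<oplus>\<^bsub>?C\<^esub> y)) = ?h (\<iota> x) \<oplus>\<^bsub>?Q\<^esub> ?h (\<iota> y)"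
      by (simp add: hadd \<iota>_add[symmetric]) (simp add: class_ring_ops_def)
  qed
  interpret hi: ring_hom_ring ?C ?Q "\<lambda>c. ?h (\<iota> c)"
    by (rule ring_hom_ringI2[OF C.ring_axioms Q.ring_axioms hom\<iota>])
  have "\<one>\<^bsub>?Q\<^esub> \<noteq> \<zero>\<^bsub>?Q\<^esub>"
    using h.hom_one one h0[of 1] by (simp add: class_ring_ops_def)
  moreover have "subfield (carrier ?C) ?C"
    by (rule C.carrier_is_subfield)
  ultimately have "subfield ((\<lambda>c. ?h (\<iota> c)) ` carrier ?C) ?Q"
    by (intro hi.img_is_subfield)
  then have K: "subfield (range (\<lambda>c. ?h (\<iota> c))) ?Q" by (simp add: class_ring_ops_def)
  let ?K = "range (\<lambda>c. ?h (\<iota> c))" and ?Us = "map ?h bs"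
  have comb: "ring.combine ?Q (map (\<lambda>c. ?h (\<iota> c)) cs) (map ?h bs) = ?h (\<Sum>(c, b)\<leftarrow>zip cs bs. \<iota> c * b)"
    if "length cs = length bs" for cs bs
    using that
  proof (induction cs bs rule: list_induct2)
    case Nil
    show ?case using h0[of 0] ideal3_0[of f g h] by simp
  next
    case (Cons c cs b bs)
    then show ?case by (simp add: hadd hmult)
  qed
  have inK: "\<exists>cs. length cs = length Ks \<and> Ks = map (\<lambda>c. ?h (\<iota> c)) cs" if "set Ks \<subseteq> ?K" for Ks
  proof -
    define v where "v = inv_into UNIV (\<lambda>c. ?h (\<iota> c))"
    have v: "x = ?h (\<iota> (v x))" if "x \<in> ?K" for x
      unfolding v_def by (rule f_inv_into_f[OF that, symmetric])
    have "Ks = map (\<lambda>c. ?h (\<iota> c)) (map v Ks)"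
      using that v by (induction Ks) simp_all
    then show ?thesis by (intro exI[of _ "map v Ks"] conjI) simp_all
  qed
  have carrU: "set ?Us \<subseteq> carrier ?Q" using h.hom_closed carr by auto
  have indep: "ring.independent ?Q ?K ?Us"
  proof (rule ccontr)
    assume "\<not> ?thesis"
    then obtain Ks where Ks: "length Ks = length ?Us" "Q.combine Ks ?Us = \<zero>\<^bsub>?Q\<^esub>" "set Ks \<subseteq> ?K"
        "set Ks \<noteq> {\<zero>\<^bsub>?Q\<^esub>}"
      using Q.dependent_imp_non_trivial_combine[OF K carrU] by metis
    obtain cs where cs: "length cs = length Ks" "Ks = map (\<lambda>c. ?h (\<iota> c)) cs"
      using inK[OF Ks(3)] by (elim exE conjE) (rule that)
    have len: "length cs = length bs" using cs(1) Ks(1) by (simp only: length_map)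
    have combK: "Q.combine Ks ?Us = ?h (\<Sum>(c, b)\<leftarrow>zip cs bs. \<iota> c * b)"
      unfolding cs(2) by (rule comb[OF len])
    have "(\<Sum>(c, b)\<leftarrow>zip cs bs. \<iota> c * b) \<in> ?I"
      by (rule h0[THEN iffD1]) (rule trans[OF combK[symmetric] Ks(2)])
    then have z: "set cs \<subseteq> {0}" by (rule ind[OF len])
    have z0: "?h (\<iota> 0) = \<zero>\<^bsub>?Q\<^esub>" unfolding \<iota>_0 by (rule h0[THEN iffD2, OF ideal3_0])
    have "set Ks \<subseteq> {\<zero>\<^bsub>?Q\<^esub>}"
      unfolding cs(2) set_map
    proof (rule image_subsetI)
      fix c assume "c \<in> set cs"
      then have "c = 0" using z by blast
      then show "?h (\<iota> c) \<in> {\<zero>\<^bsub>?Q\<^esub>}" using z0 by (simp only: singleton_iff)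
    qed
    from subset_singletonD[OF this] Ks(4) have "set Ks = {}" by argo
    then have "length Ks = 0" by (simp only: set_empty length_0_conv)
    then have "?Us = []" using Ks(1) by (simp only: length_0_conv[symmetric])
    then have "Q.independent ?K ?Us" by (simp only: Q.li_Nil)
    with \<open>\<not> Q.independent ?K ?Us\<close> show False by (rule notE)
  qed
  have spanQ: "ring.Span ?Q ?K ?Us = ?h ` V"
  proof (unfold Q.Span_eq_combine_set_length_version[OF K carrU], intro equalityI subsetI)
    fix x assume "x \<in> {Q.combine Ks ?Us |Ks. length Ks = length ?Us \<and> set Ks \<subseteq> ?K}"
    then obtain Ks where Ks: "x = Q.combine Ks ?Us" "length Ks = length ?Us" "set Ks \<subseteq> ?K"
      by (elim CollectE exE conjE) (rule that)
    obtain cs where cs: "length cs = length Ks" "Ks = map (\<lambda>c. ?h (\<iota> c)) cs"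
      using inK[OF Ks(3)] by (elim exE conjE) (rule that)
    have len: "length cs = length bs" using cs(1) Ks(2) by (simp only: length_map)
    have combK: "Q.combine Ks ?Us = ?h (\<Sum>(c, b)\<leftarrow>zip cs bs. \<iota> c * b)"
      unfolding cs(2) by (rule comb[OF len])
    have "x = ?h (\<Sum>(c, b)\<leftarrow>zip cs bs. \<iota> c * b)" using Ks(1) combK by (rule trans)
    moreover have "(\<Sum>(c, b)\<leftarrow>zip cs bs. \<iota> c * b) \<in> V"
    proof -
      have "set bs \<subseteq> V \<Longrightarrow> (\<Sum>(c, b)\<leftarrow>zip cs bs. \<iota> c * b) \<in> V" for cs bs
        by (induction cs bs rule: list_induct2')
           (use V vs.subspace_0 vs.subspace_add vs.subspace_scale in auto)
      then show ?thesis using bs by blast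
    qed
    ultimately show "x \<in> ?h ` V" by (rule image_eqI)
  next
    fix x assume "x \<in> ?h ` V"
    then obtain v where v: "v \<in> V" "x = ?h v" by (elim imageE) (rule that)
    obtain cs where cs: "length cs = length bs" "v - (\<Sum>(c, b)\<leftarrow>zip cs bs. \<iota> c * b) \<in> ?I"
      using span[OF v(1)] by blast
    have "x = Q.combine (map (\<lambda>c. ?h (\<iota> c)) cs) ?Us"
      unfolding comb[OF cs(1)] v(2) by (rule eq[THEN iffD2, OF cs(2)])
    moreover have "length (map (\<lambda>c. ?h (\<iota> c)) cs) = length ?Us" by (simp only: length_map cs(1))
    moreover have "set (map (\<lambda>c. ?h (\<iota> c)) cs) \<subseteq> ?K" unfolding set_map by (rule image_mono) (rule subset_UNIV)
    ultimately show "x \<in> {Q.combine Ks ?Us |Ks. length Ks = length ?Us \<and> set Ks \<subseteq> ?K}"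
      by (intro CollectI exI conjI)
  qed
  have "ring.dimension ?Q (length ?Us) ?K (?h ` V)"
    by (rule Q.dimensionI[OF K indep spanQ])
  then have "ring.dim ?Q ?K (?h ` V) = length ?Us"
    using Q.dimI[OF K] unfolding over_def by blast
  then show ?thesis unfolding quot_dim_def Let_def genideal_eq_ideal3 by (simp only: length_map)
qed

text \<open>A basis of the part of \<open>V\<close> inside the ideal is extended to a basis of
  \<open>V\<close>; the added vectors represent a basis of the quotient.\<close>

lemma quot_dim_fin_dim:
  assumes one: "1 \<notin> ideal3 f g h"
    and V: "vs.subspace V" "vs.fin_dim V"
  shows "quot_dim \<iota> {f, g, h} V = vs.dim V - vs.dim (V \<inter> ideal3 f g h)"
    and "vs.dim (V \<inter> ideal3 f g h) \<le> vs.dim V"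
proof -
  let ?J = "V \<inter> ideal3 f g h"
  have I: "vs.subspace (ideal3 f g h)"
    by (rule vs.subspaceI) (auto intro: ideal3_0 ideal3_add ideal3_mult)
  have J: "vs.subspace ?J" by (rule vs.subspace_inter[OF V(1) I])
  obtain B where B: "B \<subseteq> ?J" "finite B" "vs.independent B" "?J \<subseteq> vs.span B" "card B = vs.dim ?J"
    using vs.fin_dim_basis[OF vs.fin_dim_mono[OF V(2), of ?J]] by auto
  obtain C where C: "B \<subseteq> C" "C \<subseteq> V" "vs.independent C" "V \<subseteq> vs.span C"
    using vs.maximal_independent_subset_extend[OF _ B(3), of V] B(1) by auto
  have finC: "finite C" using vs.finite_independent_fin_dim[OF V(2) C(3,2)] .
  have spanC: "vs.span C = V" using C V by (simp add: vs.span_subspace)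
  have spanB: "vs.span B = ?J" using B J by (simp add: vs.span_subspace)
  obtain bs where bs: "set bs = C - B" "distinct bs" using finC finite_distinct_list by (metis finite_Diff)
  have zipsum: "(\<Sum>(c, b)\<leftarrow>zip (map u bs) bs. \<iota> c * b) = (\<Sum>b\<in>C - B. \<iota> (u b) * b)" for u
    using bs by (simp add: zip_map1 zip_same_conv_map o_def sum_list_distinct_conv_sum_set)
  have "quot_dim \<iota> {f, g, h} V = length bs"
  proof (rule quot_dim_eqI[OF one V(1)])
    show "set bs \<subseteq> V" using bs C by auto
    fix v assume "v \<in> V"
    then have "v \<in> vs.span C" using spanC by simp
    then obtain u where u: "v = (\<Sum>b\<in>C. \<iota> (u b) * b)" using finC vs.span_finite[of C] by auto
    have "(\<Sum>b\<in>C. \<iota> (u b) * b) = (\<Sum>b\<in>C - B. \<iota> (u b) * b) + (\<Sum>b\<in>B. \<iota> (u b) * b)"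
      using sum.subset_diff[OF C(1) finC] by auto
    then have "v - (\<Sum>b\<in>C - B. \<iota> (u b) * b) = (\<Sum>b\<in>B. \<iota> (u b) * b)" using u by simp
    also have "\<dots> \<in> ?J" using B J by (intro vs.subspace_sum vs.subspace_scale) auto
    finally have "v - (\<Sum>(c, b)\<leftarrow>zip (map u bs) bs. \<iota> c * b) \<in> ideal3 f g h" by (simp add: zipsum)
    then show "\<exists>cs. length cs = length bs \<and> v - (\<Sum>(c, b)\<leftarrow>zip cs bs. \<iota> c * b) \<in> ideal3 f g h"
      by (intro exI[of _ "map u bs"]) simp
  next
    fix cs assume l: "length cs = length bs" and inI: "(\<Sum>(c, b)\<leftarrow>zip cs bs. \<iota> c * b) \<in> ideal3 f g h"
    define u where "u b = (case map_of (zip bs cs) b of Some c \<Rightarrow> c | None \<Rightarrow> 0)" for b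
    have cs: "cs = map u bs"
    proof (rule nth_equalityI)
      fix i assume i: "i < length cs"
      then have "map_of (zip bs cs) (bs ! i) = Some (cs ! i)"
        using l bs(2) by (simp add: map_of_zip_nth)
      then show "cs ! i = map u bs ! i" using i l by (simp add: u_def)
    qed (simp add: l)
    have s: "(\<Sum>b\<in>C - B. \<iota> (u b) * b) \<in> ideal3 f g h" using inI cs zipsum by simp
    moreover have "(\<Sum>b\<in>C - B. \<iota> (u b) * b) \<in> V"
      using C V by (intro vs.subspace_sum vs.subspace_scale) auto
    ultimately have "(\<Sum>b\<in>C - B. \<iota> (u b) * b) \<in> vs.span B" using spanB by simp
    then obtain w where w: "(\<Sum>b\<in>C - B. \<iota> (u b) * b) = (\<Sum>b\<in>B. \<iota> (w b) * b)"
      using vs.span_finite[OF B(2)] by auto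
    \<comment> \<open>A combination of the added vectors that falls into the ideal is a combination
      of \<open>B\<close>; moving it to one side gives a relation within the basis
      \<open>C\<close>.\<close>
    define t where "t b = (if b \<in> B then - w b else u b)" for b
    have "(\<Sum>b\<in>C. \<iota> (t b) * b) = (\<Sum>b\<in>C - B. \<iota> (t b) * b) + (\<Sum>b\<in>B. \<iota> (t b) * b)"
      using sum.subset_diff[OF C(1) finC] by auto
    also have "\<dots> = (\<Sum>b\<in>C - B. \<iota> (u b) * b) + (\<Sum>b\<in>B. - (\<iota> (w b) * b))"
      by (intro arg_cong2[of _ _ _ _ "(+)"] sum.cong) (auto simp: t_def \<iota>_minus)
    also have "\<dots> = 0" using w by (simp add: sum_negf)
    finally have t0: "t b = 0" if "b \<in> C" for b
      using vs.independentD[OF C(3) finC subset_refl, of t b] that by blast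
    have "u b = 0" if "b \<in> set bs" for b using t0[of b] that bs by (auto simp: t_def)
    then show "set cs \<subseteq> {0}" by (auto simp: cs)
  qed
  moreover have "length bs = card C - card B"
    using bs distinct_card[OF bs(2)] B C by (simp add: card_Diff_subset)
  moreover have "vs.dim V = card C" using C spanC by (metis vs.dim_eq_card_independent vs.dim_span)
  ultimately show "quot_dim \<iota> {f, g, h} V = vs.dim V - vs.dim ?J" using B by simp
  show "vs.dim ?J \<le> vs.dim V" by (rule vs.dim_subset_fin_dim[OF V(2)]) auto
qed

end

section \<open>The polynomial ring in three variables\<close>

lemma lookup_sum_single:
  "finite A \<Longrightarrow> Poly_Mapping.lookup (\<Sum>m\<in>A. Poly_Mapping.single m (g m)) n = (if n \<in> A then g n else 0)"
  by (simp add: lookup_sum lookup_single when_def)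

lemma poly_mapping_sum_single: "p = (\<Sum>m\<in>Poly_Mapping.keys p. Poly_Mapping.single m (Poly_Mapping.lookup p m))"
  by (rule poly_mapping_eqI) (simp add: lookup_sum_single in_keys_iff)

text \<open>Identities that are additive in a polynomial reduce to monomials; evaluation and the
  Leibniz rule are both proved in this way.\<close>

lemma poly3_induct [case_names single add]:
  fixes p :: poly3
  assumes s: "\<And>i j k c. P (Poly_Mapping.single (i, j, k) c)" and a: "\<And>p q. P p \<Longrightarrow> P q \<Longrightarrow> P (p + q)"
  shows "P p"
proof -
  have "finite A \<Longrightarrow> P (\<Sum>m\<in>A. Poly_Mapping.single m (Poly_Mapping.lookup p m))" for A
  proof (induction A rule: finite_induct)
    case empty
    show ?case using s[of 0 0 0 0] by simp
  next
    case (insert m A)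
    then show ?case using s by (cases m) (auto intro!: a)
  qed
  then show ?thesis using poly_mapping_sum_single[of p] finite_keys by metis
qed

subsection \<open>Evaluation\<close>

context complex_algebra
begin

lemma eval_in_superset:
  assumes "finite A" "Poly_Mapping.keys p \<subseteq> A"
  shows "eval_in \<iota> p (a, b, c) = (\<Sum>(i, j, k) \<in> A. \<iota> (Poly_Mapping.lookup p (i, j, k)) * a ^ i * b ^ j * c ^ k)"
  unfolding eval_in_def prod.case
  by (rule sum.mono_neutral_left) (use assms in \<open>auto simp: in_keys_iff \<iota>_0\<close>)

lemma eval_in_add: "eval_in \<iota> (p + q) v = eval_in \<iota> p v + eval_in \<iota> q v"
proof -
  obtain a b c where v: "v = (a, b, c)" by (cases v)
  let ?A = "Poly_Mapping.keys p \<union> Poly_Mapping.keys q"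
  show ?thesis unfolding v
    by (subst (1 2 3) eval_in_superset[of ?A])
       (use keys_add[of p q] in \<open>auto simp: lookup_add \<iota>_add algebra_simps sum.distrib[symmetric] intro!: sum.cong\<close>)
qed

lemma eval_in_single: "eval_in \<iota> (Poly_Mapping.single (i, j, k) t) (a, b, c) = \<iota> t * a ^ i * b ^ j * c ^ k"
  by (subst eval_in_superset[of "{(i, j, k)}"]) auto

lemma eval_in_0 [simp]: "eval_in \<iota> 0 v = 0"
  by (cases v) (simp add: eval_in_def)

lemma eval_in_mult: "eval_in \<iota> (p * q) v = eval_in \<iota> p v * eval_in \<iota> q v"
proof (induction p rule: poly3_induct)
  case (single i j k t)
  obtain a b c where v: "v = (a, b, c)" by (cases v)
  show ?case
  proof (induction q rule: poly3_induct)
    case (single i' j' k' t')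
    show ?case
      unfolding mult_single add_Pair v eval_in_single \<iota>_mult power_add by (simp only: mult_ac)
  qed (simp add: eval_in_add distrib_left)
qed (simp add: eval_in_add distrib_right)

lemma eval_in_const3 [simp]: "eval_in \<iota> (const3 t) v = \<iota> t"
  by (cases v) (simp add: const3_def eval_in_single)

lemma eval_in_1 [simp]: "eval_in \<iota> 1 v = 1"
  using eval_in_const3[of 1] by (simp add: const3_def \<iota>_1 flip: single_one zero_prod_def)

lemma eval_in_uminus: "eval_in \<iota> (- p) v = - eval_in \<iota> p v"
  using eval_in_add[of p "- p" v] by (simp add: minus_unique)

lemma eval_in_diff: "eval_in \<iota> (p - q) v = eval_in \<iota> p v - eval_in \<iota> q v"
  using eval_in_add[of p "- q" v] by (simp add: eval_in_uminus)

lemma eval_in_sum: "eval_in \<iota> (sum f A) v = (\<Sum>i\<in>A. eval_in \<iota> (f i) v)"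
  by (induction A rule: infinite_finite_induct) (simp_all add: eval_in_add)

lemma eval_in_prod_list: "eval_in \<iota> (prod_list ps) v = (\<Prod>p\<leftarrow>ps. eval_in \<iota> p v)"
  by (induction ps) (simp_all add: eval_in_mult)

lemma eval_in_power: "eval_in \<iota> (p ^ n) v = eval_in \<iota> p v ^ n"
  by (induction n) (simp_all add: eval_in_mult)

lemma eval_in_vars [simp]:
  "eval_in \<iota> poly_x (a, b, c) = a" "eval_in \<iota> poly_y (a, b, c) = b" "eval_in \<iota> poly_z (a, b, c) = c"
  by (simp_all add: poly_x_def poly_y_def poly_z_def eval_in_single \<iota>_1)

lemma eval_in_linear_form: "eval_in \<iota> (linear_form (l, m, n)) (a, b, c) = \<iota> l * a + \<iota> m * b + \<iota> n * c"
  by (simp add: linear_form_def eval_in_add eval_in_mult)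

lemmas eval_in_simps = eval_in_add eval_in_mult eval_in_uminus eval_in_diff eval_in_power eval_in_linear_form

end

interpretation ev: complex_algebra "\<lambda>c. c"
  by unfold_locales auto

interpretation S: complex_algebra_space const3
  by unfold_locales (simp_all add: const3_def single_add mult_single flip: single_one zero_prod_def)

interpretation evp: complex_algebra "\<lambda>c. [:c:]"
  by unfold_locales auto

interpretation uv: complex_algebra_space const_uv
  by unfold_locales (simp_all add: const_uv_def)

text \<open>Evaluation at the variables themselves; together with substitution it compares a
  polynomial with its values at modified arguments.\<close>

lemma eval_in_self: "eval_in const3 p (poly_x, poly_y, poly_z) = p"
proof (induction p rule: poly3_induct)
  case (single i j k t)
  have "poly_x ^ i = Poly_Mapping.single (i, 0, 0) 1" for i
    by (induction i) (simp_all add: poly_x_def mult_single flip: single_one zero_prod_def)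
  moreover have "poly_y ^ i = Poly_Mapping.single (0, i, 0) 1" for i
    by (induction i) (simp_all add: poly_y_def mult_single flip: single_one zero_prod_def)
  moreover have "poly_z ^ i = Poly_Mapping.single (0, 0, i) 1" for i
    by (induction i) (simp_all add: poly_z_def mult_single flip: single_one zero_prod_def)
  ultimately show ?case unfolding S.eval_in_single by (simp add: const3_def mult_single)
qed (simp add: S.eval_in_add)

text \<open>Homomorphisms of \<complex>-algebras commute with evaluation. The instances are
  substitution of polynomials, restriction to a line, and constants regarded as polynomials.\<close>

lemma eval_in_eval_in:
  fixes h :: "'a::comm_ring_1 \<Rightarrow> 'b::comm_ring_1"
  assumes "complex_algebra \<iota>" "complex_algebra \<kappa>"
    and add: "\<And>x y. h (x + y) = h x + h y" and mult: "\<And>x y. h (x * y) = h x * h y"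
    and h\<iota>: "\<And>c. h (\<iota> c) = \<kappa> c"
  shows "h (eval_in \<iota> p (a, b, c)) = eval_in \<kappa> p (h a, h b, h c)"
proof -
  interpret i: complex_algebra \<iota> by fact
  interpret k: complex_algebra \<kappa> by fact
  have h1: "h 1 = 1" using h\<iota>[of 1] i.\<iota>_1 k.\<iota>_1 by simp
  have pow: "h (x ^ n) = h x ^ n" for x n by (induction n) (simp_all add: h1 mult)
  show ?thesis
  proof (induction p rule: poly3_induct)
    case (single i j k t)
    show ?case by (simp add: i.eval_in_single k.eval_in_single mult h\<iota> pow)
  qed (simp add: i.eval_in_add k.eval_in_add add)
qed

lemma eval3_substitute:
  "eval3 (eval_in const3 p (A, B, C)) v = eval3 p (eval3 A v, eval3 B v, eval3 C v)"
  by (rule eval_in_eval_in[OF S.complex_algebra_axioms ev.complex_algebra_axioms])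
     (simp_all only: ev.eval_in_add ev.eval_in_mult ev.eval_in_const3)

subsection \<open>Forms\<close>

abbreviation forms :: "nat \<Rightarrow> poly3 set"
  where "forms k \<equiv> {p. homogeneous3 k p}"

lemma homogeneous3_iff: "homogeneous3 d p \<longleftrightarrow> (\<forall>i j k. Poly_Mapping.lookup p (i, j, k) \<noteq> 0 \<longrightarrow> i + j + k = d)"
  unfolding homogeneous3_def Ball_def split_paired_All by (simp add: in_keys_iff)

lemma homogeneous3_0 [simp]: "homogeneous3 d 0"
  by (simp add: homogeneous3_iff)

lemma homogeneous3_add: "homogeneous3 d p \<Longrightarrow> homogeneous3 d q \<Longrightarrow> homogeneous3 d (p + q)"
  unfolding homogeneous3_iff lookup_add by (metis add.right_neutral add.left_neutral)

lemma homogeneous3_single: "homogeneous3 d (Poly_Mapping.single (i, j, k) c) \<longleftrightarrow> c = 0 \<or> i + j + k = d"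
  by (auto simp: homogeneous3_iff lookup_single when_def)

lemma homogeneous3_uminus [simp]: "homogeneous3 d (- p) \<longleftrightarrow> homogeneous3 d p"
  by (simp add: homogeneous3_iff)

lemma homogeneous3_diff: "homogeneous3 d p \<Longrightarrow> homogeneous3 d q \<Longrightarrow> homogeneous3 d (p - q)"
  using homogeneous3_add[of d p "- q"] by simp

lemma homogeneous3_sum: "(\<And>i. i \<in> A \<Longrightarrow> homogeneous3 d (f i)) \<Longrightarrow> homogeneous3 d (sum f A)"
  by (induction A rule: infinite_finite_induct) (auto intro: homogeneous3_add)

definition hcomp :: "nat \<Rightarrow> poly3 \<Rightarrow> poly3"
  where "hcomp n p = (\<Sum>m\<in>Poly_Mapping.keys p. Poly_Mapping.single m
    (if (case m of (i, j, k) \<Rightarrow> i + j + k = n) then Poly_Mapping.lookup p m else 0))"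

lemma lookup_hcomp: "Poly_Mapping.lookup (hcomp n p) (i, j, k) = (if i + j + k = n then Poly_Mapping.lookup p (i, j, k) else 0)"
  unfolding hcomp_def by (simp add: lookup_sum_single in_keys_iff)

lemma hcomp_add: "hcomp n (p + q) = hcomp n p + hcomp n q"
  by (rule poly_mapping_eqI) (auto simp: lookup_hcomp lookup_add)

lemma homogeneous3_hcomp: "homogeneous3 n (hcomp n p)"
  by (simp add: homogeneous3_iff lookup_hcomp)

lemma hcomp_homogeneous3: "homogeneous3 d p \<Longrightarrow> hcomp n p = (if n = d then p else 0)"
  unfolding homogeneous3_iff by (rule poly_mapping_eqI) (auto simp: lookup_hcomp, metis+)

lemma homogeneous3_mult:
  assumes "homogeneous3 d p" "homogeneous3 e q"
  shows "homogeneous3 (d + e) (p * q)"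
proof -
  have "p * q = (\<Sum>m\<in>Poly_Mapping.keys p. \<Sum>m'\<in>Poly_Mapping.keys q.
      Poly_Mapping.single (m + m') (Poly_Mapping.lookup p m * Poly_Mapping.lookup q m'))"
    by (subst poly_mapping_sum_single[of p], subst poly_mapping_sum_single[of q])
       (simp add: sum_product mult_single)
  moreover have "homogeneous3 (d + e) (Poly_Mapping.single (m + m') c)"
    if "m \<in> Poly_Mapping.keys p" "m' \<in> Poly_Mapping.keys q" for m m' c
  proof -
    obtain i j k i' j' k' where m: "m = (i, j, k)" "m' = (i', j', k')" by (cases m, cases m')
    then have "i + j + k = d" "i' + j' + k' = e" using assms that by (auto simp: homogeneous3_def)
    then show ?thesis by (simp add: m homogeneous3_single)
  qed
  ultimately show ?thesis by (auto intro!: homogeneous3_sum)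
qed

text \<open>Taking components of the cofactors turns any representation of a form by homogeneous
  generators into one with homogeneous cofactors.\<close>

lemma hcomp_mult:
  assumes "homogeneous3 k h"
  shows "hcomp (n + k) (q * h) = hcomp n q * h"
proof (induction q rule: poly3_induct)
  case (single i j l c)
  have s: "homogeneous3 (i + j + l) (Poly_Mapping.single (i, j, l) c)" by (simp add: homogeneous3_single)
  show ?case
    using hcomp_homogeneous3[OF homogeneous3_mult[OF s assms], of "n + k"] hcomp_homogeneous3[OF s, of n]
    by auto
qed (simp add: hcomp_add algebra_simps)

lemma hcomp_mult_less:
  assumes "homogeneous3 k h" "n < k"
  shows "hcomp n (q * h) = 0"
proof (induction q rule: poly3_induct)
  case (single i j l c)
  have s: "homogeneous3 (i + j + l) (Poly_Mapping.single (i, j, l) c)" by (simp add: homogeneous3_single)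
  show ?case
    using hcomp_homogeneous3[OF homogeneous3_mult[OF s assms(1)], of n] assms(2)
    by auto
qed (simp add: hcomp_add algebra_simps)

lemma homogeneous3_const3 [simp]: "homogeneous3 0 (const3 c)"
  by (simp add: const3_def homogeneous3_single)

lemma homogeneous3_1 [simp]: "homogeneous3 0 1"
  using homogeneous3_const3[of 1] by (simp add: S.\<iota>_1)

lemma homogeneous3_const3_mult: "homogeneous3 d p \<Longrightarrow> homogeneous3 d (const3 c * p)"
  using homogeneous3_mult[OF homogeneous3_const3] by (metis add_0)

lemma homogeneous3_vars: "homogeneous3 1 poly_x" "homogeneous3 1 poly_y" "homogeneous3 1 poly_z"
  by (simp_all add: poly_x_def poly_y_def poly_z_def homogeneous3_single)

lemma homogeneous3_linear_form: "homogeneous3 1 (linear_form l)"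
  by (cases l) (auto simp only: linear_form_def prod.case intro!: homogeneous3_add homogeneous3_const3_mult homogeneous3_vars)

lemmas homogeneous3_Suc_0 [simp] = homogeneous3_vars[unfolded One_nat_def] homogeneous3_linear_form[unfolded One_nat_def]

lemma homogeneous3_power: "homogeneous3 d p \<Longrightarrow> homogeneous3 (d * n) (p ^ n)"
  by (induction n) (auto intro: homogeneous3_mult)

lemma homogeneous3_prod_list: "(\<And>p. p \<in> set ps \<Longrightarrow> homogeneous3 1 p) \<Longrightarrow> homogeneous3 (length ps) (prod_list ps)"
proof (induction ps)
  case (Cons p ps)
  then have "homogeneous3 (1 + length ps) (p * prod_list ps)" by (intro homogeneous3_mult) auto
  then show ?case by simp
qed simp

lemma homogeneous3_defining_poly: "homogeneous3 (length ls) (defining_poly ls)"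
proof -
  have "homogeneous3 (length (map linear_form ls)) (prod_list (map linear_form ls))"
    by (rule homogeneous3_prod_list) auto
  then show ?thesis by (simp add: defining_poly_def)
qed

lemma subspace_forms: "S.vs.subspace (forms k)"
  by (rule S.vs.subspaceI) (auto intro: homogeneous3_add homogeneous3_const3_mult)

lemma eval_in_homogeneous:
  assumes "complex_algebra \<iota>" "homogeneous3 d p"
  shows "eval_in \<iota> p (t * a, t * b, t * c) = t ^ d * eval_in \<iota> p (a, b, c)"
proof -
  interpret complex_algebra \<iota> by fact
  show ?thesis unfolding eval_in_def prod.case sum_distrib_left
  proof (rule sum.cong[OF refl])
    fix m assume "m \<in> Poly_Mapping.keys p"
    moreover obtain i j k where m: "m = (i, j, k)" by (cases m)
    ultimately have "d = i + j + k" using assms(2) unfolding homogeneous3_def by auto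
    then show "(case m of (i, j, k) \<Rightarrow> \<iota> (Poly_Mapping.lookup p (i, j, k)) * (t * a) ^ i * (t * b) ^ j * (t * c) ^ k) =
       t ^ d * (case m of (i, j, k) \<Rightarrow> \<iota> (Poly_Mapping.lookup p (i, j, k)) * a ^ i * b ^ j * c ^ k)"
      by (simp add: m power_mult_distrib power_add algebra_simps)
  qed
qed

definition mono_exps :: "nat \<Rightarrow> (nat \<times> nat \<times> nat) set"
  where "mono_exps k = {(i, j, l). i + j + l = k}"

lemma mono_exps_image: "mono_exps k = (\<lambda>(i, j). (i, j, k - i - j)) ` (SIGMA i:{..k}. {..k - i})"
  by (auto simp: mono_exps_def image_iff)

lemma finite_mono_exps [simp]: "finite (mono_exps k)"
  by (simp add: mono_exps_image)

text \<open>Doubled, as all later dimension formulas, to stay free of division in the natural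
  numbers.\<close>

lemma card_mono_exps: "2 * card (mono_exps k) = (k + 1) * (k + 2)"
proof -
  have "card (mono_exps k) = card (SIGMA i:{..k}. {..k - i})"
    unfolding mono_exps_image by (rule card_image) (auto simp: inj_on_def)
  also have "\<dots> = (\<Sum>i\<le>k. k - i + 1)" by simp
  also have "\<dots> = (\<Sum>i\<le>k. i + 1)"
    using sum.nat_diff_reindex[of "\<lambda>i. i + 1" "Suc k"] by (simp add: lessThan_Suc_atMost)
  finally have "2 * card (mono_exps k) = 2 * (\<Sum>i\<le>k. i + 1)" by simp
  also have "\<dots> = (k + 1) * (k + 2)" by (induction k) auto
  finally show ?thesis .
qed

lemma forms_eq_span: "forms k = S.vs.span ((\<lambda>m. Poly_Mapping.single m 1) ` mono_exps k)"
proof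
  show "S.vs.span ((\<lambda>m. Poly_Mapping.single m 1) ` mono_exps k) \<subseteq> forms k"
    by (rule S.vs.span_minimal[OF _ subspace_forms]) (auto simp: mono_exps_def homogeneous3_single)
  show "forms k \<subseteq> S.vs.span ((\<lambda>m. Poly_Mapping.single m 1) ` mono_exps k)"
  proof
    fix p assume "p \<in> forms k"
    then have keys: "Poly_Mapping.keys p \<subseteq> mono_exps k" by (auto simp: homogeneous3_def mono_exps_def)
    have "(\<Sum>m\<in>Poly_Mapping.keys p. const3 (Poly_Mapping.lookup p m) * Poly_Mapping.single m 1)
        \<in> S.vs.span ((\<lambda>m. Poly_Mapping.single m 1) ` mono_exps k)"
      by (intro S.vs.span_sum S.vs.span_scale S.vs.span_base) (use keys in auto)
    moreover have "const3 c * Poly_Mapping.single m 1 = Poly_Mapping.single m c" for c m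
      by (simp add: const3_def mult_single flip: zero_prod_def)
    ultimately show "p \<in> S.vs.span ((\<lambda>m. Poly_Mapping.single m 1) ` mono_exps k)"
      using poly_mapping_sum_single[of p] by simp
  qed
qed

lemma fin_dim_forms: "S.vs.fin_dim (forms k)"
  unfolding forms_eq_span by (rule S.vs.fin_dim_span) simp

lemma dim_forms: "S.vs.dim (forms k) = card (mono_exps k)"
proof (rule S.vs.dim_family[OF finite_mono_exps forms_eq_span], intro ballI)
  fix c m assume z: "(\<Sum>i\<in>mono_exps k. const3 (c i) * Poly_Mapping.single i 1) = (0 :: poly3)"
    and m: "m \<in> mono_exps k"
  have "const3 c * Poly_Mapping.single m 1 = Poly_Mapping.single m c" for c m
    by (simp add: const3_def mult_single flip: zero_prod_def)
  then have "Poly_Mapping.lookup (\<Sum>i\<in>mono_exps k. Poly_Mapping.single i (c i)) m = 0" using z by simp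
  then show "c m = 0" using m
    by (simp add: lookup_sum_single)
qed

subsection \<open>A polynomial is determined by its values\<close>

text \<open>Kronecker substitution: with \<open>N\<close> above all exponents, x = t, y = t^N, z =
  t^(N * N) sends distinct monomials to distinct powers of t, the exponents being digits in base
  \<open>N\<close>. A univariate polynomial with all values zero is zero.\<close>

lemma eval3_eq_0_imp:
  assumes "\<And>a b c. eval3 p (a, b, c) = 0"
  shows "p = 0"
proof (rule ccontr)
  assume "p \<noteq> 0"
  define N where "N = Suc (Max ((\<lambda>(i, j, k). i + j + k) ` Poly_Mapping.keys p))"
  have N: "i < N \<and> j < N \<and> k < N" if "(i, j, k) \<in> Poly_Mapping.keys p" for i j k
  proof -
    have "i + j + k \<le> Max ((\<lambda>(i, j, k). i + j + k) ` Poly_Mapping.keys p)"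
      using that by (intro Max_ge) (auto simp: image_iff intro!: bexI[of _ "(i, j, k)"])
    then show ?thesis by (simp add: N_def)
  qed
  define e where "e = (\<lambda>(i, j, k). i + N * j + N * N * k)"
  have inj: "inj_on e (Poly_Mapping.keys p)"
  proof (rule inj_onI)
    fix m m' assume mm: "m \<in> Poly_Mapping.keys p" "m' \<in> Poly_Mapping.keys p" "e m = e m'"
    obtain i j k i' j' k' where m: "m = (i, j, k)" "m' = (i', j', k')" by (cases m, cases m')
    have eq: "i + N * (j + N * k) = i' + N * (j' + N * k')" using mm(3) by (simp add: m e_def algebra_simps)
    have b: "i < N" "i' < N" "j < N" "j' < N" using N mm m by blast+
    have "i = i'" using arg_cong[OF eq, of "\<lambda>x. x mod N"] b by simp
    then have eq2: "j + N * k = j' + N * k'" using eq b by simp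
    have "j = j'" using arg_cong[OF eq2, of "\<lambda>x. x mod N"] b by simp
    then show "m = m'" using eq2 b \<open>i = i'\<close> m by simp
  qed
  define Q where "Q = (\<Sum>m\<in>Poly_Mapping.keys p. monom (Poly_Mapping.lookup p m) (e m))"
  have "poly Q t = 0" for t
  proof -
    have "poly Q t = eval3 p (t, t ^ N, t ^ (N * N))"
      unfolding Q_def poly_sum eval_in_def prod.case
      by (intro sum.cong) (auto simp: poly_monom e_def power_add power_mult)
    then show ?thesis using assms by simp
  qed
  then have Q0: "Q = 0" using poly_all_0_iff_0 by blast
  have "Poly_Mapping.keys p \<noteq> {}" using \<open>p \<noteq> 0\<close> poly_mapping_sum_single[of p] by (metis sum.empty)
  then obtain m where m: "m \<in> Poly_Mapping.keys p" by blast
  have "coeff Q (e m) = (\<Sum>m'\<in>Poly_Mapping.keys p. if m' = m then Poly_Mapping.lookup p m' else 0)"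
    unfolding Q_def coeff_sum by (intro sum.cong) (use inj m in \<open>auto simp: inj_on_def\<close>)
  then have "coeff Q (e m) = Poly_Mapping.lookup p m" using m by simp
  then show False using Q0 m by (simp add: in_keys_iff)
qed

text \<open>Multiplication by a monomial only shifts the coefficients, which allows cancelling x and
  y.\<close>

lemma mono_mult_eq_0:
  fixes p :: poly3
  assumes "Poly_Mapping.single m 1 * p = 0"
  shows "p = 0"
proof (rule poly_mapping_eqI)
  fix m'
  have "Poly_Mapping.lookup (Poly_Mapping.single m 1 * p) (m + m') = Poly_Mapping.lookup p m'"
  proof -
    have "Poly_Mapping.single m 1 * p = (\<Sum>n\<in>Poly_Mapping.keys p. Poly_Mapping.single (m + n) (Poly_Mapping.lookup p n))"
      by (subst poly_mapping_sum_single[of p]) (simp add: sum_distrib_left mult_single)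
    then show ?thesis
      by (simp add: lookup_sum lookup_single when_def in_keys_iff)
  qed
  then show "Poly_Mapping.lookup p m' = Poly_Mapping.lookup 0 m'" using assms by simp
qed

lemma poly_x_mult_eq_0: "poly_x * p = 0 \<Longrightarrow> p = 0" and poly_y_mult_eq_0: "poly_y * p = 0 \<Longrightarrow> p = 0"
  unfolding poly_x_def poly_y_def using mono_mult_eq_0 by blast+

subsection \<open>Divisibility by linear forms\<close>

lemma power_diff_dvd: "(a - b :: 'a::comm_ring_1) dvd a ^ n - b ^ n"
  by (metis dvd_triv_left power_diff_sumr2)

text \<open>Arguments congruent modulo \<open>d\<close> give congruent values, as for integer
  polynomials.\<close>

lemma eval_diff_dvd:
  assumes "complex_algebra \<iota>"
    and "d dvd a - a'" "d dvd b - b'" "d dvd c - c'"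
  shows "(d :: 'a::comm_ring_1) dvd eval_in \<iota> p (a, b, c) - eval_in \<iota> p (a', b', c')"
proof -
  interpret complex_algebra \<iota> by fact
  have pw: "d dvd x ^ n - y ^ n" if "d dvd x - y" for x y n
    using that power_diff_dvd dvd_trans by blast
  have mul: "d dvd x * u - y * w" if "d dvd x - y" "d dvd u - w" for x y u w
  proof -
    have "x * u - y * w = (x - y) * u + y * (u - w)" by (simp add: algebra_simps)
    then show ?thesis using that by simp
  qed
  show ?thesis
  proof (induction p rule: poly3_induct)
    case (single i j k t)
    show ?case unfolding eval_in_single by (intro mul pw assms) simp_all
  next
    case (add p q)
    then have "d dvd (eval_in \<iota> p (a, b, c) - eval_in \<iota> p (a', b', c')) + (eval_in \<iota> q (a, b, c) - eval_in \<iota> q (a', b', c'))"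
      by (rule dvd_add)
    then show ?case by (simp add: eval_in_add algebra_simps)
  qed
qed

text \<open>Pick a vector t with l(t) = 1 and project along it onto the plane l = 0. Composed with
  the projection v - l(v) t, the polynomial vanishes identically; since the arguments change by
  multiples of the linear form, so does the value.\<close>

lemma linear_form_dvd:
  assumes l: "l \<noteq> (0, 0, 0)"
    and van: "\<And>a b c. eval3 (linear_form l) (a, b, c) = 0 \<Longrightarrow> eval3 p (a, b, c) = 0"
  shows "linear_form l dvd p"
proof -
  obtain l1 l2 l3 where ld: "l = (l1, l2, l3)" by (cases l)
  define L where "L = linear_form l"
  obtain t1 t2 t3 where t: "l1 * t1 + l2 * t2 + l3 * t3 = 1"
  proof -
    consider "l1 \<noteq> 0" | "l2 \<noteq> 0" | "l3 \<noteq> 0" using l ld by auto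
    then show ?thesis
      by cases (use that[of "1 / l1" 0 0] that[of 0 "1 / l2" 0] that[of 0 0 "1 / l3"] in auto)
  qed
  let ?q = "eval_in const3 p (poly_x - const3 t1 * L, poly_y - const3 t2 * L, poly_z - const3 t3 * L)"
  have "?q = 0"
  proof (rule eval3_eq_0_imp)
    fix a b c
    let ?L = "l1 * a + l2 * b + l3 * c"
    have "eval3 ?q (a, b, c) = eval3 p (a - t1 * ?L, b - t2 * ?L, c - t3 * ?L)"
      unfolding eval3_substitute L_def ld ev.eval_in_simps ev.eval_in_const3 ev.eval_in_vars by (rule refl)
    also have "\<dots> = 0"
    proof (rule van)
      have "l1 * (a - t1 * s) + l2 * (b - t2 * s) + l3 * (c - t3 * s) = ?L - (l1 * t1 + l2 * t2 + l3 * t3) * s" for s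
        by (simp only: ring_distribs mult_ac) (simp only: algebra_simps)
      then show "eval3 (linear_form l) (a - t1 * ?L, b - t2 * ?L, c - t3 * ?L) = 0"
        unfolding ld ev.eval_in_linear_form by (simp only: t mult_1_left diff_self)
    qed
    finally show "eval3 ?q (a, b, c) = 0" .
  qed
  moreover have "L dvd eval_in const3 p (poly_x, poly_y, poly_z) - ?q"
    by (rule eval_diff_dvd[OF S.complex_algebra_axioms]) simp_all
  ultimately show ?thesis by (simp add: eval_in_self L_def)
qed

lemma linear_form_dvd_form:
  assumes "l \<noteq> (0, 0, 0)" "homogeneous3 (Suc j) p"
    and "\<And>a b c. eval3 (linear_form l) (a, b, c) = 0 \<Longrightarrow> eval3 p (a, b, c) = 0"
  obtains g where "homogeneous3 j g" "p = g * linear_form l"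
proof -
  obtain g where g: "p = g * linear_form l"
    using linear_form_dvd[OF assms(1,3)] by (metis dvdE mult.commute)
  have "p = hcomp j g * linear_form l"
    using hcomp_mult[OF homogeneous3_linear_form, of j g l] hcomp_homogeneous3[OF assms(2), of "Suc j"] g
    by simp
  then show ?thesis using that homogeneous3_hcomp by blast
qed

section \<open>Partial derivatives\<close>

lemma partial_superset:
  assumes "finite A" "Poly_Mapping.keys p \<subseteq> A"
  shows "partial_x p = (\<Sum>(i, j, k)\<in>A. Poly_Mapping.single (i - 1, j, k) (of_nat i * Poly_Mapping.lookup p (i, j, k)))"
    and "partial_y p = (\<Sum>(i, j, k)\<in>A. Poly_Mapping.single (i, j - 1, k) (of_nat j * Poly_Mapping.lookup p (i, j, k)))"
    and "partial_z p = (\<Sum>(i, j, k)\<in>A. Poly_Mapping.single (i, j, k - 1) (of_nat k * Poly_Mapping.lookup p (i, j, k)))"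
  unfolding partial_x_def partial_y_def partial_z_def
  by (rule sum.mono_neutral_left; use assms in \<open>auto simp: in_keys_iff\<close>)+

lemma partial_add:
  "partial_x (p + q) = partial_x p + partial_x q"
  "partial_y (p + q) = partial_y p + partial_y q"
  "partial_z (p + q) = partial_z p + partial_z q"
proof -
  let ?A = "Poly_Mapping.keys p \<union> Poly_Mapping.keys q"
  have A: "finite ?A" "Poly_Mapping.keys p \<subseteq> ?A" "Poly_Mapping.keys q \<subseteq> ?A" "Poly_Mapping.keys (p + q) \<subseteq> ?A"
    using keys_add[of p q] by auto
  show "partial_x (p + q) = partial_x p + partial_x q"
    "partial_y (p + q) = partial_y p + partial_y q"
    "partial_z (p + q) = partial_z p + partial_z q"
    unfolding partial_superset[OF A(1,2)] partial_superset[OF A(1,3)] partial_superset[OF A(1,4)]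
      sum.distrib[symmetric]
    by (rule sum.cong; auto simp: lookup_add distrib_left single_add)+
qed

lemma partial_single:
  "partial_x (Poly_Mapping.single (i, j, k) c) = Poly_Mapping.single (i - 1, j, k) (of_nat i * c)"
  "partial_y (Poly_Mapping.single (i, j, k) c) = Poly_Mapping.single (i, j - 1, k) (of_nat j * c)"
  "partial_z (Poly_Mapping.single (i, j, k) c) = Poly_Mapping.single (i, j, k - 1) (of_nat k * c)"
  by (simp_all add: partial_superset[of "{(i, j, k)}"])

text \<open>\<open>F\<close> inserts an exponent into a monomial in one of the three places. The
  case split is forced by the truncated \<open>i - 1\<close>: at exponent zero the coefficient
  vanishes, so the wrong monomial does no harm.\<close>

lemma single_leibniz:
  "Poly_Mapping.single (F (i + i' - 1)) (of_nat (i + i') * (c * c')) =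
    Poly_Mapping.single (F (i - 1 + i')) (of_nat i * c * c') +
    Poly_Mapping.single (F (i + (i' - 1))) (c * (of_nat i' * c' :: complex))"
proof (cases i)
  case (Suc n)
  show ?thesis
  proof (cases i')
    case (Suc n')
    have "of_nat (i + i') * (c * c') = of_nat i * c * c' + c * (of_nat i' * c')"
      by (simp only: of_nat_add ring_distribs mult_ac)
    then show ?thesis using Suc \<open>i = Suc n\<close> by (simp add: single_add)
  qed (use Suc in \<open>simp add: mult.assoc\<close>)
next
  case 0
  have "of_nat i' * (c * c') = c * (of_nat i' * c')" by (rule mult.left_commute)
  then show ?thesis unfolding 0 by (simp only: add_0 diff_0_eq_0 of_nat_0 mult_zero_left single_zero)
qed

lemma partial_single_mult:
  "partial_x (Poly_Mapping.single (i, j, k) c * Poly_Mapping.single (i', j', k') c') =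
    partial_x (Poly_Mapping.single (i, j, k) c) * Poly_Mapping.single (i', j', k') c' +
    Poly_Mapping.single (i, j, k) c * partial_x (Poly_Mapping.single (i', j', k') c')"
  "partial_y (Poly_Mapping.single (i, j, k) c * Poly_Mapping.single (i', j', k') c') =
    partial_y (Poly_Mapping.single (i, j, k) c) * Poly_Mapping.single (i', j', k') c' +
    Poly_Mapping.single (i, j, k) c * partial_y (Poly_Mapping.single (i', j', k') c')"
  "partial_z (Poly_Mapping.single (i, j, k) c * Poly_Mapping.single (i', j', k') c') =
    partial_z (Poly_Mapping.single (i, j, k) c) * Poly_Mapping.single (i', j', k') c' +
    Poly_Mapping.single (i, j, k) c * partial_z (Poly_Mapping.single (i', j', k') c')"
  unfolding mult_single add_Pair partial_single
  by (rule single_leibniz[of "\<lambda>n. (n, j + j', k + k')"] single_leibniz[of "\<lambda>n. (i + i', n, k + k')"]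
      single_leibniz[of "\<lambda>n. (i + i', j + j', n)"])+

lemma partial_mult:
  "partial_x (p * q) = partial_x p * q + p * partial_x q"
  "partial_y (p * q) = partial_y p * q + p * partial_y q"
  "partial_z (p * q) = partial_z p * q + p * partial_z q"
proof -
  have "partial_x (p * q) = partial_x p * q + p * partial_x q \<and>
    partial_y (p * q) = partial_y p * q + p * partial_y q \<and>
    partial_z (p * q) = partial_z p * q + p * partial_z q"
  proof (induction p rule: poly3_induct)
    case (single i j k t)
    show ?case
    proof (induction q rule: poly3_induct)
      case (single i' j' k' t')
      show ?case unfolding partial_single_mult by (intro conjI refl)
    next
      case (add p q)
      then show ?case by (simp add: partial_add distrib_left)
    qed
  next
    case (add p q)
    then show ?case by (simp add: partial_add distrib_right)
  qed
  then show "partial_x (p * q) = partial_x p * q + p * partial_x q"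
    "partial_y (p * q) = partial_y p * q + p * partial_y q"
    "partial_z (p * q) = partial_z p * q + p * partial_z q" by blast+
qed

lemma homogeneous3_partial:
  assumes "homogeneous3 (Suc d) p"
  shows "homogeneous3 d (partial_x p)" "homogeneous3 d (partial_y p)" "homogeneous3 d (partial_z p)"
proof -
  have keys: "i + j + k = Suc d" if "(i, j, k) \<in> Poly_Mapping.keys p" for i j k
    using assms that by (auto simp: homogeneous3_def)
  have h: "homogeneous3 d (Poly_Mapping.single (i - 1, j, k) (of_nat i * c))"
     "homogeneous3 d (Poly_Mapping.single (i, j - 1, k) (of_nat j * c))"
     "homogeneous3 d (Poly_Mapping.single (i, j, k - 1) (of_nat k * c))" if "i + j + k = Suc d" for i j k c
    using that unfolding homogeneous3_single by (cases i, auto)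
  show "homogeneous3 d (partial_x p)" "homogeneous3 d (partial_y p)" "homogeneous3 d (partial_z p)"
    unfolding partial_x_def partial_y_def partial_z_def
    by (rule homogeneous3_sum, use keys h in \<open>auto simp del: One_nat_def\<close>)+
qed

lemma euler:
  assumes "homogeneous3 d p"
  shows "poly_x * partial_x p + poly_y * partial_y p + poly_z * partial_z p = const3 (of_nat d) * p"
proof -
  have "poly_x * partial_x p + poly_y * partial_y p + poly_z * partial_z p =
    (\<Sum>m\<in>Poly_Mapping.keys p. const3 (of_nat d) * Poly_Mapping.single m (Poly_Mapping.lookup p m))"
    unfolding partial_x_def partial_y_def partial_z_def sum_distrib_left sum.distrib[symmetric]
  proof (rule sum.cong[OF refl])
    fix m assume m: "m \<in> Poly_Mapping.keys p"
    obtain i j k where mm: "m = (i, j, k)" by (cases m)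
    have d: "d = i + j + k" using m assms by (auto simp: mm homogeneous3_def)
    have e1: "poly_x * Poly_Mapping.single (i - 1, j, k) (of_nat i * c) = Poly_Mapping.single (i, j, k) (of_nat i * c)" for c
      by (cases i) (simp_all add: poly_x_def mult_single)
    have e2: "poly_y * Poly_Mapping.single (i, j - 1, k) (of_nat j * c) = Poly_Mapping.single (i, j, k) (of_nat j * c)" for c
      by (cases j) (simp_all add: poly_y_def mult_single)
    have e3: "poly_z * Poly_Mapping.single (i, j, k - 1) (of_nat k * c) = Poly_Mapping.single (i, j, k) (of_nat k * c)" for c
      by (cases k) (simp_all add: poly_z_def mult_single)
    show "poly_x * (case m of (i, j, k) \<Rightarrow> Poly_Mapping.single (i - 1, j, k) (of_nat i * Poly_Mapping.lookup p (i, j, k))) +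
       poly_y * (case m of (i, j, k) \<Rightarrow> Poly_Mapping.single (i, j - 1, k) (of_nat j * Poly_Mapping.lookup p (i, j, k))) +
       poly_z * (case m of (i, j, k) \<Rightarrow> Poly_Mapping.single (i, j, k - 1) (of_nat k * Poly_Mapping.lookup p (i, j, k))) =
       const3 (of_nat d) * Poly_Mapping.single m (Poly_Mapping.lookup p m)"
      unfolding mm prod.case e1 e2 e3 by (simp add: d const3_def mult_single algebra_simps flip: single_add)
  qed
  also have "\<dots> = const3 (of_nat d) * p"
    unfolding sum_distrib_left[symmetric] poly_mapping_sum_single[symmetric] by (rule refl)
  finally show ?thesis .
qed

lemma partial_linear_form:
  "partial_x (linear_form (l, m, n)) = const3 l" "partial_y (linear_form (l, m, n)) = const3 m"
  "partial_z (linear_form (l, m, n)) = const3 n"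
  by (simp_all add: linear_form_def const3_def poly_x_def poly_y_def poly_z_def mult_single partial_add partial_single)

section \<open>Triples of polynomials acting as derivations\<close>

type_synonym triple = "poly3 \<times> poly3 \<times> poly3"

definition tscale :: "complex \<Rightarrow> triple \<Rightarrow> triple"
  where "tscale t = (\<lambda>(a, b, c). (const3 t * a, const3 t * b, const3 t * c))"

interpretation T: lin_space tscale
  by unfold_locales (auto simp: tscale_def S.\<iota>_add S.\<iota>_mult S.\<iota>_1 algebra_simps)

interpretation TS: lin_space_pair tscale "\<lambda>c p. const3 c * p"
  by unfold_locales

definition der :: "triple \<Rightarrow> poly3 \<Rightarrow> poly3"
  where "der = (\<lambda>(a, b, c) f. a * partial_x f + b * partial_y f + c * partial_z f)"

lemma der_mult: "der \<theta> (f * g) = der \<theta> f * g + f * der \<theta> g"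
  by (cases \<theta>) (simp add: der_def partial_mult algebra_simps)

lemma der_add_left: "der (\<theta> + \<eta>) f = der \<theta> f + der \<eta> f"
  by (cases \<theta>, cases \<eta>) (simp add: der_def algebra_simps)

lemma der_tscale: "der (tscale c \<theta>) f = const3 c * der \<theta> f"
  by (cases \<theta>) (simp add: der_def tscale_def algebra_simps)

lemma linear_der: "Vector_Spaces.linear tscale (\<lambda>c p. const3 c * p) (\<lambda>\<theta>. der \<theta> f)"
  by (simp add: Vector_Spaces.linear_iff T.vector_space_axioms S.vs.vector_space_axioms der_add_left der_tscale)

lemma der_linear_form: "der (a, b, c) (linear_form (l, m, n)) = const3 l * a + const3 m * b + const3 n * c"
  by (simp add: der_def partial_linear_form algebra_simps)

definition tforms :: "nat \<Rightarrow> triple set"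
  where "tforms j = forms j \<times> forms j \<times> forms j"

lemma tforms_iff: "(a, b, c) \<in> tforms j \<longleftrightarrow> homogeneous3 j a \<and> homogeneous3 j b \<and> homogeneous3 j c"
  by (simp add: tforms_def)

lemma subspace_tforms: "T.subspace (tforms j)"
  by (rule T.subspaceI)
     (auto simp: tforms_def tscale_def zero_prod_def intro: homogeneous3_add homogeneous3_const3_mult)

lemma homogeneous3_der:
  assumes "\<theta> \<in> tforms j" "homogeneous3 (Suc e) f"
  shows "homogeneous3 (e + j) (der \<theta> f)"
  using assms
  by (cases \<theta>) (auto simp: der_def tforms_iff add.commute[of e] intro!: homogeneous3_add homogeneous3_mult homogeneous3_partial)

definition tri_unit :: "nat \<Rightarrow> poly3 \<Rightarrow> triple"
  where "tri_unit r p = (if r = 0 then (p, 0, 0) else if r = 1 then (0, p, 0) else (0, 0, p))"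

lemma linear_tri_unit: "Vector_Spaces.linear (\<lambda>c p. const3 c * p) tscale (tri_unit r)"
  by (auto simp: Vector_Spaces.linear_iff T.vector_space_axioms S.vs.vector_space_axioms tri_unit_def tscale_def)

lemma tri_unit_decomp: "(a, b, c) = tri_unit 0 a + tri_unit 1 b + tri_unit 2 c"
  by (simp add: tri_unit_def)

lemma tforms_eq_span: "tforms j = T.span ((\<lambda>(r, m). tri_unit r (Poly_Mapping.single m 1)) ` ({0, 1, 2} \<times> mono_exps j))"
  (is "_ = T.span ?B")
proof
  show "T.span ?B \<subseteq> tforms j"
    by (rule T.span_minimal[OF _ subspace_tforms])
       (auto simp: tri_unit_def tforms_iff mono_exps_def homogeneous3_single)
  have unit: "tri_unit r p \<in> T.span ?B" if "r \<in> {0, 1, 2}" "p \<in> forms j" for r p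
  proof -
    interpret u: Vector_Spaces.linear "\<lambda>c p. const3 c * p" tscale "tri_unit r" by (rule linear_tri_unit)
    have "tri_unit r ` forms j \<subseteq> T.span (tri_unit r ` ((\<lambda>m. Poly_Mapping.single m 1) ` mono_exps j))"
      unfolding forms_eq_span u.span_image by (rule subset_refl)
    also have "\<dots> \<subseteq> T.span ?B" using that(1) by (intro T.span_mono) force
    finally show ?thesis using that(2) by blast
  qed
  show "tforms j \<subseteq> T.span ?B"
  proof
    fix \<theta> assume "\<theta> \<in> tforms j"
    moreover obtain a b c where abc: "\<theta> = (a, b, c)" by (cases \<theta>)
    ultimately have "a \<in> forms j" "b \<in> forms j" "c \<in> forms j" by (auto simp: tforms_iff)
    then show "\<theta> \<in> T.span ?B" unfolding abc tri_unit_decomp[of a b c]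
      by (intro T.span_add unit) simp_all
  qed
qed

lemma fin_dim_tforms: "T.fin_dim (tforms j)"
  unfolding tforms_eq_span by (rule T.fin_dim_span) simp

lemma dim_tforms: "T.dim (tforms j) = 3 * S.vs.dim (forms j)"
proof -
  have "T.dim (tforms j) = card ({0, 1, 2 :: nat} \<times> mono_exps j)"
  proof (rule T.dim_family[OF _ tforms_eq_span], simp, intro ballI)
    fix c and i :: "nat \<times> nat \<times> nat \<times> nat"
    assume z: "(\<Sum>i\<in>{0, 1, 2} \<times> mono_exps j. tscale (c i) (case i of (r, m) \<Rightarrow> tri_unit r (Poly_Mapping.single m 1))) = 0"
      and i: "i \<in> {0, 1, 2} \<times> mono_exps j"
    have "tscale c (tri_unit r (Poly_Mapping.single m 1)) = tri_unit r (Poly_Mapping.single m c)" for c and r :: nat and m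
      by (cases m) (simp add: tscale_def tri_unit_def const3_def mult_single)
    then have "(\<Sum>(r, m)\<in>{0, 1, 2 :: nat} \<times> mono_exps j. tri_unit r (Poly_Mapping.single m (c (r, m)))) = 0"
      using z by (simp add: case_prod_unfold)
    then have s: "(\<Sum>r\<in>{0, 1, 2 :: nat}. \<Sum>m\<in>mono_exps j. tri_unit r (Poly_Mapping.single m (c (r, m)))) = 0"
      by (simp only: sum.cartesian_product)
    have "(\<Sum>m\<in>mono_exps j. tri_unit r (g m)) = tri_unit r (\<Sum>m\<in>mono_exps j. g m)" for r and g :: "_ \<Rightarrow> poly3"
    proof -
      interpret u: Vector_Spaces.linear "\<lambda>c p. const3 c * p" tscale "tri_unit r" by (rule linear_tri_unit)
      show ?thesis by (simp add: u.sum)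
    qed
    then have "tri_unit 0 (\<Sum>m\<in>mono_exps j. Poly_Mapping.single m (c (0, m))) +
        (tri_unit 1 (\<Sum>m\<in>mono_exps j. Poly_Mapping.single m (c (1, m))) +
        tri_unit 2 (\<Sum>m\<in>mono_exps j. Poly_Mapping.single m (c (2, m)))) = 0"
      using s by simp
    then have "(\<Sum>m\<in>mono_exps j. Poly_Mapping.single m (c (r, m))) = 0" if "r \<in> {0, 1, 2}" for r :: nat
      using that by (auto simp: tri_unit_def zero_prod_def)
    moreover obtain r :: nat and m where rm: "i = (r, m)" by (cases i)
    ultimately have "(\<Sum>m\<in>mono_exps j. Poly_Mapping.single m (c (r, m))) = 0" using i by blast
    then have "Poly_Mapping.lookup (\<Sum>m\<in>mono_exps j. Poly_Mapping.single m (c (r, m))) m = 0" by simp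
    then show "c i = 0" using i by (simp add: lookup_sum_single rm)
  qed
  also have "\<dots> = 3 * card (mono_exps j)" by (simp add: card_cartesian_product)
  finally show ?thesis by (simp add: dim_forms)
qed

definition syz :: "poly3 \<Rightarrow> nat \<Rightarrow> triple set"
  where "syz f j = {\<theta> \<in> tforms j. der \<theta> f = 0}"

lemma der_0_left: "der 0 f = 0"
  by (simp add: der_def zero_prod_def)

lemma subspace_syz: "T.subspace (syz f j)"
proof (rule T.subspaceI)
  show "0 \<in> syz f j" using T.subspace_0[OF subspace_tforms] by (simp add: syz_def der_0_left)
  show "x + y \<in> syz f j" if "x \<in> syz f j" "y \<in> syz f j" for x y
    using that T.subspace_add[OF subspace_tforms] by (simp add: syz_def der_add_left)
  show "tscale c x \<in> syz f j" if "x \<in> syz f j" for c x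
    using that T.subspace_scale[OF subspace_tforms] by (simp add: syz_def der_tscale)
qed

lemma fin_dim_syz: "T.fin_dim (syz f j)"
  by (rule T.fin_dim_mono[OF fin_dim_tforms]) (auto simp: syz_def)

section \<open>Dimensions of the Milnor algebra\<close>

lemma ideal3_partial_iff: "p \<in> ideal3 (partial_x f) (partial_y f) (partial_z f) \<longleftrightarrow> (\<exists>\<theta>. p = der \<theta> f)"
  by (auto simp: ideal3_iff der_def)

lemma one_notin_jacobian:
  assumes "homogeneous3 (Suc e) f" "0 < e"
  shows "1 \<notin> ideal3 (partial_x f) (partial_y f) (partial_z f)"
proof
  assume "1 \<in> ideal3 (partial_x f) (partial_y f) (partial_z f)"
  then obtain a b c where abc: "1 = a * partial_x f + b * partial_y f + c * partial_z f"
    unfolding ideal3_iff by blast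
  have "hcomp 0 1 = hcomp 0 (a * partial_x f) + hcomp 0 (b * partial_y f) + hcomp 0 (c * partial_z f)"
    using arg_cong[OF abc, of "hcomp 0"] unfolding hcomp_add .
  also have "\<dots> = 0" using homogeneous3_partial[OF assms(1)] assms(2) by (simp add: hcomp_mult_less)
  finally have "(1 :: poly3) = 0" using hcomp_homogeneous3[OF homogeneous3_1, of 0] by simp
  then show False by simp
qed

text \<open>The partial derivatives have degree \<open>e\<close>, so the Jacobian ideal has nothing
  below it.\<close>

lemma milnor_dim_low:
  assumes "homogeneous3 (Suc e) f" "k < e"
  shows "milnor_dim f k = S.vs.dim (forms k)"
proof -
  have "forms k \<inter> ideal3 (partial_x f) (partial_y f) (partial_z f) \<subseteq> {0}"
  proof
    fix p assume p: "p \<in> forms k \<inter> ideal3 (partial_x f) (partial_y f) (partial_z f)"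
    then obtain a b c where abc: "p = a * partial_x f + b * partial_y f + c * partial_z f"
      by (auto simp: ideal3_iff)
    have "hcomp k p = 0" unfolding abc
      using homogeneous3_partial[OF assms(1)] assms(2) by (simp add: hcomp_mult_less hcomp_add)
    then show "p \<in> {0}" using p hcomp_homogeneous3[of k p k] by simp
  qed
  then have "S.vs.dim (forms k \<inter> ideal3 (partial_x f) (partial_y f) (partial_z f)) = 0"
    using S.vs.dim_zero_fin_dim[OF S.vs.fin_dim_mono[OF fin_dim_forms]] by (metis Int_lower1)
  then show ?thesis
    using S.quot_dim_fin_dim(1)[OF one_notin_jacobian[OF assms(1)] subspace_forms fin_dim_forms] assms(2)
    by (simp add: milnor_dim_def)
qed

text \<open>The part of the Jacobian ideal in degree \<open>e + j\<close> is the image of the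
  triples of degree \<open>j\<close>, with kernel the syzygies. Written additively to avoid
  subtraction of natural numbers.\<close>

lemma milnor_dim_high:
  assumes f: "homogeneous3 (Suc e) f" "0 < e"
  shows "milnor_dim f (e + j) + 3 * S.vs.dim (forms j) = S.vs.dim (forms (e + j)) + T.dim (syz f j)"
proof -
  let ?J = "forms (e + j) \<inter> ideal3 (partial_x f) (partial_y f) (partial_z f)"
  have J: "?J = (\<lambda>\<theta>. der \<theta> f) ` tforms j"
  proof (intro equalityI subsetI)
    fix p assume p: "p \<in> ?J"
    then obtain a b c where abc: "p = a * partial_x f + b * partial_y f + c * partial_z f"
      by (auto simp: ideal3_iff)
    note pd = homogeneous3_partial[OF f(1)]
    have "p = hcomp (j + e) p" using p hcomp_homogeneous3[of "e + j" p "j + e"] by (simp add: add.commute)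
    also have "\<dots> = der (hcomp j a, hcomp j b, hcomp j c) f"
      unfolding abc hcomp_add hcomp_mult[OF pd(1)] hcomp_mult[OF pd(2)] hcomp_mult[OF pd(3)] by (simp add: der_def)
    finally show "p \<in> (\<lambda>\<theta>. der \<theta> f) ` tforms j"
      by (rule image_eqI) (simp add: tforms_iff homogeneous3_hcomp)
  next
    fix p assume "p \<in> (\<lambda>\<theta>. der \<theta> f) ` tforms j"
    then show "p \<in> ?J" using homogeneous3_der[OF _ f(1)] by (auto simp: ideal3_partial_iff)
  qed
  have "3 * S.vs.dim (forms j) = S.vs.dim ?J + T.dim (syz f j)"
    using TS.rank_nullity[OF linear_der[of f] subspace_tforms fin_dim_tforms, of j]
    by (simp add: J syz_def dim_tforms)
  then show ?thesis
    using S.quot_dim_fin_dim[OF one_notin_jacobian[OF f] subspace_forms fin_dim_forms, of "e + j"]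
    by (simp add: milnor_dim_def)
qed

section \<open>Vectors, lines and their parametrisations\<close>

definition dot3 :: "vec3 \<Rightarrow> vec3 \<Rightarrow> complex"
  where "dot3 = (\<lambda>(a, b, c) (x, y, z). a * x + b * y + c * z)"

definition cross3 :: "vec3 \<Rightarrow> vec3 \<Rightarrow> vec3"
  where "cross3 = (\<lambda>(a, b, c) (x, y, z). (b * z - c * y, c * x - a * z, a * y - b * x))"

definition det3 :: "vec3 \<Rightarrow> vec3 \<Rightarrow> vec3 \<Rightarrow> complex"
  where "det3 a b c = dot3 a (cross3 b c)"

definition smult3 :: "complex \<Rightarrow> vec3 \<Rightarrow> vec3"
  where "smult3 t = (\<lambda>(a, b, c). (t * a, t * b, t * c))"

lemma dot3_simps [simp]:
  "dot3 k (p + q) = dot3 k p + dot3 k q" "dot3 k (smult3 t p) = t * dot3 k p"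
  "dot3 (smult3 t k) p = t * dot3 k p"
  by (cases k; cases p; cases q; simp add: dot3_def smult3_def algebra_simps)+

lemma eval3_linear_form: "eval3 (linear_form k) v = dot3 k v"
  by (cases k; cases v) (simp add: dot3_def ev.eval_in_linear_form)

lemma dot3_cross3 [simp]: "dot3 a (cross3 a b) = 0" "dot3 b (cross3 a b) = 0"
  by (cases a; cases b; simp add: dot3_def cross3_def algebra_simps)+

lemma det3_rotate: "det3 a b c = det3 b c a"
  by (cases a; cases b; cases c) (simp add: det3_def dot3_def cross3_def algebra_simps)

lemma det3_swap: "det3 a c b = - det3 a b c"
  by (cases a; cases b; cases c) (simp add: det3_def dot3_def cross3_def algebra_simps)

lemma det3_same [simp]: "det3 a a b = 0" "det3 a b a = 0" "det3 a b b = 0"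
  by (cases a; cases b; simp add: det3_def dot3_def cross3_def algebra_simps)+

lemma dot3_cross3_cross3: "dot3 (cross3 u w) (cross3 k k') = dot3 k u * dot3 k' w - dot3 k w * dot3 k' u"
  by (cases u; cases w; cases k; cases k') (simp add: dot3_def cross3_def algebra_simps)

lemma cross3_nonzero:
  assumes "cross3 a b \<noteq> 0"
  shows "a \<noteq> 0" "b \<noteq> 0" "cross3 b a \<noteq> 0" "a \<noteq> b"
proof -
  show "a \<noteq> 0" "b \<noteq> 0" "a \<noteq> b" using assms
    by (cases a; cases b; force simp: cross3_def zero_prod_def mult.commute)+
  show "cross3 b a \<noteq> 0" using assms
    by (cases a; cases b) (auto simp: cross3_def zero_prod_def mult.commute)
qed

lemma dot3_eq_0_of_det3:
  assumes "cross3 k k' \<noteq> 0" "dot3 k v = 0" "dot3 k' v = 0" "det3 l k k' = 0"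
  shows "dot3 l v = 0"
proof -
  obtain k1 k2 k3 k1' k2' k3' v1 v2 v3 l1 l2 l3
    where [simp]: "k = (k1, k2, k3)" "k' = (k1', k2', k3')" "v = (v1, v2, v3)" "l = (l1, l2, l3)"
    by (cases k; cases k'; cases v; cases l) blast
  define n1 n2 n3 where n: "n1 = k2 * k3' - k3 * k2'" "n2 = k3 * k1' - k1 * k3'" "n3 = k1 * k2' - k2 * k1'"
  have e1: "k1 * v1 + k2 * v2 + k3 * v3 = 0" and e2: "k1' * v1 + k2' * v2 + k3' * v3 = 0"
    using assms(2,3) by (simp_all add: dot3_def)
  have ln: "l1 * n1 + l2 * n2 + l3 * n3 = 0"
    using assms(4) by (simp add: det3_def dot3_def cross3_def n)
  let ?E = "k1 * v1 + k2 * v2 + k3 * v3" and ?E' = "k1' * v1 + k2' * v2 + k3' * v3"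
  have "v1 * n2 - v2 * n1 = k3 * ?E' - k3' * ?E" "v2 * n3 - v3 * n2 = k1 * ?E' - k1' * ?E"
    "v1 * n3 - v3 * n1 = k2' * ?E - k2 * ?E'"
    by (simp_all only: n ring_distribs mult_ac add_ac diff_conv_add_uminus minus_add_distrib) (simp_all add: algebra_simps)
  then have x: "v1 * n2 = v2 * n1" "v2 * n3 = v3 * n2" "v1 * n3 = v3 * n1"
    unfolding e1 e2 by simp_all
  let ?L = "l1 * v1 + l2 * v2 + l3 * v3" and ?N = "l1 * n1 + l2 * n2 + l3 * n3"
  have "?L * n1 = v1 * ?N + l2 * (v2 * n1 - v1 * n2) + l3 * (v3 * n1 - v1 * n3)"
    "?L * n2 = v2 * ?N + l1 * (v1 * n2 - v2 * n1) + l3 * (v3 * n2 - v2 * n3)"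
    "?L * n3 = v3 * ?N + l1 * (v1 * n3 - v3 * n1) + l2 * (v2 * n3 - v3 * n2)"
    by (simp_all add: algebra_simps)
  then have "?L * n1 = 0" "?L * n2 = 0" "?L * n3 = 0" unfolding ln x by simp_all
  moreover have "n1 \<noteq> 0 \<or> n2 \<noteq> 0 \<or> n3 \<noteq> 0"
    using assms(1) by (auto simp: cross3_def n zero_prod_def)
  ultimately show ?thesis by (auto simp: dot3_def)
qed

text \<open>\<open>u\<close> and \<open>w\<close> span the plane over the line \<open>l\<close>,
  with dual coordinates \<open>\<alpha>\<close> and \<open>\<beta>\<close>; the line is traced by u
  + t w, with \<open>w\<close> as its point at infinity. The factor \<open>\<mu>\<close> translates
  determinants with \<open>l\<close> into 2 by 2 determinants on the line.\<close>

locale line_param =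
  fixes l u w \<alpha> \<beta> :: vec3 and \<mu> :: complex
  assumes lu: "dot3 l u = 0" and lw: "dot3 l w = 0"
    and \<alpha>: "dot3 \<alpha> u = 1" "dot3 \<alpha> w = 0" and \<beta>: "dot3 \<beta> u = 0" "dot3 \<beta> w = 1"
    and on_line: "dot3 l v = 0 \<Longrightarrow> v = smult3 (dot3 \<alpha> v) u + smult3 (dot3 \<beta> v) w"
    and cross: "cross3 u w = smult3 \<mu> l" and \<mu>: "\<mu> \<noteq> 0"

lemma line_param_exists:
  assumes l: "l \<noteq> 0" and fin: "finite K" and K: "\<And>k. k \<in> K \<Longrightarrow> cross3 l k \<noteq> 0"
  obtains u w \<alpha> \<beta> \<mu> where "line_param l u w \<alpha> \<beta> \<mu>" "\<And>k. k \<in> K \<Longrightarrow> dot3 k w \<noteq> 0"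
proof -
  obtain e e' \<gamma> \<delta> \<mu> where e: "dot3 l e = 0" "dot3 l e' = 0" "dot3 \<gamma> e = 1" "dot3 \<gamma> e' = 0" "dot3 \<delta> e = 0" "dot3 \<delta> e' = 1"
    "\<And>v. dot3 l v = 0 \<Longrightarrow> v = smult3 (dot3 \<gamma> v) e + smult3 (dot3 \<delta> v) e'"
    "cross3 e e' = smult3 \<mu> l" "\<mu> \<noteq> 0"
  proof -
    obtain a b c where ld: "l = (a, b, c)" by (cases l)
    consider "a \<noteq> 0" | "b \<noteq> 0" | "c \<noteq> 0" using l ld by (auto simp: zero_prod_def)
    then show ?thesis
    proof cases
      case 1
      show ?thesis
        by (rule that[of "(- b / a, 1, 0)" "(- c / a, 0, 1)" "(0, 1, 0)" "(0, 0, 1)" "1 / a"])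
           (use 1 in \<open>auto simp: ld dot3_def smult3_def cross3_def field_simps eq_neg_iff_add_eq_0\<close>)
    next
      case 2
      show ?thesis
        by (rule that[of "(1, - a / b, 0)" "(0, - c / b, 1)" "(1, 0, 0)" "(0, 0, 1)" "- 1 / b"])
           (use 2 in \<open>auto simp: ld dot3_def smult3_def cross3_def field_simps eq_neg_iff_add_eq_0\<close>)
    next
      case 3
      show ?thesis
        by (rule that[of "(1, 0, - a / c)" "(0, 1, - b / c)" "(1, 0, 0)" "(0, 1, 0)" "1 / c"])
           (use 3 in \<open>auto simp: ld dot3_def smult3_def cross3_def field_simps eq_neg_iff_add_eq_0\<close>)
    qed
  qed
  have "finite (\<Union>k\<in>K. {s. dot3 k e + s * dot3 k e' = 0})"
  proof (intro finite_UN_I[OF fin])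
    fix k assume k: "k \<in> K"
    have "{s. dot3 k e + s * dot3 k e' = 0} \<subseteq> {- dot3 k e / dot3 k e'}" if "dot3 k e' \<noteq> 0"
      using that by (auto simp: field_simps add_eq_0_iff2)
    moreover have "{s. dot3 k e + s * dot3 k e' = 0} = {}" if "dot3 k e' = 0"
    proof -
      \<comment> \<open>If \<open>k\<close> vanished at both basis vectors it would vanish on the
        whole plane l = 0 and so be proportional to \<open>l\<close>.\<close>
      have "dot3 k e \<noteq> 0"
      proof
        assume "dot3 k e = 0"
        then have *: "dot3 k (cross3 l v) = 0" for v
          using that e(7)[of "cross3 l v"] by (metis add_0 dot3_cross3(1) dot3_simps(1,2) mult_zero_right)
        have "cross3 l k = 0"
        proof -
          obtain a b c where ld: "l = (a, b, c)" by (cases l)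
          obtain x y z where kd: "k = (x, y, z)" by (cases k)
          show ?thesis using *[of "(1, 0, 0)"] *[of "(0, 1, 0)"] *[of "(0, 0, 1)"]
            by (simp add: ld kd cross3_def dot3_def zero_prod_def algebra_simps)
        qed
        then show False using K k by blast
      qed
      then show ?thesis using that by simp
    qed
    ultimately show "finite {s. dot3 k e + s * dot3 k e' = 0}"
      by (metis finite.emptyI finite.insertI finite_subset)
  qed
  then obtain s where s: "s \<notin> (\<Union>k\<in>K. {s. dot3 k e + s * dot3 k e' = 0})"
    using ex_new_if_finite[OF infinite_UNIV_char_0] by blast
  \<comment> \<open>The point at infinity is moved to \<open>e + s e'\<close>, off all lines of
    \<open>K\<close>, so that each of them meets \<open>l\<close> at a finite parameter.\<close>
  show ?thesis
  proof (rule that[of e' "e + smult3 s e'" "\<delta> + smult3 (- s) \<gamma>" \<gamma> "- \<mu>"])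
    have dl: "dot3 (a + b) v = dot3 a v + dot3 b v" for a b v
      by (cases a; cases b; cases v) (simp add: dot3_def algebra_simps)
    show "line_param l e' (e + smult3 s e') (\<delta> + smult3 (- s) \<gamma>) \<gamma> (- \<mu>)"
    proof
      fix v assume "dot3 l v = 0"
      then have v: "v = smult3 (dot3 \<gamma> v) e + smult3 (dot3 \<delta> v) e'" by (rule e(7))
      have "smult3 (d - s * g) e' + smult3 g (e + smult3 s e') = smult3 g e + smult3 d e'" for d g
        by (cases e; cases e') (simp add: smult3_def algebra_simps)
      then show "v = smult3 (dot3 (\<delta> + smult3 (- s) \<gamma>) v) e' + smult3 (dot3 \<gamma> v) (e + smult3 s e')"
        using v by (simp add: dl)
    next
      have "cross3 e' (e + smult3 s e') = smult3 (-1) (cross3 e e')"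
        by (cases e; cases e') (simp add: cross3_def smult3_def algebra_simps)
      also have "\<dots> = smult3 (- \<mu>) l" unfolding e(8) by (cases l) (simp add: smult3_def)
      finally show "cross3 e' (e + smult3 s e') = smult3 (- \<mu>) l" .
    qed (use e in \<open>simp_all add: dl\<close>)
    show "dot3 k (e + smult3 s e') \<noteq> 0" if "k \<in> K" for k using s that by simp
  qed
qed

section \<open>Restriction of forms to a line\<close>

definition restr :: "vec3 \<Rightarrow> vec3 \<Rightarrow> poly3 \<Rightarrow> complex poly"
  where "restr = (\<lambda>(u1, u2, u3) (w1, w2, w3) p. eval_in (\<lambda>c. [:c:]) p ([:u1, w1:], [:u2, w2:], [:u3, w3:]))"

lemma restr_add: "restr u w (p + q) = restr u w p + restr u w q"
  and restr_mult: "restr u w (p * q) = restr u w p * restr u w q"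
  and restr_const3: "restr u w (const3 c) = [:c:]"
  and restr_1: "restr u w 1 = 1"
  and restr_power: "restr u w (p ^ n) = restr u w p ^ n"
  and restr_sum: "restr u w (sum f A) = (\<Sum>i\<in>A. restr u w (f i))"
  by (cases u; cases w; simp add: restr_def evp.eval_in_add evp.eval_in_mult evp.eval_in_power evp.eval_in_sum)+

lemma restr_prod: "restr u w (prod f A) = (\<Prod>i\<in>A. restr u w (f i))"
  by (induction A rule: infinite_finite_induct) (simp_all add: restr_mult restr_1)

lemma poly_restr: "poly (restr u w p) t = eval3 p (u + smult3 t w)"
proof -
  obtain u1 u2 u3 w1 w2 w3 where uw: "u = (u1, u2, u3)" "w = (w1, w2, w3)" by (cases u; cases w)
  have "poly (eval_in (\<lambda>c. [:c:]) p ([:u1, w1:], [:u2, w2:], [:u3, w3:])) t =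
     eval_in (\<lambda>c. c) p (poly [:u1, w1:] t, poly [:u2, w2:] t, poly [:u3, w3:] t)"
    by (rule eval_in_eval_in[OF evp.complex_algebra_axioms ev.complex_algebra_axioms]) simp_all
  then show ?thesis by (simp add: uw restr_def smult3_def)
qed

lemma restr_linear_form: "restr u w (linear_form k) = [:dot3 k u, dot3 k w:]"
proof -
  have "poly (restr u w (linear_form k)) t = poly [:dot3 k u, dot3 k w:] t" for t
    by (simp add: poly_restr eval3_linear_form)
  then show ?thesis by (simp add: poly_eq_poly_eq_iff[symmetric] fun_eq_iff)
qed

text \<open>A strict bound that includes 0, so that \<open>N\<close> is the dimension also for
  \<open>N = 0\<close>, which \<open>degree\<close> cannot express.\<close>

definition polys_below :: "nat \<Rightarrow> complex poly set"
  where "polys_below N = {p. \<forall>i\<ge>N. coeff p i = 0}"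

lemma polys_below_Suc: "p \<in> polys_below (Suc n) \<longleftrightarrow> degree p \<le> n"
  unfolding polys_below_def by (auto intro: degree_le coeff_eq_0)

lemma restr_polys_below:
  assumes "homogeneous3 d p"
  shows "restr u w p \<in> polys_below (Suc d)"
proof -
  obtain u1 u2 u3 w1 w2 w3 where uw: "u = (u1, u2, u3)" "w = (w1, w2, w3)" by (cases u; cases w)
  have lin: "degree ([:a, b:] ^ n :: complex poly) \<le> n" for a b n
  proof -
    have "degree [:a, b:] \<le> 1" by (simp add: degree_pCons_eq_if)
    then show ?thesis using degree_power_le[of "[:a, b:]" n] mult_le_mono1[of "degree [:a, b:]" 1 n] by linarith
  qed
  have "degree (restr u w p) \<le> d"
    unfolding uw restr_def prod.case eval_in_def
  proof (rule degree_sum_le[OF finite_keys])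
    fix m assume m: "m \<in> Poly_Mapping.keys p"
    obtain i j k where mm: "m = (i, j, k)" by (cases m)
    have ijk: "i + j + k = d" using m assms by (auto simp: mm homogeneous3_def)
    have "degree ([:Poly_Mapping.lookup p (i, j, k):] * [:u1, w1:] ^ i * [:u2, w2:] ^ j * [:u3, w3:] ^ k) \<le> 0 + i + j + k"
      by (intro degree_mult_le[THEN le_trans] add_mono lin) simp
    then show "degree (case m of (i, j, k) \<Rightarrow> [:Poly_Mapping.lookup p (i, j, k):] * [:u1, w1:] ^ i * [:u2, w2:] ^ j * [:u3, w3:] ^ k) \<le> d"
      using ijk by (simp add: mm)
  qed
  then show ?thesis by (simp add: polys_below_Suc)
qed

context line_param
begin

lemma restr_eq_0_iff:
  assumes "homogeneous3 d p"
  shows "restr u w p = 0 \<longleftrightarrow> (\<forall>v. dot3 l v = 0 \<longrightarrow> eval3 p v = 0)"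
proof
  assume 0: "restr u w p = 0"
  have hom: "eval3 p (smult3 t v) = t ^ d * eval3 p v" for t v
    using eval_in_homogeneous[OF ev.complex_algebra_axioms assms] by (cases v) (simp add: smult3_def)
  have nz: "eval3 p (smult3 a u + smult3 b w) = 0" if "a \<noteq> 0" for a b
  proof -
    have "smult3 a u + smult3 b w = smult3 a (u + smult3 (b / a) w)"
      using that by (cases u; cases w) (simp add: smult3_def field_simps)
    then show ?thesis using 0 poly_restr[of u w p "b / a"] by (simp add: hom)
  qed
  \<comment> \<open>The parametrisation misses the point at infinity. It is reached by letting the
    coefficient of \<open>u\<close> vary: a polynomial that vanishes at all nonzero parameters
    vanishes at zero as well.\<close>
  have "eval3 p (smult3 b w + smult3 s u) = 0" for b s
  proof -
    have "poly (restr (smult3 b w) u p) s = 0" if "s \<noteq> 0" for s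
      using nz[OF that, of b] by (simp add: poly_restr add.commute)
    then have "- {0} \<subseteq> {s. poly (restr (smult3 b w) u p) s = 0}" by auto
    moreover have "infinite (- {0 :: complex})"
      by (simp add: infinite_UNIV_char_0 finite_compl)
    ultimately have "restr (smult3 b w) u p = 0"
      using poly_roots_finite finite_subset by metis
    then show ?thesis by (simp add: poly_restr[symmetric])
  qed
  then show "\<forall>v. dot3 l v = 0 \<longrightarrow> eval3 p v = 0"
    using on_line by (metis add.commute)
next
  assume van: "\<forall>v. dot3 l v = 0 \<longrightarrow> eval3 p v = 0"
  have "dot3 l (u + smult3 t w) = 0" for t by (simp add: lu lw)
  then have "poly (restr u w p) t = 0" for t using van by (metis poly_restr)
  then show "restr u w p = 0" using poly_all_0_iff_0 by blast
qed

text \<open>On the parametrised line \<open>\<beta>\<close> restricts to t and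
  \<open>\<alpha>\<close> to 1, so a preimage is the homogenisation of \<open>r\<close> in these two
  linear forms.\<close>

lemma restr_surj:
  assumes "r \<in> polys_below (Suc d)"
  obtains p where "homogeneous3 d p" "restr u w p = r"
proof -
  have dr: "degree r \<le> d" using assms by (simp add: polys_below_Suc)
  let ?p = "\<Sum>i\<le>d. const3 (coeff r i) * (linear_form \<beta> ^ i * linear_form \<alpha> ^ (d - i))"
  have "homogeneous3 d ?p"
  proof (intro homogeneous3_sum homogeneous3_const3_mult)
    fix i assume "i \<in> {..d}"
    moreover have "homogeneous3 (1 * i + 1 * (d - i)) (linear_form \<beta> ^ i * linear_form \<alpha> ^ (d - i))"
      by (intro homogeneous3_mult homogeneous3_power homogeneous3_linear_form)
    ultimately show "homogeneous3 d (linear_form \<beta> ^ i * linear_form \<alpha> ^ (d - i))" by simp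
  qed
  moreover have "restr u w ?p = r"
  proof -
    have "restr u w ?p = (\<Sum>i\<le>d. monom (coeff r i) i)"
      by (simp add: restr_sum restr_mult restr_const3 restr_power restr_linear_form \<alpha> \<beta>
          monom_altdef one_pCons[symmetric])
    also have "\<dots> = r" using poly_as_sum_of_monoms'[OF dr] .
    finally show ?thesis .
  qed
  ultimately show ?thesis by (rule that)
qed

end

interpretation P: lin_space "smult :: complex \<Rightarrow> _ \<Rightarrow> complex poly"
  by unfold_locales (simp_all add: smult_add_right smult_add_left)

interpretation TP: lin_space_pair tscale "smult :: complex \<Rightarrow> _ \<Rightarrow> complex poly"
  by unfold_locales

interpretation PP: lin_space_pair "smult :: complex \<Rightarrow> _ \<Rightarrow> complex poly" "smult :: complex \<Rightarrow> _ \<Rightarrow> complex poly"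
  by unfold_locales

lemma subspace_polys_below: "P.subspace (polys_below N)"
  by (rule P.subspaceI) (auto simp: polys_below_def)

lemma polys_below_eq_span: "polys_below N = P.span ((\<lambda>i. monom 1 i) ` {..<N})"
proof
  show "P.span ((\<lambda>i. monom 1 i) ` {..<N}) \<subseteq> polys_below N"
    by (rule P.span_minimal[OF _ subspace_polys_below]) (auto simp: polys_below_def)
  show "polys_below N \<subseteq> P.span ((\<lambda>i. monom 1 i) ` {..<N})"
  proof
    fix p assume p: "p \<in> polys_below N"
    have "p = (\<Sum>i<N. smult (coeff p i) (monom 1 i))"
      by (rule poly_eqI) (use p in \<open>auto simp: coeff_sum polys_below_def if_distrib cong: if_cong\<close>)
    then show "p \<in> P.span ((\<lambda>i. monom 1 i) ` {..<N})"
      by (metis (no_types, lifting) P.span_base P.span_scale P.span_sum imageI)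
  qed
qed

lemma fin_dim_polys_below: "P.fin_dim (polys_below N)"
  unfolding polys_below_eq_span by (rule P.fin_dim_span) simp

lemma dim_polys_below: "P.dim (polys_below N) = N"
proof -
  have "P.dim (polys_below N) = card {..<N}"
  proof (rule P.dim_family[OF _ polys_below_eq_span], simp, intro ballI)
    fix c i assume "(\<Sum>i<N. smult (c i) (monom 1 i)) = (0 :: complex poly)" "i \<in> {..<N}"
    then have "coeff (\<Sum>i<N. smult (c i) (monom 1 i)) i = 0" by simp
    then show "c i = 0" using \<open>i \<in> {..<N}\<close> by (simp add: coeff_sum if_distrib cong: if_cong)
  qed
  then show ?thesis by simp
qed

section \<open>Univariate polynomials with prescribed roots\<close>

lemma prod_roots_factor:
  fixes p :: "complex poly"
  assumes "finite A" "\<And>t. t \<in> A \<Longrightarrow> poly p t = 0"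
  obtains r where "p = (\<Prod>t\<in>A. [:- t, 1:]) * r"
proof -
  have "\<exists>r. p = (\<Prod>t\<in>A. [:- t, 1:]) * r"
    using assms
  proof (induction A rule: finite_induct)
    case (insert a A)
    then obtain r where r: "p = (\<Prod>t\<in>A. [:- t, 1:]) * r" by auto
    have "poly (\<Prod>t\<in>A. [:- t, 1:]) a \<noteq> 0" using insert.hyps by (auto simp: poly_prod)
    then have "poly r a = 0" using insert.prems[of a] r by simp
    then obtain r' where r': "r = [:- a, 1:] * r'" unfolding poly_eq_0_iff_dvd by (rule dvdE)
    show ?case unfolding r r' prod.insert[OF insert.hyps] by (intro exI[of _ r']) (simp only: mult_ac)
  qed simp
  then show ?thesis using that by blast
qed

lemma prod_mult_polys_below:
  fixes r :: "complex poly"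
  assumes "finite A"
  shows "(\<Prod>t\<in>A. [:- t, 1:]) * r \<in> polys_below (card A + N) \<longleftrightarrow> r \<in> polys_below N"
proof -
  let ?G = "\<Prod>t\<in>A. [:- t, 1:]"
  have G0: "?G \<noteq> 0" using assms by simp
  have dG: "degree ?G = card A" by (subst degree_prod_eq_sum_degree) (use assms in auto)
  have pb: "p \<in> polys_below N \<longleftrightarrow> p = 0 \<or> degree p < N" for p N
    unfolding polys_below_def using coeff_eq_0[of p] leading_coeff_neq_0[of p] by (auto, metis le_trans linorder_not_le le_degree)
  show ?thesis unfolding pb using G0 by (cases "r = 0") (auto simp: degree_mult_eq dG)
qed

text \<open>Lagrange interpolation with cofactors of degree at most \<open>e\<close>; for
  \<open>e = 0\<close> it is the classical case. In the induction a constant multiple of the product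
  over \<open>A\<close> corrects the value at the new point, after which its linear factor divides
  out.\<close>

lemma lagrange_decomposition:
  assumes "finite A" "A \<noteq> {}" "r \<in> polys_below (card A + e)"
  obtains m where "\<And>t. t \<in> A \<Longrightarrow> m t \<in> polys_below (Suc e)"
    "r = (\<Sum>t\<in>A. (\<Prod>x\<in>A - {t}. [:- x, 1:]) * m t)"
proof -
  have "\<exists>m. (\<forall>t\<in>A. m t \<in> polys_below (Suc e)) \<and> r = (\<Sum>t\<in>A. (\<Prod>x\<in>A - {t}. [:- x, 1:]) * m t)"
    using assms
  proof (induction A arbitrary: r rule: finite_ne_induct)
    case (singleton a)
    then show ?case by (intro exI[of _ "\<lambda>_. r"]) simp
  next
    case (insert a A)
    let ?G = "\<Prod>x\<in>A. [:- x, 1:]"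
    have Ga: "poly ?G a \<noteq> 0" using insert.hyps by (auto simp: poly_prod)
    define c where "c = poly r a / poly ?G a"
    have "poly (r - smult c ?G) a = 0" using Ga by (simp add: c_def)
    then obtain q where q: "r - smult c ?G = [:- a, 1:] * q" unfolding poly_eq_0_iff_dvd by (rule dvdE)
    have "?G * [:c:] \<in> polys_below (card A + Suc e)"
      using prod_mult_polys_below[of A "[:c:]" "Suc e"] insert.hyps by (simp add: polys_below_Suc)
    then have "r - smult c ?G \<in> polys_below (card A + Suc e)"
      using insert.prems insert.hyps P.subspace_diff[OF subspace_polys_below, of r] by (simp add: mult.commute)
    then have "[:- a, 1:] * q \<in> polys_below (card {a} + (card A + e))" unfolding q by simp
    then have "q \<in> polys_below (card A + e)"
      using prod_mult_polys_below[of "{a}" q "card A + e"] by simp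
    then obtain m where m: "\<forall>t\<in>A. m t \<in> polys_below (Suc e)" "q = (\<Sum>t\<in>A. (\<Prod>x\<in>A - {t}. [:- x, 1:]) * m t)"
      using insert.IH by blast
    define m' where "m' t = (if t = a then [:c:] else m t)" for t
    have "r = ?G * [:c:] + [:- a, 1:] * q" using q by (simp add: algebra_simps)
    also have "[:- a, 1:] * q = (\<Sum>t\<in>A. (\<Prod>x\<in>insert a A - {t}. [:- x, 1:]) * m' t)"
      unfolding m(2) sum_distrib_left
    proof (rule sum.cong[OF refl])
      fix t assume t: "t \<in> A"
      then have "insert a A - {t} = insert a (A - {t})" "a \<notin> A - {t}" "t \<noteq> a" using insert.hyps by auto
      then show "[:- a, 1:] * ((\<Prod>x\<in>A - {t}. [:- x, 1:]) * m t) = (\<Prod>x\<in>insert a A - {t}. [:- x, 1:]) * m' t"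
        using insert.hyps by (simp add: m'_def mult.assoc del: mult_pCons_left)
    qed
    also have "?G * [:c:] = (\<Prod>x\<in>insert a A - {a}. [:- x, 1:]) * m' a"
      using insert.hyps by (simp add: m'_def)
    finally have "r = (\<Sum>t\<in>insert a A. (\<Prod>x\<in>insert a A - {t}. [:- x, 1:]) * m' t)"
      using insert.hyps by simp
    moreover have "\<forall>t\<in>insert a A. m' t \<in> polys_below (Suc e)" using m(1) by (auto simp: m'_def polys_below_Suc)
    ultimately show ?case by blast
  qed
  then show ?thesis using that by blast
qed

section \<open>Logarithmic derivations of line arrangements\<close>

text \<open>The degree \<open>j\<close> part of the module of logarithmic derivations; \<theta>(l)
  lying in (l) is expressed by vanishing on the plane l = 0. Euler multiples are included.\<close>

definition logder :: "vec3 list \<Rightarrow> nat \<Rightarrow> triple set"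
  where "logder ls j = {\<theta> \<in> tforms j. \<forall>k\<in>set ls. \<forall>v. dot3 k v = 0 \<longrightarrow> eval3 (der \<theta> (linear_form k)) v = 0}"

lemma subspace_logder: "T.subspace (logder ls j)"
proof (rule T.subspaceI)
  show "0 \<in> logder ls j" using T.subspace_0[OF subspace_tforms] by (simp add: logder_def der_0_left)
  show "x + y \<in> logder ls j" if "x \<in> logder ls j" "y \<in> logder ls j" for x y
    using that T.subspace_add[OF subspace_tforms] by (simp add: logder_def der_add_left ev.eval_in_add)
  show "tscale c x \<in> logder ls j" if "x \<in> logder ls j" for c x
    using that T.subspace_scale[OF subspace_tforms] by (simp add: logder_def der_tscale ev.eval_in_mult)
qed

lemma fin_dim_logder: "T.fin_dim (logder ls j)"
  by (rule T.fin_dim_mono[OF fin_dim_tforms]) (auto simp: logder_def)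

lemma homogeneous3_der_linear: "\<theta> \<in> tforms j \<Longrightarrow> homogeneous3 j (der \<theta> (linear_form k))"
  using homogeneous3_der[of \<theta> j 0] by simp

lemma linear_restr_der: "Vector_Spaces.linear tscale smult (\<lambda>\<theta>. restr u w (der \<theta> f))"
  by (simp add: Vector_Spaces.linear_iff T.vector_space_axioms P.vector_space_axioms der_add_left der_tscale
      restr_add restr_mult restr_const3)

definition dir_der :: "poly3 \<Rightarrow> vec3 \<Rightarrow> triple"
  where "dir_der p = (\<lambda>(a, b, c). (p * const3 a, p * const3 b, p * const3 c))"

lemma der_dir_der: "der (dir_der p q) (linear_form k) = p * const3 (dot3 k q)"
  by (cases q; cases k) (simp add: dir_der_def der_linear_form dot3_def S.\<iota>_add S.\<iota>_mult algebra_simps)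

lemma dir_der_tforms: "homogeneous3 j p \<Longrightarrow> dir_der p q \<in> tforms j"
  by (cases q) (auto simp: dir_der_def tforms_iff mult.commute[of p] intro: homogeneous3_const3_mult)

text \<open>The constant field in direction \<open>q\<close> is tangent to every line through
  \<open>q\<close>; the coefficient has to take care of the others only.\<close>

lemma dir_der_logder:
  assumes "homogeneous3 j p" "\<And>k. k \<in> set ls \<Longrightarrow> dot3 k q \<noteq> 0 \<Longrightarrow> linear_form k dvd p"
  shows "dir_der p q \<in> logder ls j"
  unfolding logder_def
proof (intro CollectI conjI ballI allI impI)
  fix k v assume k: "k \<in> set ls" and v: "dot3 k v = 0"
  show "eval3 (der (dir_der p q) (linear_form k)) v = 0"
  proof (cases "dot3 k q = 0")
    case False
    then obtain r where "p = linear_form k * r" using assms(2)[OF k] by (auto elim: dvdE)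
    then show ?thesis using v by (simp add: der_dir_der ev.eval_in_mult eval3_linear_form)
  qed (simp add: der_dir_der ev.eval_in_mult)
qed (rule dir_der_tforms[OF assms(1)])

lemma homogeneous3_prod: "finite A \<Longrightarrow> (\<And>k. k \<in> A \<Longrightarrow> homogeneous3 1 (f k)) \<Longrightarrow> homogeneous3 (card A) (prod f A)"
proof (induction A rule: finite_induct)
  case (insert a A)
  then show ?case using homogeneous3_mult[of 1 "f a" "card A" "prod f A"] by simp
qed simp

context line_param
begin

text \<open>The parameter at which the line \<open>k\<close> meets \<open>l\<close>.\<close>

definition tau :: "vec3 \<Rightarrow> complex"
  where "tau k = - dot3 k u / dot3 k w"

lemma restr_linear_tau: "dot3 k w \<noteq> 0 \<Longrightarrow> restr u w (linear_form k) = smult (dot3 k w) [:- tau k, 1:]"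
  by (simp add: restr_linear_form tau_def)

lemma tau_eq_iff:
  assumes "dot3 k w \<noteq> 0" "dot3 k' w \<noteq> 0"
  shows "tau k = tau k' \<longleftrightarrow> det3 l k k' = 0"
proof -
  have "\<mu> * det3 l k k' = dot3 k u * dot3 k' w - dot3 k w * dot3 k' u"
    using dot3_cross3_cross3[of u w k k'] by (simp add: cross det3_def)
  then have "det3 l k k' = 0 \<longleftrightarrow> dot3 k u * dot3 k' w = dot3 k w * dot3 k' u"
    using \<mu> by (metis eq_iff_diff_eq_0 mult_eq_0_iff)
  then show ?thesis using assms by (auto simp: tau_def field_simps)
qed

lemma kernel_restr_der: "{\<theta> \<in> logder ks j. restr u w (der \<theta> (linear_form l)) = 0} = logder (l # ks) j"
proof (rule Set.set_eqI)
  fix \<theta>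
  show "\<theta> \<in> {\<theta> \<in> logder ks j. restr u w (der \<theta> (linear_form l)) = 0} \<longleftrightarrow> \<theta> \<in> logder (l # ks) j"
  proof (cases "\<theta> \<in> tforms j")
    case True
    show ?thesis
      unfolding logder_def mem_Collect_eq restr_eq_0_iff[OF homogeneous3_der_linear[OF True]] list.set ball_simps
      by blast
  qed (simp add: logder_def)
qed

text \<open>The restriction of \<theta>(l) to \<open>l\<close> must vanish where two lines of
  \<open>ks\<close> meet on \<open>l\<close>, and the claim is that this is the only condition. With
  \<open>D\<close> the set of these points, the image has dimension \<open>j + 1 - card D\<close>,
  and \<open>card D\<close> is the number of lines minus the number of their points on
  \<open>l\<close>.\<close>

lemma addition_step:
  assumes dist: "distinct ks" and kw: "\<And>k. k \<in> set ks \<Longrightarrow> dot3 k w \<noteq> 0"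
    and par: "\<And>k k'. k \<in> set ks \<Longrightarrow> k' \<in> set ks \<Longrightarrow> k \<noteq> k' \<Longrightarrow> cross3 k k' \<noteq> 0"
    and two: "\<And>t. card {k \<in> set ks. tau k = t} \<le> 2"
    and n: "2 \<le> card (tau ` set ks)" and j: "length ks \<le> j + 2"
  shows "T.dim (logder ks j) + length ks = T.dim (logder (l # ks) j) + (j + 1) + card (tau ` set ks)"
proof -
  let ?K = "set ks" and ?f = "\<lambda>\<theta>. restr u w (der \<theta> (linear_form l))"
  let ?T = "tau ` ?K"
  define D where "D = {t \<in> ?T. card {k \<in> ?K. tau k = t} = 2}"
  have finT: "finite ?T" "finite D" by (auto simp: D_def)
  have fib: "card {k \<in> ?K. tau k = t} = 1 + (if t \<in> D then 1 else 0)" if "t \<in> ?T" for t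
  proof -
    have "{k \<in> ?K. tau k = t} \<noteq> {}" using that by auto
    then have "card {k \<in> ?K. tau k = t} \<noteq> 0" by simp
    moreover have "card {k \<in> ?K. tau k = t} \<le> 2" by (rule two)
    moreover have "t \<in> D \<longleftrightarrow> card {k \<in> ?K. tau k = t} = 2" using that by (simp add: D_def)
    ultimately show ?thesis
    proof (cases "t \<in> D")
      case False
      with \<open>t \<in> D \<longleftrightarrow> card {k \<in> ?K. tau k = t} = 2\<close> have "card {k \<in> ?K. tau k = t} \<noteq> 2" by blast
      with \<open>card {k \<in> ?K. tau k = t} \<noteq> 0\<close> \<open>card {k \<in> ?K. tau k = t} \<le> 2\<close>
      have "card {k \<in> ?K. tau k = t} = 1" by linarith
      with False show ?thesis by simp
    qed simp
  qed
  have DT: "D \<subseteq> ?T" by (auto simp: D_def)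
  have cardK: "card ?K = length ks" by (rule distinct_card[OF dist])
  have "card ?K = (\<Sum>t\<in>?T. card {k \<in> ?K. tau k = t})"
    using sum.image_gen[of ?K "\<lambda>_. 1 :: nat" tau] by simp
  also have "\<dots> = (\<Sum>t\<in>?T. 1 + (if t \<in> D then 1 else 0))" by (rule sum.cong[OF refl fib])
  also have "\<dots> = card ?T + card D" unfolding sum.distrib using DT finT by (simp add: sum.If_cases Int_absorb1)
  finally have d: "length ks = card ?T + card D" using cardK by simp
  have cD: "card D \<le> card ?T" by (rule card_mono[OF finT(1) DT])
  have Dj: "card D \<le> j + 1" using d cD j n by linarith
  let ?G = "\<Prod>t\<in>D. [:- t, 1:]"
  define N where "N = j + 1 - card D"
  have prodK: "(\<Prod>k\<in>?K. [:- tau k, 1:]) = (\<Prod>t\<in>?T. [:- t, 1:]) * ?G"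
  proof -
    have "(\<Prod>k\<in>?K. [:- tau k, 1:]) = (\<Prod>t\<in>?T. \<Prod>k\<in>{k \<in> ?K. tau k = t}. [:- tau k, 1:])"
      by (rule prod.image_gen) simp
    also have "\<dots> = (\<Prod>t\<in>?T. [:- t, 1:] ^ (card {k \<in> ?K. tau k = t}))"
      by (intro prod.cong refl) simp
    also have "\<dots> = (\<Prod>t\<in>?T. [:- t, 1:] * (if t \<in> D then [:- t, 1:] else 1))"
      by (rule prod.cong[OF refl]) (subst fib; simp)
    also have "\<dots> = (\<Prod>t\<in>?T. [:- t, 1:]) * (\<Prod>t\<in>?T \<inter> D. [:- t, 1:])"
      unfolding prod.distrib prod.inter_restrict[OF finT(1)] by (rule refl)
    finally show ?thesis using DT by (simp add: Int_absorb1)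
  qed
  have im: "?f ` logder ks j = (\<lambda>r. ?G * r) ` polys_below N"
  proof (intro equalityI subsetI)
    fix p assume "p \<in> ?f ` logder ks j"
    then obtain \<theta> where \<theta>: "\<theta> \<in> logder ks j" "p = ?f \<theta>" by blast
    then have \<theta>t: "\<theta> \<in> tforms j" by (simp add: logder_def)
    \<comment> \<open>At such a point the vector \<theta>(v) is annihilated by two independent lines
      and therefore by \<open>l\<close>, which is concurrent with them.\<close>
    have "poly p t = 0" if t: "t \<in> D" for t
    proof -
      have "card {k \<in> ?K. tau k = t} = 2" using t by (simp add: D_def)
      then obtain k k' where kk: "{k \<in> ?K. tau k = t} = {k, k'}" "k \<noteq> k'" by (meson card_2_iff)
      then have k: "k \<in> ?K" "k' \<in> ?K" "tau k = t" "tau k' = t" by auto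
      let ?v = "u + smult3 t w"
      have on: "dot3 k ?v = 0" if "k \<in> ?K" "tau k = t" for k
        using that kw[OF that(1)] by (auto simp: tau_def)
      obtain a b c where abc: "\<theta> = (a, b, c)" by (cases \<theta>)
      have ev: "eval3 (der \<theta> (linear_form m)) ?v = dot3 m (eval3 a ?v, eval3 b ?v, eval3 c ?v)" for m
        by (cases m) (simp add: abc der_linear_form dot3_def ev.eval_in_add ev.eval_in_mult)
      have "dot3 l (eval3 a ?v, eval3 b ?v, eval3 c ?v) = 0"
      proof (rule dot3_eq_0_of_det3[OF par[OF k(1,2) kk(2)]])
        show "det3 l k k' = 0" using tau_eq_iff[OF kw[OF k(1)] kw[OF k(2)]] k by simp
        show "dot3 k (eval3 a ?v, eval3 b ?v, eval3 c ?v) = 0" "dot3 k' (eval3 a ?v, eval3 b ?v, eval3 c ?v) = 0"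
          using \<theta>(1) k on unfolding logder_def ev[symmetric] by blast+
      qed
      then show ?thesis by (simp add: \<theta>(2) poly_restr ev)
    qed
    then obtain r where r: "p = ?G * r" using prod_roots_factor[OF finT(2)] by blast
    have "p \<in> polys_below (card D + N)"
      using restr_polys_below[OF homogeneous3_der_linear[OF \<theta>t]] Dj by (simp add: \<theta>(2) N_def)
    then have "r \<in> polys_below N" unfolding r using prod_mult_polys_below[OF finT(2)] by blast
    then show "p \<in> (\<lambda>r. ?G * r) ` polys_below N" using r by blast
  next
    fix p assume "p \<in> (\<lambda>r. ?G * r) ` polys_below N"
    then obtain r where r: "r \<in> polys_below N" "p = ?G * r" by blast
    have subim: "P.subspace (?f ` logder ks j)"
    proof -
      interpret f: Vector_Spaces.linear tscale smult ?f by (rule linear_restr_der)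
      show ?thesis by (rule f.subspace_image[OF subspace_logder])
    qed
    \<comment> \<open>One line \<open>ks0\<close> is kept fixed. Interpolation over the remaining
      points \<open>?T'\<close> of \<open>l\<close> writes \<open>r\<close> as a sum, each summand
      of which is realised by the field pointing to the intersection of \<open>ks0\<close> with a
      line through that point.\<close>
    have "?T \<noteq> {}" using n by (metis card.empty not_numeral_le_zero)
    then obtain s where s: "s \<in> ?T" by (meson ex_in_conv)
    then obtain ks0 where ks0: "ks0 \<in> ?K" "tau ks0 = s" by (metis imageE)
    let ?T' = "?T - {s}"
    have cT': "card ?T' + 1 = card ?T" using card_Suc_Diff1[OF finT(1) s] by linarith
    have T'0: "?T' \<noteq> {}"
    proof
      assume "?T' = {}"
      then have "card ?T' = 0" by (simp only: card.empty)
      then show False using cT' n by linarith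
    qed
    \<comment> \<open>The field uses two lines and its coefficient contains the other
      \<open>length ks - 2\<close>, which leaves degree \<open>e\<close> for the free
      factor.\<close>
    define e where "e = j + 2 - length ks"
    have "N = card ?T' + e" using d j n cT' Dj by (simp add: N_def e_def)
    then have "r \<in> polys_below (card ?T' + e)" using r by simp
    then obtain m where m: "\<And>t. t \<in> ?T' \<Longrightarrow> m t \<in> polys_below (Suc e)"
       "r = (\<Sum>t\<in>?T'. (\<Prod>x\<in>?T' - {t}. [:- x, 1:]) * m t)"
      using lagrange_decomposition[of ?T' r e] T'0 finT by blast
    have "?G * ((\<Prod>x\<in>?T' - {t}. [:- x, 1:]) * m t) \<in> ?f ` logder ks j" if t: "t \<in> ?T'" for t
    proof -
      obtain k where k: "k \<in> ?K" "tau k = t" "k \<noteq> ks0" using t ks0 by auto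
      let ?R = "?K - {ks0, k}" and ?q = "cross3 ks0 k"
      obtain M where M: "homogeneous3 e M" "restr u w M = m t" using restr_surj[OF m(1)[OF t]] by blast
      let ?Q = "\<Prod>k\<in>?R. linear_form k"
      have "card ?R = length ks - 2" using ks0 k cardK by (subst card_Diff_subset) auto
      then have "homogeneous3 (e + (length ks - 2)) (M * ?Q)"
        using homogeneous3_mult[OF M(1) homogeneous3_prod[of ?R linear_form]] homogeneous3_linear_form by simp
      moreover have "e + (length ks - 2) = j" using j d n by (simp add: e_def)
      ultimately have hom: "homogeneous3 j (M * ?Q)" by simp
      have ld: "dir_der (M * ?Q) ?q \<in> logder ks j"
      proof (rule dir_der_logder[OF hom])
        fix k' assume "k' \<in> ?K" "dot3 k' ?q \<noteq> 0"
        then have "k' \<in> ?R" by auto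
        then show "linear_form k' dvd M * ?Q" by (intro dvd_mult dvd_prodI) auto
      qed
      define c where "c = dot3 l ?q * (\<Prod>k\<in>?R. dot3 k w)"
      have "det3 l ks0 k \<noteq> 0"
        using tau_eq_iff[OF kw[OF ks0(1)] kw[OF k(1)]] t ks0 k by auto
      then have c0: "c \<noteq> 0" using kw by (simp add: c_def det3_def)
      have "(\<Prod>k\<in>?R. restr u w (linear_form k)) = (\<Prod>k\<in>?R. smult (dot3 k w) [:- tau k, 1:])"
        by (rule prod.cong[OF refl]) (use restr_linear_tau kw in blast)
      also have "\<dots> = smult (\<Prod>k\<in>?R. dot3 k w) (\<Prod>k\<in>?R. [:- tau k, 1:])"
        by (rule prod_smult)
      finally have pR: "(\<Prod>k\<in>?R. restr u w (linear_form k)) = smult (\<Prod>k\<in>?R. dot3 k w) (\<Prod>k\<in>?R. [:- tau k, 1:])" .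
      have "(\<Prod>k\<in>?K. [:- tau k, 1:]) = ([:- s, 1:] * [:- t, 1:]) * (\<Prod>k\<in>?R. [:- tau k, 1:])"
      proof -
        have "?K = insert ks0 (insert k ?R)" using ks0 k by auto
        then have "(\<Prod>k\<in>?K. [:- tau k, 1:]) = (\<Prod>k\<in>insert ks0 (insert k ?R). [:- tau k, 1:])" by (rule arg_cong)
        also have "\<dots> = [:- tau ks0, 1:] * ([:- tau k, 1:] * (\<Prod>k\<in>?R. [:- tau k, 1:]))"
          by (subst prod.insert; (subst prod.insert)?; use k in auto)
        finally show ?thesis unfolding ks0(2) k(2) by (simp only: mult.assoc)
      qed
      moreover have "(\<Prod>t\<in>?T. [:- t, 1:]) = ([:- s, 1:] * [:- t, 1:]) * (\<Prod>x\<in>?T' - {t}. [:- x, 1:])"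
        by (subst prod.remove[OF finT(1) s], subst prod.remove[of ?T' t])
           (use finT t in \<open>simp_all only: finite_Diff mult.assoc\<close>)
      ultimately have "([:- s, 1:] * [:- t, 1:]) * (\<Prod>k\<in>?R. [:- tau k, 1:]) =
          ([:- s, 1:] * [:- t, 1:]) * ((\<Prod>x\<in>?T' - {t}. [:- x, 1:]) * ?G)"
        using prodK by (simp only: mult.assoc)
      moreover have "[:- s, 1:] * [:- t, 1:] \<noteq> 0" by simp
      \<comment> \<open>Removing \<open>ks0\<close> and \<open>k\<close> removes one root at
        \<open>s\<close> and one at \<open>t\<close>; what remains is \<open>?G\<close> times the
        interpolation product at \<open>t\<close>.\<close>
      ultimately have pp: "(\<Prod>k\<in>?R. [:- tau k, 1:]) = (\<Prod>x\<in>?T' - {t}. [:- x, 1:]) * ?G"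
        using mult_left_cancel by blast
      have "?f (dir_der (M * ?Q) ?q) = smult c (?G * ((\<Prod>x\<in>?T' - {t}. [:- x, 1:]) * m t))"
        unfolding der_dir_der restr_mult restr_const3 M(2) restr_prod pR pp c_def by (simp add: mult_ac)
      then have "smult (1 / c) (?f (dir_der (M * ?Q) ?q)) = ?G * ((\<Prod>x\<in>?T' - {t}. [:- x, 1:]) * m t)"
        using c0 by simp
      moreover have "smult (1 / c) (?f (dir_der (M * ?Q) ?q)) \<in> ?f ` logder ks j"
        using ld by (intro P.subspace_scale[OF subim]) blast
      ultimately show ?thesis by simp
    qed
    then have "(\<Sum>t\<in>?T'. ?G * ((\<Prod>x\<in>?T' - {t}. [:- x, 1:]) * m t)) \<in> ?f ` logder ks j"
      by (rule P.subspace_sum[OF subim])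
    then show "p \<in> ?f ` logder ks j" by (simp add: r(2) m(2) sum_distrib_left)
  qed
  have "P.dim (?f ` logder ks j) = N"
  proof -
    have "P.dim ((\<lambda>r. ?G * r) ` polys_below N) = P.dim (polys_below N)"
      by (rule PP.dim_image_inj[OF _ subspace_polys_below fin_dim_polys_below])
         (use finT in \<open>auto simp: Vector_Spaces.linear_iff P.vector_space_axioms algebra_simps\<close>)
    then show ?thesis by (simp add: im dim_polys_below)
  qed
  then have "T.dim (logder ks j) = N + T.dim (logder (l # ks) j)"
    using TP.rank_nullity[OF linear_restr_der[of u w "linear_form l"] subspace_logder[of ks j] fin_dim_logder]
    by (simp add: kernel_restr_der)
  then show ?thesis using d Dj by (simp add: N_def)
qed

end

text \<open>Through any point passes a line in a direction on which \<open>k\<close> is nonzero;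
  restricted to it the product lives in a domain and the first factor is not zero.\<close>

lemma linear_form_mult_eq_0:
  assumes "k \<noteq> 0" "linear_form k * h = 0"
  shows "h = 0"
proof (rule eval3_eq_0_imp)
  fix a b c :: complex
  have "\<exists>v. dot3 k v \<noteq> 0"
  proof (rule ccontr)
    assume "\<not> ?thesis"
    then have "dot3 k (1, 0, 0) = 0" "dot3 k (0, 1, 0) = 0" "dot3 k (0, 0, 1) = 0" by blast+
    then show False using assms(1) by (cases k) (simp add: dot3_def zero_prod_def)
  qed
  then obtain v where v: "dot3 k v \<noteq> 0" by blast
  let ?p = "(a, b, c)"
  have "restr ?p v (linear_form k) * restr ?p v h = 0"
    using assms(2) by (metis restr_mult restr_const3 S.\<iota>_0 pCons_0_0)
  moreover have "restr ?p v (linear_form k) \<noteq> 0" using v by (simp add: restr_linear_form)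
  ultimately have "restr ?p v h = 0" using mult_eq_0_iff by blast
  then have "eval3 h (?p + smult3 0 v) = 0" using poly_restr[of ?p v h 0] by simp
  moreover have "?p + smult3 0 v = ?p" by (cases v) (simp add: smult3_def)
  ultimately show "eval3 h (a, b, c) = 0" by simp
qed

lemma defining_poly_Cons: "defining_poly (k # ls) = linear_form k * defining_poly ls"
  by (simp add: defining_poly_def)

lemma defining_poly_mult_eq_0: "(\<And>k. k \<in> set ls \<Longrightarrow> k \<noteq> 0) \<Longrightarrow> h * defining_poly ls = 0 \<Longrightarrow> h = 0"
proof (induction ls)
  case Nil
  then show ?case by (simp add: defining_poly_def)
next
  case (Cons k ls)
  have "linear_form k * (h * defining_poly ls) = 0" using Cons.prems(2) by (simp add: defining_poly_Cons mult_ac)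
  then have "h * defining_poly ls = 0" using Cons.prems(1) linear_form_mult_eq_0 by (metis list.set_intros(1))
  then show ?case using Cons by (metis list.set_intros(2))
qed

section \<open>Syzygies as tangent derivations modulo Euler multiples\<close>

definition pairwise_indep :: "vec3 list \<Rightarrow> bool"
  where "pairwise_indep ls \<longleftrightarrow> distinct ls \<and> (\<forall>k\<in>set ls. k \<noteq> 0) \<and> (\<forall>k\<in>set ls. \<forall>k'\<in>set ls. k \<noteq> k' \<longrightarrow> cross3 k k' \<noteq> 0)"

lemma pairwise_indep_Cons:
  "pairwise_indep (l # ls) \<longleftrightarrow> l \<noteq> 0 \<and> (\<forall>k\<in>set ls. cross3 l k \<noteq> 0) \<and> pairwise_indep ls"
proof -
  have "cross3 l l = 0" by (cases l) (simp add: cross3_def zero_prod_def mult.commute)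
  have sym: "cross3 a b \<noteq> 0 \<Longrightarrow> cross3 b a \<noteq> 0" for a b by (rule cross3_nonzero(3))
  show ?thesis
  proof
    assume L: "pairwise_indep (l # ls)"
    then have "l \<notin> set ls" "l \<noteq> 0" by (simp_all add: pairwise_indep_def)
    moreover have "cross3 l k \<noteq> 0" if "k \<in> set ls" for k
      using L that \<open>l \<notin> set ls\<close> unfolding pairwise_indep_def by (metis list.set_intros)
    moreover have "pairwise_indep ls" using L unfolding pairwise_indep_def by simp
    ultimately show "l \<noteq> 0 \<and> (\<forall>k\<in>set ls. cross3 l k \<noteq> 0) \<and> pairwise_indep ls" by blast
  next
    assume R: "l \<noteq> 0 \<and> (\<forall>k\<in>set ls. cross3 l k \<noteq> 0) \<and> pairwise_indep ls"
    then have "l \<notin> set ls" using \<open>cross3 l l = 0\<close> by blast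
    with R sym show "pairwise_indep (l # ls)"
      unfolding pairwise_indep_def by (metis distinct.simps(2) set_ConsD)
  qed
qed

text \<open>Write f = k g. From \<theta>(k) g + k \<theta>(g) = 0 the restriction of \<theta>(k) g
  to the line \<open>k\<close> is zero, and g does not vanish identically there.\<close>

lemma syz_subset_logder:
  assumes ls: "pairwise_indep ls"
  shows "syz (defining_poly ls) j \<subseteq> logder ls j"
proof
  fix \<theta> assume \<theta>: "\<theta> \<in> syz (defining_poly ls) j"
  then have \<theta>t: "\<theta> \<in> tforms j" by (simp add: syz_def)
  have "\<forall>v. dot3 k v = 0 \<longrightarrow> eval3 (der \<theta> (linear_form k)) v = 0" if k: "k \<in> set ls" for k
  proof -
    let ?R = "set ls - {k}"
    have k0: "k \<noteq> 0" and kR: "\<And>k'. k' \<in> ?R \<Longrightarrow> cross3 k k' \<noteq> 0"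
      using ls k by (auto simp: pairwise_indep_def)
    obtain u w \<alpha> \<beta> \<mu> where lp: "line_param k u w \<alpha> \<beta> \<mu>" and w: "\<And>k'. k' \<in> ?R \<Longrightarrow> dot3 k' w \<noteq> 0"
      using line_param_exists[OF k0 _ kR] by (metis finite_Diff finite_set)
    interpret line_param k u w \<alpha> \<beta> \<mu> by (rule lp)
    let ?g = "\<Prod>k'\<in>?R. linear_form k'"
    have "defining_poly ls = (\<Prod>k'\<in>set ls. linear_form k')"
      using ls by (simp add: defining_poly_def pairwise_indep_def prod.distinct_set_conv_list)
    also have "\<dots> = linear_form k * ?g" using k by (simp add: prod.remove)
    finally have "der \<theta> (linear_form k) * ?g + linear_form k * der \<theta> ?g = 0"
      using \<theta> by (simp add: syz_def der_mult)
    then have "restr u w (der \<theta> (linear_form k)) * restr u w ?g + restr u w (linear_form k) * restr u w (der \<theta> ?g) = 0"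
      by (metis restr_add restr_mult restr_const3 S.\<iota>_0 pCons_0_0)
    moreover have "restr u w (linear_form k) = 0" by (simp add: restr_linear_form lu lw)
    moreover have "restr u w ?g \<noteq> 0" using w by (simp add: restr_prod restr_linear_form)
    ultimately have "restr u w (der \<theta> (linear_form k)) = 0" by simp
    then show ?thesis using restr_eq_0_iff[OF homogeneous3_der_linear[OF \<theta>t]] by blast
  qed
  then show "\<theta> \<in> logder ls j" using \<theta>t by (simp add: logder_def)
qed

text \<open>Logarithmic differentiation: \<open>h\<close> is the sum of the quotients \<theta>(k)/k
  over the lines.\<close>

lemma logder_der_defining_poly:
  assumes "\<theta> \<in> logder ls (Suc i)" "\<And>k. k \<in> set ls \<Longrightarrow> k \<noteq> 0"
  obtains h where "homogeneous3 i h" "der \<theta> (defining_poly ls) = h * defining_poly ls"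
proof -
  have "\<exists>h. homogeneous3 i h \<and> der \<theta> (defining_poly ls) = h * defining_poly ls"
    using assms
  proof (induction ls)
    case Nil
    have "der \<theta> 1 = 0"
      using der_mult[of \<theta> 1 1] by simp
    then show ?case by (intro exI[of _ 0]) (simp add: defining_poly_def)
  next
    case (Cons k ls)
    then have "\<theta> \<in> logder ls (Suc i)" by (simp add: logder_def)
    then obtain h where h: "homogeneous3 i h" "der \<theta> (defining_poly ls) = h * defining_poly ls"
      using Cons by (metis list.set_intros(2))
    have "\<theta> \<in> tforms (Suc i)" using Cons.prems by (simp add: logder_def)
    then have hom: "homogeneous3 (Suc i) (der \<theta> (linear_form k))" by (rule homogeneous3_der_linear)
    have van: "eval3 (der \<theta> (linear_form k)) v = 0" if "dot3 k v = 0" for v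
      using Cons.prems(1) that list.set_intros(1)[of k ls] unfolding logder_def by blast
    have k0: "k \<noteq> (0, 0, 0)" using Cons.prems(2) by (auto simp: zero_prod_def)
    obtain g where g: "homogeneous3 i g" "der \<theta> (linear_form k) = g * linear_form k"
      using linear_form_dvd_form[OF k0 hom] van by (metis eval3_linear_form)
    have "der \<theta> (defining_poly (k # ls)) = (g + h) * defining_poly (k # ls)"
      by (simp add: defining_poly_Cons der_mult g h algebra_simps)
    then show ?case using g h homogeneous3_add by blast
  qed
  then show ?thesis using that by blast
qed

definition euler_der :: "poly3 \<Rightarrow> triple"
  where "euler_der h = (h * poly_x, h * poly_y, h * poly_z)"

lemma der_euler_der: "homogeneous3 d f \<Longrightarrow> der (euler_der h) f = const3 (of_nat d) * (h * f)"
proof -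
  assume f: "homogeneous3 d f"
  have "der (euler_der h) f = h * (poly_x * partial_x f + poly_y * partial_y f + poly_z * partial_z f)"
    by (simp add: der_def euler_der_def algebra_simps)
  then show ?thesis unfolding euler[OF f] by (simp add: mult_ac)
qed

lemma euler_der_logder:
  assumes "homogeneous3 i h"
  shows "euler_der h \<in> logder ls (Suc i)"
proof -
  have "der (euler_der h) (linear_form k) = h * linear_form k" for k
    using der_euler_der[OF homogeneous3_linear_form] by (simp add: S.\<iota>_1)
  moreover have "euler_der h \<in> tforms (Suc i)"
    using homogeneous3_mult[OF assms homogeneous3_vars(1)] homogeneous3_mult[OF assms homogeneous3_vars(2)]
      homogeneous3_mult[OF assms homogeneous3_vars(3)] by (simp add: euler_der_def tforms_iff)
  ultimately show ?thesis by (simp add: logder_def ev.eval_in_mult eval3_linear_form)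
qed

text \<open>Applying derivations to f maps the logarithmic ones of degree \<open>i + 1\<close> onto
  the multiples h f with h of degree \<open>i\<close>, already by Euler multiples, and the kernel
  consists of the syzygies.\<close>

lemma dim_logder_syz:
  assumes ls: "pairwise_indep ls" and ne: "ls \<noteq> []"
  shows "T.dim (logder ls (Suc i)) = T.dim (syz (defining_poly ls) (Suc i)) + S.vs.dim (forms i)"
proof -
  let ?f = "defining_poly ls"
  have nz: "\<And>k. k \<in> set ls \<Longrightarrow> k \<noteq> 0" using ls by (simp add: pairwise_indep_def)
  have im: "(\<lambda>\<theta>. der \<theta> ?f) ` logder ls (Suc i) = (\<lambda>h. h * ?f) ` forms i"
  proof (intro equalityI subsetI)
    fix p assume "p \<in> (\<lambda>\<theta>. der \<theta> ?f) ` logder ls (Suc i)"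
    then obtain \<theta> where "\<theta> \<in> logder ls (Suc i)" "p = der \<theta> ?f" by (rule imageE)
    then show "p \<in> (\<lambda>h. h * ?f) ` forms i" using logder_der_defining_poly[OF _ nz] by (metis image_eqI mem_Collect_eq)
  next
    fix p assume "p \<in> (\<lambda>h. h * ?f) ` forms i"
    then obtain h where h: "homogeneous3 i h" "p = h * ?f" by blast
    let ?c = "1 / of_nat (length ls) :: complex"
    have "homogeneous3 i (const3 ?c * h)" by (rule homogeneous3_const3_mult[OF h(1)])
    then have "euler_der (const3 ?c * h) \<in> logder ls (Suc i)" by (rule euler_der_logder)
    moreover have "der (euler_der (const3 ?c * h)) ?f = p"
    proof -
      have "der (euler_der (const3 ?c * h)) ?f = (const3 (of_nat (length ls)) * const3 ?c) * (h * ?f)"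
        unfolding der_euler_der[OF homogeneous3_defining_poly] by (simp only: mult_ac)
      also have "const3 (of_nat (length ls)) * const3 ?c = 1"
        unfolding S.\<iota>_mult[symmetric] using ne by (simp add: S.\<iota>_1)
      finally show ?thesis using h by simp
    qed
    ultimately show "p \<in> (\<lambda>\<theta>. der \<theta> ?f) ` logder ls (Suc i)" by (metis image_eqI)
  qed
  interpret SS: lin_space_pair "\<lambda>c p. const3 c * p" "\<lambda>c p. const3 c * p" by unfold_locales
  have "S.vs.dim ((\<lambda>h. h * ?f) ` forms i) = S.vs.dim (forms i)"
  proof (rule SS.dim_image_inj[OF _ subspace_forms fin_dim_forms])
    show "Vector_Spaces.linear (\<lambda>c p. const3 c * p) (\<lambda>c p. const3 c * p) (\<lambda>h. h * ?f)"
      unfolding Vector_Spaces.linear_iff using S.vs.vector_space_axioms by (simp add: distrib_right mult.assoc)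
    show "h = 0" if "h * ?f = 0" for h by (rule defining_poly_mult_eq_0[OF nz that])
  qed
  moreover have "{\<theta> \<in> logder ls (Suc i). der \<theta> ?f = 0} = syz ?f (Suc i)"
    using syz_subset_logder[OF ls, of "Suc i"] by (auto simp: syz_def logder_def)
  ultimately show ?thesis
    using TS.rank_nullity[OF linear_der[of ?f] subspace_logder[of ls "Suc i"] fin_dim_logder] by (simp add: im)
qed

section \<open>Dimensions of the spaces of tangent derivations\<close>

context line_param
begin

text \<open>When all earlier lines pass through a point \<open>q\<close> off \<open>l\<close>, every
  multiple of the constant field towards \<open>q\<close> is admissible, so the restriction is onto.
  This starts the induction, where the new line has fewer than two intersection points.\<close>

lemma addition_step_free:
  assumes q: "dot3 l q \<noteq> 0" "\<And>k. k \<in> set ks \<Longrightarrow> dot3 k q = 0"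
  shows "T.dim (logder ks j) = T.dim (logder (l # ks) j) + (j + 1)"
proof -
  let ?f = "\<lambda>\<theta>. restr u w (der \<theta> (linear_form l))"
  have "?f ` logder ks j = polys_below (Suc j)"
  proof (intro equalityI subsetI)
    fix p assume "p \<in> ?f ` logder ks j"
    then obtain \<theta> where "\<theta> \<in> tforms j" "p = ?f \<theta>" unfolding logder_def by blast
    then show "p \<in> polys_below (Suc j)" using restr_polys_below[OF homogeneous3_der_linear] by simp
  next
    fix p assume "p \<in> polys_below (Suc j)"
    then have "smult (1 / dot3 l q) p \<in> polys_below (Suc j)" by (simp add: polys_below_def)
    then obtain M where M: "homogeneous3 j M" "restr u w M = smult (1 / dot3 l q) p" by (rule restr_surj)
    have "dir_der M q \<in> logder ks j" by (rule dir_der_logder[OF M(1)]) (use q(2) in blast)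
    moreover have "?f (dir_der M q) = p" using q(1) by (simp add: der_dir_der restr_mult restr_const3 M(2))
    ultimately show "p \<in> ?f ` logder ks j" by (metis image_eqI)
  qed
  then show ?thesis
    using TP.rank_nullity[OF linear_restr_der[of u w "linear_form l"] subspace_logder[of ks j] fin_dim_logder]
    by (simp add: kernel_restr_der dim_polys_below)
qed

end

text \<open>The number of pairs of lines of \<open>ks\<close> meeting on \<open>l\<close>, provided that no three of them do.\<close>

fun conc :: "vec3 \<Rightarrow> vec3 list \<Rightarrow> nat"
  where "conc l [] = 0"
  | "conc l (k # ks) = (if \<exists>k'\<in>set ks. det3 l k k' = 0 then 1 else 0) + conc l ks"

text \<open>Without points of higher multiplicity this is the number of triple points, each counted
  at the earliest of its three lines.\<close>

fun total_conc :: "vec3 list \<Rightarrow> nat"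
  where "total_conc [] = 0"
  | "total_conc (l # ks) = conc l ks + total_conc ks"

text \<open>Two vanishing determinants with the same pair \<open>l\<close>, \<open>k\<close> put
  both further lines through the intersection of that pair.\<close>

definition at_most_triple :: "vec3 list \<Rightarrow> bool"
  where "at_most_triple ls \<longleftrightarrow> (\<forall>l\<in>set ls. \<forall>k\<in>set ls. \<forall>k'\<in>set ls. \<forall>k''\<in>set ls. distinct [l, k, k', k''] \<longrightarrow>
    \<not> (det3 l k k' = 0 \<and> det3 l k k'' = 0))"

lemma at_most_triple_Cons: "at_most_triple (l # ks) \<Longrightarrow> at_most_triple ks"
  unfolding at_most_triple_def by (meson list.set_intros(2))

text \<open>\<open>\<phi>\<close> labels the intersection points on \<open>l\<close>; a line repeats
  the label of a later one exactly when \<open>conc\<close> counts it. It serves with parameters on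
  \<open>l\<close> and with points of the plane as labels.\<close>

lemma card_image_conc:
  assumes "distinct ks" "\<And>k k'. k \<in> set ks \<Longrightarrow> k' \<in> set ks \<Longrightarrow> \<phi> k = \<phi> k' \<longleftrightarrow> det3 l k k' = 0"
  shows "card (\<phi> ` set ks) + conc l ks = length ks"
  using assms
proof (induction ks)
  case (Cons k ks)
  have "\<phi> k \<in> \<phi> ` set ks \<longleftrightarrow> (\<exists>k'\<in>set ks. det3 l k k' = 0)"
    unfolding image_iff by (rule bex_cong[OF refl]) (use Cons.prems(2) in simp)
  moreover have "card (\<phi> ` set ks) + conc l ks = length ks" using Cons by simp
  ultimately show ?case
    by (cases "\<exists>k'\<in>set ks. det3 l k k' = 0") (simp_all add: card_insert_if del: bex_simps split_paired_Ex)
qed simp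

lemma dim_logder_Cons:
  assumes "pairwise_indep (l # ks)" "at_most_triple (l # ks)"
    and j: "length ks \<le> j + 2" and two: "2 + conc l ks \<le> length ks"
  shows "T.dim (logder ks j) + conc l ks = T.dim (logder (l # ks) j) + (j + 1)"
proof -
  have l0: "l \<noteq> 0" and lk: "\<And>k. k \<in> set ks \<Longrightarrow> cross3 l k \<noteq> 0" and ks: "pairwise_indep ks"
    using assms(1) by (auto simp: pairwise_indep_Cons)
  have lnk: "l \<notin> set ks" using assms(1) by (simp add: pairwise_indep_def)
  obtain u w \<alpha> \<beta> \<mu> where lp: "line_param l u w \<alpha> \<beta> \<mu>" and w: "\<And>k. k \<in> set ks \<Longrightarrow> dot3 k w \<noteq> 0"
    using line_param_exists[OF l0 finite_set lk] by metis
  interpret line_param l u w \<alpha> \<beta> \<mu> by (rule lp)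
  have dist: "distinct ks" using ks by (simp add: pairwise_indep_def)
  have c: "card (tau ` set ks) + conc l ks = length ks"
    by (rule card_image_conc[OF dist]) (rule tau_eq_iff[OF w w])
  have "T.dim (logder ks j) + length ks = T.dim (logder (l # ks) j) + (j + 1) + card (tau ` set ks)"
  proof (rule addition_step[OF dist w])
    show "cross3 k k' \<noteq> 0" if "k \<in> set ks" "k' \<in> set ks" "k \<noteq> k'" for k k'
      using ks that by (simp add: pairwise_indep_def)
    show "card {k \<in> set ks. tau k = t} \<le> 2" for t
    proof (rule ccontr)
      assume "\<not> ?thesis"
      then have "3 \<le> card {k \<in> set ks. tau k = t}" by simp
      then obtain B where B: "B \<subseteq> {k \<in> set ks. tau k = t}" "card B = 3" by (meson obtain_subset_with_card_n)
      then obtain k k' k'' where "B = {k, k', k''}" "distinct [k, k', k'']"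
        by (auto simp: card_3_iff)
      then have kk: "k \<in> set ks" "k' \<in> set ks" "k'' \<in> set ks" "tau k = t" "tau k' = t" "tau k'' = t"
        "distinct [l, k, k', k'']" using B(1) lnk by auto
      have "det3 l k k' = 0" "det3 l k k'' = 0" using tau_eq_iff[OF w w] kk by metis+
      then show False using assms(2) kk unfolding at_most_triple_def by (metis list.set_intros)
    qed
    show "2 \<le> card (tau ` set ks)" using c two by linarith
  qed (use j in simp_all)
  then show ?thesis using c by linarith
qed

text \<open>Without quadruple points the concurrent pairs on \<open>l\<close> are disjoint. The
  induction deletes a line together with its partner.\<close>

lemma conc_le:
  assumes "pairwise_indep (l # ks)" "at_most_triple (l # ks)"
  shows "2 * conc l ks \<le> length ks"
proof -
  have "2 * conc l xs \<le> length xs" if "set xs \<subseteq> set ks" "distinct xs" for xs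
    using that
  proof (induction "length xs" arbitrary: xs rule: less_induct)
    case less
    show ?case
    proof (cases xs)
      case (Cons k ys)
      show ?thesis
      proof (cases "\<exists>k'\<in>set ys. det3 l k k' = 0")
        case True
        then obtain k' where k': "k' \<in> set ys" "det3 l k k' = 0" by blast
        have lnk: "l \<notin> set ks" using assms(1) by (simp add: pairwise_indep_def)
        \<comment> \<open>The partner \<open>k'\<close> already belongs to the pair with
          \<open>k\<close>, so no other line is concurrent with it and deleting it loses no
          pair.\<close>
        have rm: "conc l zs \<le> conc l (remove1 k' zs)" if "set zs \<subseteq> set ys" "distinct zs" for zs
          using that
        proof (induction zs)
          case (Cons z zs)
          have sub: "z \<in> set ys" "set zs \<subseteq> set ys" using Cons.prems by auto
          show ?case
          proof (cases "z = k'")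
            case True
            have "\<not> (\<exists>x\<in>set zs. det3 l z x = 0)"
            proof
              assume "\<exists>x\<in>set zs. det3 l z x = 0"
              then obtain x where x: "x \<in> set zs" "det3 l z x = 0" by blast
              have "det3 l k' k = 0" using k'(2) det3_swap[of l k' k] by simp
              moreover have "distinct [l, k', k, x]" using x True sub Cons.prems less.prems lnk Cons \<open>xs = k # ys\<close> by auto
              moreover have "k' \<in> set ks" "k \<in> set ks" "x \<in> set ks" using x k' sub less.prems \<open>xs = k # ys\<close> by auto
              ultimately show False using assms(2) x True unfolding at_most_triple_def by (metis list.set_intros)
            qed
            then show ?thesis using True by simp
          next
            case False
            have "(\<exists>x\<in>set zs. det3 l z x = 0) \<longrightarrow> (\<exists>x\<in>set (remove1 k' zs). det3 l z x = 0)"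
            proof
              assume "\<exists>x\<in>set zs. det3 l z x = 0"
              then obtain x where x: "x \<in> set zs" "det3 l z x = 0" by blast
              have "x \<noteq> k'"
              proof
                assume "x = k'"
                then have "det3 l k' z = 0" using x det3_swap[of l k' z] by simp
                moreover have "det3 l k' k = 0" using k'(2) det3_swap[of l k' k] by simp
                moreover have "distinct [l, k', z, k]" using x False sub k' Cons.prems less.prems lnk \<open>xs = k # ys\<close> by auto
                moreover have "k' \<in> set ks" "k \<in> set ks" "z \<in> set ks" using x k' sub less.prems \<open>xs = k # ys\<close> by auto
                ultimately show False using assms(2) unfolding at_most_triple_def by (metis list.set_intros)
              qed
              then show "\<exists>x\<in>set (remove1 k' zs). det3 l z x = 0" using x Cons.prems by auto
            qed
            then show ?thesis using Cons False sub by auto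
          qed
        qed simp
        have "conc l xs \<le> 1 + conc l (remove1 k' ys)" using rm[of ys] Cons less.prems by simp
        moreover have "2 * conc l (remove1 k' ys) \<le> length (remove1 k' ys)"
          by (rule less.hyps) (use Cons less.prems k' in \<open>auto simp: length_remove1\<close>)
        moreover have "length (remove1 k' ys) = length ys - 1" using k' by (simp add: length_remove1)
        moreover have "length ys \<ge> 1" using k' by (cases ys) auto
        ultimately show ?thesis using Cons by simp
      next
        case False
        then show ?thesis using less.hyps[of ys] Cons less.prems by simp
      qed
    qed simp
  qed
  then show ?thesis using assms(1) by (simp add: pairwise_indep_def)
qed

text \<open>Each line costs \<open>j + 1\<close> dimensions and each triple point returns one. The
  three lines at the end of the list, where the induction starts, have to be in general
  position.\<close>

lemma dim_logder:
  assumes "pairwise_indep ls" "at_most_triple ls" "length ls \<le> j + 3"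
    and "ls = xs @ [c, b, a]" "det3 c b a \<noteq> 0"
  shows "T.dim (logder ls j) + length ls * (j + 1) = 3 * S.vs.dim (forms j) + total_conc ls"
  using assms
proof (induction xs arbitrary: ls)
  case Nil
  have ls: "ls = [c, b, a]" using Nil by simp
  have pi: "pairwise_indep [c, b, a]" "pairwise_indep [b, a]" "pairwise_indep [a]"
    using Nil.prems(1) ls by (auto simp: pairwise_indep_Cons)
  have ba: "cross3 b a \<noteq> 0" and a0: "a \<noteq> 0" and b0: "b \<noteq> 0" using pi by (auto simp: pairwise_indep_Cons)
  have "logder [] j = tforms j" by (simp add: logder_def)
  then have 0: "T.dim (logder [] j) = 3 * S.vs.dim (forms j)" by (simp add: dim_tforms)
  have ex: "\<exists>q. dot3 k q \<noteq> 0" if "k \<noteq> 0" for k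
  proof (rule ccontr)
    assume "\<not> ?thesis"
    then have "dot3 k (1, 0, 0) = 0" "dot3 k (0, 1, 0) = 0" "dot3 k (0, 0, 1) = 0" by blast+
    then show False using that by (cases k) (simp add: dot3_def zero_prod_def)
  qed
  have 1: "T.dim (logder [] j) = T.dim (logder [a] j) + (j + 1)"
  proof -
    obtain u w \<alpha> \<beta> \<mu> where lp: "line_param a u w \<alpha> \<beta> \<mu>" using line_param_exists[OF a0, of "{}"] by (metis empty_iff finite.emptyI)
    obtain q where "dot3 a q \<noteq> 0" using ex[OF a0] by blast
    then show ?thesis using line_param.addition_step_free[OF lp, of q "[]" j] by simp
  qed
  have 2: "T.dim (logder [a] j) = T.dim (logder [b, a] j) + (j + 1)"
  proof -
    obtain u w \<alpha> \<beta> \<mu> where lp: "line_param b u w \<alpha> \<beta> \<mu>" using line_param_exists[OF b0, of "{}"] by (metis empty_iff finite.emptyI)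
    obtain e where e: "dot3 (cross3 b a) e \<noteq> 0" using ex[OF ba] by blast
    have "dot3 b (cross3 a e) = dot3 (cross3 b a) e"
      by (cases a; cases b; cases e) (simp add: dot3_def cross3_def algebra_simps)
    then show ?thesis using line_param.addition_step_free[OF lp, of "cross3 a e" "[a]"] e by simp
  qed
  \<comment> \<open>A third line through the intersection of the first two would have only one
    intersection point, too few for the addition step.\<close>
  have c0: "conc c [b, a] = 0" "total_conc [c, b, a] = 0" using Nil.prems(5) by simp_all
  have "T.dim (logder [b, a] j) + conc c [b, a] = T.dim (logder [c, b, a] j) + (j + 1)"
    by (rule dim_logder_Cons) (use Nil.prems ls c0 in simp_all)
  then show ?case using 0 1 2 c0 ls by simp
next
  case (Cons x xs)
  let ?ks = "xs @ [c, b, a]"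
  have ls: "ls = x # ?ks" using Cons.prems by simp
  have IH: "T.dim (logder ?ks j) + length ?ks * (j + 1) = 3 * S.vs.dim (forms j) + total_conc ?ks"
    by (rule Cons.IH) (use Cons.prems ls in \<open>auto simp: pairwise_indep_Cons dest: at_most_triple_Cons\<close>)
  have "2 * conc x ?ks \<le> length ?ks" by (rule conc_le) (use Cons.prems ls in simp_all)
  then have two: "2 + conc x ?ks \<le> length ?ks" by simp
  have "T.dim (logder ?ks j) + conc x ?ks = T.dim (logder (x # ?ks) j) + (j + 1)"
    by (rule dim_logder_Cons) (use Cons.prems ls two in simp_all)
  then show ?case unfolding ls using IH by (simp add: algebra_simps)
qed

section \<open>Smooth forms have no non-Koszul syzygies\<close>

text \<open>Bezout for polynomials over \<complex> in terms of roots: an inverse modulo f/(t - r) is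
  corrected to one modulo f.\<close>

lemma inverse_mod_poly:
  fixes f g :: "complex poly"
  assumes "f \<noteq> 0" "\<And>t. poly f t = 0 \<Longrightarrow> poly g t \<noteq> 0"
  obtains q where "f dvd 1 - q * g"
proof -
  have "\<exists>q. f dvd 1 - q * g"
    using assms
  proof (induction "degree f" arbitrary: f rule: less_induct)
    case less
    show ?case
    proof (cases "degree f = 0")
      case True
      then have "f dvd 1" using less.prems(1) by (simp add: is_unit_iff_degree)
      then show ?thesis by (intro exI[of _ 0]) simp
    next
      case False
      then obtain r where r: "poly f r = 0"
        by (metis constant_degree fundamental_theorem_of_algebra)
      then obtain f' where f': "f = [:- r, 1:] * f'" unfolding poly_eq_0_iff_dvd by (rule dvdE)
      have f'0: "f' \<noteq> 0" using less.prems(1) f' by auto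
      have "degree f = Suc (degree f')" unfolding f' using f'0 by (subst degree_mult_eq) auto
      moreover have "poly g t \<noteq> 0" if "poly f' t = 0" for t using less.prems(2)[of t] that by (simp add: f')
      ultimately obtain q s where s: "1 - q * g = f' * s" using less.hyps[of f'] f'0 by (metis dvdE lessI)
      \<comment> \<open>The constant that makes the remaining cofactor vanish at the root
        \<open>r\<close>.\<close>
      define t where "t = poly s r / poly g r"
      have "poly (s - [:t:] * g) r = 0" using less.prems(2)[OF r] by (simp add: t_def)
      then obtain s' where s': "s - [:t:] * g = [:- r, 1:] * s'" unfolding poly_eq_0_iff_dvd by (rule dvdE)
      have "1 - (q + [:t:] * f') * g = f' * s - f' * ([:t:] * g)" unfolding s[symmetric] by (simp only: algebra_simps)
      also have "\<dots> = f' * (s - [:t:] * g)" by (simp only: right_diff_distrib)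
      also have "\<dots> = f * s'" unfolding s' f' by (simp only: mult_ac)
      finally show ?thesis by (metis dvd_triv_left)
    qed
  qed
  then show ?thesis using that by blast
qed

section \<open>Forms restricted to the line y = 0\<close>

lemma polys_below_mult:
  assumes "p \<in> polys_below (Suc a)" "q \<in> polys_below (Suc b)"
  shows "p * q \<in> polys_below (Suc (a + b))"
  using assms degree_mult_le[of p q] by (simp add: polys_below_Suc)

lemma polys_below_mono: "p \<in> polys_below N \<Longrightarrow> N \<le> M \<Longrightarrow> p \<in> polys_below M"
  by (simp add: polys_below_def)

lemma polys_below_iff_degree: "p \<in> polys_below N \<longleftrightarrow> p = 0 \<or> degree p < N"
  unfolding polys_below_def using leading_coeff_neq_0[of p] coeff_eq_0[of p] by (auto, metis le_trans linorder_not_le le_degree)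

text \<open>Restriction to the line y = 0 in the coordinate t = x/z; the point at infinity is (1, 0,
  0).\<close>

definition res_y :: "poly3 \<Rightarrow> complex poly"
  where "res_y = restr (0, 0, 1) (1, 0, 0)"

interpretation Y: line_param "(0, 1, 0)" "(0, 0, 1)" "(1, 0, 0)" "(0, 0, 1)" "(1, 0, 0)" 1
  by unfold_locales (auto simp: dot3_def cross3_def smult3_def)

lemma linear_form_y: "linear_form (0, 1, 0) = poly_y"
  by (simp add: linear_form_def S.\<iota>_0 S.\<iota>_1)

lemma poly_res_y: "poly (res_y p) t = eval3 p (t, 0, 1)"
  by (simp add: res_y_def poly_restr smult3_def)

lemma res_y_0_imp:
  assumes "homogeneous3 k p" "res_y p = 0"
  obtains q where "p = poly_y * q" "k = 0 \<Longrightarrow> p = 0" "\<And>j. k = Suc j \<Longrightarrow> homogeneous3 j q"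
proof -
  have van: "eval3 p v = 0" if "dot3 (0, 1, 0) v = 0" for v
    using assms(2) that Y.restr_eq_0_iff[OF assms(1)] unfolding res_y_def by blast
  have van': "eval3 p (a, b, c) = 0" if "eval3 (linear_form (0, 1, 0)) (a, b, c) = 0" for a b c
    using van[of "(a, b, c)"] that by (simp only: eval3_linear_form)
  show ?thesis
  proof (cases k)
    case 0
    have "poly_y dvd p" using linear_form_dvd[of "(0, 1, 0)" p] van' by (simp add: linear_form_y)
    then obtain q where q: "p = poly_y * q" by (rule dvdE)
    have "p = hcomp 0 p" using assms(1) 0 hcomp_homogeneous3[of 0 p 0] by simp
    also have "\<dots> = 0" unfolding q mult.commute[of poly_y] by (rule hcomp_mult_less[OF homogeneous3_vars(2)]) simp
    finally show ?thesis using that[of 0] 0 by simp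
  next
    case (Suc j)
    have "(0, 1, 0) \<noteq> ((0, 0, 0) :: vec3)" by simp
    then obtain g where "homogeneous3 j g" "p = g * linear_form (0, 1, 0)"
      using linear_form_dvd_form[of "(0, 1, 0)" j p] assms(1) Suc van' by metis
    then show ?thesis using that[of g] Suc by (simp add: linear_form_y mult.commute)
  qed
qed

text \<open>The top coefficient is the value at infinity, so a form that does not vanish at (1, 0,
  0) keeps its full degree under restriction.\<close>

lemma coeff_res_y:
  assumes "homogeneous3 d p"
  shows "coeff (res_y p) d = eval3 p (1, 0, 0)"
proof -
  have "coeff (res_y p) d = (\<Sum>m\<in>Poly_Mapping.keys p. coeff (res_y (Poly_Mapping.single m (Poly_Mapping.lookup p m))) d)"
    by (subst poly_mapping_sum_single[of p]) (simp add: res_y_def restr_sum coeff_sum)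
  also have "\<dots> = (\<Sum>m\<in>Poly_Mapping.keys p. eval3 (Poly_Mapping.single m (Poly_Mapping.lookup p m)) (1, 0, 0))"
  proof (rule sum.cong[OF refl])
    fix m assume m: "m \<in> Poly_Mapping.keys p"
    obtain i j k where mm: "m = (i, j, k)" by (cases m)
    have ijk: "i + j + k = d" using m assms by (auto simp: mm homogeneous3_def)
    have "[:0, 1:] ^ i = (monom 1 i :: complex poly)" by (simp add: monom_altdef)
    then have "res_y (Poly_Mapping.single m c) = (if j = 0 then monom c i else 0)" for c
      by (simp add: mm res_y_def restr_def evp.eval_in_single smult_monom power_0_left flip: one_pCons)
    then show "coeff (res_y (Poly_Mapping.single m (Poly_Mapping.lookup p m))) d =
       eval3 (Poly_Mapping.single m (Poly_Mapping.lookup p m)) (1, 0, 0)"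
      using ijk by (auto simp: mm ev.eval_in_single power_0_left)
  qed
  also have "\<dots> = eval3 p (1, 0, 0)"
    by (subst (3) poly_mapping_sum_single[of p]) (simp add: ev.eval_in_sum)
  finally show ?thesis .
qed

text \<open>\<open>f\<close> and \<open>g\<close> have no common zero on the line y = 0:
  \<open>f1\<close> excludes the point at infinity, \<open>cop\<close> the finite points. Hence f,
  g, y will form a regular sequence.\<close>

locale coprime_pair =
  fixes e :: nat and f g :: poly3
  assumes f: "homogeneous3 e f" and g: "homogeneous3 e g"
    and f1: "eval3 f (1, 0, 0) \<noteq> 0"
    and cop: "\<And>t. eval3 f (t, 0, 1) = 0 \<Longrightarrow> eval3 g (t, 0, 1) \<noteq> 0"
begin

abbreviation I :: "poly3 set"
  where "I \<equiv> ideal3 f g 0"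

lemma I_iff: "p \<in> I \<longleftrightarrow> (\<exists>a b. p = a * f + b * g)"
  by (simp add: ideal3_iff)

lemma res_f: "degree (res_y f) = e" "res_y f \<noteq> 0"
proof -
  have c: "coeff (res_y f) e \<noteq> 0" using coeff_res_y[OF f] f1 by simp
  then have "e \<le> degree (res_y f)" by (rule le_degree)
  moreover have "degree (res_y f) \<le> e"
    using restr_polys_below[OF f] by (simp add: polys_below_Suc res_y_def)
  ultimately show "degree (res_y f) = e" by simp
  show "res_y f \<noteq> 0" using c by auto
qed

lemma res_g: "res_y g \<in> polys_below (Suc e)"
  using restr_polys_below[OF g] by (simp add: res_y_def)

lemma inverse_g:
  obtains q where "res_y f dvd 1 - q * res_y g"
  using inverse_mod_poly[OF res_f(2), of "res_y g"] cop by (auto simp: poly_res_y)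

lemma res_f_factor:
  assumes "res_y f * p \<in> polys_below (Suc i)"
  shows "p = 0 \<or> (e \<le> i \<and> p \<in> polys_below (Suc (i - e)))"
  using assms res_f by (cases "p = 0") (auto simp: polys_below_Suc degree_mult_eq)

text \<open>On y = 0 the two forms become coprime univariate polynomials, whose syzygies are
  multiples of the obvious one. The multiplier is lifted to a form \<open>u\<close>; below degree
  \<open>e\<close> there is room only for \<open>u = 0\<close>.\<close>

lemma res_syzygy:
  assumes ab: "homogeneous3 i a" "homogeneous3 i b" and z: "res_y (a * f + b * g) = 0"
  obtains u where "homogeneous3 i (u * g)" "homogeneous3 i (u * f)"
    "res_y (a - u * g) = 0" "res_y (b + u * f) = 0" "i < e \<Longrightarrow> u = 0"
proof -
  have z': "res_y a * res_y f + res_y b * res_y g = 0"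
    using z by (simp add: res_y_def restr_add restr_mult)
  obtain q where q: "res_y f dvd 1 - q * res_y g" by (rule inverse_g)
  have "res_y b * (1 - q * res_y g) = res_y b - q * (res_y b * res_y g)"
    by (simp only: algebra_simps mult_1_left)
  also have "res_y b * res_y g = - (res_y a * res_y f)" using z' by (simp add: add_eq_0_iff)
  finally have "res_y b = res_y b * (1 - q * res_y g) - q * (res_y a * res_y f)" by simp
  moreover have "res_y f dvd res_y b * (1 - q * res_y g) - q * (res_y a * res_y f)"
    by (rule dvd_diff[OF dvd_mult[OF q]]) simp
  ultimately have "res_y f dvd res_y b" by simp
  then obtain v where v: "res_y b = res_y f * v" by (rule dvdE)
  have "(res_y a + v * res_y g) * res_y f = 0" using z' v by (simp add: algebra_simps)
  then have a: "res_y a = - v * res_y g" using res_f(2) by (simp add: eq_neg_iff_add_eq_0)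
  have "res_y f * v \<in> polys_below (Suc i)"
    using restr_polys_below[OF ab(2)] by (simp add: res_y_def flip: v[unfolded res_y_def])
  then consider "v = 0" | "e \<le> i" "v \<in> polys_below (Suc (i - e))" using res_f_factor by blast
  then show ?thesis
  proof cases
    case 1
    then show ?thesis using that[of 0] a v by simp
  next
    case 2
    show ?thesis
    proof (cases "v = 0")
      case True
      then show ?thesis using that[of 0] a v by simp
    next
      case False
      have "- v \<in> polys_below (Suc (i - e))" using 2 by (simp add: polys_below_def)
      then obtain u where u: "homogeneous3 (i - e) u" "res_y u = - v" using Y.restr_surj unfolding res_y_def by metis
      have "homogeneous3 (i - e + e) (u * f)" "homogeneous3 (i - e + e) (u * g)"
        using homogeneous3_mult[OF u(1)] f g by blast+
      moreover have "res_y (a - u * g) = 0" "res_y (b + u * f) = 0"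
      proof -
        have rd: "res_y (p - q) = res_y p - res_y q" "res_y (p + q) = res_y p + res_y q" "res_y (p * q) = res_y p * res_y q" for p q
          using restr_add[of _ _ "p - q" q] by (simp_all add: res_y_def restr_mult restr_add eq_diff_eq)
        show "res_y (a - u * g) = 0" "res_y (b + u * f) = 0"
          unfolding rd u a v by (simp_all add: mult.commute)
      qed
      ultimately show ?thesis using that[of u] 2 by simp
    qed
  qed
qed

lemma I_homogeneous:
  assumes "p \<in> I" "homogeneous3 k p" "p \<noteq> 0"
  obtains i a b where "k = i + e" "homogeneous3 i a" "homogeneous3 i b" "p = a * f + b * g"
proof -
  obtain a b where ab: "p = a * f + b * g" using assms(1) I_iff by blast
  have hp: "p = hcomp k p" using hcomp_homogeneous3[OF assms(2), of k] by simp
  show ?thesis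
  proof (cases "k < e")
    case True
    then have "hcomp k p = 0" unfolding ab hcomp_add by (simp add: hcomp_mult_less[OF f] hcomp_mult_less[OF g])
    then show ?thesis using hp assms(3) by simp
  next
    case False
    then have k: "k = (k - e) + e" by simp
    have "p = hcomp (k - e) a * f + hcomp (k - e) b * g"
      using hp hcomp_mult[OF f, of "k - e" a] hcomp_mult[OF g, of "k - e" b] k unfolding ab hcomp_add by simp
    then show ?thesis using that[OF k] homogeneous3_hcomp by blast
  qed
qed

text \<open>If y c = a f + b g, then (a, b) is a syzygy on y = 0; subtracting a multiple of the
  Koszul syzygy makes both cofactors divisible by y, which then cancels.\<close>

lemma y_regular:
  assumes c: "homogeneous3 k c" and yc: "poly_y * c \<in> I"
  shows "c \<in> I"
proof (cases "poly_y * c = 0")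
  case True
  then show ?thesis using poly_y_mult_eq_0 ideal3_0 by metis
next
  case False
  have "homogeneous3 (1 + k) (poly_y * c)" by (rule homogeneous3_mult[OF homogeneous3_vars(2) c])
  then obtain i a b where ab: "1 + k = i + e" "homogeneous3 i a" "homogeneous3 i b" "poly_y * c = a * f + b * g"
    using I_homogeneous[OF yc _ False] by metis
  have "res_y (poly_y * c) = 0"
    by (simp add: res_y_def restr_mult linear_form_y[symmetric] restr_linear_form dot3_def)
  then obtain u where u: "homogeneous3 i (u * g)" "homogeneous3 i (u * f)"
    "res_y (a - u * g) = 0" "res_y (b + u * f) = 0"
    using res_syzygy[OF ab(2,3)] ab(4) by metis
  obtain a' where a': "a - u * g = poly_y * a'"
    using res_y_0_imp[OF homogeneous3_diff[OF ab(2) u(1)] u(3)] by metis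
  obtain b' where b': "b + u * f = poly_y * b'"
    using res_y_0_imp[OF homogeneous3_add[OF ab(3) u(2)] u(4)] by metis
  have "poly_y * c = (a - u * g) * f + (b + u * f) * g" unfolding ab(4) by (simp only: algebra_simps)
  also have "\<dots> = poly_y * (a' * f + b' * g)" unfolding a' b' by (simp only: algebra_simps)
  finally have "poly_y * (c - (a' * f + b' * g)) = 0" by (simp add: right_diff_distrib)
  then have "c - (a' * f + b' * g) = 0" by (rule poly_y_mult_eq_0)
  then show ?thesis unfolding I_iff by (intro exI[of _ a'] exI[of _ b']) simp
qed

lemma y_power_regular:
  assumes "homogeneous3 k c" "poly_y ^ m * c \<in> I"
  shows "c \<in> I"
  using assms(2)
proof (induction m)
  case (Suc m)
  have "homogeneous3 (1 * m + k) (poly_y ^ m * c)"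
    by (intro homogeneous3_mult homogeneous3_power homogeneous3_vars assms(1))
  moreover have "poly_y * (poly_y ^ m * c) \<in> I" using Suc.prems by (simp add: mult.assoc)
  ultimately have "poly_y ^ m * c \<in> I" by (rule y_regular)
  then show ?case by (rule Suc.IH)
qed simp

text \<open>Descent on the degree: below \<open>e\<close> both cofactors vanish on y = 0, and
  dividing them by y gives a syzygy of smaller degree.\<close>

lemma koszul_syzygies:
  assumes "homogeneous3 i a" "homogeneous3 i b" "a * f + b * g = 0" "i < e"
  shows "a = 0 \<and> b = 0"
  using assms
proof (induction i arbitrary: a b)
  case 0
  have "res_y (a * f + b * g) = 0" using 0 by (simp add: res_y_def restr_const3[of _ _ 0, unfolded S.\<iota>_0])
  then obtain u where "res_y (a - u * g) = 0" "res_y (b + u * f) = 0" "u = 0"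
    using res_syzygy[OF 0(1,2)] 0(4) by metis
  then have "res_y a = 0" "res_y b = 0" by simp_all
  then show ?case using res_y_0_imp[OF 0(1)] res_y_0_imp[OF 0(2)] by metis
next
  case (Suc i)
  have "res_y (a * f + b * g) = 0" using Suc by (simp add: res_y_def restr_const3[of _ _ 0, unfolded S.\<iota>_0])
  then obtain u where "res_y (a - u * g) = 0" "res_y (b + u * f) = 0" "u = 0"
    using res_syzygy[OF Suc.prems(1,2)] Suc.prems(4) by metis
  then have z: "res_y a = 0" "res_y b = 0" by simp_all
  obtain a' where a': "a = poly_y * a'" "homogeneous3 i a'" using res_y_0_imp[OF Suc.prems(1) z(1)] by metis
  obtain b' where b': "b = poly_y * b'" "homogeneous3 i b'" using res_y_0_imp[OF Suc.prems(2) z(2)] by metis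
  have "poly_y * (a' * f + b' * g) = 0" using Suc.prems(3) a' b' by (simp add: algebra_simps)
  then have "a' * f + b' * g = 0" by (rule poly_y_mult_eq_0)
  then have "a' = 0 \<and> b' = 0" using Suc.IH a' b' Suc.prems(4) by simp
  then show ?case using a' b' by simp
qed

text \<open>From degree \<open>2 * e - 1\<close> on, the restrictions of \<open>f\<close> and
  \<open>g\<close> generate all univariate polynomials of the allowed degree, so modulo the ideal
  every form is divisible by y. The case \<open>e = 0\<close> is separate because then the ideal is
  the whole ring.\<close>

lemma reduce_mod_y:
  assumes p: "homogeneous3 (Suc k) p" and k: "2 * e \<le> Suc (Suc k)"
  obtains p' where "homogeneous3 k p'" "p - poly_y * p' \<in> I"
proof (cases "e = 0")
  case True
  have "poly (res_y f) t = eval3 f (1, 0, 0)" for t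
  proof -
    have "res_y f = [:coeff (res_y f) 0:]" using res_f(1) True by (metis degree_eq_zeroE coeff_pCons_0)
    then show ?thesis using coeff_res_y[OF f] True by (metis poly_const_conv)
  qed
  have "homogeneous3 0 f" using f True by simp
  then have "Poly_Mapping.keys f \<subseteq> {(0, 0, 0)}" by (auto simp: homogeneous3_def)
  then have "f = const3 (Poly_Mapping.lookup f (0, 0, 0))"
    by (intro poly_mapping_eqI) (auto simp: const3_def lookup_single when_def in_keys_iff)
  then obtain c where c: "f = const3 c" by blast
  then have "c \<noteq> 0" using f1 by auto
  then have "const3 (1 / c) * const3 c = 1" by (simp add: S.\<iota>_mult[symmetric] S.\<iota>_1)
  then have "p = p * (const3 (1 / c) * const3 c)" by simp
  also have "\<dots> = (const3 (1 / c) * p) * f + 0 * g" unfolding c by (simp only: mult_ac mult_zero_left add_0_right)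
  finally have "p = (const3 (1 / c) * p) * f + 0 * g" .
  then have "p \<in> I" unfolding I_iff by blast
  then show ?thesis using that[of 0] by simp
next
  case False
  obtain q where q: "res_y f dvd 1 - q * res_y g" by (rule inverse_g)
  \<comment> \<open>Reducing modulo \<open>res_y f\<close> bounds this cofactor by \<open>e\<close>,
    which forces the right degree for the other one.\<close>
  define b where "b = (res_y p * q) mod res_y f"
  have bb: "b \<in> polys_below e"
    using degree_mod_less[OF res_f(2), of "res_y p * q"] res_f(1) False
    by (auto simp: b_def polys_below_iff_degree)
  have "res_y f dvd res_y p * q - b" by (simp add: b_def)
  then have "res_y f dvd (res_y p * q - b) * res_y g + res_y p * (1 - q * res_y g)"
    using q by (intro dvd_add dvd_mult2 dvd_mult) simp_all
  moreover have "(res_y p * q - b) * res_y g + res_y p * (1 - q * res_y g) = res_y p - b * res_y g"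
    by (simp only: algebra_simps mult_1_left)
  ultimately have "res_y f dvd res_y p - b * res_y g" by simp
  then obtain a where a: "res_y p - b * res_y g = res_y f * a" by (rule dvdE)
  have b': "b \<in> polys_below (Suc (e - 1))" using bb False by simp
  have "b * res_y g \<in> polys_below (Suc (e - 1 + e))" by (rule polys_below_mult[OF b' res_g])
  then have "b * res_y g \<in> polys_below (Suc (Suc k))" by (rule polys_below_mono) (use k in simp)
  moreover have "res_y p \<in> polys_below (Suc (Suc k))" using restr_polys_below[OF p] by (simp add: res_y_def)
  ultimately have "res_y f * a \<in> polys_below (Suc (Suc k))"
    unfolding a[symmetric] by (intro P.subspace_diff[OF subspace_polys_below])
  then have ab: "a \<in> polys_below (Suc (Suc k - e))" using res_f_factor[of a "Suc k"] by (auto simp: polys_below_iff_degree)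
  have "b \<in> polys_below (Suc (Suc k - e))" by (rule polys_below_mono[OF bb]) (use k in simp)
  then obtain B where B: "homogeneous3 (Suc k - e) B" "res_y B = b" using Y.restr_surj unfolding res_y_def by metis
  obtain A where A: "homogeneous3 (Suc k - e) A" "res_y A = a" using Y.restr_surj[OF ab] unfolding res_y_def by metis
  have "Suc k - e + e = Suc k" using k False by simp
  then have hom: "homogeneous3 (Suc k) (A * f + B * g)"
    using homogeneous3_add[OF homogeneous3_mult[OF A(1) f] homogeneous3_mult[OF B(1) g]] by simp
  have rd: "res_y (p - q) = res_y p - res_y q" "res_y (p + q) = res_y p + res_y q" "res_y (p * q) = res_y p * res_y q" for p q
    using restr_add[of _ _ "p - q" q] by (simp_all add: res_y_def restr_mult restr_add eq_diff_eq)
  have "res_y (p - (A * f + B * g)) = 0"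
    unfolding rd A B using a by (simp add: algebra_simps)
  then obtain p' where p': "p - (A * f + B * g) = poly_y * p'" "homogeneous3 k p'"
    using res_y_0_imp[OF homogeneous3_diff[OF p hom]] by metis
  have "p - poly_y * p' = A * f + B * g" using p'(1) by (simp add: algebra_simps)
  then have "p - poly_y * p' \<in> I" unfolding I_iff by blast
  then show ?thesis using that p'(2) by blast
qed

lemma reduce_mod_y_power:
  assumes "homogeneous3 (2 * e + m) p"
  obtains s where "homogeneous3 (2 * e) s" "p - poly_y ^ m * s \<in> I"
proof -
  have "\<exists>s. homogeneous3 (2 * e) s \<and> p - poly_y ^ m * s \<in> I"
    using assms
  proof (induction m arbitrary: p)
    case 0
    then show ?case by (intro exI[of _ p]) (simp add: ideal3_0)
  next
    case (Suc m)
    obtain p' where p': "homogeneous3 (2 * e + m) p'" "p - poly_y * p' \<in> I"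
      using reduce_mod_y[of "2 * e + m" p] Suc.prems by auto
    obtain s where s: "homogeneous3 (2 * e) s" "p' - poly_y ^ m * s \<in> I" using Suc.IH[OF p'(1)] by blast
    have "(p - poly_y * p') + poly_y * (p' - poly_y ^ m * s) \<in> I"
      by (intro ideal3_add ideal3_mult p' s)
    moreover have "(p - poly_y * p') + poly_y * (p' - poly_y ^ m * s) = p - poly_y ^ Suc m * s"
      by (simp add: algebra_simps)
    ultimately show ?case using s(1) by auto
  qed
  then show ?thesis using that by blast
qed

text \<open>The polynomial C evaluated at \<xi>/y and cleared of denominators by y^m.\<close>

definition homog :: "poly3 \<Rightarrow> nat \<Rightarrow> complex poly \<Rightarrow> poly3"
  where "homog \<xi> m C = (\<Sum>i\<le>m. const3 (coeff C i) * (\<xi> ^ i * poly_y ^ (m - i)))"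

lemma homogeneous3_homog:
  assumes "homogeneous3 1 \<xi>"
  shows "homogeneous3 m (homog \<xi> m C)"
  unfolding homog_def
proof (intro homogeneous3_sum homogeneous3_const3_mult)
  fix i assume "i \<in> {..m}"
  moreover have "homogeneous3 (1 * i + 1 * (m - i)) (\<xi> ^ i * poly_y ^ (m - i))"
    by (intro homogeneous3_mult homogeneous3_power homogeneous3_vars assms)
  ultimately show "homogeneous3 m (\<xi> ^ i * poly_y ^ (m - i))" by simp
qed

lemma homog_linear_mult:
  assumes "degree C \<le> m"
  shows "homog \<xi> (Suc m) ([:- \<alpha>, 1:] * C) = (\<xi> - const3 \<alpha> * poly_y) * homog \<xi> m C"
proof -
  have c: "coeff ([:- \<alpha>, 1:] * C) i = (if i = 0 then 0 else coeff C (i - 1)) - \<alpha> * coeff C i" for i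
    by (cases i) simp_all
  have cd: "const3 (a - b) = const3 a - const3 b" for a b
    using S.\<iota>_add[of a "- b"] S.\<iota>_minus[of b] by simp
  have "homog \<xi> (Suc m) ([:- \<alpha>, 1:] * C) =
     (\<Sum>i\<le>Suc m. const3 (if i = 0 then 0 else coeff C (i - 1)) * (\<xi> ^ i * poly_y ^ (Suc m - i))) -
     (\<Sum>i\<le>Suc m. const3 (\<alpha> * coeff C i) * (\<xi> ^ i * poly_y ^ (Suc m - i)))"
    unfolding homog_def c cd left_diff_distrib sum_subtractf by (rule refl)
  also have "(\<Sum>i\<le>Suc m. const3 (if i = 0 then 0 else coeff C (i - 1)) * (\<xi> ^ i * poly_y ^ (Suc m - i))) =
     \<xi> * homog \<xi> m C"
    unfolding sum.atMost_Suc_shift homog_def sum_distrib_left by (simp add: S.\<iota>_0 mult_ac)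
  also have "(\<Sum>i\<le>Suc m. const3 (\<alpha> * coeff C i) * (\<xi> ^ i * poly_y ^ (Suc m - i))) =
     const3 \<alpha> * poly_y * homog \<xi> m C"
  proof -
    have "coeff C (Suc m) = 0" using assms by (intro coeff_eq_0) simp
    then have "(\<Sum>i\<le>Suc m. const3 (\<alpha> * coeff C i) * (\<xi> ^ i * poly_y ^ (Suc m - i))) =
       (\<Sum>i\<le>m. const3 (\<alpha> * coeff C i) * (\<xi> ^ i * poly_y ^ (Suc m - i)))" by (simp add: S.\<iota>_0)
    also have "\<dots> = const3 \<alpha> * poly_y * homog \<xi> m C"
      unfolding homog_def sum_distrib_left
    proof (rule sum.cong[OF refl])
      fix i assume "i \<in> {..m}"
      then have d: "Suc m - i = Suc (m - i)" by (simp add: Suc_diff_le)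
      show "const3 (\<alpha> * coeff C i) * (\<xi> ^ i * poly_y ^ (Suc m - i)) =
          const3 \<alpha> * poly_y * (const3 (coeff C i) * (\<xi> ^ i * poly_y ^ (m - i)))"
        unfolding d power_Suc S.\<iota>_mult by (simp only: mult_ac)
    qed
    finally show ?thesis .
  qed
  finally show ?thesis by (simp add: left_diff_distrib)
qed

text \<open>Multiplication by \<open>\<xi> / y\<close> on \<open>S/(f, g)\<close> in large degrees has an eigenvector.\<close>

lemma eigenvector:
  assumes n: "homogeneous3 k n" "n \<notin> I" and \<xi>: "homogeneous3 1 \<xi>"
  obtains \<alpha> t k' where "homogeneous3 k' (t * n)" "t * n \<notin> I" "(\<xi> - const3 \<alpha> * poly_y) * (t * n) \<in> I"
proof -
  \<comment> \<open>Large enough that every product below reduces to a power of y times a form of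
    degree \<open>2 * e\<close>, and that the \<open>m + 1\<close> forms so obtained are linearly
    dependent.\<close>
  define m where "m = 2 * e + S.vs.dim (forms (2 * e))"
  obtain r where r: "k + m = 2 * e + r" by (metis add.left_commute m_def add.assoc)
  have "\<exists>s. homogeneous3 (2 * e) s \<and> \<xi> ^ i * poly_y ^ (m - i) * n - poly_y ^ r * s \<in> I" if "i \<le> m" for i
  proof -
    have "homogeneous3 (1 * i + 1 * (m - i) + k) (\<xi> ^ i * poly_y ^ (m - i) * n)"
      by (intro homogeneous3_mult homogeneous3_power homogeneous3_vars n \<xi>)
    then have "homogeneous3 (2 * e + r) (\<xi> ^ i * poly_y ^ (m - i) * n)" using that r by (simp add: add.commute)
    then show ?thesis using reduce_mod_y_power by metis
  qed
  then obtain s where s: "\<And>i. i \<le> m \<Longrightarrow> homogeneous3 (2 * e) (s i)"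
     "\<And>i. i \<le> m \<Longrightarrow> \<xi> ^ i * poly_y ^ (m - i) * n - poly_y ^ r * s i \<in> I" by metis
  have "S.vs.dim (forms (2 * e)) < card {..m}" by (simp add: m_def)
  then obtain c i0 where c: "(\<Sum>i\<le>m. const3 (c i) * s i) = 0" "i0 \<le> m" "c i0 \<noteq> 0"
    using S.vs.dependent_family[OF fin_dim_forms[of "2 * e"], of "{..m}" s] s(1) by auto
  define C where "C = (\<Sum>i\<le>m. monom (c i) i)"
  have cC: "coeff C i = (if i \<le> m then c i else 0)" for i
    by (simp add: C_def coeff_sum if_distrib cong: if_cong)
  have C0: "C \<noteq> 0" using cC[of i0] c by auto
  have dC: "degree C \<le> m" by (rule degree_le) (simp add: cC)
  have "(\<Sum>i\<le>m. const3 (c i) * (\<xi> ^ i * poly_y ^ (m - i) * n - poly_y ^ r * s i)) \<in> I"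
  proof -
    have "(\<Sum>i\<in>A. const3 (c i) * (\<xi> ^ i * poly_y ^ (m - i) * n - poly_y ^ r * s i)) \<in> I" if "A \<subseteq> {..m}" for A
      using finite_subset[OF that finite_atMost] that
      by (induction A rule: finite_induct) (auto intro!: ideal3_0 ideal3_add ideal3_mult s(2))
    then show ?thesis by blast
  qed
  moreover have "(\<Sum>i\<le>m. const3 (c i) * (\<xi> ^ i * poly_y ^ (m - i) * n - poly_y ^ r * s i)) =
     homog \<xi> m C * n - poly_y ^ r * (\<Sum>i\<le>m. const3 (c i) * s i)"
    unfolding homog_def sum_distrib_left sum_distrib_right sum_subtractf[symmetric]
    by (rule sum.cong) (auto simp: cC algebra_simps)
  ultimately have hC: "homog \<xi> m C * n \<in> I" using c(1) by simp
  \<comment> \<open>The dependence yields a polynomial in \<xi>/y that annihilates \<open>n\<close>.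
    Its linear factors are split off one by one; the first product outside the ideal is an
    eigenvector, and a constant annihilator is impossible because y is regular.\<close>
  have "\<exists>\<alpha> t k'. homogeneous3 k' (t * n) \<and> t * n \<notin> I \<and> (\<xi> - const3 \<alpha> * poly_y) * (t * n) \<in> I"
    using C0 dC hC
  proof (induction "degree C" arbitrary: C m rule: less_induct)
    case less
    show ?case
    proof (cases "degree C = 0")
      case True
      then obtain a where a: "C = [:a:]" "a \<noteq> 0" using less.prems(1) by (metis degree_eq_zeroE pCons_0_0)
      have "homog \<xi> m C = (\<Sum>i\<in>{..m}. if i = 0 then const3 a * poly_y ^ m else 0)"
        unfolding homog_def a by (rule sum.cong) (auto simp: coeff_pCons S.\<iota>_0 split: nat.splits)
      also have "\<dots> = const3 a * poly_y ^ m" by simp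
      finally have "const3 (1 / a) * (const3 a * poly_y ^ m * n) \<in> I" using ideal3_mult less.prems(3) by metis
      moreover have "const3 (1 / a) * (const3 a * poly_y ^ m * n) = (const3 (1 / a) * const3 a) * (poly_y ^ m * n)"
        by (simp only: mult_ac)
      moreover have "const3 (1 / a) * const3 a = 1" using a by (simp add: S.\<iota>_mult[symmetric] S.\<iota>_1)
      ultimately have "poly_y ^ m * n \<in> I" by simp
      then show ?thesis using y_power_regular n by blast
    next
      case False
      then obtain \<alpha> where r: "poly C \<alpha> = 0"
        by (metis constant_degree fundamental_theorem_of_algebra)
      then obtain C' where C': "C = [:- \<alpha>, 1:] * C'" unfolding poly_eq_0_iff_dvd by (rule dvdE)
      have C'0: "C' \<noteq> 0" using less.prems(1) C' by auto
      have d: "degree C = Suc (degree C')" unfolding C' using C'0 by (subst degree_mult_eq) auto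
      then obtain m' where m': "m = Suc m'" using less.prems(2) by (cases m) auto
      have dC': "degree C' \<le> m'" using d less.prems(2) m' by simp
      have prod: "homog \<xi> m C * n = (\<xi> - const3 \<alpha> * poly_y) * (homog \<xi> m' C' * n)"
        unfolding m' C' homog_linear_mult[OF dC'] by (simp only: mult.assoc)
      show ?thesis
      proof (cases "homog \<xi> m' C' * n \<in> I")
        case True
        then show ?thesis using less.hyps[of C' m'] d C'0 dC' by simp
      next
        case False
        have "homogeneous3 (m' + k) (homog \<xi> m' C' * n)"
          by (rule homogeneous3_mult[OF homogeneous3_homog[OF \<xi>] n(1)])
        then show ?thesis using False less.prems(3) unfolding prod by blast
      qed
    qed
  qed
  then show ?thesis using that by blast
qed

text \<open>A zero divisor is turned into a common eigenvector \<open>N\<close> of x/y and z/y, with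
  eigenvalues \<alpha> and \<beta>. The forms f, g and h all annihilate \<open>N\<close>, hence
  vanish at (\<alpha>, 1, \<beta>), against the hypothesis.\<close>

lemma third_form_regular:
  assumes h: "homogeneous3 e h" and nz: "\<And>v. v \<noteq> 0 \<Longrightarrow> eval3 f v = 0 \<Longrightarrow> eval3 g v = 0 \<Longrightarrow> eval3 h v \<noteq> 0"
    and n: "homogeneous3 k n" "h * n \<in> I"
  shows "n \<in> I"
proof (rule ccontr)
  assume "n \<notin> I"
  then obtain \<alpha> t k1 where 1: "homogeneous3 k1 (t * n)" "t * n \<notin> I" "(poly_x - const3 \<alpha> * poly_y) * (t * n) \<in> I"
    using eigenvector[OF n(1) _ homogeneous3_vars(1)] by metis
  obtain \<beta> t' k2 where 2: "homogeneous3 k2 (t' * (t * n))" "t' * (t * n) \<notin> I" "(poly_z - const3 \<beta> * poly_y) * (t' * (t * n)) \<in> I"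
    using eigenvector[OF 1(1,2) homogeneous3_vars(3)] by metis
  define N where "N = t' * (t * n)"
  have xN: "(poly_x - const3 \<alpha> * poly_y) * N \<in> I"
    using ideal3_mult[OF 1(3), of t'] by (simp add: N_def mult_ac)
  have zN: "(poly_z - const3 \<beta> * poly_y) * N \<in> I" using 2(3) by (simp add: N_def)
  \<comment> \<open>On \<open>N\<close> one may replace x by \<alpha> y and z by \<beta> y, so
    \<open>p\<close> acts as its value at the point times y^e, and y is regular.\<close>
  have van: "eval3 p (\<alpha>, 1, \<beta>) = 0" if p: "homogeneous3 e p" "p * N \<in> I" for p
  proof (rule ccontr)
    assume c0: "eval3 p (\<alpha>, 1, \<beta>) \<noteq> 0"
    let ?p1 = "eval_in const3 p (const3 \<alpha> * poly_y, poly_y, poly_z)"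
    let ?p2 = "eval_in const3 p (const3 \<alpha> * poly_y, poly_y, const3 \<beta> * poly_y)"
    have "poly_x - const3 \<alpha> * poly_y dvd eval_in const3 p (poly_x, poly_y, poly_z) - ?p1"
      by (rule eval_diff_dvd[OF S.complex_algebra_axioms]) simp_all
    then obtain q1 where q1: "p - ?p1 = (poly_x - const3 \<alpha> * poly_y) * q1" unfolding eval_in_self by (rule dvdE)
    have "poly_z - const3 \<beta> * poly_y dvd ?p1 - ?p2"
      by (rule eval_diff_dvd[OF S.complex_algebra_axioms]) simp_all
    then obtain q2 where q2: "?p1 - ?p2 = (poly_z - const3 \<beta> * poly_y) * q2" by (rule dvdE)
    have "?p2 = eval_in const3 p (poly_y * const3 \<alpha>, poly_y * 1, poly_y * const3 \<beta>)" by (simp add: mult.commute)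
    also have "\<dots> = poly_y ^ e * eval_in const3 p (const3 \<alpha>, 1, const3 \<beta>)"
      by (rule eval_in_homogeneous[OF S.complex_algebra_axioms p(1)])
    also have "eval_in const3 p (const3 \<alpha>, 1, const3 \<beta>) = const3 (eval3 p (\<alpha>, 1, \<beta>))"
      using eval_in_eval_in[OF ev.complex_algebra_axioms S.complex_algebra_axioms S.\<iota>_add S.\<iota>_mult refl, of p \<alpha> 1 \<beta>]
      by (simp add: S.\<iota>_1)
    finally have p2: "?p2 = poly_y ^ e * const3 (eval3 p (\<alpha>, 1, \<beta>))" .
    have "?p2 * N = p * N - q1 * ((poly_x - const3 \<alpha> * poly_y) * N) - q2 * ((poly_z - const3 \<beta> * poly_y) * N)"
    proof -
      have "q1 * ((poly_x - const3 \<alpha> * poly_y) * N) = (p - ?p1) * N" unfolding q1 by (simp only: mult_ac)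
      moreover have "q2 * ((poly_z - const3 \<beta> * poly_y) * N) = (?p1 - ?p2) * N" unfolding q2 by (simp only: mult_ac)
      ultimately show ?thesis by (simp add: algebra_simps)
    qed
    also have "\<dots> \<in> I" by (intro ideal3_diff p(2) ideal3_mult xN zN)
    finally have "const3 (1 / eval3 p (\<alpha>, 1, \<beta>)) * (?p2 * N) \<in> I" by (rule ideal3_mult)
    moreover have "const3 (1 / eval3 p (\<alpha>, 1, \<beta>)) * (?p2 * N) =
       (const3 (1 / eval3 p (\<alpha>, 1, \<beta>)) * const3 (eval3 p (\<alpha>, 1, \<beta>))) * (poly_y ^ e * N)"
      unfolding p2 by (simp only: mult_ac)
    moreover have "const3 (1 / eval3 p (\<alpha>, 1, \<beta>)) * const3 (eval3 p (\<alpha>, 1, \<beta>)) = 1"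
      using c0 by (simp add: S.\<iota>_mult[symmetric] S.\<iota>_1)
    ultimately have "poly_y ^ e * N \<in> I" by simp
    then have "N \<in> I" using y_power_regular 2(1) by (simp add: N_def)
    then show False using 2(2) by (simp add: N_def)
  qed
  have "h * N \<in> I" using ideal3_mult[OF n(2), of "t' * t"] by (simp add: N_def mult_ac)
  moreover have "f * N \<in> I" "g * N \<in> I" using ideal3_mult[OF ideal3_gens(1)] ideal3_mult[OF ideal3_gens(2)] by (metis mult.commute)+
  ultimately show False using van[OF h] van[OF f] van[OF g] nz[of "(\<alpha>, 1, \<beta>)"] by (simp add: zero_prod_def)
qed

text \<open>Regularity of \<open>h\<close> puts \<open>c\<close> into the ideal of \<open>f\<close>
  and \<open>g\<close>, which has nothing but 0 in degree \<open>j < e\<close>; the case of two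
  forms remains.\<close>

lemma no_syzygies:
  assumes h: "homogeneous3 e h" and nz: "\<And>v. v \<noteq> 0 \<Longrightarrow> eval3 f v = 0 \<Longrightarrow> eval3 g v = 0 \<Longrightarrow> eval3 h v \<noteq> 0"
    and abc: "homogeneous3 j a" "homogeneous3 j b" "homogeneous3 j c" "a * f + b * g + c * h = 0" and j: "j < e"
  shows "a = 0 \<and> b = 0 \<and> c = 0"
proof -
  have "h * c = (- a) * f + (- b) * g" using abc(4) by (simp add: algebra_simps eq_neg_iff_add_eq_0)
  then have "h * c \<in> I" unfolding I_iff by blast
  then have "c \<in> I" using third_form_regular[OF h nz abc(3)] by blast
  then have c: "c = 0" using I_homogeneous[OF _ abc(3)] j by (metis not_add_less2)
  then show ?thesis using koszul_syzygies[OF abc(1,2) _ j] abc(4) by simp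
qed

end

text \<open>Replacing \<open>g\<close> by \<open>g + s h\<close> removes common zeros on y = 0:
  \<open>f\<close> has finitely many zeros there, and each excludes at most one value of
  \<open>s\<close>.\<close>

lemma no_syzygies_of_no_common_zero:
  assumes fgh: "homogeneous3 e f" "homogeneous3 e g" "homogeneous3 e h" and f1: "eval3 f (1, 0, 0) \<noteq> 0"
    and nz: "\<And>v. v \<noteq> 0 \<Longrightarrow> eval3 f v = 0 \<Longrightarrow> eval3 g v = 0 \<Longrightarrow> eval3 h v \<noteq> 0"
    and abc: "homogeneous3 j a" "homogeneous3 j b" "homogeneous3 j c" "a * f + b * g + c * h = 0" and j: "j < e"
  shows "a = 0 \<and> b = 0 \<and> c = 0"
proof -
  have "coeff (res_y f) e \<noteq> 0" using coeff_res_y[OF fgh(1)] f1 by simp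
  then have "res_y f \<noteq> 0" by auto
  then have fin: "finite {t. poly (res_y f) t = 0}" by (rule poly_roots_finite)
  have "finite (\<Union>t\<in>{t. poly (res_y f) t = 0}. {s. eval3 g (t, 0, 1) + s * eval3 h (t, 0, 1) = 0})"
  proof (rule finite_UN_I[OF fin])
    fix t assume "t \<in> {t. poly (res_y f) t = 0}"
    then have ft: "eval3 f (t, 0, 1) = 0" by (simp add: poly_res_y)
    show "finite {s. eval3 g (t, 0, 1) + s * eval3 h (t, 0, 1) = 0}"
    proof (cases "eval3 h (t, 0, 1) = 0")
      case True
      then have "eval3 g (t, 0, 1) \<noteq> 0" using nz[of "(t, 0, 1)"] ft by (auto simp: zero_prod_def)
      then show ?thesis using True by simp
    next
      case False
      have "{s. eval3 g (t, 0, 1) + s * eval3 h (t, 0, 1) = 0} \<subseteq> {- eval3 g (t, 0, 1) / eval3 h (t, 0, 1)}"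
        using False by (auto simp: field_simps eq_neg_iff_add_eq_0)
      then show ?thesis by (rule finite_subset) simp
    qed
  qed
  then obtain s where s: "s \<notin> (\<Union>t\<in>{t. poly (res_y f) t = 0}. {s. eval3 g (t, 0, 1) + s * eval3 h (t, 0, 1) = 0})"
    using ex_new_if_finite[OF infinite_UNIV_char_0] by blast
  interpret coprime_pair e f "g + const3 s * h"
  proof
    show "homogeneous3 e (g + const3 s * h)" by (intro homogeneous3_add homogeneous3_const3_mult fgh)
    show "eval3 (g + const3 s * h) (t, 0, 1) \<noteq> 0" if "eval3 f (t, 0, 1) = 0" for t
      using s that by (auto simp: poly_res_y ev.eval_in_add ev.eval_in_mult)
  qed (fact fgh f1)+
  have "a = 0 \<and> b = 0 \<and> c - const3 s * b = 0"
  proof (rule no_syzygies[OF fgh(3) _ abc(1,2) _ _ j])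
    show "homogeneous3 j (c - const3 s * b)" by (intro homogeneous3_diff homogeneous3_const3_mult abc)
    show "a * f + b * (g + const3 s * h) + (c - const3 s * b) * h = 0"
      using abc(4) by (simp add: algebra_simps)
    show "eval3 h v \<noteq> 0" if "v \<noteq> 0" "eval3 f v = 0" "eval3 (g + const3 s * h) v = 0" for v
      using nz[OF that(1,2)] that(3) by (auto simp: ev.eval_in_add ev.eval_in_mult)
  qed
  then show ?thesis by auto
qed

lemma eval3_homogeneous: "homogeneous3 d p \<Longrightarrow> eval3 p (smult3 t v) = t ^ d * eval3 p v"
  using eval_in_homogeneous[OF ev.complex_algebra_axioms] by (cases v) (simp add: smult3_def)

lemma proj_point_smult3: "proj_point v = {smult3 t v |t. t \<noteq> 0}"
  by (cases v) (simp add: proj_point_def smult3_def)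

lemma singular_point_iff:
  assumes f: "homogeneous3 (Suc e) f" and v: "v \<noteq> 0"
  shows "proj_point v \<in> singular_points f \<longleftrightarrow>
    eval3 (partial_x f) v = 0 \<and> eval3 (partial_y f) v = 0 \<and> eval3 (partial_z f) v = 0"
proof
  have "v = smult3 1 v" by (cases v) (simp add: smult3_def)
  then have "v \<in> proj_point v" unfolding proj_point_smult3 by (metis (mono_tags, lifting) mem_Collect_eq zero_neq_one)
  then show "eval3 (partial_x f) v = 0 \<and> eval3 (partial_y f) v = 0 \<and> eval3 (partial_z f) v = 0"
    if "proj_point v \<in> singular_points f" using that unfolding singular_points_def by blast
next
  assume z: "eval3 (partial_x f) v = 0 \<and> eval3 (partial_y f) v = 0 \<and> eval3 (partial_z f) v = 0"
  obtain a b c where abc: "v = (a, b, c)" by (cases v)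
  have "eval3 (const3 (of_nat (Suc e)) * f) v = 0"
    unfolding euler[OF f, symmetric] using z by (simp add: ev.eval_in_add ev.eval_in_mult)
  then have "of_nat (Suc e) * eval3 f v = 0" unfolding ev.eval_in_mult ev.eval_in_const3 .
  then have fv: "eval3 f v = 0" by (metis mult_eq_0_iff of_nat_neq_0)
  have "proj_point v \<in> proj_plane" using v unfolding proj_plane_def by (auto simp: zero_prod_def)
  then show "proj_point v \<in> singular_points f"
    unfolding singular_points_def proj_point_smult3
    using z fv by (auto simp only: mem_Collect_eq eval3_homogeneous[OF f] eval3_homogeneous[OF homogeneous3_partial(1)[OF f]]
       eval3_homogeneous[OF homogeneous3_partial(2)[OF f]] eval3_homogeneous[OF homogeneous3_partial(3)[OF f]] mult_zero_right)
qed

text \<open>Some partial derivative is nonzero at (1, 0, 0); the three are permuted so that it comes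
  first.\<close>

lemma smooth_form_syz:
  assumes s: "smooth_form (Suc e) f" and j: "j < e"
  shows "syz f j = {0}"
proof -
  have f: "homogeneous3 (Suc e) f" using s by (simp add: smooth_form_def)
  note pf = homogeneous3_partial[OF f]
  have nz: "\<not> (eval3 (partial_x f) v = 0 \<and> eval3 (partial_y f) v = 0 \<and> eval3 (partial_z f) v = 0)" if "v \<noteq> 0" for v
    using singular_point_iff[OF f that] s unfolding smooth_form_def by blast
  have "\<theta> = 0" if "\<theta> \<in> syz f j" for \<theta>
  proof -
    obtain a b c where abc: "\<theta> = (a, b, c)" by (cases \<theta>)
    have h: "homogeneous3 j a" "homogeneous3 j b" "homogeneous3 j c"
      and z: "a * partial_x f + b * partial_y f + c * partial_z f = 0"
      using that by (auto simp: abc syz_def tforms_iff der_def)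
    have "(1, 0, 0) \<noteq> (0 :: vec3)" by (simp add: zero_prod_def)
    from nz[OF this] consider "eval3 (partial_x f) (1, 0, 0) \<noteq> 0" | "eval3 (partial_y f) (1, 0, 0) \<noteq> 0"
      | "eval3 (partial_z f) (1, 0, 0) \<noteq> 0" by blast
    then have "a = 0 \<and> b = 0 \<and> c = 0"
    proof cases
      case 1
      show ?thesis by (rule no_syzygies_of_no_common_zero[OF pf 1 _ h z j]) (use nz in blast)
    next
      case 2
      have "b * partial_y f + a * partial_x f + c * partial_z f = 0" using z by (simp add: add_ac)
      then have "b = 0 \<and> a = 0 \<and> c = 0"
        by (rule no_syzygies_of_no_common_zero[OF pf(2,1,3) 2 _ h(2,1,3) _ j, rotated]) (use nz in blast)
      then show ?thesis by blast
    next
      case 3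
      have "c * partial_z f + a * partial_x f + b * partial_y f = 0" using z by (simp add: add_ac)
      then have "c = 0 \<and> a = 0 \<and> b = 0"
        by (rule no_syzygies_of_no_common_zero[OF pf(3,1,2) 3 _ h(3,1,2) _ j, rotated]) (use nz in blast)
      then show ?thesis by blast
    qed
    then show ?thesis by (simp add: abc zero_prod_def)
  qed
  then show ?thesis using T.subspace_0[OF subspace_syz] by blast
qed

section \<open>Tjurina numbers of ordinary double and triple points\<close>

lemma deriv_u_nth: "fps_nth (deriv_u F) n = fps_deriv (fps_nth F n)"
  by (simp add: deriv_u_def)

lemma deriv_u_add: "deriv_u (F + G) = deriv_u F + deriv_u G"
  by (rule fps_ext) (simp add: deriv_u_nth)

lemma deriv_u_mult: "deriv_u (F * G) = deriv_u F * G + F * deriv_u G"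
proof (rule fps_ext)
  fix n
  have s: "fps_deriv (\<Sum>i\<in>A. h i) = (\<Sum>i\<in>A. fps_deriv (h i))" for h :: "nat \<Rightarrow> complex fps" and A
    by (induction A rule: infinite_finite_induct) simp_all
  show "fps_nth (deriv_u (F * G)) n = fps_nth (deriv_u F * G + F * deriv_u G) n"
    by (simp add: deriv_u_nth fps_mult_nth s sum.distrib[symmetric] add.commute)
qed

lemma deriv_v_add: "deriv_v (F + G) = deriv_v F + deriv_v G"
  and deriv_v_mult: "deriv_v (F * G) = deriv_v F * G + F * deriv_v G"
  by (simp_all add: deriv_v_def)

definition lin_uv :: "complex \<Rightarrow> complex \<Rightarrow> complex fps fps"
  where "lin_uv a b = const_uv a * var_u + const_uv b * var_v"

lemma deriv_const_uv: "deriv_u (const_uv c) = 0" "deriv_v (const_uv c) = 0"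
proof -
  show "deriv_u (const_uv c) = 0" by (rule fps_ext) (simp add: deriv_u_nth const_uv_def)
qed (simp add: deriv_v_def const_uv_def)

lemma deriv_vars: "deriv_u var_u = 1" "deriv_u var_v = 0" "deriv_v var_u = 0" "deriv_v var_v = 1"
proof -
  show "deriv_u var_u = 1" by (rule fps_ext) (simp add: deriv_u_nth var_u_def fps_const_def)
  show "deriv_u var_v = 0" by (rule fps_ext) (simp add: deriv_u_nth var_v_def fps_X_def)
qed (simp_all add: deriv_v_def var_u_def var_v_def)

lemma deriv_lin_uv: "deriv_u (lin_uv a b) = const_uv a" "deriv_v (lin_uv a b) = const_uv b"
  by (simp_all add: lin_uv_def deriv_u_add deriv_u_mult deriv_v_add deriv_v_mult deriv_const_uv deriv_vars)

text \<open>The terms of order at most two, evaluated in the direction \<open>(x, y)\<close>.\<close>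

definition jet0 :: "complex fps fps \<Rightarrow> complex"
  where "jet0 F = fps_nth (fps_nth F 0) 0"

definition jet1 :: "complex \<times> complex \<Rightarrow> complex fps fps \<Rightarrow> complex"
  where "jet1 = (\<lambda>(x, y) F. x * fps_nth (fps_nth F 0) 1 + y * fps_nth (fps_nth F 1) 0)"

definition jet2 :: "complex \<times> complex \<Rightarrow> complex fps fps \<Rightarrow> complex"
  where "jet2 = (\<lambda>(x, y) F. x * x * fps_nth (fps_nth F 0) 2 + x * y * fps_nth (fps_nth F 1) 1 + y * y * fps_nth (fps_nth F 2) 0)"

lemma jet_add: "jet0 (F + G) = jet0 F + jet0 G" "jet1 p (F + G) = jet1 p F + jet1 p G"
  "jet2 p (F + G) = jet2 p F + jet2 p G"
  by (cases p; simp add: jet0_def jet1_def jet2_def algebra_simps)+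

lemma jet_mult: "jet0 (F * G) = jet0 F * jet0 G" "jet1 p (F * G) = jet0 F * jet1 p G + jet1 p F * jet0 G"
  "jet2 p (F * G) = jet0 F * jet2 p G + jet1 p F * jet1 p G + jet2 p F * jet0 G"
proof -
  have s: "{0..1 :: nat} = {0, 1}" "{0..2 :: nat} = {0, 1, 2}" "{0..Suc 0} = {0, 1}" by auto
  obtain x y where p: "p = (x, y)" by (cases p)
  show "jet0 (F * G) = jet0 F * jet0 G" by (simp add: jet0_def fps_mult_nth)
  show "jet1 p (F * G) = jet0 F * jet1 p G + jet1 p F * jet0 G"
    by (simp add: p jet0_def jet1_def fps_mult_nth s fps_sum_nth algebra_simps)
  show "jet2 p (F * G) = jet0 F * jet2 p G + jet1 p F * jet1 p G + jet2 p F * jet0 G"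
    by (simp add: p jet0_def jet1_def jet2_def fps_mult_nth s fps_sum_nth algebra_simps)
qed

lemma jet_const_uv: "jet0 (const_uv c) = c" "jet1 p (const_uv c) = 0" "jet2 p (const_uv c) = 0"
  by (cases p; simp add: jet0_def jet1_def jet2_def const_uv_def fps_const_def)+

lemma jet_lin_uv: "jet0 (lin_uv a b) = 0" "jet1 (x, y) (lin_uv a b) = a * x + b * y" "jet2 (x, y) (lin_uv a b) = 0"
  by (simp_all add: jet0_def jet1_def jet2_def lin_uv_def const_uv_def var_u_def var_v_def fps_mult_nth fps_const_def fps_X_def
      numeral_2_eq_2)

lemma unit_uv:
  assumes "jet0 F \<noteq> 0"
  obtains G where "F * G = 1"
proof -
  have "fps_nth F 0 * inverse (fps_nth F 0) = 1"
    using assms by (simp add: jet0_def inverse_mult_eq_1')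
  then have "F * fps_right_inverse F (inverse (fps_nth F 0)) = 1" by (rule fps_right_inverse)
  then show ?thesis by (rule that)
qed

lemma uv_decomposition:
  obtains A B where "F = const_uv (jet0 F) + var_u * A + var_v * B"
proof -
  have d: "G = fps_const (fps_nth G 0) + fps_X * fps_shift 1 G" for G :: "'a::comm_ring_1 fps"
    by (rule fps_ext) (simp add: fps_X_mult_nth)
  have "fps_const (fps_nth F 0) = fps_const (fps_const (jet0 F)) + var_u * fps_const (fps_shift 1 (fps_nth F 0))"
    by (subst d[of "fps_nth F 0"]) (simp add: jet0_def var_u_def)
  then have "F = const_uv (jet0 F) + var_u * fps_const (fps_shift 1 (fps_nth F 0)) + var_v * fps_shift 1 F"
    using d[of F] by (simp add: const_uv_def var_v_def)
  then show ?thesis by (rule that)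
qed

text \<open>Two transversal branches, used as local coordinates; the fractions over \<open>D\<close>
  are the entries of the inverse coordinate change.\<close>

locale transversal =
  fixes a1 b1 a2 b2 :: complex
  assumes D: "a1 * b2 - a2 * b1 \<noteq> 0"
begin

abbreviation "D \<equiv> a1 * b2 - a2 * b1"
abbreviation "L1 \<equiv> lin_uv a1 b1"
abbreviation "L2 \<equiv> lin_uv a2 b2"

lemma D_inverse:
  "b2 / D * a1 + - (b1 / D) * a2 = 1" "a1 / D * b2 + - (a2 / D) * b1 = 1"
  "b2 / D * a1 + - (a2 / D) * b1 = 1" "a1 / D * b2 + - (b1 / D) * a2 = 1"
proof -
  have e: "x / D * y + - (z / D) * w = (x * y - z * w) / D" for x y z w
    by (simp add: diff_divide_distrib)
  have "b2 * a1 - b1 * a2 = D" "a1 * b2 - a2 * b1 = D" "b2 * a1 - a2 * b1 = D" "a1 * b2 - b1 * a2 = D"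
    by (simp_all add: mult.commute)
  then show "b2 / D * a1 + - (b1 / D) * a2 = 1" "a1 / D * b2 + - (a2 / D) * b1 = 1"
    "b2 / D * a1 + - (a2 / D) * b1 = 1" "a1 / D * b2 + - (b1 / D) * a2 = 1"
    unfolding e using D by simp_all
qed

lemma decomposition:
  obtains A B where "F = const_uv (jet0 F) + L1 * A + L2 * B"
proof -
  obtain A B where AB: "F = const_uv (jet0 F) + var_u * A + var_v * B" by (rule uv_decomposition)
  have u: "var_u = const_uv (b2 / D) * L1 - const_uv (b1 / D) * L2"
  proof -
    have "const_uv (b2 / D) * L1 - const_uv (b1 / D) * L2 =
      const_uv (b2 / D * a1 + - (b1 / D) * a2) * var_u + const_uv (b2 / D * b1 + - (b1 / D) * b2) * var_v"
      by (simp only: lin_uv_def uv.\<iota>_add uv.\<iota>_mult uv.\<iota>_minus) (simp add: algebra_simps)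
    also have "b2 / D * a1 + - (b1 / D) * a2 = 1" by (rule D_inverse)
    also have "b2 / D * b1 + - (b1 / D) * b2 = 0" by (simp add: field_simps)
    finally show ?thesis by (simp add: uv.\<iota>_1 uv.\<iota>_0)
  qed
  have v: "var_v = const_uv (a1 / D) * L2 - const_uv (a2 / D) * L1"
  proof -
    have "const_uv (a1 / D) * L2 - const_uv (a2 / D) * L1 =
      const_uv (a1 / D * a2 + - (a2 / D) * a1) * var_u + const_uv (a1 / D * b2 + - (a2 / D) * b1) * var_v"
      by (simp only: lin_uv_def uv.\<iota>_add uv.\<iota>_mult uv.\<iota>_minus) (simp add: algebra_simps)
    also have "a1 / D * b2 + - (a2 / D) * b1 = 1" by (rule D_inverse)
    also have "a1 / D * a2 + - (a2 / D) * a1 = 0" by (simp add: field_simps)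
    finally show ?thesis by (simp add: uv.\<iota>_1 uv.\<iota>_0)
  qed
  have "F = const_uv (jet0 F) + L1 * (const_uv (b2 / D) * A - const_uv (a2 / D) * B) +
      L2 * (const_uv (a1 / D) * B - const_uv (b1 / D) * A)"
    by (subst AB, subst u, subst v) (simp add: algebra_simps)
  then show ?thesis by (rule that)
qed

text \<open>The Tjurina ideal of a node is the maximal ideal. The unit \<open>U\<close> cancels once
  \<open>L1 * L2\<close> is known to lie in the ideal; the two derivatives then give independent
  combinations of \<open>L1\<close> and \<open>L2\<close>.\<close>

lemma ideal_double_point:
  assumes U: "U * U' = 1"
  defines "g \<equiv> U * (L1 * L2)"
  shows "p \<in> ideal3 g (deriv_u g) (deriv_v g) \<longleftrightarrow> (\<exists>A B. p = A * L1 + B * L2)"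
proof
  let ?I = "ideal3 g (deriv_u g) (deriv_v g)"
  have gu: "deriv_u g = deriv_u U * (L1 * L2) + U * (const_uv a1 * L2 + L1 * const_uv a2)"
    by (simp only: g_def deriv_u_mult deriv_lin_uv)
  have gv: "deriv_v g = deriv_v U * (L1 * L2) + U * (const_uv b1 * L2 + L1 * const_uv b2)"
    by (simp only: g_def deriv_v_mult deriv_lin_uv)
  { assume "p \<in> ?I"
    then obtain x y z where "p = x * g + y * deriv_u g + z * deriv_v g" by (auto simp: ideal3_iff)
    then have "p = (x * (U * L2) + y * (deriv_u U * L2 + U * const_uv a2) + z * (deriv_v U * L2 + U * const_uv b2)) * L1 +
        (y * (U * const_uv a1) + z * (U * const_uv b1)) * L2"
      unfolding gu gv unfolding g_def by (simp add: algebra_simps)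
    then show "\<exists>A B. p = A * L1 + B * L2" by blast }
  { assume "\<exists>A B. p = A * L1 + B * L2"
    then obtain A B where p: "p = A * L1 + B * L2" by blast
    have q: "L1 * L2 \<in> ?I"
    proof -
      have "U' * g = L1 * L2" using U unfolding g_def by (metis mult.assoc mult.commute mult_1)
      then show ?thesis using ideal3_mult[OF ideal3_gens(1), of U' g] by metis
    qed
    have qu: "const_uv a1 * L2 + L1 * const_uv a2 \<in> ?I"
    proof -
      have "U' * (deriv_u g - deriv_u U * (L1 * L2)) = (U * U') * (const_uv a1 * L2 + L1 * const_uv a2)"
        unfolding gu by (simp add: mult_ac)
      then show ?thesis using U ideal3_mult[OF ideal3_diff[OF ideal3_gens(2) ideal3_mult[OF q]]] by (metis mult_1)
    qed
    have qv: "const_uv b1 * L2 + L1 * const_uv b2 \<in> ?I"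
    proof -
      have "U' * (deriv_v g - deriv_v U * (L1 * L2)) = (U * U') * (const_uv b1 * L2 + L1 * const_uv b2)"
        unfolding gv by (simp add: mult_ac)
      then show ?thesis using U ideal3_mult[OF ideal3_diff[OF ideal3_gens(3) ideal3_mult[OF q]]] by (metis mult_1)
    qed
    have "const_uv (b2 / D) * (const_uv a1 * L2 + L1 * const_uv a2) - const_uv (a2 / D) * (const_uv b1 * L2 + L1 * const_uv b2)
       = const_uv (b2 / D * a1 + - (a2 / D) * b1) * L2 + const_uv (b2 / D * a2 + - (a2 / D) * b2) * L1"
      by (simp only: uv.\<iota>_add uv.\<iota>_mult uv.\<iota>_minus) (simp add: algebra_simps)
    also have "b2 / D * a1 + - (a2 / D) * b1 = 1" by (rule D_inverse)
    also have "b2 / D * a2 + - (a2 / D) * b2 = 0" by (simp add: field_simps)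
    finally have "L2 = const_uv (b2 / D) * (const_uv a1 * L2 + L1 * const_uv a2) - const_uv (a2 / D) * (const_uv b1 * L2 + L1 * const_uv b2)"
      by (simp add: uv.\<iota>_0 uv.\<iota>_1)
    then have L2: "L2 \<in> ?I" using ideal3_diff[OF ideal3_mult[OF qu] ideal3_mult[OF qv]] by metis
    have "const_uv (a1 / D) * (const_uv b1 * L2 + L1 * const_uv b2) - const_uv (b1 / D) * (const_uv a1 * L2 + L1 * const_uv a2)
       = const_uv (a1 / D * b1 + - (b1 / D) * a1) * L2 + const_uv (a1 / D * b2 + - (b1 / D) * a2) * L1"
      by (simp only: uv.\<iota>_add uv.\<iota>_mult uv.\<iota>_minus) (simp add: algebra_simps)
    also have "a1 / D * b2 + - (b1 / D) * a2 = 1" by (rule D_inverse)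
    also have "a1 / D * b1 + - (b1 / D) * a1 = 0" by (simp add: field_simps)
    finally have "L1 = const_uv (a1 / D) * (const_uv b1 * L2 + L1 * const_uv b2) - const_uv (b1 / D) * (const_uv a1 * L2 + L1 * const_uv a2)"
      by (simp add: uv.\<iota>_0 uv.\<iota>_1)
    then have L1: "L1 \<in> ?I" using ideal3_diff[OF ideal3_mult[OF qv] ideal3_mult[OF qu]] by metis
    show "p \<in> ?I" unfolding p by (intro ideal3_add ideal3_mult L1 L2) }
qed

lemma quot_dim_double_point:
  assumes U: "U * U' = 1"
  defines "g \<equiv> U * (L1 * L2)"
  shows "quot_dim const_uv {g, deriv_u g, deriv_v g} UNIV = 1"
proof -
  note iff = ideal_double_point[OF U, folded g_def]
  have j0: "jet0 p = 0" if "p \<in> ideal3 g (deriv_u g) (deriv_v g)" for p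
    using that by (auto simp: iff jet_add jet_mult jet_lin_uv)
  have "quot_dim const_uv {g, deriv_u g, deriv_v g} UNIV = length [1 :: complex fps fps]"
  proof (rule uv.quot_dim_eqI)
    show "1 \<notin> ideal3 g (deriv_u g) (deriv_v g)"
      using j0[of 1] jet_const_uv(1)[of 1] by (auto simp: uv.\<iota>_1)
    fix F :: "complex fps fps"
    obtain A B where "F = const_uv (jet0 F) + L1 * A + L2 * B" by (rule decomposition)
    then have "F - const_uv (jet0 F) * 1 = A * L1 + B * L2" by (simp add: algebra_simps)
    then have "F - const_uv (jet0 F) * 1 \<in> ideal3 g (deriv_u g) (deriv_v g)" unfolding iff by blast
    then show "\<exists>cs. length cs = length [1 :: complex fps fps] \<and>
        F - (\<Sum>(c, b)\<leftarrow>zip cs [1]. const_uv c * b) \<in> ideal3 g (deriv_u g) (deriv_v g)"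
      by (intro exI[of _ "[jet0 F]"]) simp
  next
    fix cs :: "complex list"
    assume "length cs = length [1 :: complex fps fps]"
      and i: "(\<Sum>(c, b)\<leftarrow>zip cs [1]. const_uv c * b) \<in> ideal3 g (deriv_u g) (deriv_v g)"
    then obtain c where cs: "cs = [c]" by (auto simp: length_Suc_conv)
    have "jet0 (const_uv c) = 0" using j0[OF i] by (simp add: cs)
    then show "set cs \<subseteq> {0}" by (simp add: cs jet_const_uv)
  qed simp_all
  then show ?thesis by simp
qed

text \<open>A third branch \<open>a L\<^sub>1 + b L\<^sub>2\<close>; in the coordinates \<open>L\<^sub>1, L\<^sub>2\<close> the partial derivatives of the cubic
  \<open>L\<^sub>1 L\<^sub>2 (a L\<^sub>1 + b L\<^sub>2)\<close> are the two quadrics below.\<close>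

lemma ideal_triple_point:
  fixes a b :: complex
  assumes U: "U * U' = 1"
  defines "g \<equiv> U * (L1 * L2 * (const_uv a * L1 + const_uv b * L2))"
  defines "q1 \<equiv> L2 * (const_uv (2 * a) * L1 + const_uv b * L2)"
    and "q2 \<equiv> L1 * (const_uv a * L1 + const_uv (2 * b) * L2)"
  shows "p \<in> ideal3 g (deriv_u g) (deriv_v g) \<longleftrightarrow> (\<exists>A B. p = A * q1 + B * q2)"
proof
  let ?I = "ideal3 g (deriv_u g) (deriv_v g)"
  define q where "q = L1 * L2 * (const_uv a * L1 + const_uv b * L2)"
  have two: "const_uv (2 * c) = 2 * const_uv c" for c
    using uv.\<iota>_add[of c c] by simp
  have gq: "g = U * q" by (simp add: g_def q_def)
  have qu: "deriv_u q = const_uv a1 * q1 + const_uv a2 * q2"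
    unfolding q_def q1_def q2_def deriv_u_mult deriv_u_add deriv_lin_uv deriv_const_uv two
    by (simp add: algebra_simps)
  have qv: "deriv_v q = const_uv b1 * q1 + const_uv b2 * q2"
    unfolding q_def q1_def q2_def deriv_v_mult deriv_v_add deriv_lin_uv deriv_const_uv two
    by (simp add: algebra_simps)
  have gu: "deriv_u g = deriv_u U * q + U * (const_uv a1 * q1 + const_uv a2 * q2)"
    by (simp only: gq deriv_u_mult qu)
  have gv: "deriv_v g = deriv_v U * q + U * (const_uv b1 * q1 + const_uv b2 * q2)"
    by (simp only: gq deriv_v_mult qv)
  have euler: "L1 * q1 + L2 * q2 = const_uv 3 * q"
  proof -
    have "const_uv 3 = 1 + 1 + 1" using uv.\<iota>_add[of 1 2] uv.\<iota>_add[of 1 1] by (simp add: uv.\<iota>_1)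
    then show ?thesis unfolding q1_def q2_def q_def two by (simp add: algebra_simps)
  qed
  have q3: "q = const_uv (1 / 3) * (L1 * q1 + L2 * q2)"
    unfolding euler by (simp add: uv.\<iota>_1 flip: mult.assoc uv.\<iota>_mult)
  { assume "p \<in> ?I"
    then obtain x y z where p: "p = x * g + y * deriv_u g + z * deriv_v g" by (auto simp: ideal3_iff)
    define w where "w = (x * U + y * deriv_u U + z * deriv_v U) * const_uv (1 / 3)"
    have "p = (x * U + y * deriv_u U + z * deriv_v U) * q + y * U * (const_uv a1 * q1 + const_uv a2 * q2) +
        z * U * (const_uv b1 * q1 + const_uv b2 * q2)"
      unfolding p gu gv unfolding gq by (simp add: algebra_simps)
    also have "(x * U + y * deriv_u U + z * deriv_v U) * q = w * (L1 * q1 + L2 * q2)"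
      unfolding w_def by (subst q3) (simp only: mult.assoc)
    finally have "p = (w * L1 + y * U * const_uv a1 + z * U * const_uv b1) * q1 +
        (w * L2 + y * U * const_uv a2 + z * U * const_uv b2) * q2"
      by (simp only: algebra_simps)
    then show "\<exists>A B. p = A * q1 + B * q2" by blast }
  { assume "\<exists>A B. p = A * q1 + B * q2"
    then obtain A B where p: "p = A * q1 + B * q2" by blast
    have q: "q \<in> ?I"
    proof -
      have "U' * g = q" using U unfolding gq by (metis mult.assoc mult.commute mult_1)
      then show ?thesis using ideal3_mult[OF ideal3_gens(1), of U' g] by metis
    qed
    have "deriv_u q \<in> ?I"
    proof -
      have "U' * (deriv_u g - deriv_u U * q) = (U * U') * deriv_u q"
        unfolding gu qu by (simp add: mult_ac)
      then show ?thesis using U ideal3_mult[OF ideal3_diff[OF ideal3_gens(2) ideal3_mult[OF q]]] by (metis mult_1)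
    qed
    note qu' = this[unfolded qu]
    have "deriv_v q \<in> ?I"
    proof -
      have "U' * (deriv_v g - deriv_v U * q) = (U * U') * deriv_v q"
        unfolding gv qv by (simp add: mult_ac)
      then show ?thesis using U ideal3_mult[OF ideal3_diff[OF ideal3_gens(3) ideal3_mult[OF q]]] by (metis mult_1)
    qed
    note qv' = this[unfolded qv]
    have "const_uv (b2 / D) * (const_uv a1 * q1 + const_uv a2 * q2) - const_uv (a2 / D) * (const_uv b1 * q1 + const_uv b2 * q2)
       = const_uv (b2 / D * a1 + - (a2 / D) * b1) * q1 + const_uv (b2 / D * a2 + - (a2 / D) * b2) * q2"
      by (simp only: uv.\<iota>_add uv.\<iota>_mult uv.\<iota>_minus) (simp add: algebra_simps)
    also have "b2 / D * a1 + - (a2 / D) * b1 = 1" by (rule D_inverse)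
    also have "b2 / D * a2 + - (a2 / D) * b2 = 0" by (simp add: field_simps)
    finally have "q1 = const_uv (b2 / D) * (const_uv a1 * q1 + const_uv a2 * q2) - const_uv (a2 / D) * (const_uv b1 * q1 + const_uv b2 * q2)"
      by (simp add: uv.\<iota>_0 uv.\<iota>_1)
    then have q1: "q1 \<in> ?I" using ideal3_diff[OF ideal3_mult[OF qu'] ideal3_mult[OF qv']] by metis
    have "const_uv (a1 / D) * (const_uv b1 * q1 + const_uv b2 * q2) - const_uv (b1 / D) * (const_uv a1 * q1 + const_uv a2 * q2)
       = const_uv (a1 / D * b1 + - (b1 / D) * a1) * q1 + const_uv (a1 / D * b2 + - (b1 / D) * a2) * q2"
      by (simp only: uv.\<iota>_add uv.\<iota>_mult uv.\<iota>_minus) (simp add: algebra_simps)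
    also have "a1 / D * b2 + - (b1 / D) * a2 = 1" by (rule D_inverse)
    also have "a1 / D * b1 + - (b1 / D) * a1 = 0" by (simp add: field_simps)
    finally have "q2 = const_uv (a1 / D) * (const_uv b1 * q1 + const_uv b2 * q2) - const_uv (b1 / D) * (const_uv a1 * q1 + const_uv a2 * q2)"
      by (simp add: uv.\<iota>_0 uv.\<iota>_1)
    then have q2: "q2 \<in> ?I" using ideal3_diff[OF ideal3_mult[OF qv'] ideal3_mult[OF qu']] by metis
    show "p \<in> ?I" unfolding p by (intro ideal3_add ideal3_mult q1 q2) }
qed

text \<open>Modulo the two quadrics all cubic monomials vanish and both squares are multiples of
  \<open>L1 * L2\<close>, so 1, \<open>L1\<close>, \<open>L2\<close>, \<open>L1 * L2\<close> span;
  their independence is read off jets of order at most two.\<close>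

lemma quot_dim_triple_point:
  fixes a b :: complex
  assumes U: "U * U' = 1" and ab: "a \<noteq> 0" "b \<noteq> 0"
  defines "g \<equiv> U * (L1 * L2 * (const_uv a * L1 + const_uv b * L2))"
  shows "quot_dim const_uv {g, deriv_u g, deriv_v g} UNIV = 4"
proof -
  define q1 q2 where q12: "q1 = L2 * (const_uv (2 * a) * L1 + const_uv b * L2)"
    "q2 = L1 * (const_uv a * L1 + const_uv (2 * b) * L2)"
  let ?I = "ideal3 g (deriv_u g) (deriv_v g)"
  note iff = ideal_triple_point[OF U, where a = a and b = b, folded g_def q12]
  have two: "const_uv (2 * c) = 2 * const_uv c" for c
    using uv.\<iota>_add[of c c] by simp
  have q1I: "q1 \<in> ?I" unfolding iff by (rule exI[of _ 1], rule exI[of _ 0]) simp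
  have q2I: "q2 \<in> ?I" unfolding iff by (rule exI[of _ 0], rule exI[of _ 1]) simp
  have cancel: "x \<in> ?I" if "const_uv c * x \<in> ?I" "c \<noteq> 0" for c x
  proof -
    have "const_uv (1 / c) * (const_uv c * x) = x" using that(2) by (simp add: uv.\<iota>_1 flip: mult.assoc uv.\<iota>_mult)
    then show ?thesis using ideal3_mult[OF that(1)] by metis
  qed
  have c122: "L1 * (L2 * L2) \<in> ?I"
  proof -
    have "const_uv (3 * b) * (L1 * (L2 * L2)) = 2 * (L2 * q2) - L1 * q1"
      using uv.\<iota>_add[of b "2 * b"] unfolding q12 two by (simp add: algebra_simps)
    moreover have "2 * (L2 * q2) - L1 * q1 \<in> ?I" by (intro ideal3_diff ideal3_mult q1I q2I)
    ultimately show ?thesis using cancel[of "3 * b"] ab by simp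
  qed
  have c112: "L1 * (L1 * L2) \<in> ?I"
  proof -
    have "const_uv a * (L1 * (L1 * L2)) = L2 * q2 - const_uv (2 * b) * (L1 * (L2 * L2))"
      unfolding q12 by (simp add: algebra_simps)
    moreover have "L2 * q2 - const_uv (2 * b) * (L1 * (L2 * L2)) \<in> ?I" by (intro ideal3_diff ideal3_mult q2I c122)
    ultimately show ?thesis using cancel[of a] ab by simp
  qed
  have c222: "L2 * (L2 * L2) \<in> ?I"
  proof -
    have "const_uv b * (L2 * (L2 * L2)) = L2 * q1 - const_uv (2 * a) * (L1 * (L2 * L2))"
      unfolding q12 by (simp add: algebra_simps)
    moreover have "L2 * q1 - const_uv (2 * a) * (L1 * (L2 * L2)) \<in> ?I" by (intro ideal3_diff ideal3_mult q1I c122)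
    ultimately show ?thesis using cancel[of b] ab by simp
  qed
  have c111: "L1 * (L1 * L1) \<in> ?I"
  proof -
    have "const_uv a * (L1 * (L1 * L1)) = L1 * q2 - const_uv (2 * b) * (L1 * (L1 * L2))"
      unfolding q12 by (simp add: algebra_simps)
    moreover have "L1 * q2 - const_uv (2 * b) * (L1 * (L1 * L2)) \<in> ?I" by (intro ideal3_diff ideal3_mult q2I c112)
    ultimately show ?thesis using cancel[of a] ab by simp
  qed
  let ?bs = "[1, L1, L2, L1 * L2]"
  \<comment> \<open>Directions in which the pair \<open>L1\<close>, \<open>L2\<close> takes the
    values (1, 0), (0, 1) and (1, 1).\<close>
  let ?p1 = "(b2 / D, - a2 / D)" and ?p2 = "(- b1 / D, a1 / D)" and ?p3 = "((b2 - b1) / D, (a1 - a2) / D)"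
  have j1: "jet1 ?p1 L1 = 1" "jet1 ?p1 L2 = 0" "jet1 ?p2 L1 = 0" "jet1 ?p2 L2 = 1" "jet1 ?p3 L1 = 1" "jet1 ?p3 L2 = 1"
  proof -
    have e: "x * (y / D) + z * (w / D) = (x * y + z * w) / D" for x y z w by (simp add: add_divide_distrib)
    have "a1 * b2 + b1 * - a2 = D" "a2 * b2 + b2 * - a2 = 0" "a1 * - b1 + b1 * a1 = 0" "a2 * - b1 + b2 * a1 = D"
      "a1 * (b2 - b1) + b1 * (a1 - a2) = D" "a2 * (b2 - b1) + b2 * (a1 - a2) = D"
      by (simp_all add: algebra_simps)
    then show "jet1 ?p1 L1 = 1" "jet1 ?p1 L2 = 0" "jet1 ?p2 L1 = 0" "jet1 ?p2 L2 = 1" "jet1 ?p3 L1 = 1" "jet1 ?p3 L2 = 1"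
      unfolding jet_lin_uv e using D by simp_all
  qed
  have jq: "jet0 q1 = 0" "jet0 q2 = 0" "jet1 p q1 = 0" "jet1 p q2 = 0"
    "jet2 p q1 = jet1 p L2 * (2 * a * jet1 p L1 + b * jet1 p L2)"
    "jet2 p q2 = jet1 p L1 * (a * jet1 p L1 + 2 * b * jet1 p L2)" for p
    by (cases p; simp add: q12 jet_add jet_mult jet_const_uv jet_lin_uv)+
  have "quot_dim const_uv {g, deriv_u g, deriv_v g} UNIV = length ?bs"
  proof (rule uv.quot_dim_eqI)
    show "1 \<notin> ?I"
    proof
      assume "1 \<in> ?I"
      then obtain A B where "1 = A * q1 + B * q2" unfolding iff by blast
      then have "jet0 1 = jet0 (A * q1 + B * q2)" by simp
      then show False using jet_const_uv(1)[of 1] jq by (simp add: jet_add jet_mult uv.\<iota>_1)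
    qed
    fix F :: "complex fps fps"
    obtain A B where F: "F = const_uv (jet0 F) + L1 * A + L2 * B" by (rule decomposition)
    obtain A1 A2 where A: "A = const_uv (jet0 A) + L1 * A1 + L2 * A2" by (rule decomposition)
    obtain B1 B2 where B: "B = const_uv (jet0 B) + L1 * B1 + L2 * B2" by (rule decomposition)
    obtain A11 A12 where A1: "A1 = const_uv (jet0 A1) + L1 * A11 + L2 * A12" by (rule decomposition)
    define C where "C = A2 + B1"
    obtain C1 C2 where C: "C = const_uv (jet0 C) + L1 * C1 + L2 * C2" by (rule decomposition)
    obtain B21 B22 where B2: "B2 = const_uv (jet0 B2) + L1 * B21 + L2 * B22" by (rule decomposition)
    have F': "F = const_uv (jet0 F) + const_uv (jet0 A) * L1 + const_uv (jet0 B) * L2 + (L1 * L1) * A1 + (L1 * L2) * C + (L2 * L2) * B2"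
      by (subst F, subst A, subst B) (simp add: C_def algebra_simps)
    \<comment> \<open>Modulo the ideal, the square of \<open>L1\<close> is \<open>- e1\<close> times
      \<open>L1 * L2\<close> and that of \<open>L2\<close> is \<open>- e2\<close> times it.\<close>
    define e1 e2 where e: "e1 = 2 * b / a" "e2 = 2 * a / b"
    define cs where "cs = [jet0 F, jet0 A, jet0 B, jet0 C - jet0 A1 * e1 - jet0 B2 * e2]"
    have s1: "L1 * L1 + const_uv e1 * (L1 * L2) = const_uv (1 / a) * q2"
    proof -
      have "const_uv (1 / a) * q2 = const_uv (1 / a * a) * (L1 * L1) + const_uv (1 / a * (2 * b)) * (L1 * L2)"
        unfolding q12 uv.\<iota>_mult[of "1 / a"] by (simp only: algebra_simps)
      then show ?thesis using ab by (simp add: uv.\<iota>_1 e)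
    qed
    have s2: "L2 * L2 + const_uv e2 * (L1 * L2) = const_uv (1 / b) * q1"
    proof -
      have "const_uv (1 / b) * q1 = const_uv (1 / b * b) * (L2 * L2) + const_uv (1 / b * (2 * a)) * (L1 * L2)"
        unfolding q12 uv.\<iota>_mult[of "1 / b"] by (simp only: algebra_simps)
      then show ?thesis using ab by (simp add: uv.\<iota>_1 e)
    qed
    have cdiff: "const_uv (x - y) = const_uv x - const_uv y" for x y
      using uv.\<iota>_add[of x "- y"] uv.\<iota>_minus[of y] by simp
    have "F - (\<Sum>(c, b)\<leftarrow>zip cs ?bs. const_uv c * b) =
       const_uv (jet0 A1) * (L1 * L1 + const_uv e1 * (L1 * L2)) +
       const_uv (jet0 B2) * (L2 * L2 + const_uv e2 * (L1 * L2)) +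
       A11 * (L1 * (L1 * L1)) + (A12 + C1) * (L1 * (L1 * L2)) + (C2 + B21) * (L1 * (L2 * L2)) + B22 * (L2 * (L2 * L2))"
      by (subst F', subst A1, subst C, subst B2) (simp add: cs_def cdiff uv.\<iota>_add algebra_simps)
    also have "\<dots> \<in> ?I"
      unfolding s1 s2 by (intro ideal3_add ideal3_mult q1I q2I c111 c112 c122 c222)
    finally show "\<exists>cs. length cs = length ?bs \<and> F - (\<Sum>(c, b)\<leftarrow>zip cs ?bs. const_uv c * b) \<in> ?I"
      by (intro exI[of _ cs]) (simp add: cs_def)
  next
    fix cs :: "complex list"
    assume "length cs = length ?bs" and i: "(\<Sum>(c, b)\<leftarrow>zip cs ?bs. const_uv c * b) \<in> ?I"
    then obtain c0 c1 c2 c3 where cs: "cs = [c0, c1, c2, c3]" by (auto simp: length_Suc_conv)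
    obtain A B where AB: "const_uv c0 * 1 + const_uv c1 * L1 + const_uv c2 * L2 + const_uv c3 * (L1 * L2) = A * q1 + B * q2"
      using i unfolding iff cs by (auto simp: add.assoc)
    have one: "jet0 1 = 1" "jet1 p 1 = 0" "jet2 p 1 = 0" for p
      using jet_const_uv(1)[of 1] jet_const_uv(2)[of p 1] jet_const_uv(3)[of p 1] by (simp_all add: uv.\<iota>_1)
    have z0: "c0 = 0" using arg_cong[OF AB, of jet0] jq by (simp add: jet_add jet_mult jet_const_uv jet_lin_uv one)
    have z1: "c1 * jet1 p L1 + c2 * jet1 p L2 = 0" for p
      using arg_cong[OF AB, of "jet1 p"] jq z0
      by (cases p) (simp add: jet_add jet_mult jet_const_uv jet_lin_uv one)
    have "c1 = 0" "c2 = 0" using z1[of ?p1] z1[of ?p2] unfolding j1 by simp_all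
    have jl: "jet2 p (lin_uv x y) = 0" for p x y by (cases p) (simp add: jet_lin_uv)
    \<comment> \<open>Comparison of quadratic parts. The first direction kills q1, the second kills
      q2, and the third then isolates \<open>c3\<close>.\<close>
    have z2: "c3 * (jet1 p L1 * jet1 p L2) = jet0 A * (jet1 p L2 * (2 * a * jet1 p L1 + b * jet1 p L2)) +
       jet0 B * (jet1 p L1 * (a * jet1 p L1 + 2 * b * jet1 p L2))" for p
      using arg_cong[OF AB, of "jet2 p"] z0 \<open>c1 = 0\<close> \<open>c2 = 0\<close> jq
      by (simp add: jet_add jet_mult jet_const_uv jet_lin_uv(1) jl one)
    have "jet0 B = 0" using z2[of ?p1] ab unfolding j1 by simp
    moreover have "jet0 A = 0" using z2[of ?p2] ab unfolding j1 by simp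
    ultimately have "c3 = 0" using z2[of ?p3] unfolding j1 by simp
    then show "set cs \<subseteq> {0}" using z0 \<open>c1 = 0\<close> \<open>c2 = 0\<close> by (simp add: cs)
  qed simp_all
  then show ?thesis by simp
qed

end

section \<open>Total Tjurina numbers of line arrangements\<close>

lemma parallel_cross3:
  assumes n: "cross3 k k' \<noteq> 0" and v: "dot3 k v = 0" "dot3 k' v = 0"
  obtains t where "v = smult3 t (cross3 k k')"
proof -
  obtain k1 k2 k3 where k: "k = (k1, k2, k3)" by (cases k)
  obtain m1 m2 m3 where k': "k' = (m1, m2, m3)" by (cases k')
  obtain v1 v2 v3 where vv: "v = (v1, v2, v3)" by (cases v)
  obtain n1 n2 n3 where nn: "cross3 k k' = (n1, n2, n3)" by (cases "cross3 k k'")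
  have d: "det3 (0, v3, - v2) k k' = 0" "det3 (- v3, 0, v1) k k' = 0" "det3 (v2, - v1, 0) k k' = 0"
  proof -
    let ?E = "k1 * v1 + k2 * v2 + k3 * v3" and ?E' = "m1 * v1 + m2 * v2 + m3 * v3"
    have e: "?E = 0" "?E' = 0" using v by (simp_all add: k k' vv dot3_def)
    have "det3 (0, v3, - v2) k k' = k1 * ?E' - m1 * ?E - (k1 * v1 * m1 - m1 * v1 * k1) - 2 * (k1 * ?E' - m1 * ?E)"
      "det3 (- v3, 0, v1) k k' = - (k2 * ?E' - m2 * ?E)"
      "det3 (v2, - v1, 0) k k' = - (k3 * ?E' - m3 * ?E)"
      by (simp_all add: det3_def dot3_def cross3_def k k' algebra_simps)
    then show "det3 (0, v3, - v2) k k' = 0" "det3 (- v3, 0, v1) k k' = 0" "det3 (v2, - v1, 0) k k' = 0"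
      unfolding e by simp_all
  qed
  then have x: "v3 * n2 = v2 * n3" "v1 * n3 = v3 * n1" "v2 * n1 = v1 * n2"
    by (simp_all add: det3_def nn dot3_def)
  consider "n1 \<noteq> 0" | "n2 \<noteq> 0" | "n3 \<noteq> 0" using n nn by (auto simp: zero_prod_def)
  then have "\<exists>t. v = smult3 t (cross3 k k')"
  proof cases
    case 1
    then show ?thesis using x by (intro exI[of _ "v1 / n1"]) (simp add: nn vv smult3_def field_simps)
  next
    case 2
    then show ?thesis using x by (intro exI[of _ "v2 / n2"]) (simp add: nn vv smult3_def field_simps)
  next
    case 3
    then show ?thesis using x by (intro exI[of _ "v3 / n3"]) (simp add: nn vv smult3_def field_simps)
  qed
  then show ?thesis using that by blast
qed

lemma smult3_smult3: "smult3 s (smult3 t v) = smult3 (s * t) v"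
  by (cases v) (simp add: smult3_def)

lemma smult3_1 [simp]: "smult3 1 v = v"
  by (cases v) (simp add: smult3_def)

lemma smult3_0 [simp]: "smult3 0 v = 0"
  by (cases v) (simp add: smult3_def zero_prod_def)

lemma self_in_proj_point: "v \<in> proj_point v"
  unfolding proj_point_smult3 by (rule CollectI, rule exI[of _ 1]) simp

lemma proj_point_eq:
  assumes "t \<noteq> 0"
  shows "proj_point (smult3 t v) = proj_point v"
proof -
  have "\<exists>s'. smult3 s (smult3 t v) = smult3 s' v \<and> s' \<noteq> 0" if "s \<noteq> 0" for s
    using assms that by (intro exI[of _ "s * t"]) (simp add: smult3_smult3)
  moreover have "\<exists>s'. smult3 s v = smult3 s' (smult3 t v) \<and> s' \<noteq> 0" if "s \<noteq> 0" for s
    using assms that by (intro exI[of _ "s / t"]) (simp add: smult3_smult3)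
  ultimately show ?thesis unfolding proj_point_smult3 by blast
qed

lemma proj_point_in_line:
  assumes "v \<noteq> 0"
  shows "proj_point v \<in> line k \<longleftrightarrow> dot3 k v = 0"
proof -
  have "proj_point v \<in> proj_plane" using assms unfolding proj_plane_def zero_prod_def by blast
  moreover have "(\<forall>p\<in>proj_point v. dot3 k p = 0) \<longleftrightarrow> dot3 k v = 0"
    using self_in_proj_point[of v] unfolding proj_point_smult3 by (auto simp only: dot3_simps mult_zero_right)
  ultimately show ?thesis unfolding line_def eval3_linear_form by blast
qed

lemma proj_plane_cases:
  assumes "P \<in> proj_plane"
  obtains v where "v \<noteq> 0" "P = proj_point v"
  using assms unfolding proj_plane_def zero_prod_def by blast

lemma rep_point:
  assumes "P \<in> proj_plane" "v \<in> P"
  shows "v \<noteq> 0 \<and> P = proj_point v"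
proof -
  obtain w where w: "w \<noteq> 0" "P = proj_point w" using assms(1) by (rule proj_plane_cases)
  then obtain t where t: "t \<noteq> 0" "v = smult3 t w" using assms(2) unfolding proj_point_smult3 by blast
  have "w = smult3 (1 / t) v" using t by (simp add: smult3_smult3)
  then have "v \<noteq> 0" using w(1) by (auto simp: smult3_def zero_prod_def)
  then show ?thesis using proj_point_eq[OF t(1)] t(2) w(2) by simp
qed

definition meet :: "vec3 \<Rightarrow> vec3 \<Rightarrow> point"
  where "meet k k' = proj_point (cross3 k k')"

lemma meet_in_plane: "cross3 k k' \<noteq> 0 \<Longrightarrow> meet k k' \<in> proj_plane"
  unfolding meet_def proj_plane_def zero_prod_def by blast

lemma meet_in_line: "cross3 k k' \<noteq> 0 \<Longrightarrow> meet k k' \<in> line l \<longleftrightarrow> det3 l k k' = 0"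
  unfolding meet_def by (simp add: proj_point_in_line det3_def)

lemma meet_unique:
  assumes "cross3 k k' \<noteq> 0" "P \<in> line k" "P \<in> line k'"
  shows "P = meet k k'"
proof -
  have "P \<in> proj_plane" using assms(2) by (simp add: line_def)
  then obtain v where v: "v \<noteq> 0" "P = proj_point v" by (rule proj_plane_cases)
  then have "dot3 k v = 0" "dot3 k' v = 0" using assms proj_point_in_line by metis+
  then obtain t where t: "v = smult3 t (cross3 k k')" using parallel_cross3[OF assms(1)] by metis
  have "t \<noteq> 0" using v(1) t by auto
  then show ?thesis using v t proj_point_eq by (simp add: meet_def)
qed

definition lines_at :: "vec3 list \<Rightarrow> point \<Rightarrow> vec3 set"
  where "lines_at ls P = {k \<in> set ls. P \<in> line k}"

lemma eval3_defining_poly_eq_0: "eval3 (defining_poly ls) v = 0 \<longleftrightarrow> (\<exists>k\<in>set ls. dot3 k v = 0)"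
  by (induction ls) (auto simp: defining_poly_Cons ev.eval_in_mult eval3_linear_form, simp add: defining_poly_def)

text \<open>At a point of the line \<open>k\<close> the gradient of the product is the vector
  \<open>k\<close> times the product of the other lines.\<close>

lemma partial_defining_poly:
  assumes "pairwise_indep ls" "k \<in> set ls" "dot3 k v = 0" "v \<noteq> 0"
  shows "(eval3 (partial_x (defining_poly ls)) v = 0 \<and> eval3 (partial_y (defining_poly ls)) v = 0 \<and>
     eval3 (partial_z (defining_poly ls)) v = 0) \<longleftrightarrow> (\<exists>k'\<in>set ls. k' \<noteq> k \<and> dot3 k' v = 0)"
proof -
  have k0: "k \<noteq> 0" using assms(1,2) by (simp add: pairwise_indep_def)
  let ?g = "\<Prod>k'\<in>set ls - {k}. linear_form k'"
  have "defining_poly ls = (\<Prod>k'\<in>set ls. linear_form k')"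
    using assms(1) by (simp add: defining_poly_def pairwise_indep_def prod.distinct_set_conv_list)
  also have "\<dots> = linear_form k * ?g" using assms(2) by (simp add: prod.remove)
  finally have f: "defining_poly ls = linear_form k * ?g" .
  have lk: "eval3 (linear_form k) v = 0" using assms(3) by (simp add: eval3_linear_form)
  obtain a b c where abc: "k = (a, b, c)" by (cases k)
  have p: "eval3 (partial_x (defining_poly ls)) v = a * eval3 ?g v" "eval3 (partial_y (defining_poly ls)) v = b * eval3 ?g v"
    "eval3 (partial_z (defining_poly ls)) v = c * eval3 ?g v"
    unfolding f partial_mult ev.eval_in_add ev.eval_in_mult lk by (simp_all add: abc partial_linear_form)
  have "eval3 (\<Prod>k'\<in>A. linear_form k') v = (\<Prod>k'\<in>A. dot3 k' v)" for A
    by (induction A rule: infinite_finite_induct) (simp_all add: ev.eval_in_mult eval3_linear_form)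
  then have "eval3 ?g v = 0 \<longleftrightarrow> (\<exists>k'\<in>set ls. k' \<noteq> k \<and> dot3 k' v = 0)" by auto
  moreover have "a \<noteq> 0 \<or> b \<noteq> 0 \<or> c \<noteq> 0" using k0 abc by (auto simp: zero_prod_def)
  ultimately show ?thesis unfolding p by auto
qed

lemma singular_points_defining_poly:
  assumes ls: "pairwise_indep ls" and ne: "ls \<noteq> []"
  shows "singular_points (defining_poly ls) = {P \<in> proj_plane. 2 \<le> card (lines_at ls P)}"
proof -
  obtain e where e: "length ls = Suc e" using ne by (cases ls) auto
  have hom: "homogeneous3 (Suc e) (defining_poly ls)" using homogeneous3_defining_poly[of ls] e by simp
  have two: "2 \<le> card (lines_at ls P) \<longleftrightarrow> (\<exists>k\<in>set ls. P \<in> line k \<and> (\<exists>k'\<in>set ls. k' \<noteq> k \<and> P \<in> line k'))" for P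
  proof
    assume "2 \<le> card (lines_at ls P)"
    then obtain B where "B \<subseteq> lines_at ls P" "card B = 2" by (meson obtain_subset_with_card_n)
    then show "\<exists>k\<in>set ls. P \<in> line k \<and> (\<exists>k'\<in>set ls. k' \<noteq> k \<and> P \<in> line k')"
      unfolding card_2_iff lines_at_def by blast
  next
    assume "\<exists>k\<in>set ls. P \<in> line k \<and> (\<exists>k'\<in>set ls. k' \<noteq> k \<and> P \<in> line k')"
    then obtain k k' where "{k, k'} \<subseteq> lines_at ls P" "k' \<noteq> k" unfolding lines_at_def by blast
    then show "2 \<le> card (lines_at ls P)" using card_mono[of "lines_at ls P" "{k, k'}"] by (simp add: lines_at_def)
  qed
  have "P \<in> singular_points (defining_poly ls) \<longleftrightarrow> 2 \<le> card (lines_at ls P)" if P: "P \<in> proj_plane" for P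
  proof -
    obtain v where v: "v \<noteq> 0" "P = proj_point v" using P by (rule proj_plane_cases)
    have "P \<in> singular_points (defining_poly ls) \<longleftrightarrow> eval3 (partial_x (defining_poly ls)) v = 0 \<and>
        eval3 (partial_y (defining_poly ls)) v = 0 \<and> eval3 (partial_z (defining_poly ls)) v = 0"
      unfolding v(2) by (rule singular_point_iff[OF hom v(1)])
    also have "\<dots> \<longleftrightarrow> (\<exists>k\<in>set ls. dot3 k v = 0 \<and> (\<exists>k'\<in>set ls. k' \<noteq> k \<and> dot3 k' v = 0))"
    proof (cases "\<exists>k\<in>set ls. dot3 k v = 0")
      case True
      then show ?thesis using partial_defining_poly[OF ls _ _ v(1)] by blast
    next
      case False
      then have "eval3 (defining_poly ls) v \<noteq> 0" by (simp add: eval3_defining_poly_eq_0)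
      then have "P \<notin> singular_points (defining_poly ls)"
        unfolding v(2) singular_points_def using self_in_proj_point[of v] by blast
      then show ?thesis using False singular_point_iff[OF hom v(1)] v(2) by blast
    qed
    finally show ?thesis unfolding two v(2) proj_point_in_line[OF v(1)] .
  qed
  moreover have "singular_points (defining_poly ls) \<subseteq> proj_plane" by (auto simp: singular_points_def)
  ultimately show ?thesis by blast
qed

text \<open>In every chart a line becomes its value at the point plus a linear form in u and v. The
  three charts are treated alike, and the conclusion no longer depends on the chart.\<close>

lemma local_equation_defining_poly:
  assumes P: "P \<in> proj_plane"
  obtains s a b :: "vec3 \<Rightarrow> complex"
  where "local_equation (defining_poly ls) P = (\<Prod>k\<leftarrow>ls. const_uv (s k) + lin_uv (a k) (b k))"
    "\<And>k. s k = 0 \<longleftrightarrow> P \<in> line k"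
    "\<And>k k'. cross3 k k' \<noteq> 0 \<Longrightarrow> P \<in> line k \<Longrightarrow> P \<in> line k' \<Longrightarrow> a k * b k' - a k' * b k \<noteq> 0"
proof -
  obtain x y z where xyz: "(SOME p. p \<in> P) = (x, y, z)" by (cases "SOME p. p \<in> P")
  have "(x, y, z) \<in> P"
    using P self_in_proj_point someI_ex[of "\<lambda>p. p \<in> P"] xyz by (metis proj_plane_cases)
  then have p: "(x, y, z) \<noteq> 0" "P = proj_point (x, y, z)" using rep_point[OF P] by blast+
  have in_line: "P \<in> line k \<longleftrightarrow> dot3 k (x, y, z) = 0" for k using p proj_point_in_line by metis
  \<comment> \<open>The determinant of two local branches is, up to sign, the coordinate of the
    cross product belonging to the chart; it is nonzero because the cross product represents
    \<open>P\<close>.\<close>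
  have parallel: "\<exists>t. t \<noteq> 0 \<and> cross3 k k' = smult3 t (x, y, z)"
    if c: "cross3 k k' \<noteq> 0" and on: "P \<in> line k" "P \<in> line k'" for k k'
  proof -
    obtain t where t: "(x, y, z) = smult3 t (cross3 k k')" using parallel_cross3[OF c] on in_line by metis
    then have "t \<noteq> 0" using p(1) by auto
    moreover have "cross3 k k' = smult3 (1 / t) (x, y, z)" unfolding t smult3_smult3 using \<open>t \<noteq> 0\<close> by simp
    ultimately show ?thesis by (intro exI[of _ "1 / t"]) simp
  qed
  have prodc: "eval_in const_uv (defining_poly ls) v = (\<Prod>k\<leftarrow>ls. eval_in const_uv (linear_form k) v)" for v
    by (simp add: defining_poly_def uv.eval_in_prod_list o_def)
  have xyz0: "x \<noteq> 0 \<or> y \<noteq> 0 \<or> z \<noteq> 0" using p(1) by (auto simp: zero_prod_def)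
  consider "z \<noteq> 0" | "z = 0" "y \<noteq> 0" | "z = 0" "y = 0" "x \<noteq> 0" using xyz0 by blast
  then show ?thesis
  proof cases
    case 1
    show ?thesis
    proof (rule that)
      have "eval_in const_uv (linear_form k) (const_uv (x / z) + var_u, const_uv (y / z) + var_v, 1) =
          const_uv (dot3 k (x, y, z) / z) + lin_uv (fst k) (fst (snd k))" for k
      proof -
        obtain k1 k2 k3 where k: "k = (k1, k2, k3)" by (cases k)
        have d: "dot3 (k1, k2, k3) (x, y, z) / z = k1 * (x / z) + k2 * (y / z) + k3" using 1 by (simp add: dot3_def field_simps)
        show ?thesis
          unfolding k by (simp only: d uv.eval_in_linear_form lin_uv_def uv.\<iota>_add uv.\<iota>_mult fst_conv snd_conv distrib_left mult_1_right add_ac)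
      qed
      then show "local_equation (defining_poly ls) P = (\<Prod>k\<leftarrow>ls. const_uv (dot3 k (x, y, z) / z) + lin_uv (fst k) (fst (snd k)))"
        using 1 by (simp add: local_equation_def xyz prodc)
      show "dot3 k (x, y, z) / z = 0 \<longleftrightarrow> P \<in> line k" for k using 1 by (simp add: in_line)
      show "fst k * fst (snd k') - fst k' * fst (snd k) \<noteq> 0"
        if "cross3 k k' \<noteq> 0" "P \<in> line k" "P \<in> line k'" for k k'
        using parallel[OF that] 1 by (cases k; cases k') (auto simp: cross3_def smult3_def mult.commute)
    qed
  next
    case 2
    show ?thesis
    proof (rule that)
      have "eval_in const_uv (linear_form k) (const_uv (x / y) + var_u, 1, const_uv (z / y) + var_v) =
          const_uv (dot3 k (x, y, z) / y) + lin_uv (fst k) (snd (snd k))" for k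
      proof -
        obtain k1 k2 k3 where k: "k = (k1, k2, k3)" by (cases k)
        have d: "dot3 (k1, k2, k3) (x, y, z) / y = k1 * (x / y) + k2 + k3 * (z / y)" using 2 by (simp add: dot3_def field_simps)
        show ?thesis
          unfolding k by (simp only: d uv.eval_in_linear_form lin_uv_def uv.\<iota>_add uv.\<iota>_mult fst_conv snd_conv distrib_left mult_1_right add_ac)
      qed
      then show "local_equation (defining_poly ls) P = (\<Prod>k\<leftarrow>ls. const_uv (dot3 k (x, y, z) / y) + lin_uv (fst k) (snd (snd k)))"
        using 2 by (simp add: local_equation_def xyz prodc)
      show "dot3 k (x, y, z) / y = 0 \<longleftrightarrow> P \<in> line k" for k using 2 by (simp add: in_line)
      show "fst k * snd (snd k') - fst k' * snd (snd k) \<noteq> 0"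
        if "cross3 k k' \<noteq> 0" "P \<in> line k" "P \<in> line k'" for k k'
        using parallel[OF that] 2 by (cases k; cases k') (auto simp: cross3_def smult3_def mult.commute)
    qed
  next
    case 3
    show ?thesis
    proof (rule that)
      have "eval_in const_uv (linear_form k) (1, const_uv (y / x) + var_u, const_uv (z / x) + var_v) =
          const_uv (dot3 k (x, y, z) / x) + lin_uv (fst (snd k)) (snd (snd k))" for k
      proof -
        obtain k1 k2 k3 where k: "k = (k1, k2, k3)" by (cases k)
        have d: "dot3 (k1, k2, k3) (x, y, z) / x = k1 + k2 * (y / x) + k3 * (z / x)" using 3 by (simp add: dot3_def field_simps)
        show ?thesis
          unfolding k by (simp only: d uv.eval_in_linear_form lin_uv_def uv.\<iota>_add uv.\<iota>_mult fst_conv snd_conv distrib_left mult_1_right add_ac)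
      qed
      then show "local_equation (defining_poly ls) P = (\<Prod>k\<leftarrow>ls. const_uv (dot3 k (x, y, z) / x) + lin_uv (fst (snd k)) (snd (snd k)))"
        using 3 by (simp add: local_equation_def xyz prodc)
      show "dot3 k (x, y, z) / x = 0 \<longleftrightarrow> P \<in> line k" for k using 3 by (simp add: in_line)
      show "fst (snd k) * snd (snd k') - fst (snd k') * snd (snd k) \<noteq> 0"
        if "cross3 k k' \<noteq> 0" "P \<in> line k" "P \<in> line k'" for k k'
        using parallel[OF that] 3 by (cases k; cases k') (auto simp: cross3_def smult3_def mult.commute)
    qed
  qed
qed

lemma unit_prod_uv:
  assumes "finite A" "\<And>k. k \<in> A \<Longrightarrow> s k \<noteq> 0"
  obtains U' where "(\<Prod>k\<in>A. const_uv (s k) + lin_uv (a k) (b k)) * U' = 1"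
proof -
  have "jet0 (\<Prod>k\<in>A. const_uv (s k) + lin_uv (a k) (b k)) = (\<Prod>k\<in>A. s k)"
    using assms(1)
  proof (induction A rule: finite_induct)
    case empty
    then show ?case using jet_const_uv(1)[of 1] by (simp add: uv.\<iota>_1)
  next
    case (insert k A)
    obtain x y where "(a k, b k) = (x, y)" by simp
    then show ?case using insert by (simp add: jet_mult jet_add jet_const_uv jet_lin_uv)
  qed
  then have "jet0 (\<Prod>k\<in>A. const_uv (s k) + lin_uv (a k) (b k)) \<noteq> 0" using assms by simp
  then show ?thesis by (rule unit_uv) (rule that)
qed

text \<open>Lines that miss the point contribute a unit to the local equation, which leaves two or
  three transversal branches.\<close>

lemma tjurina_number_defining_poly:
  assumes ls: "pairwise_indep ls" and P: "P \<in> proj_plane"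
  shows "card (lines_at ls P) = 2 \<Longrightarrow> tjurina_number (defining_poly ls) P = 1"
    and "card (lines_at ls P) = 3 \<Longrightarrow> tjurina_number (defining_poly ls) P = 4"
proof -
  obtain s a b :: "vec3 \<Rightarrow> complex"
    where loc: "local_equation (defining_poly ls) P = (\<Prod>k\<leftarrow>ls. const_uv (s k) + lin_uv (a k) (b k))"
      and s: "\<And>k. s k = 0 \<longleftrightarrow> P \<in> line k"
      and ab: "\<And>k k'. cross3 k k' \<noteq> 0 \<Longrightarrow> P \<in> line k \<Longrightarrow> P \<in> line k' \<Longrightarrow> a k * b k' - a k' * b k \<noteq> 0"
    using local_equation_defining_poly[OF P] by blast
  let ?F = "\<lambda>k. const_uv (s k) + lin_uv (a k) (b k)" and ?A = "set ls - lines_at ls P"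
  have "local_equation (defining_poly ls) P = (\<Prod>k\<in>set ls. ?F k)"
    using ls by (simp add: loc pairwise_indep_def prod.distinct_set_conv_list)
  also have "\<dots> = (\<Prod>k\<in>?A. ?F k) * (\<Prod>k\<in>lines_at ls P. ?F k)"
    by (rule prod.subset_diff) (auto simp: lines_at_def)
  also have "(\<Prod>k\<in>lines_at ls P. ?F k) = (\<Prod>k\<in>lines_at ls P. lin_uv (a k) (b k))"
    by (rule prod.cong[OF refl]) (simp add: lines_at_def s uv.\<iota>_0 flip: s)
  finally have eq: "local_equation (defining_poly ls) P = (\<Prod>k\<in>?A. ?F k) * (\<Prod>k\<in>lines_at ls P. lin_uv (a k) (b k))" .
  obtain U' where U': "(\<Prod>k\<in>?A. ?F k) * U' = 1"
    by (rule unit_prod_uv[of ?A s a b]) (auto simp: lines_at_def s)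
  have indep: "a k * b k' - a k' * b k \<noteq> 0" if "k \<in> lines_at ls P" "k' \<in> lines_at ls P" "k \<noteq> k'" for k k'
    using ab[of k k'] that ls unfolding lines_at_def pairwise_indep_def by blast
  show "tjurina_number (defining_poly ls) P = 1" if "card (lines_at ls P) = 2"
  proof -
    obtain k k' where kk: "lines_at ls P = {k, k'}" "k \<noteq> k'" using \<open>card (lines_at ls P) = 2\<close> by (meson card_2_iff)
    interpret transversal "a k" "b k" "a k'" "b k'" by unfold_locales (use indep kk in blast)
    have "local_equation (defining_poly ls) P = (\<Prod>k\<in>?A. ?F k) * (L1 * L2)" unfolding eq unfolding kk using kk(2) by simp
    then show ?thesis unfolding tjurina_number_def Let_def using quot_dim_double_point[OF U'] by simp
  qed
  show "tjurina_number (defining_poly ls) P = 4" if "card (lines_at ls P) = 3"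
  proof -
    obtain k k' k'' where kk: "lines_at ls P = {k, k', k''}" "k \<noteq> k'" "k \<noteq> k''" "k' \<noteq> k''"
      using \<open>card (lines_at ls P) = 3\<close> by (auto simp: card_3_iff)
    interpret transversal "a k" "b k" "a k'" "b k'" by unfold_locales (use indep kk in blast)
    \<comment> \<open>Cramer's rule for the third branch in terms of the first two; the coefficients
      are nonzero because it differs from both.\<close>
    define c d where "c = (a k'' * b k' - a k' * b k'') / D" and "d = (a k * b k'' - a k'' * b k) / D"
    have "c \<noteq> 0" using indep[of k'' k'] kk D by (simp add: c_def)
    have "d \<noteq> 0" using indep[of k k''] kk D by (simp add: d_def)
    have e: "x / D * y + z / D * w = (x * y + z * w) / D" for x y z w by (simp add: add_divide_distrib)
    have "(a k'' * b k' - a k' * b k'') * a k + (a k * b k'' - a k'' * b k) * a k' = a k'' * D"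
      "(a k'' * b k' - a k' * b k'') * b k + (a k * b k'' - a k'' * b k) * b k' = b k'' * D"
      by (simp_all add: algebra_simps)
    then have "c * a k + d * a k' = a k''" "c * b k + d * b k' = b k''"
      unfolding c_def d_def e using D by simp_all
    then have "lin_uv (a k'') (b k'') = lin_uv (c * a k + d * a k') (c * b k + d * b k')" by simp
    also have "\<dots> = const_uv c * L1 + const_uv d * L2"
      by (simp add: lin_uv_def uv.\<iota>_add uv.\<iota>_mult algebra_simps)
    finally have L3: "lin_uv (a k'') (b k'') = const_uv c * L1 + const_uv d * L2" .
    have "local_equation (defining_poly ls) P = (\<Prod>k\<in>?A. ?F k) * (L1 * L2 * (const_uv c * L1 + const_uv d * L2))"
      unfolding eq unfolding kk L3[symmetric] using kk(2-4) by (simp add: mult.assoc)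
    then show ?thesis unfolding tjurina_number_def Let_def
      using quot_dim_triple_point[OF U' \<open>c \<noteq> 0\<close> \<open>d \<noteq> 0\<close>] by simp
  qed
qed

lemma lines_at_le_3:
  assumes ls: "pairwise_indep ls" and tr: "at_most_triple ls"
  shows "card (lines_at ls P) \<le> 3"
proof (rule ccontr)
  assume "\<not> ?thesis"
  then have "4 \<le> card (lines_at ls P)" by simp
  then obtain B where B: "B \<subseteq> lines_at ls P" "card B = 4" by (meson obtain_subset_with_card_n)
  then have "B \<noteq> {}" "finite B" by (auto intro: card_ge_0_finite)
  then obtain l where l: "l \<in> B" by blast
  have "card (B - {l}) = 3" using B l \<open>finite B\<close> by simp
  then obtain k k' k'' where kk: "B - {l} = {k, k', k''}" "k \<noteq> k'" "k \<noteq> k''" "k' \<noteq> k''" by (auto simp: card_3_iff)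
  then have d: "distinct [l, k, k', k'']" by auto
  have "{l, k, k', k''} \<subseteq> lines_at ls P" using B(1) l kk(1) by blast
  then have m: "l \<in> set ls" "k \<in> set ls" "k' \<in> set ls" "k'' \<in> set ls"
    and p: "P \<in> line l" "P \<in> line k" "P \<in> line k'" "P \<in> line k''" by (auto simp: lines_at_def)
  have det: "det3 l k m = 0" if "m \<in> set ls" "P \<in> line m" "m \<noteq> k" for m
  proof -
    have c: "cross3 k m \<noteq> 0" using ls \<open>k \<in> set ls\<close> that unfolding pairwise_indep_def by metis
    have "P = meet k m" by (rule meet_unique[OF c p(2) that(2)])
    then show ?thesis using meet_in_line[OF c] p(1) by simp
  qed
  show False using tr d m p det[of k'] det[of k''] unfolding at_most_triple_def by (metis distinct_length_2_or_more)
qed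

lemma finite_multiple_points:
  assumes "pairwise_indep ls"
  shows "finite {P \<in> proj_plane. 2 \<le> card (lines_at ls P)}"
proof (rule finite_subset)
  show "finite ((\<lambda>(k, k'). meet k k') ` (set ls \<times> set ls))" by simp
  show "{P \<in> proj_plane. 2 \<le> card (lines_at ls P)} \<subseteq> (\<lambda>(k, k'). meet k k') ` (set ls \<times> set ls)"
  proof
    fix P assume "P \<in> {P \<in> proj_plane. 2 \<le> card (lines_at ls P)}"
    then obtain B where "B \<subseteq> lines_at ls P" "card B = 2" by (metis (mono_tags, lifting) mem_Collect_eq obtain_subset_with_card_n)
    then obtain k k' where kk: "k \<in> set ls" "k' \<in> set ls" "k \<noteq> k'" "P \<in> line k" "P \<in> line k'"
      unfolding card_2_iff lines_at_def by blast
    then have "cross3 k k' \<noteq> 0" using assms unfolding pairwise_indep_def by metis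
    then have "P = meet k k'" using meet_unique kk by blast
    then show "P \<in> (\<lambda>(k, k'). meet k k') ` (set ls \<times> set ls)" using kk by force
  qed
qed

text \<open>(m - 1)^2 for the multiplicities that occur; the default 0 lets points that are not yet
  multiple enter the sums.\<close>

definition tjurina_mult :: "nat \<Rightarrow> nat"
  where "tjurina_mult m = (if m = 2 then 1 else if m = 3 then 4 else 0)"

text \<open>A new line through a point of multiplicity m raises its Tjurina number by 2 m - 1, for m
  = 1 and m = 2. Summed over the points on the new line this is twice the number of lines minus the
  number of points.\<close>

lemma sum_tjurina_mult:
  assumes "pairwise_indep ls" "at_most_triple ls"
  shows "(\<Sum>P\<in>{P \<in> proj_plane. 2 \<le> card (lines_at ls P)}. tjurina_mult (card (lines_at ls P))) =
    (length ls choose 2) + total_conc ls"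
  using assms
proof (induction ls)
  case Nil
  then show ?case by (simp add: lines_at_def)
next
  case (Cons l ks)
  let ?M = "\<lambda>ls. {P \<in> proj_plane. 2 \<le> card (lines_at ls P)}" and ?m = "\<lambda>P. card (lines_at ks P)"
  have ks: "pairwise_indep ks" "at_most_triple ks" and lk: "\<And>k. k \<in> set ks \<Longrightarrow> cross3 l k \<noteq> 0"
    using Cons.prems by (auto simp: pairwise_indep_Cons dest: at_most_triple_Cons)
  have lnk: "l \<notin> set ks" using Cons.prems(1) by (simp add: pairwise_indep_def)
  define X where "X = meet l ` set ks"
  have finX: "finite X" by (simp add: X_def)
  have at_l: "lines_at (l # ks) P = (if P \<in> line l then insert l (lines_at ks P) else lines_at ks P)" for P
    by (auto simp: lines_at_def)
  have m_l: "card (lines_at (l # ks) P) = ?m P + (if P \<in> line l then 1 else 0)" for P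
    unfolding at_l using lnk by (simp add: lines_at_def)
  have X: "P \<in> X \<longleftrightarrow> P \<in> line l \<and> 1 \<le> ?m P" for P
  proof
    assume "P \<in> X"
    then obtain k where k: "k \<in> set ks" "P = meet l k" by (auto simp: X_def)
    then have "P \<in> line l" "P \<in> line k" using meet_in_line[OF lk[OF k(1)]] by simp_all
    then have "k \<in> lines_at ks P" using k by (simp add: lines_at_def)
    moreover have "finite (lines_at ks P)" by (simp add: lines_at_def)
    ultimately have "?m P \<noteq> 0" by (metis card_eq_0_iff empty_iff)
    then show "P \<in> line l \<and> 1 \<le> ?m P" using \<open>P \<in> line l\<close> by simp
  next
    assume r: "P \<in> line l \<and> 1 \<le> ?m P"
    then have "lines_at ks P \<noteq> {}" by auto
    then obtain k where k: "k \<in> set ks" "P \<in> line k" by (auto simp: lines_at_def)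
    then have "P = meet l k" using meet_unique[OF lk[OF k(1)]] r by blast
    then show "P \<in> X" using k by (simp add: X_def)
  qed
  have fib: "lines_at ks P = {k \<in> set ks. meet l k = P}" if "P \<in> X" for P
  proof (rule Set.set_eqI)
    fix k
    have "P \<in> line l" using that X by blast
    moreover have "meet l k \<in> line k" if "k \<in> set ks" using meet_in_line[OF lk[OF that]] by simp
    ultimately have "P \<in> line k \<longleftrightarrow> meet l k = P" if "k \<in> set ks" using meet_unique[OF lk[OF that]] that by metis
    then show "k \<in> lines_at ks P \<longleftrightarrow> k \<in> {k \<in> set ks. meet l k = P}" unfolding lines_at_def by blast
  qed
  have d: "(\<Sum>P\<in>X. ?m P) = length ks"
  proof -
    have "(\<Sum>k\<in>set ks. 1) = (\<Sum>P\<in>X. \<Sum>k\<in>{k \<in> set ks. meet l k = P}. 1)"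
      unfolding X_def by (rule sum.image_gen) simp
    also have "\<dots> = (\<Sum>P\<in>X. ?m P)" by (rule sum.cong[OF refl]) (simp add: fib)
    finally show ?thesis using ks(1) by (simp add: pairwise_indep_def distinct_card)
  qed
  have n: "card X + conc l ks = length ks"
    unfolding X_def
  proof (rule card_image_conc)
    show "distinct ks" using ks(1) by (simp add: pairwise_indep_def)
    fix k k' assume k: "k \<in> set ks" "k' \<in> set ks"
    have "meet l k = meet l k' \<longleftrightarrow> meet l k \<in> line k'"
    proof
      have "meet l k' \<in> line k'" using meet_in_line[OF lk[OF k(2)]] by simp
      then show "meet l k \<in> line k'" if "meet l k = meet l k'" using that by simp
      have "meet l k \<in> line l" using meet_in_line[OF lk[OF k(1)]] by simp
      then show "meet l k = meet l k'" if "meet l k \<in> line k'" using meet_unique[OF lk[OF k(2)]] that by blast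
    qed
    also have "\<dots> \<longleftrightarrow> det3 l k k' = 0"
      using meet_in_line[OF lk[OF k(1)], of k'] det3_rotate[of k' l k] by simp
    finally show "meet l k = meet l k' \<longleftrightarrow> det3 l k k' = 0" .
  qed
  have sub: "?M ks \<subseteq> ?M (l # ks)" "X \<subseteq> ?M (l # ks)"
  proof -
    show "?M ks \<subseteq> ?M (l # ks)" by (auto simp: m_l)
    show "X \<subseteq> ?M (l # ks)" using X by (auto simp: m_l line_def)
  qed
  have finM: "finite (?M (l # ks))" by (rule finite_multiple_points[OF Cons.prems(1)])
  have le3: "card (lines_at (l # ks) P) \<le> 3" for P by (rule lines_at_le_3[OF Cons.prems])
  have inc: "tjurina_mult (card (lines_at (l # ks) P)) = tjurina_mult (?m P) + (if P \<in> X then 2 * ?m P - 1 else 0)"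
    if "P \<in> ?M (l # ks)" for P
  proof (cases "P \<in> line l")
    case True
    then have "?m P \<le> 2" "1 \<le> ?m P" using le3[of P] that by (auto simp: m_l)
    then consider "?m P = 1" | "?m P = 2" by linarith
    then show ?thesis using True X[of P] by cases (simp_all add: m_l tjurina_mult_def)
  next
    case False
    then show ?thesis using X[of P] by (simp add: m_l)
  qed
  have "(\<Sum>P\<in>?M (l # ks). tjurina_mult (card (lines_at (l # ks) P))) =
      (\<Sum>P\<in>?M (l # ks). tjurina_mult (?m P) + (if P \<in> X then 2 * ?m P - 1 else 0))"
    by (rule sum.cong[OF refl inc])
  also have "\<dots> = (\<Sum>P\<in>?M (l # ks). tjurina_mult (?m P)) + (\<Sum>P\<in>?M (l # ks). if P \<in> X then 2 * ?m P - 1 else 0)"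
    by (rule sum.distrib)
  also have "(\<Sum>P\<in>?M (l # ks). tjurina_mult (?m P)) = (\<Sum>P\<in>?M ks. tjurina_mult (?m P))"
    by (rule sum.mono_neutral_right[OF finM sub(1)]) (auto simp: tjurina_mult_def)
  also have "\<dots> = (length ks choose 2) + total_conc ks" by (rule Cons.IH[OF ks])
  also have "(\<Sum>P\<in>?M (l # ks). if P \<in> X then 2 * ?m P - 1 else 0) = (\<Sum>P\<in>X. 2 * ?m P - 1)"
    using sub(2) finM by (simp add: sum.If_cases Int_absorb1)
  also have "(\<Sum>P\<in>X. 2 * ?m P - 1) = length ks + conc l ks"
  proof -
    have "(\<Sum>P\<in>X. 2 * ?m P - 1) + card X = (\<Sum>P\<in>X. (2 * ?m P - 1) + 1)" by (simp only: sum.distrib card_eq_sum)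
    also have "\<dots> = (\<Sum>P\<in>X. 2 * ?m P)" by (rule sum.cong[OF refl]) (use X in auto)
    also have "\<dots> = 2 * length ks" by (simp only: sum_distrib_left[symmetric] d)
    finally show ?thesis using n by linarith
  qed
  finally show ?case by (simp add: numeral_2_eq_2)
qed

theorem total_tjurina_defining_poly:
  assumes "pairwise_indep ls" "at_most_triple ls" "ls \<noteq> []"
  shows "total_tjurina (defining_poly ls) = (length ls choose 2) + total_conc ls"
proof -
  have "total_tjurina (defining_poly ls) =
     (\<Sum>P\<in>{P \<in> proj_plane. 2 \<le> card (lines_at ls P)}. tjurina_mult (card (lines_at ls P)))"
    unfolding total_tjurina_def singular_points_defining_poly[OF assms(1,3)]
  proof (rule sum.cong[OF refl])
    fix P assume P: "P \<in> {P \<in> proj_plane. 2 \<le> card (lines_at ls P)}"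
    then have "card (lines_at ls P) = 2 \<or> card (lines_at ls P) = 3"
      using lines_at_le_3[OF assms(1,2), of P] by auto
    then show "tjurina_number (defining_poly ls) P = tjurina_mult (card (lines_at ls P))"
      using tjurina_number_defining_poly[OF assms(1), of P] P by (auto simp: tjurina_mult_def)
  qed
  then show ?thesis using sum_tjurina_mult[OF assms(1,2)] by simp
qed

section \<open>Intersection lattices\<close>

definition flat :: "vec3 set \<Rightarrow> point set"
  where "flat B = proj_plane \<inter> \<Inter>(line ` B)"

lemma intersection_lattice_flat: "intersection_lattice ls = flat ` Pow (set ls)"
  unfolding intersection_lattice_def flat_def by blast

lemma exists_not_on_line:
  assumes "k \<noteq> 0"
  shows "\<exists>v. dot3 k v \<noteq> 0"
proof (rule ccontr)
  assume "\<not> ?thesis"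
  then have "dot3 k (1, 0, 0) = 0" "dot3 k (0, 1, 0) = 0" "dot3 k (0, 0, 1) = 0" by blast+
  then show False using assms by (cases k) (simp add: dot3_def zero_prod_def)
qed

lemma point_on_line_not_on_line:
  assumes "cross3 k l \<noteq> 0"
  obtains P where "P \<in> line k" "P \<notin> line l"
proof -
  have "k \<noteq> 0" using cross3_nonzero[OF assms] by blast
  then obtain u w \<alpha> \<beta> \<mu> where lp: "line_param k u w \<alpha> \<beta> \<mu>" and w: "dot3 l w \<noteq> 0"
    using line_param_exists[of k "{l}"] assms by (metis finite.emptyI finite.insertI singletonD singletonI)
  have "w \<noteq> 0" using w by (cases l) (auto simp: dot3_def zero_prod_def)
  then show ?thesis
    using that[of "proj_point w"] proj_point_in_line w line_param.lw[OF lp] by metis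
qed

lemma cross3_of_det3: "det3 k k' k'' \<noteq> 0 \<Longrightarrow> cross3 k k' \<noteq> 0 \<and> cross3 k k'' \<noteq> 0 \<and> cross3 k' k'' \<noteq> 0"
proof -
  have z: "dot3 m 0 = 0" for m by (cases m) (simp add: dot3_def zero_prod_def)
  show "det3 k k' k'' \<noteq> 0 \<Longrightarrow> ?thesis"
    using det3_rotate[of k k' k''] det3_rotate[of k' k'' k] cross3_nonzero(3)[of k'' k] z
    unfolding det3_def by metis
qed

text \<open>Containment depends on vanishing determinants only: the line belongs to
  \<open>B\<close>, or it passes through the intersection of two members, or the flat is
  empty.\<close>

lemma flat_subset_line_iff:
  assumes ls: "pairwise_indep ls" and B: "B \<subseteq> set ls" and l: "l \<in> set ls"
  shows "flat B \<subseteq> line l \<longleftrightarrow> l \<in> B \<or> (\<exists>k\<in>B. \<exists>k'\<in>B. k \<noteq> k' \<and> det3 l k k' = 0) \<or>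
    (\<exists>k\<in>B. \<exists>k'\<in>B. \<exists>k''\<in>B. det3 k k' k'' \<noteq> 0)" (is "_ \<longleftrightarrow> ?R")
proof
  assume ?R
  then consider "l \<in> B" | k k' where "k \<in> B" "k' \<in> B" "k \<noteq> k'" "det3 l k k' = 0"
    | k k' k'' where "k \<in> B" "k' \<in> B" "k'' \<in> B" "det3 k k' k'' \<noteq> 0" by blast
  then show "flat B \<subseteq> line l"
  proof cases
    case 1
    then show ?thesis by (auto simp: flat_def)
  next
    case 2
    then have c: "cross3 k k' \<noteq> 0" using ls B unfolding pairwise_indep_def by blast
    show ?thesis
    proof
      fix P assume "P \<in> flat B"
      then have "P \<in> line k" "P \<in> line k'" using 2 by (auto simp: flat_def)
      then show "P \<in> line l" using meet_unique[OF c] meet_in_line[OF c] 2(4) by blast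
    qed
  next
    case 3
    have c: "cross3 k' k'' \<noteq> 0" using cross3_of_det3[OF 3(4)] by blast
    show ?thesis
    proof
      fix P assume "P \<in> flat B"
      then have "P \<in> line k" "P \<in> line k'" "P \<in> line k''" using 3 by (auto simp: flat_def)
      then have False using meet_unique[OF c] meet_in_line[OF c] 3(4) by blast
      then show "P \<in> line l" ..
    qed
  qed
next
  assume sub: "flat B \<subseteq> line l"
  show ?R
  proof (rule ccontr)
    assume nR: "\<not> ?R"
    consider "B = {}" | k where "B = {k}" | k k' where "k \<in> B" "k' \<in> B" "k \<noteq> k'" by blast
    then show False
    proof cases
      case 1
      have "l \<noteq> 0" using ls l by (simp add: pairwise_indep_def)
      then obtain v where v: "dot3 l v \<noteq> 0" using exists_not_on_line by blast
      then have "v \<noteq> 0" by (cases l) (auto simp: dot3_def zero_prod_def)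
      moreover have "proj_point v \<in> proj_plane" using \<open>v \<noteq> 0\<close> unfolding proj_plane_def zero_prod_def by blast
      then have "proj_point v \<in> flat B" by (simp add: 1 flat_def)
      ultimately show False using sub v proj_point_in_line by blast
    next
      case 2
      then have "k \<noteq> l" "k \<in> set ls" using nR B by blast+
      then have "cross3 k l \<noteq> 0" using ls l unfolding pairwise_indep_def by blast
      then obtain P where P: "P \<in> line k" "P \<notin> line l" by (rule point_on_line_not_on_line)
      then have "P \<in> flat B" using 2 by (simp add: flat_def line_def)
      then show False using sub P by blast
    next
      case 3
      then have c: "cross3 k k' \<noteq> 0" using ls B unfolding pairwise_indep_def by blast
      have "meet k k' \<in> line m" if "m \<in> B" for m
        using meet_in_line[OF c] nR 3 that by blast
      then have "meet k k' \<in> flat B" using meet_in_plane[OF c] by (simp add: flat_def)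
      then have "det3 l k k' = 0" using sub meet_in_line[OF c] by blast
      then show False using nR 3 by blast
    qed
  qed
qed

text \<open>A flat is determined by the set of lines containing it, and this closure operator is
  expressed by determinants, which \<open>\<sigma>\<close> respects.\<close>

lemma isomorphic_lattices_map:
  assumes ls: "pairwise_indep ls" and ls': "pairwise_indep ls'" and bij: "bij_betw \<sigma> (set ls) (set ls')"
    and det: "\<And>k k' k''. k \<in> set ls \<Longrightarrow> k' \<in> set ls \<Longrightarrow> k'' \<in> set ls \<Longrightarrow>
      det3 (\<sigma> k) (\<sigma> k') (\<sigma> k'') = 0 \<longleftrightarrow> det3 k k' k'' = 0"
  shows "isomorphic_lattices ls ls'"
proof -
  have inj: "inj_on \<sigma> (set ls)" and im: "\<sigma> ` set ls = set ls'" using bij by (auto simp: bij_betw_def)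
  define cl where "cl B = {l \<in> set ls. flat B \<subseteq> line l}" for B
  define cl' where "cl' B = {l \<in> set ls'. flat B \<subseteq> line l}" for B
  have cl: "\<sigma> l \<in> cl' (\<sigma> ` B) \<longleftrightarrow> l \<in> cl B" if B: "B \<subseteq> set ls" and l: "l \<in> set ls" for B l
  proof -
    have B': "\<sigma> ` B \<subseteq> set ls'" and l': "\<sigma> l \<in> set ls'" using B l im by blast+
    have 1: "\<sigma> l \<in> \<sigma> ` B \<longleftrightarrow> l \<in> B" using inj B l by (meson inj_on_image_mem_iff)
    have 2: "(\<exists>k\<in>\<sigma> ` B. \<exists>k'\<in>\<sigma> ` B. k \<noteq> k' \<and> det3 (\<sigma> l) k k' = 0) \<longleftrightarrow> (\<exists>k\<in>B. \<exists>k'\<in>B. k \<noteq> k' \<and> det3 l k k' = 0)"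
    proof -
      have "\<sigma> k \<noteq> \<sigma> k' \<and> det3 (\<sigma> l) (\<sigma> k) (\<sigma> k') = 0 \<longleftrightarrow> k \<noteq> k' \<and> det3 l k k' = 0" if "k \<in> B" "k' \<in> B" for k k'
        using det[OF l, of k k'] inj_onD[OF inj, of k k'] that B by blast
      then show ?thesis by blast
    qed
    have 3: "(\<exists>k\<in>\<sigma> ` B. \<exists>k'\<in>\<sigma> ` B. \<exists>k''\<in>\<sigma> ` B. det3 k k' k'' \<noteq> 0) \<longleftrightarrow> (\<exists>k\<in>B. \<exists>k'\<in>B. \<exists>k''\<in>B. det3 k k' k'' \<noteq> 0)"
    proof -
      have "det3 (\<sigma> k) (\<sigma> k') (\<sigma> k'') \<noteq> 0 \<longleftrightarrow> det3 k k' k'' \<noteq> 0" if "k \<in> B" "k' \<in> B" "k'' \<in> B" for k k' k''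
        using det[of k k' k''] that B by blast
      then show ?thesis by blast
    qed
    show ?thesis
      unfolding cl_def cl'_def mem_Collect_eq flat_subset_line_iff[OF ls B l] flat_subset_line_iff[OF ls' B' l'] 1 2 3
      using l l' by blast
  qed
  have order: "flat C \<subseteq> flat B \<longleftrightarrow> B \<subseteq> cl C" if "B \<subseteq> set ls" for B C
    using that unfolding cl_def flat_def by blast
  have order': "flat C \<subseteq> flat B \<longleftrightarrow> B \<subseteq> cl' C" if "B \<subseteq> set ls'" for B C
    using that unfolding cl'_def flat_def by blast
  have iso: "flat (\<sigma> ` C) \<subseteq> flat (\<sigma> ` B) \<longleftrightarrow> flat C \<subseteq> flat B" if "B \<subseteq> set ls" "C \<subseteq> set ls" for B C
  proof -
    have "\<sigma> ` B \<subseteq> set ls'" using that im by blast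
    then have "flat (\<sigma> ` C) \<subseteq> flat (\<sigma> ` B) \<longleftrightarrow> (\<forall>l\<in>B. \<sigma> l \<in> cl' (\<sigma> ` C))" using order' by blast
    also have "\<dots> \<longleftrightarrow> B \<subseteq> cl C" using cl[OF that(2)] that(1) by blast
    finally show ?thesis using order that by blast
  qed
  \<comment> \<open>The closed set of lines is used as the canonical representative, since different
    sets \<open>B\<close> can have the same flat.\<close>
  define \<phi> where "\<phi> X = flat (\<sigma> ` {l \<in> set ls. X \<subseteq> line l})" for X
  have \<phi>: "\<phi> (flat B) = flat (\<sigma> ` B)" if "B \<subseteq> set ls" for B
  proof -
    have sub: "cl B \<subseteq> set ls" by (auto simp: cl_def)
    have "flat (cl B) = flat B" using that unfolding cl_def flat_def by blast
    then have "flat (\<sigma> ` cl B) = flat (\<sigma> ` B)" using iso[OF sub that] iso[OF that sub] by blast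
    then show ?thesis by (simp add: \<phi>_def cl_def)
  qed
  have bij\<phi>: "bij_betw \<phi> (flat ` Pow (set ls)) (flat ` Pow (set ls'))"
    unfolding bij_betw_def
  proof
    show "inj_on \<phi> (flat ` Pow (set ls))"
    proof (rule inj_onI)
      fix X Y assume "X \<in> flat ` Pow (set ls)" "Y \<in> flat ` Pow (set ls)" and eq: "\<phi> X = \<phi> Y"
      then obtain B C where BC: "B \<subseteq> set ls" "C \<subseteq> set ls" "X = flat B" "Y = flat C" by blast
      then have "flat (\<sigma> ` B) = flat (\<sigma> ` C)" using eq \<phi> by metis
      then show "X = Y" using iso[OF BC(1,2)] iso[OF BC(2,1)] BC by blast
    qed
    show "\<phi> ` flat ` Pow (set ls) = flat ` Pow (set ls')"
    proof
      show "\<phi> ` flat ` Pow (set ls) \<subseteq> flat ` Pow (set ls')"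
      proof
        fix Y assume "Y \<in> \<phi> ` flat ` Pow (set ls)"
        then obtain B where "B \<subseteq> set ls" "Y = flat (\<sigma> ` B)" using \<phi> by auto
        moreover have "\<sigma> ` B \<subseteq> set ls'" using \<open>B \<subseteq> set ls\<close> im by blast
        ultimately show "Y \<in> flat ` Pow (set ls')" by blast
      qed
      show "flat ` Pow (set ls') \<subseteq> \<phi> ` flat ` Pow (set ls)"
      proof
        fix Y assume "Y \<in> flat ` Pow (set ls')"
        then obtain B' where B': "B' \<subseteq> \<sigma> ` set ls" "Y = flat B'" using im by blast
        then obtain B where "B \<subseteq> set ls" "B' = \<sigma> ` B" by (meson subset_imageE)
        then show "Y \<in> \<phi> ` flat ` Pow (set ls)" using \<phi> B'(2) by (metis PowI imageI)
      qed
    qed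
  qed
  have order\<phi>: "X \<supseteq> Y \<longleftrightarrow> \<phi> X \<supseteq> \<phi> Y" if XY: "X \<in> flat ` Pow (set ls)" "Y \<in> flat ` Pow (set ls)" for X Y
  proof -
    obtain B C where BC: "B \<subseteq> set ls" "C \<subseteq> set ls" "X = flat B" "Y = flat C" using XY by blast
    show ?thesis using iso[OF BC(1,2)] \<phi> BC by metis
  qed
  show ?thesis
    unfolding isomorphic_lattices_def intersection_lattice_flat
    by (intro exI[of _ \<phi>] conjI ballI) (rule bij\<phi>, rule order\<phi>)
qed

lemma isomorphic_lattices_nth:
  assumes ls: "pairwise_indep ls" and ls': "pairwise_indep ls'" and len: "length ls = length ls'"
    and det: "\<And>i j k. i < length ls \<Longrightarrow> j < length ls \<Longrightarrow> k < length ls \<Longrightarrow>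
      det3 (ls' ! i) (ls' ! j) (ls' ! k) = 0 \<longleftrightarrow> det3 (ls ! i) (ls ! j) (ls ! k) = 0"
  shows "isomorphic_lattices ls ls'"
proof (rule isomorphic_lattices_map[OF ls ls'])
  define \<sigma> where "\<sigma> k = the (map_of (zip ls ls') k)" for k
  have dist: "distinct ls" "distinct ls'" using ls ls' by (simp_all add: pairwise_indep_def)
  have \<sigma>: "\<sigma> (ls ! i) = ls' ! i" if "i < length ls" for i
    using that len dist(1) by (simp add: \<sigma>_def map_of_zip_nth)
  show "bij_betw \<sigma> (set ls) (set ls')"
  proof (rule bij_betw_imageI)
    show "inj_on \<sigma> (set ls)"
    proof (rule inj_onI)
      fix x y assume "x \<in> set ls" "y \<in> set ls" and eq: "\<sigma> x = \<sigma> y"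
      then obtain i j where ij: "i < length ls" "j < length ls" "x = ls ! i" "y = ls ! j"
        unfolding in_set_conv_nth by blast
      then have "ls' ! i = ls' ! j" using eq \<sigma> by simp
      then show "x = y" using ij len dist(2) nth_eq_iff_index_eq by metis
    qed
    show "\<sigma> ` set ls = set ls'"
    proof
      show "\<sigma> ` set ls \<subseteq> set ls'" using \<sigma> len by (metis image_subsetI in_set_conv_nth)
      show "set ls' \<subseteq> \<sigma> ` set ls" using \<sigma> len by (metis imageI in_set_conv_nth subsetI)
    qed
  qed
  fix k k' k'' assume "k \<in> set ls" "k' \<in> set ls" "k'' \<in> set ls"
  then obtain i j m where "i < length ls" "j < length ls" "m < length ls" "k = ls ! i" "k' = ls ! j" "k'' = ls ! m"
    unfolding in_set_conv_nth by blast
  then show "det3 (\<sigma> k) (\<sigma> k') (\<sigma> k'') = 0 \<longleftrightarrow> det3 k k' k'' = 0"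
    using \<sigma> det by simp
qed

section \<open>The thresholds\<close>

lemma syz_Suc_eq_0:
  assumes "syz f (Suc j) = {0}"
  shows "syz f j = {0}"
proof -
  have "\<theta> = 0" if "\<theta> \<in> syz f j" for \<theta>
  proof -
    obtain a b c where abc: "\<theta> = (a, b, c)" by (cases \<theta>)
    have "(poly_x * a, poly_x * b, poly_x * c) \<in> syz f (Suc j)"
    proof -
      have "homogeneous3 j a" "homogeneous3 j b" "homogeneous3 j c" and z: "der (a, b, c) f = 0"
        using that by (auto simp: abc syz_def tforms_iff)
      then have "homogeneous3 (Suc j) (poly_x * a)" "homogeneous3 (Suc j) (poly_x * b)" "homogeneous3 (Suc j) (poly_x * c)"
        using homogeneous3_mult[OF homogeneous3_vars(1), of j] by simp_all
      moreover have "der (poly_x * a, poly_x * b, poly_x * c) f = poly_x * der (a, b, c) f"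
        by (simp add: der_def algebra_simps)
      ultimately show ?thesis using z by (simp add: syz_def tforms_iff)
    qed
    then have "poly_x * a = 0" "poly_x * b = 0" "poly_x * c = 0" using assms by (auto simp: zero_prod_def)
    then show ?thesis using poly_x_mult_eq_0 by (auto simp: abc zero_prod_def)
  qed
  then show ?thesis using T.subspace_0[OF subspace_syz] by blast
qed

lemma syz_le_eq_0: "syz f j = {0} \<Longrightarrow> i \<le> j \<Longrightarrow> syz f i = {0}"
  by (induction j) (auto simp: le_Suc_eq dest: syz_Suc_eq_0)

text \<open>Multiplying a syzygy by \<open>x\<close> and \<open>y\<close> gives two independent ones.\<close>

lemma syz_eq_0_of_dim_le_1:
  assumes "T.dim (syz f (Suc j)) \<le> 1"
  shows "syz f j = {0}"
proof -
  have "\<theta> = 0" if \<theta>: "\<theta> \<in> syz f j" for \<theta>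
  proof (rule ccontr)
    assume n0: "\<theta> \<noteq> 0"
    obtain a b c where abc: "\<theta> = (a, b, c)" by (cases \<theta>)
    define e where "e i = (if i = (0 :: nat) then (poly_x * a, poly_x * b, poly_x * c) else (poly_y * a, poly_y * b, poly_y * c))" for i
    have h: "homogeneous3 j a" "homogeneous3 j b" "homogeneous3 j c" and z: "der (a, b, c) f = 0"
      using \<theta> by (auto simp: abc syz_def tforms_iff)
    have "der (p * a, p * b, p * c) f = p * der (a, b, c) f" for p by (simp add: der_def algebra_simps)
    then have "e ` {0, 1} \<subseteq> syz f (Suc j)"
      using h z homogeneous3_mult[OF homogeneous3_vars(1), of j] homogeneous3_mult[OF homogeneous3_vars(2), of j]
      by (auto simp: e_def syz_def tforms_iff)
    moreover have "\<forall>i\<in>{0, 1}. d i = 0" if s: "(\<Sum>i\<in>{0, 1}. tscale (d i) (e i)) = 0" for d :: "nat \<Rightarrow> complex"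
    proof (rule ccontr)
      assume "\<not> ?thesis"
      then have "(d 0, d 1, 0) \<noteq> (0 :: vec3)" by (auto simp: zero_prod_def)
      note lf = linear_form_mult_eq_0[OF this]
      have "linear_form (d 0, d 1, 0) * p = const3 (d 0) * (poly_x * p) + const3 (d 1) * (poly_y * p)" for p
        by (simp add: linear_form_def S.\<iota>_0 algebra_simps)
      then have "linear_form (d 0, d 1, 0) * a = 0" "linear_form (d 0, d 1, 0) * b = 0" "linear_form (d 0, d 1, 0) * c = 0"
        using s by (auto simp: e_def tscale_def zero_prod_def)
      then show False using lf n0 abc by (auto simp: zero_prod_def)
    qed
    ultimately have "card {0 :: nat, 1} \<le> T.dim (syz f (Suc j))"
      using T.card_family_le_dim[OF fin_dim_syz[of f "Suc j"], of "{0, 1}" e] by blast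
    then show False using assms by simp
  qed
  then show ?thesis using T.subspace_0[OF subspace_syz] by blast
qed

lemma dim_syz_0: "T.dim (syz f j) = 0 \<longleftrightarrow> syz f j = {0}"
  using T.dim_zero_fin_dim[OF fin_dim_syz[of f j]] T.subspace_0[OF subspace_syz, of f j] by blast

lemma two_dim_forms: "2 * S.vs.dim (forms k) = (k + 1) * (k + 2)"
  by (simp only: dim_forms card_mono_exps)

lemma dim_forms_num:
  "S.vs.dim (forms 5) = 21" "S.vs.dim (forms 6) = 28" "S.vs.dim (forms 15) = 136"
  using two_dim_forms[of 5] two_dim_forms[of 6] two_dim_forms[of 15] by simp_all

text \<open>The partial derivatives have degree 9, so in degree \<open>9 + i\<close> the Milnor
  algebras differ exactly by the syzygies of degree \<open>i\<close>; \<open>j < 8\<close> keeps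
  degree \<open>Suc j\<close> in the range where the smooth form has none.\<close>

lemma ct_eqI:
  assumes f: "homogeneous3 10 f" and fs: "smooth_form 10 fs"
    and z: "syz f j = {0}" and nz: "syz f (Suc j) \<noteq> {0}" and j: "j < 8"
  shows "ct fs f = 9 + j"
proof -
  have hs: "homogeneous3 10 fs" using fs by (simp add: smooth_form_def)
  have S: "Suc 9 = (10 :: nat)" by simp
  have syzs: "syz fs i = {0}" if "i < 9" for i using smooth_form_syz[of 9 fs i] fs that by simp
  have eq: "milnor_dim f k = milnor_dim fs k" if "k \<le> 9 + j" for k
  proof (cases "k < 9")
    case True
    then show ?thesis using milnor_dim_low[of 9] f hs by simp
  next
    case False
    then obtain i where i: "k = 9 + i" by (metis le_add_diff_inverse not_less)
    then have "i \<le> j" using that by simp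
    then have "syz f i = {0}" "syz fs i = {0}" using syz_le_eq_0[OF z] syzs j by simp_all
    then show ?thesis using milnor_dim_high[of 9 f i] milnor_dim_high[of 9 fs i] f hs by (simp add: i)
  qed
  have neq: "milnor_dim f (9 + Suc j) \<noteq> milnor_dim fs (9 + Suc j)"
    using milnor_dim_high[of 9 f "Suc j"] milnor_dim_high[of 9 fs "Suc j"] f hs nz syzs[of "Suc j"] j
      dim_syz_0[of f "Suc j"] dim_syz_0[of fs "Suc j"] by simp
  have "{q. \<forall>k\<le>q. milnor_dim f k = milnor_dim fs k} = {..9 + j}"
  proof (intro equalityI subsetI)
    fix q assume "q \<in> {q. \<forall>k\<le>q. milnor_dim f k = milnor_dim fs k}"
    then have "\<not> 9 + Suc j \<le> q" using neq by blast
    then show "q \<in> {..9 + j}" by simp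
  qed (use eq in auto)
  moreover have "Max {..9 + j} = 9 + j" by (rule Max_eqI) auto
  ultimately show ?thesis by (simp add: ct_def)
qed

text \<open>Ten lines without points of multiplicity above three and with exactly six triple points, all of
  them off the line \<open>l\<close>.\<close>

locale ten_lines =
  fixes l :: vec3 and ks :: "vec3 list"
  assumes indep: "pairwise_indep (l # ks)" and triple: "at_most_triple (l # ks)"
    and len: "length ks = 9" and conc_l: "conc l ks = 0" and conc_ks: "total_conc ks = 6"
    and last3: "\<exists>xs c b a. ks = xs @ [c, b, a] \<and> det3 c b a \<noteq> 0"
begin

abbreviation "f \<equiv> defining_poly (l # ks)"

lemma hom_f: "homogeneous3 (Suc 9) f"
  using homogeneous3_defining_poly[of "l # ks"] len by simp

lemma dim_logder_10:
  assumes "7 \<le> j"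
  shows "T.dim (logder (l # ks) j) + 10 * (j + 1) = 3 * S.vs.dim (forms j) + 6"
proof -
  obtain xs c b a where xs: "ks = xs @ [c, b, a]" "det3 c b a \<noteq> 0" using last3 by blast
  have "T.dim (logder (l # ks) j) + length (l # ks) * (j + 1) = 3 * S.vs.dim (forms j) + total_conc (l # ks)"
  proof (rule dim_logder[OF indep triple])
    show "length (l # ks) \<le> j + 3" using len assms by simp
    show "l # ks = (l # xs) @ [c, b, a]" using xs(1) by simp
  qed (rule xs(2))
  then show ?thesis by (simp add: len conc_l conc_ks)
qed

lemma dim_logder_9: "T.dim (logder ks 6) = 27"
proof -
  obtain xs c b a where "ks = xs @ [c, b, a]" "det3 c b a \<noteq> 0" using last3 by blast
  then have "T.dim (logder ks 6) + length ks * (6 + 1) = 3 * S.vs.dim (forms 6) + total_conc ks"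
    using indep triple len by (intro dim_logder) (auto simp: pairwise_indep_Cons dest: at_most_triple_Cons)
  then show ?thesis using len conc_ks by (simp add: dim_forms_num)
qed

lemma dim_syz_logder: "T.dim (logder (l # ks) (Suc i)) = T.dim (syz f (Suc i)) + S.vs.dim (forms i)"
  by (rule dim_logder_syz[OF indep]) simp

text \<open>Degree 16 is 9 + 7, and 7 is the first degree in which the dimension formula covers ten
  lines.\<close>

lemma milnor_dim_ge_16:
  assumes "16 \<le> k"
  shows "milnor_dim f k = 51"
proof -
  obtain i where i: "k = 9 + Suc i" "6 \<le> i"
    using assms by (intro that[of "k - 10"]) auto
  have "milnor_dim f k + 3 * S.vs.dim (forms (Suc i)) = S.vs.dim (forms k) + T.dim (syz f (Suc i))"
    unfolding i(1) using milnor_dim_high[OF hom_f, of "Suc i"] by simp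
  moreover have "T.dim (syz f (Suc i)) + S.vs.dim (forms i) + 10 * (Suc i + 1) = 3 * S.vs.dim (forms (Suc i)) + 6"
    using dim_logder_10[of "Suc i"] dim_syz_logder[of i] i(2) by simp
  \<comment> \<open>Abstracting the dimensions makes the elimination a linear problem.\<close>
  moreover have "M + 3 * S = K + z \<Longrightarrow> z + F + 10 * (Suc i + 1) = 3 * S + 6 \<Longrightarrow> 2 * M + 2 * F + 20 * (i + 2) = 2 * K + 12"
    for M S K z F :: nat by presburger
  ultimately have "2 * milnor_dim f k + 2 * S.vs.dim (forms i) + 20 * (i + 2) = 2 * S.vs.dim (forms k) + 12" by blast
  then have "2 * milnor_dim f k + (i + 1) * (i + 2) + 20 * (i + 2) = (i + 11) * (i + 12) + 12"
    using two_dim_forms[of i] two_dim_forms[of k] by (simp add: i(1) add.commute)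
  then show ?thesis by (simp add: algebra_simps)
qed

text \<open>Above 51 whatever the syzygies, so stability never starts before degree 16.\<close>

lemma milnor_dim_15: "milnor_dim f 15 = 52 + T.dim (syz f 6)"
  using milnor_dim_high[OF hom_f, of 6] by (simp add: dim_forms_num)

lemma total_tjurina_f: "total_tjurina f = 51"
proof -
  have "total_tjurina f = (length (l # ks) choose 2) + total_conc (l # ks)"
    by (rule total_tjurina_defining_poly[OF indep triple]) simp
  also have "length (l # ks) choose 2 = 45" using len by (simp add: choose_two)
  finally show ?thesis using conc_l conc_ks by simp
qed

theorem st_f: "st f = 16"
  unfolding st_def total_tjurina_f
proof (rule Least_equality)
  show "\<forall>k\<ge>16. milnor_dim f k = 51" using milnor_dim_ge_16 by blast
  fix q assume q: "\<forall>k\<ge>q. milnor_dim f k = 51"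
  show "16 \<le> q"
  proof (rule ccontr)
    assume "\<not> 16 \<le> q"
    then have "milnor_dim f 15 = 51" using q by simp
    then show False using milnor_dim_15 by simp
  qed
qed

lemma syz_7_nonzero: "syz f 7 \<noteq> {0}"
proof -
  have "T.dim (logder (l # ks) (Suc 6)) + 10 * (7 + 1) = 3 * S.vs.dim (forms 7) + 6" using dim_logder_10[of 7] by simp
  then have "T.dim (syz f (Suc 6)) = 6"
    using dim_syz_logder[of 6] two_dim_forms[of 7] by (simp add: dim_forms_num)
  then show ?thesis using dim_syz_0[of f "Suc 6"] by (metis eval_nat_numeral(3) zero_neq_numeral)
qed

end

lemma dvd_prod_list_member: "x \<in> set xs \<Longrightarrow> x dvd prod_list xs" for x :: "'a::comm_monoid_mult"
  by (induction xs) auto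

context ten_lines
begin

text \<open>Modulo Euler derivations, \<open>l\<close> times a logarithmic derivation of the nine other lines is a syzygy.\<close>

lemma syz_6_nonzero:
  assumes \<rho>: "(0, b, c) \<in> logder ks 5" and c: "c \<noteq> 0"
  shows "syz f 6 \<noteq> {0}"
proof -
  let ?L = "linear_form l"
  define \<theta> where "\<theta> = (0 :: poly3, ?L * b, ?L * c)"
  have h: "homogeneous3 5 b" "homogeneous3 5 c" using \<rho> by (auto simp: logder_def tforms_iff)
  have "der \<theta> g = ?L * der (0, b, c) g" for g by (simp add: \<theta>_def der_def algebra_simps)
  moreover have "\<theta> \<in> tforms (Suc 5)"
    using homogeneous3_mult[OF homogeneous3_linear_form h(1), of l] homogeneous3_mult[OF homogeneous3_linear_form h(2), of l]
    by (simp add: \<theta>_def tforms_iff)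
  moreover have "eval3 (der (0, b, c) (linear_form k)) v = 0" if "k \<in> set ks" "dot3 k v = 0" for k v
    using \<rho> that unfolding logder_def by blast
  ultimately have \<theta>: "\<theta> \<in> logder (l # ks) (Suc 5)"
    unfolding logder_def by (simp add: ev.eval_in_mult eval3_linear_form del: split_paired_All)
  have nz: "\<And>k. k \<in> set (l # ks) \<Longrightarrow> k \<noteq> 0" using indep unfolding pairwise_indep_def by blast
  obtain h where h: "homogeneous3 5 h" "der \<theta> f = h * f" using logder_der_defining_poly[OF \<theta> nz] by blast
  \<comment> \<open>The Euler derivation multiplies f by its degree 10, so this multiple cancels
    \<open>h * f\<close>.\<close>
  let ?E = "euler_der (const3 (- 1 / 10) * h)"
  have hE: "homogeneous3 5 (const3 (- 1 / 10) * h)" by (rule homogeneous3_const3_mult[OF h(1)])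
  have "der ?E f = (const3 (of_nat (Suc 9)) * const3 (- 1 / 10)) * (h * f)"
    unfolding der_euler_der[OF hom_f] by (simp only: mult_ac)
  also have "const3 (of_nat (Suc 9)) * const3 (- 1 / 10) = - 1"
    unfolding S.\<iota>_mult[symmetric] by (simp add: S.\<iota>_minus S.\<iota>_1)
  finally have "der (\<theta> + ?E) f = 0" by (simp add: der_add_left h(2))
  moreover have "\<theta> + ?E \<in> tforms (Suc 5)"
    using \<theta> euler_der_logder[OF hE, of "[]"] T.subspace_add[OF subspace_tforms] unfolding logder_def by blast
  ultimately have "\<theta> + ?E \<in> syz f (Suc 5)" by (simp add: syz_def)
  \<comment> \<open>The first component of \<open>\<theta>\<close> is zero, so cancellation would
    force the Euler part to vanish and then \<open>?L * c\<close> too.\<close>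
  moreover have "\<theta> + ?E \<noteq> 0"
  proof
    assume z: "\<theta> + ?E = 0"
    then have "poly_x * (const3 (- 1 / 10) * h) = 0" by (simp add: \<theta>_def euler_der_def zero_prod_def mult.commute)
    then have "const3 (- 1 / 10) * h = 0" by (rule poly_x_mult_eq_0)
    then have "?L * c = 0" using z by (simp add: \<theta>_def euler_der_def zero_prod_def)
    then show False using linear_form_mult_eq_0[of l c] nz[of l] c by simp
  qed
  ultimately show ?thesis by (metis singletonD eval_nat_numeral(2) semiring_norm(26,27,28) eval_nat_numeral(3) numeral_eq_Suc pred_numeral_simps(2) BitM.simps)
qed

end

section \<open>The configuration of the six triple points\<close>

text \<open>The lines, numbered from \<open>0\<close> to \<open>8\<close>, that do not pass through the \<open>q\<close>-th triple point, and two
  lines that do. The nine lines are the edges of the complete bipartite graph on the triple points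
  \<open>{0, 3, 4}\<close> and \<open>{1, 2, 5}\<close>.\<close>

definition avoiding :: "nat \<Rightarrow> nat list"
  where "avoiding q = [[1, 3, 4, 5, 6, 8], [1, 2, 4, 6, 7, 8], [0, 3, 5, 6, 7, 8], [0, 2, 4, 5, 7, 8],
    [0, 1, 2, 3, 6, 7], [0, 1, 2, 3, 4, 5]] ! q"

definition through :: "nat \<Rightarrow> nat \<times> nat"
  where "through q = [(0, 2), (0, 3), (1, 2), (1, 3), (4, 5), (6, 7)] ! q"

definition triples :: "(nat \<times> nat \<times> nat) list"
  where "triples = [(0, 2, 7), (0, 3, 5), (1, 2, 4), (1, 3, 6), (4, 5, 8), (6, 7, 8)]"

locale six_triple_points = ten_lines l "rev ls" for l and ls :: "vec3 list" +
  assumes conc_triples: "\<And>i j k. (i, j, k) \<in> set triples \<Longrightarrow> det3 (ls ! i) (ls ! j) (ls ! k) = 0"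
    and generic: "\<And>i j. i < 9 \<Longrightarrow> j < 9 \<Longrightarrow> i \<noteq> j \<Longrightarrow> det3 l (ls ! i) (ls ! j) \<noteq> 0"
begin

definition Pi :: "nat \<Rightarrow> poly3"
  where "Pi q = (\<Prod>i\<leftarrow>avoiding q. linear_form (ls ! i))"

definition dirv :: "nat \<Rightarrow> vec3"
  where "dirv q = cross3 (ls ! fst (through q)) (ls ! snd (through q))"

text \<open>The value of \<open>Pi q\<close> at the point where \<open>l\<close> meets the line
  \<open>a\<close>, written with determinants so that it can also be read as a form in
  \<open>l\<close>.\<close>

definition V :: "nat \<Rightarrow> nat \<Rightarrow> complex"
  where "V q a = (\<Prod>i\<leftarrow>avoiding q. det3 l (ls ! a) (ls ! i))"

lemma len_ls: "length ls = 9" using len by simp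

lemma q_cases: "q < 6 \<Longrightarrow> q = 0 \<or> q = 1 \<or> q = 2 \<or> q = 3 \<or> q = 4 \<or> q = (5 :: nat)" by linarith

lemma avoiding_simps: "avoiding 0 = [1, 3, 4, 5, 6, 8]" "avoiding (Suc 0) = [1, 2, 4, 6, 7, 8]" "avoiding 2 = [0, 3, 5, 6, 7, 8]"
  "avoiding 3 = [0, 2, 4, 5, 7, 8]" "avoiding 4 = [0, 1, 2, 3, 6, 7]" "avoiding 5 = [0, 1, 2, 3, 4, 5]"
  by (simp_all add: avoiding_def)

lemma avoiding_facts:
  assumes "q < 6"
  shows "length (avoiding q) = 6" "set (avoiding q) \<subseteq> {..<9}" "fst (through q) < 9" "snd (through q) < 9"
    "fst (through q) \<noteq> snd (through q)"
    "\<And>i. i < 9 \<Longrightarrow> i \<notin> set (avoiding q) \<Longrightarrow> i \<noteq> fst (through q) \<Longrightarrow> i \<noteq> snd (through q) \<Longrightarrow>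
      (fst (through q), snd (through q), i) \<in> set triples"
proof -
  show "length (avoiding q) = 6" "set (avoiding q) \<subseteq> {..<9}" "fst (through q) < 9" "snd (through q) < 9"
    "fst (through q) \<noteq> snd (through q)"
    using q_cases[OF assms] by (elim disjE; simp add: avoiding_def through_def)+
  fix i :: nat assume "i < 9" "i \<notin> set (avoiding q)" "i \<noteq> fst (through q)" "i \<noteq> snd (through q)"
  moreover have "i = 0 \<or> i = 1 \<or> i = 2 \<or> i = 3 \<or> i = 4 \<or> i = 5 \<or> i = 6 \<or> i = 7 \<or> i = 8" using \<open>i < 9\<close> by linarith
  ultimately show "(fst (through q), snd (through q), i) \<in> set triples"
    using q_cases[OF assms] by (elim disjE; simp add: avoiding_def through_def triples_def)
qed

lemma homogeneous3_Pi: "q < 6 \<Longrightarrow> homogeneous3 6 (Pi q)"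
proof -
  assume "q < 6"
  then have "length (map (\<lambda>i. linear_form (ls ! i)) (avoiding q)) = 6" using avoiding_facts(1) by simp
  moreover have "homogeneous3 (length (map (\<lambda>i. linear_form (ls ! i)) (avoiding q))) (Pi q)"
    unfolding Pi_def by (rule homogeneous3_prod_list) (auto simp: homogeneous3_linear_form simp del: One_nat_def)
  ultimately show ?thesis by simp
qed

lemma dirv_logder:
  assumes q: "q < 6"
  shows "dir_der (Pi q) (dirv q) \<in> logder (rev ls) 6"
proof (rule dir_der_logder[OF homogeneous3_Pi[OF q]])
  fix k assume "k \<in> set (rev ls)" and d: "dot3 k (dirv q) \<noteq> 0"
  then obtain i where i: "i < 9" "k = ls ! i" using len_ls by (auto simp: in_set_conv_nth simp del: split_paired_Ex)
  have "i \<in> set (avoiding q)"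
  proof (rule ccontr)
    assume n: "i \<notin> set (avoiding q)"
    have "i \<noteq> fst (through q)" "i \<noteq> snd (through q)" using d by (auto simp: i dirv_def)
    then have "det3 (ls ! fst (through q)) (ls ! snd (through q)) (ls ! i) = 0"
      using avoiding_facts(6)[OF q i(1) n] conc_triples by blast
    then show False using d det3_rotate[of "ls ! i"] by (simp add: i dirv_def det3_def)
  qed
  then show "linear_form k dvd Pi q"
    unfolding Pi_def i by (intro dvd_prod_list_member) simp
qed

lemma dot3_dirv: "q < 6 \<Longrightarrow> dot3 l (dirv q) \<noteq> 0"
  using generic avoiding_facts(3-5) by (simp add: dirv_def det3_def)

lemma eval3_Pi: "eval3 (Pi q) (cross3 l (ls ! a)) = V q a"
proof -
  have "dot3 k (cross3 l m) = det3 l m k" for k m using det3_rotate[of k l m] by (simp add: det3_def)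
  then show ?thesis by (simp add: Pi_def V_def ev.eval_in_prod_list eval3_linear_form o_def)
qed

lemma V_eq_0: "a \<in> set (avoiding q) \<Longrightarrow> V q a = 0"
  unfolding V_def by (simp add: prod_list_zero_iff image_iff) (metis det3_same(3))

lemma V_neq_0:
  assumes "q < 6" "a < 9" "a \<notin> set (avoiding q)"
  shows "V q a \<noteq> 0"
  unfolding V_def prod_list_zero_iff
proof
  assume "0 \<in> set (map (\<lambda>i. det3 l (ls ! a) (ls ! i)) (avoiding q))"
  then obtain i where i: "i \<in> set (avoiding q)" "det3 l (ls ! a) (ls ! i) = 0" by auto
  then have "i < 9" "a \<noteq> i" using avoiding_facts(2)[OF assms(1)] assms(3) by auto
  then show False using generic[OF assms(2)] i(2) by blast
qed

text \<open>The six explicit derivations lie in the 27-dimensional space for the nine lines; the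
  kernel of restriction to \<open>l\<close> has dimension 21 + dim syz_6. Independence of the
  restrictions is tested at the nine points of \<open>l\<close>.\<close>

lemma dim_syz_6_le:
  assumes Q: "Q \<subseteq> {..<6}"
    and ind: "\<And>e. (\<And>a. a < 9 \<Longrightarrow> (\<Sum>q\<in>Q. e q * V q a) = 0) \<Longrightarrow> \<forall>q\<in>Q. e q = 0"
  shows "T.dim (syz f 6) + card Q \<le> 6"
proof -
  have l0: "l \<noteq> 0" using indep by (simp add: pairwise_indep_def)
  obtain u w \<alpha> \<beta> \<mu> where lp: "line_param l u w \<alpha> \<beta> \<mu>" using line_param_exists[OF l0, of "{}"] by (metis empty_iff finite.emptyI)
  interpret line_param l u w \<alpha> \<beta> \<mu> by (rule lp)
  let ?f = "\<lambda>\<theta>. restr u w (der \<theta> (linear_form l))" and ?th = "\<lambda>q. dir_der (Pi q) (dirv q)"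
  have fin: "P.fin_dim (?f ` logder (rev ls) 6)"
    by (rule TP.fin_dim_image[OF linear_restr_der fin_dim_logder])
  have "card Q \<le> P.dim (?f ` logder (rev ls) 6)"
  proof (rule P.card_family_le_dim[OF fin])
    show "finite Q" using Q finite_subset by blast
    show "(\<lambda>q. ?f (?th q)) ` Q \<subseteq> ?f ` logder (rev ls) 6" using dirv_logder Q by blast
    fix c assume s: "(\<Sum>q\<in>Q. smult (c q) (?f (?th q))) = 0"
    let ?p = "\<Sum>q\<in>Q. const3 (c q) * (Pi q * const3 (dot3 l (dirv q)))"
    have "restr u w ?p = (\<Sum>q\<in>Q. smult (c q) (?f (?th q)))"
      by (simp add: restr_sum restr_mult restr_const3 der_dir_der mult.commute)
    then have "restr u w ?p = 0" using s by simp
    moreover have "homogeneous3 6 ?p"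
      using homogeneous3_Pi Q by (auto intro!: homogeneous3_sum homogeneous3_const3_mult simp: mult.commute[of "Pi _"])
    ultimately have van: "eval3 ?p v = 0" if "dot3 l v = 0" for v using restr_eq_0_iff that by blast
    \<comment> \<open>The nonzero factors \<open>dot3 l (dirv q)\<close> are absorbed into the
      coefficients of the relation.\<close>
    have "(\<Sum>q\<in>Q. (c q * dot3 l (dirv q)) * V q a) = 0" for a
      using van[of "cross3 l (ls ! a)"] by (simp add: ev.eval_in_sum ev.eval_in_mult eval3_Pi mult_ac)
    then have "\<forall>q\<in>Q. c q * dot3 l (dirv q) = 0" by (intro ind) blast
    then show "\<forall>q\<in>Q. c q = 0" using dot3_dirv Q by (metis lessThan_iff mult_eq_0_iff subsetD)
  qed
  moreover have "T.dim (logder (rev ls) 6) = P.dim (?f ` logder (rev ls) 6) + T.dim (logder (l # rev ls) 6)"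
    using TP.rank_nullity[OF linear_restr_der[of u w "linear_form l"] subspace_logder[of "rev ls" 6] fin_dim_logder]
    by (simp add: kernel_restr_der)
  moreover have "T.dim (logder (l # rev ls) 6) = T.dim (syz f 6) + 21"
    using dim_syz_logder[of 5] by (simp add: dim_forms_num)
  ultimately show ?thesis using dim_logder_9 by linarith
qed

text \<open>Evaluating at the point of \<open>l\<close> on the \<open>a\<close>-th line, only the terms of the two triple points on
  that line survive, so a relation is determined along the edges of the (connected) bipartite graph.\<close>

lemma syz_5: "syz f 5 = {0}"
proof -
  \<comment> \<open>Leaving out the triple point 0 makes the coefficients at its neighbours 1, 2 and
    5 vanish at once, and those at 3 and 4 follow. Rank at least five suffices.\<close>
  have "T.dim (syz f 6) + card {1, 2, 3, 4, 5 :: nat} \<le> 6"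
  proof (rule dim_syz_6_le)
    fix e :: "nat \<Rightarrow> complex"
    assume r: "\<And>a. a < 9 \<Longrightarrow> (\<Sum>q\<in>{1, 2, 3, 4, 5}. e q * V q a) = 0"
    have z: "e 1 = 0" using r[of 0] V_neq_0[of 1 0] by (simp add: V_eq_0 avoiding_simps)
    have z2: "e 2 = 0" using r[of 2] V_neq_0[of 2 2] by (simp add: V_eq_0 avoiding_simps)
    have z5: "e 5 = 0" using r[of 7] V_neq_0[of 5 7] by (simp add: V_eq_0 avoiding_simps)
    have z3: "e 3 = 0" using r[of 3] V_neq_0[of 3 3] z by (simp add: V_eq_0 avoiding_simps)
    have z4: "e 4 = 0" using r[of 5] V_neq_0[of 4 5] z by (simp add: V_eq_0 avoiding_simps)
    show "\<forall>q\<in>{1, 2, 3, 4, 5}. e q = 0" using z z2 z3 z4 z5 by simp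
  qed auto
  then have "T.dim (syz f (Suc 5)) \<le> 1" by simp
  then show ?thesis by (rule syz_eq_0_of_dim_le_1)
qed

lemma syz_6:
  assumes cyc: "V 1 0 * V 3 3 * V 2 1 * V 0 2 \<noteq> V 0 0 * V 1 3 * V 3 1 * V 2 2"
  shows "syz f 6 = {0}"
proof -
  have "T.dim (syz f 6) + card {0, 1, 2, 3, 4, 5 :: nat} \<le> 6"
  proof (rule dim_syz_6_le)
    fix e :: "nat \<Rightarrow> complex"
    assume r: "\<And>a. a < 9 \<Longrightarrow> (\<Sum>q\<in>{0, 1, 2, 3, 4, 5}. e q * V q a) = 0"
    have r0: "e 0 * V 0 0 = - (e 1 * V 1 0)" using r[of 0] by (simp add: V_eq_0 avoiding_simps eq_neg_iff_add_eq_0)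
    have r3: "e 1 * V 1 3 = - (e 3 * V 3 3)" using r[of 3] by (simp add: V_eq_0 avoiding_simps eq_neg_iff_add_eq_0)
    have r1: "e 3 * V 3 1 = - (e 2 * V 2 1)" using r[of 1] by (simp add: V_eq_0 avoiding_simps eq_neg_iff_add_eq_0 add.commute)
    have r2: "e 2 * V 2 2 = - (e 0 * V 0 2)" using r[of 2] by (simp add: V_eq_0 avoiding_simps eq_neg_iff_add_eq_0 add.commute)
    have "e 0 * (V 0 0 * V 1 3 * V 3 1 * V 2 2) = e 0 * (V 1 0 * V 3 3 * V 2 1 * V 0 2)"
    proof -
      have "e 0 * (V 0 0 * V 1 3 * V 3 1 * V 2 2) = (e 0 * V 0 0) * (V 1 3 * V 3 1 * V 2 2)" by (simp only: mult_ac)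
      also have "\<dots> = - ((e 1 * V 1 3) * (V 1 0 * V 3 1 * V 2 2))" unfolding r0 by simp
      also have "\<dots> = (e 3 * V 3 1) * (V 3 3 * V 1 0 * V 2 2)" unfolding r3 by simp
      also have "\<dots> = - ((e 2 * V 2 2) * (V 2 1 * V 3 3 * V 1 0))" unfolding r1 by simp
      also have "\<dots> = e 0 * (V 1 0 * V 3 3 * V 2 1 * V 0 2)" unfolding r2 by simp
      finally show ?thesis .
    qed
    then have z0: "e 0 = 0" using cyc by simp
    have z: "e 1 = 0" using r0 z0 V_neq_0[of 1 0] by (simp add: avoiding_simps)
    have z2: "e 2 = 0" using r2 z0 V_neq_0[of 2 2] by (simp add: avoiding_simps)
    have z3: "e 3 = 0" using r3 z V_neq_0[of 3 3] by (simp add: avoiding_simps)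
    have z5: "e 5 = 0" using r[of 7] z0 V_neq_0[of 5 7] by (simp add: V_eq_0 avoiding_simps)
    have z4: "e 4 = 0" using r[of 5] V_neq_0[of 4 5] z by (simp add: V_eq_0 avoiding_simps)
    show "\<forall>q\<in>{0, 1, 2, 3, 4, 5}. e q = 0" using z0 z z2 z3 z4 z5 by simp
  qed auto
  then show ?thesis using dim_syz_0 by simp
qed

end

section \<open>The two arrangements\<close>

type_synonym ivec = "int \<times> int \<times> int"

definition cv :: "ivec \<Rightarrow> vec3"
  where "cv = (\<lambda>(a, b, c). (of_int a, of_int b, of_int c))"

definition icross :: "ivec \<Rightarrow> ivec \<Rightarrow> ivec"
  where "icross = (\<lambda>(a, b, c) (x, y, z). (b * z - c * y, c * x - a * z, a * y - b * x))"

definition idet :: "ivec \<Rightarrow> ivec \<Rightarrow> ivec \<Rightarrow> int"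
  where "idet = (\<lambda>(a, b, c) m n. case icross m n of (x, y, z) \<Rightarrow> a * x + b * y + c * z)"

lemma cross3_cv: "cross3 (cv a) (cv b) = cv (icross a b)"
  by (cases a; cases b) (simp add: cv_def cross3_def icross_def)

lemma det3_cv: "det3 (cv a) (cv b) (cv c) = of_int (idet a b c)"
  by (cases a; cases b; cases c) (simp add: det3_def dot3_def cross3_cv, simp add: cv_def idet_def icross_def)

lemma cv_eq_0: "cv a = 0 \<longleftrightarrow> a = (0, 0, 0)"
  by (cases a) (simp add: cv_def zero_prod_def)

fun iconc :: "ivec \<Rightarrow> ivec list \<Rightarrow> nat"
  where "iconc l [] = 0"
  | "iconc l (k # ks) = (if list_ex (\<lambda>k'. idet l k k' = 0) ks then 1 else 0) + iconc l ks"

fun itotal_conc :: "ivec list \<Rightarrow> nat"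
  where "itotal_conc [] = 0"
  | "itotal_conc (l # ks) = iconc l ks + itotal_conc ks"

lemma conc_cv: "conc (cv l) (map cv ks) = iconc l ks"
  by (induction ks) (simp_all add: det3_cv list_ex_iff)

lemma total_conc_cv: "total_conc (map cv ks) = itotal_conc ks"
  by (induction ks) (simp_all add: conc_cv)

definition pairs9 :: "(nat \<times> nat) list"
  where "pairs9 = concat (map (\<lambda>j. map (\<lambda>i. (i, j)) [0..<j]) [0..<9])"

definition triples9 :: "(nat \<times> nat \<times> nat) list"
  where "triples9 = concat (map (\<lambda>k. concat (map (\<lambda>j. map (\<lambda>i. (i, j, k)) [0..<j]) [0..<k])) [0..<9])"

lemma upt_0_numeral:
    "[0..<2] = [0, 1]"
    "[0..<3] = [0, 1, 2]"
    "[0..<4] = [0, 1, 2, 3]"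
    "[0..<5] = [0, 1, 2, 3, 4]"
    "[0..<6] = [0, 1, 2, 3, 4, 5]"
    "[0..<7] = [0, 1, 2, 3, 4, 5, 6]"
    "[0..<8] = [0, 1, 2, 3, 4, 5, 6, 7]"
    "[0..<9] = [0, 1, 2, 3, 4, 5, 6, 7, 8]"
  by code_simp+

lemma set_pairs9: "(i, j) \<in> set pairs9 \<longleftrightarrow> i < j \<and> j < 9"
  by (auto simp: pairs9_def image_iff)

lemma set_triples9: "(i, j, k) \<in> set triples9 \<longleftrightarrow> i < j \<and> j < k \<and> k < 9"
  by (auto simp: triples9_def image_iff)

definition iarr :: "ivec list"
  where "iarr = [(1, 0, 0), (0, 1, 0), (1, -1, -1), (1, -1, 1), (2, 1, -2), (1, 3, -3),
    (3, 2, 3), (1, 5, 5), (7, -4, -1)]"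

definition iarr' :: "ivec list"
  where "iarr' = [(1, 0, 0), (0, 1, 0), (4, -5, -5), (1, -1, 1), (16, 13, -20), (1, 3, -3),
    (3, 2, 3), (1, 5, 5), (7, -4, -1)]"

lemma arr_cv: "arr_A = map cv iarr" "arr_A' = map cv iarr'"
  by (simp_all add: arr_A_def arr_A'_def iarr_def iarr'_def cv_def)

text \<open>Everything about an arrangement that is checked by computation. Both satisfy it with the
  same \<open>triples\<close>, so whatever follows from it alone holds for both.\<close>

definition admissible :: "ivec list \<Rightarrow> bool"
  where "admissible L \<longleftrightarrow> length L = 9 \<and>
    list_all (\<lambda>(i, j). icross (L ! i) (L ! j) \<noteq> (0, 0, 0)) pairs9 \<and>
    list_all (\<lambda>(i, j, k). (idet (L ! i) (L ! j) (L ! k) = 0) = ((i, j, k) \<in> set triples)) triples9 \<and>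
    itotal_conc (rev L) = 6"

lemma itotal_conc_iarr: "itotal_conc (rev iarr) = 6" "itotal_conc (rev iarr') = 6"
  by (simp_all add: iarr_def iarr'_def icross_def idet_def)

lemma pairs_iarr:
    "list_all (\<lambda>(i, j). icross (iarr ! i) (iarr ! j) \<noteq> (0, 0, 0)) pairs9"
    "list_all (\<lambda>(i, j). icross (iarr' ! i) (iarr' ! j) \<noteq> (0, 0, 0)) pairs9"
  by (simp_all add: pairs9_def iarr_def iarr'_def icross_def upt_0_numeral)

lemma triples_iarr:
    "list_all (\<lambda>(i, j, k). (idet (iarr ! i) (iarr ! j) (iarr ! k) = 0) = ((i, j, k) \<in> set triples)) triples9"
    "list_all (\<lambda>(i, j, k). (idet (iarr' ! i) (iarr' ! j) (iarr' ! k) = 0) = ((i, j, k) \<in> set triples)) triples9"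
  by (simp_all add: triples9_def iarr_def iarr'_def icross_def idet_def triples_def upt_0_numeral)

lemma admissible_iarr: "admissible iarr" "admissible iarr'"
  using itotal_conc_iarr pairs_iarr triples_iarr by (simp_all add: admissible_def iarr_def iarr'_def del: itotal_conc.simps)

text \<open>The triple points of both arrangements, as sets of indices of lines.\<close>

definition blocks :: "nat set set"
  where "blocks = {{0, 2, 7}, {0, 3, 5}, {1, 2, 4}, {1, 3, 6}, {4, 5, 8}, {6, 7, 8}}"

lemma blocks_meet:
  assumes "S \<in> blocks" "S' \<in> blocks" "i \<in> S" "i \<in> S'" "j \<in> S" "j \<in> S'" "i \<noteq> j"
  shows "S = S'"
proof -
  have "\<forall>S\<in>blocks. \<forall>S'\<in>blocks. S = S' \<or> (\<forall>i\<in>S. i \<in> S' \<longrightarrow> (\<forall>j\<in>S. j \<in> S' \<longrightarrow> i = j))"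
    unfolding blocks_def by simp
  then show ?thesis using assms by metis
qed

lemma triples_blocks:
  assumes "i < j" "j < k"
  shows "(i, j, k) \<in> set triples \<longleftrightarrow> {i, j, k} \<in> blocks"
proof
  assume "{i, j, k} \<in> blocks"
  \<comment> \<open>For increasing indices the ordered triple is recovered from the set, which
    transfers membership.\<close>
  moreover have "sorted_list_of_set {i, j, k} = [i, j, k]" using assms by (simp add: insort_remove1)
  ultimately have "[i, j, k] \<in> sorted_list_of_set ` blocks" by (metis image_eqI)
  then show "(i, j, k) \<in> set triples" by (simp add: blocks_def triples_def)
next
  have "(\<lambda>(i, j, k). {i, j, k}) ` set triples \<subseteq> blocks" by (simp add: blocks_def triples_def)
  then show "(i, j, k) \<in> set triples \<Longrightarrow> {i, j, k} \<in> blocks" by fastforce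
qed

section \<open>Nine lines of this configuration with a generic tenth\<close>

lemma other_index: "\<exists>j::nat. j < 9 \<and> i \<noteq> j"
  by (rule exI[of _ "if i = 0 then 1 else 0"]) simp

locale admissible_lines =
  fixes L :: "ivec list" and ls :: "vec3 list" and l :: vec3
  assumes adm: "admissible L" and ls: "ls = map cv L"
    and gen: "\<And>i j. i < j \<Longrightarrow> j < 9 \<Longrightarrow> det3 l (ls ! i) (ls ! j) \<noteq> 0"
begin

lemma len9: "length ls = 9" using adm by (simp add: admissible_def ls)

lemma nth_cv: "i < 9 \<Longrightarrow> ls ! i = cv (L ! i)" using adm by (simp add: admissible_def ls)

lemma cross_ls: "i < 9 \<Longrightarrow> j < 9 \<Longrightarrow> i \<noteq> j \<Longrightarrow> cross3 (ls ! i) (ls ! j) \<noteq> 0"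
proof -
  have *: "cross3 (ls ! i) (ls ! j) \<noteq> 0" if "i < j" "j < 9" for i j
  proof -
    have "(i, j) \<in> set pairs9" using that by (simp add: set_pairs9)
    then have "icross (L ! i) (L ! j) \<noteq> (0, 0, 0)" using adm unfolding admissible_def list_all_iff by blast
    then show ?thesis using that by (simp add: nth_cv cross3_cv cv_eq_0)
  qed
  show "i < 9 \<Longrightarrow> j < 9 \<Longrightarrow> i \<noteq> j \<Longrightarrow> cross3 (ls ! i) (ls ! j) \<noteq> 0"
    using *[of i j] *[of j i] cross3_nonzero(3) by (metis nat_neq_iff)
qed

lemma gen': "i < 9 \<Longrightarrow> j < 9 \<Longrightarrow> i \<noteq> j \<Longrightarrow> det3 l (ls ! i) (ls ! j) \<noteq> 0"
  using gen[of i j] gen[of j i] det3_swap[of l "ls ! j" "ls ! i"] by (metis nat_neq_iff neg_equal_0_iff_equal)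

lemma det_ls:
  assumes "i < 9" "j < 9" "k < 9" "i \<noteq> j" "i \<noteq> k" "j \<noteq> k"
  shows "det3 (ls ! i) (ls ! j) (ls ! k) = 0 \<longleftrightarrow> {i, j, k} \<in> blocks"
proof -
  have base: "det3 (ls ! i) (ls ! j) (ls ! k) = 0 \<longleftrightarrow> {i, j, k} \<in> blocks" if "i < j" "j < k" "k < 9" for i j k
  proof -
    have "(i, j, k) \<in> set triples9" using that by (simp add: set_triples9)
    then have "idet (L ! i) (L ! j) (L ! k) = 0 \<longleftrightarrow> (i, j, k) \<in> set triples"
      using adm unfolding admissible_def list_all_iff by blast
    then show ?thesis using that by (simp add: nth_cv det3_cv triples_blocks)
  qed
  have sw: "det3 a c b = 0 \<longleftrightarrow> det3 a b c = 0" for a b c using det3_swap[of a b c] by simp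
  have rot: "det3 b c a = 0 \<longleftrightarrow> det3 a b c = 0" for a b c using det3_rotate[of a b c] by simp
  have sets: "{i, k, j} = {i, j, k}" "{j, i, k} = {i, j, k}" "{j, k, i} = {i, j, k}" "{k, i, j} = {i, j, k}" "{k, j, i} = {i, j, k}"
    by auto
  consider "i < j" "j < k" | "i < k" "k < j" | "j < i" "i < k" | "j < k" "k < i" | "k < i" "i < j" | "k < j" "j < i"
    using assms by linarith
  then show ?thesis
  proof cases
    case 1
    then show ?thesis using base assms by blast
  next
    case 2
    then show ?thesis using base[of i k j] assms sw sets by metis
  next
    case 3
    then show ?thesis using base[of j i k] assms sw rot sets by metis
  next
    case 4
    then show ?thesis using base[of j k i] assms rot sets by metis
  next
    case 5
    then show ?thesis using base[of k i j] assms rot sets by metis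
  next
    case 6
    then show ?thesis using base[of k j i] assms sw rot sets by metis
  qed
qed

lemma indep_ls: "pairwise_indep ls"
  unfolding pairwise_indep_def
proof (intro conjI ballI impI)
  show "distinct ls"
    unfolding distinct_conv_nth len9 using cross_ls cross3_nonzero(4) by blast
  fix k assume "k \<in> set ls"
  then obtain i where i: "i < 9" "k = ls ! i" unfolding in_set_conv_nth len9 by blast
  obtain j where "j < 9" "i \<noteq> j" using other_index by blast
  then have "cross3 k (ls ! j) \<noteq> 0" using cross_ls i by blast
  then show "k \<noteq> 0" by (rule cross3_nonzero)
  fix k' assume "k' \<in> set ls" "k \<noteq> k'"
  then obtain j where j: "j < 9" "k' = ls ! j" unfolding in_set_conv_nth len9 by blast
  then show "cross3 k k' \<noteq> 0" using cross_ls i \<open>k \<noteq> k'\<close> by blast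
qed

lemma det_l: "k \<in> set ls \<Longrightarrow> k' \<in> set ls \<Longrightarrow> k \<noteq> k' \<Longrightarrow> det3 l k k' \<noteq> 0"
  unfolding in_set_conv_nth len9 using gen' by blast

lemma indep_Cons: "pairwise_indep (l # ls)"
  unfolding pairwise_indep_Cons
proof (intro conjI ballI)
  have "det3 l (ls ! 0) (ls ! 1) \<noteq> 0" using gen' by simp
  then have "cross3 l (ls ! 0) \<noteq> 0" using cross3_of_det3 by blast
  then show "l \<noteq> 0" by (rule cross3_nonzero)
  fix k assume "k \<in> set ls"
  then obtain i where i: "i < 9" "k = ls ! i" unfolding in_set_conv_nth len9 by blast
  obtain j where "j < 9" "i \<noteq> j" using other_index by blast
  then have "det3 l k (ls ! j) \<noteq> 0" using gen' i by blast
  then show "cross3 l k \<noteq> 0" using cross3_of_det3 by blast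
qed (rule indep_ls)

text \<open>Two triple points share at most one line, and \<open>l\<close> passes through no
  intersection of two others.\<close>

lemma triple_ls: "at_most_triple (l # ls)"
proof -
  have inner: False if m: "i < 9" "j < 9" "k < 9" "m < 9" and d: "distinct [i, j, k, m]"
    and z: "det3 (ls ! i) (ls ! j) (ls ! k) = 0" "det3 (ls ! i) (ls ! j) (ls ! m) = 0" for i j k m
  proof -
    have "{i, j, k} \<in> blocks" "{i, j, m} \<in> blocks" using det_ls m d z by auto
    then have "{i, j, k} = {i, j, m}" using blocks_meet[of "{i, j, k}" "{i, j, m}" i j] d by simp
    then show False using d by auto
  qed
  show ?thesis
    unfolding at_most_triple_def
  proof (intro ballI impI notI)
    fix a b c d assume m: "a \<in> set (l # ls)" "b \<in> set (l # ls)" "c \<in> set (l # ls)" "d \<in> set (l # ls)"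
      and dist: "distinct [a, b, c, d]" and z: "det3 a b c = 0 \<and> det3 a b d = 0"
    have l_free: "det3 l k k' \<noteq> 0 \<and> det3 k l k' \<noteq> 0 \<and> det3 k k' l \<noteq> 0"
      if "k \<in> set ls" "k' \<in> set ls" "k \<noteq> k'" for k k'
      using det_l[OF that] det_l[OF that(2,1)] that(3) det3_rotate[of l k k'] det3_rotate[of k l k'] by metis
    consider "a = l" | "b = l" | "c = l" | "d = l" | "a \<in> set ls" "b \<in> set ls" "c \<in> set ls" "d \<in> set ls" using m by auto
    then show False
    proof cases
      case 1
      then have "b \<in> set ls" "c \<in> set ls" "b \<noteq> c" using m dist by auto
      then show False using l_free z 1 by blast
    next
      case 2
      then have "a \<in> set ls" "c \<in> set ls" "a \<noteq> c" using m dist by auto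
      then show False using l_free z 2 by blast
    next
      case 3
      then have "a \<in> set ls" "b \<in> set ls" "a \<noteq> b" using m dist by auto
      then show False using l_free z 3 by blast
    next
      case 4
      then have "a \<in> set ls" "b \<in> set ls" "a \<noteq> b" using m dist by auto
      then show False using l_free z 4 by blast
    next
      case 5
      then obtain i j k m' where ix: "i < 9" "j < 9" "k < 9" "m' < 9" "a = ls ! i" "b = ls ! j" "c = ls ! k" "d = ls ! m'"
        unfolding in_set_conv_nth len9 by blast
      then have "distinct [i, j, k, m']" using dist by auto
      then show False using inner[OF ix(1-4)] z ix by blast
    qed
  qed
qed

lemma conc_l_0: "set ks \<subseteq> set ls \<Longrightarrow> distinct ks \<Longrightarrow> conc l ks = 0"
proof (induction ks)
  case (Cons k ks)
  then have "\<not> (\<exists>k'\<in>set ks. det3 l k k' = 0)" using det_l[of k] by (metis distinct.simps(2) insert_subset list.set(2) subsetD)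
  then show ?case using Cons by simp
qed simp

sublocale six_triple_points l ls
proof
  have "set (l # rev ls) = set (l # ls)" by simp
  then show "pairwise_indep (l # rev ls)" using indep_Cons unfolding pairwise_indep_def by (metis distinct.simps(2) distinct_rev set_rev)
  show "at_most_triple (l # rev ls)" using triple_ls \<open>set (l # rev ls) = set (l # ls)\<close> unfolding at_most_triple_def by metis
  show "length (rev ls) = 9" by (simp add: len9)
  show "conc l (rev ls) = 0" by (rule conc_l_0) (use indep_ls in \<open>simp_all add: pairwise_indep_def\<close>)
  show "total_conc (rev ls) = 6" using adm by (simp add: ls rev_map total_conc_cv admissible_def)
  show "\<exists>xs c b a. rev ls = xs @ [c, b, a] \<and> det3 c b a \<noteq> 0"
  proof -
    have "length ls = Suc (Suc (Suc 6))" using len9 by simp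
    then obtain a b c xs where abc: "ls = a # b # c # xs" unfolding length_Suc_conv by blast
    then have "rev ls = rev xs @ [ls ! 2, ls ! 1, ls ! 0]" by simp
    moreover have "{2, 1, 0} \<notin> blocks" by (auto simp: blocks_def)
    then have "det3 (ls ! 2) (ls ! 1) (ls ! 0) \<noteq> 0" using det_ls[of 2 1 0] by simp
    ultimately show ?thesis by blast
  qed
  show "det3 (ls ! i) (ls ! j) (ls ! k) = 0" if "(i, j, k) \<in> set triples" for i j k
  proof -
    have "i < 9 \<and> j < 9 \<and> k < 9 \<and> i < j \<and> j < k" using that by (auto simp: triples_def)
    then show ?thesis using det_ls[of i j k] triples_blocks[of i j k] that by simp
  qed
qed (rule gen')

lemma defining_poly_snoc: "defining_poly (ls @ [l]) = f"
proof -
  have "defining_poly (l # rev ls) = (\<Prod>k\<in>set (l # rev ls). linear_form k)"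
    using ten_lines_axioms unfolding ten_lines_def by (simp add: defining_poly_def pairwise_indep_def prod.distinct_set_conv_list del: list.set set_rev)
  moreover have "distinct (ls @ [l])" using indep_Cons by (auto simp: pairwise_indep_def)
  then have "defining_poly (ls @ [l]) = (\<Prod>k\<in>set (ls @ [l]). linear_form k)"
    by (simp add: defining_poly_def prod.distinct_set_conv_list del: set_append)
  moreover have "set (ls @ [l]) = set (l # rev ls)" by auto
  ultimately show ?thesis by simp
qed

lemma indep_snoc: "pairwise_indep (ls @ [l])"
proof -
  have "set (ls @ [l]) = set (l # ls)" "distinct (ls @ [l]) \<longleftrightarrow> distinct (l # ls)" by auto
  then show ?thesis using indep_Cons unfolding pairwise_indep_def by metis
qed

text \<open>The right-hand side mentions indices only, so it is the same for both arrangements and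
  gives the lattice isomorphism.\<close>

lemma det_snoc:
  assumes "i < 10" "j < 10" "k < 10"
  shows "det3 ((ls @ [l]) ! i) ((ls @ [l]) ! j) ((ls @ [l]) ! k) = 0 \<longleftrightarrow> i = j \<or> i = k \<or> j = k \<or> {i, j, k} \<in> blocks"
proof (cases "i = j \<or> i = k \<or> j = k")
  case True
  then show ?thesis by auto
next
  case False
  have n: "(ls @ [l]) ! a = (if a = 9 then l else ls ! a)" if "a < 10" for a
    using that len9 by (simp add: nth_append)
  have b9: "9 \<notin> S" if "S \<in> blocks" for S using that by (auto simp: blocks_def)
  have l_free: "det3 l (ls ! a) (ls ! b) \<noteq> 0 \<and> det3 (ls ! a) l (ls ! b) \<noteq> 0 \<and> det3 (ls ! a) (ls ! b) l \<noteq> 0"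
    if "a < 9" "b < 9" "a \<noteq> b" for a b
    using gen'[OF that] gen'[OF that(2,1)] that(3) det3_rotate[of l "ls ! a" "ls ! b"] det3_rotate[of "ls ! a" l "ls ! b"]
    by metis
  have nine: "a = 9 \<or> a < 9" if "a < 10" for a :: nat using that by linarith
  consider "i = 9" "j < 9" "k < 9" | "j = 9" "i < 9" "k < 9" | "k = 9" "i < 9" "j < 9" | "i < 9" "j < 9" "k < 9"
    using assms False nine by metis
  then show ?thesis
  proof cases
    case 1
    then show ?thesis using False l_free[of j k] b9[of "{i, j, k}"] by (auto simp: n)
  next
    case 2
    then show ?thesis using False l_free[of i k] b9[of "{i, j, k}"] by (auto simp: n)
  next
    case 3
    then show ?thesis using False l_free[of i j] b9[of "{i, j, k}"] by (auto simp: n)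
  next
    case 4
    then show ?thesis using False det_ls[of i j k] by (simp add: n)
  qed
qed

end

lemma isomorphic_lattices_snoc:
  assumes "admissible_lines L ls l" "admissible_lines L' ls' l'"
  shows "isomorphic_lattices (ls @ [l]) (ls' @ [l'])"
proof -
  interpret A: admissible_lines L ls l by fact
  interpret A': admissible_lines L' ls' l' by fact
  show ?thesis
    by (rule isomorphic_lattices_nth[OF A.indep_snoc A'.indep_snoc])
       (simp_all only: length_append A.len9 A'.len9 list.size add_0 A.det_snoc A'.det_snoc numeral_plus_one semiring_norm add_Suc_right add_0_right Suc_numeral)
qed

lemma line_inj:
  assumes "pairwise_indep ls" "k \<in> set ls" "k' \<in> set ls" "line k = line k'"
  shows "k = k'"
  using assms point_on_line_not_on_line[of k k'] unfolding pairwise_indep_def by metis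

lemma pairwise_indep_line_arrangement:
  assumes "pairwise_indep ls" "ls \<noteq> []"
  shows "line_arrangement ls"
  using assms line_inj[OF assms(1)] unfolding line_arrangement_def
  by (auto simp: distinct_map inj_on_def pairwise_indep_def zero_prod_def)

lemma (in admissible_lines) line_generic:
  "line l \<notin> line ` set ls" "line l \<inter> multiple_points ls = {}"
proof -
  have "l \<notin> set ls" using indep_Cons by (simp add: pairwise_indep_def)
  then show "line l \<notin> line ` set ls" using line_inj[OF indep_Cons, of l] by (metis imageE list.set_intros)
  have False if P: "P \<in> line l" "P \<in> multiple_points ls" for P
  proof -
    obtain k k' where k: "k \<in> set ls" "k' \<in> set ls" "line k \<noteq> line k'" "P \<in> line k" "P \<in> line k'"
      using P(2) unfolding multiple_points_def by blast
    then have "k \<noteq> k'" by blast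
    then have c: "cross3 k k' \<noteq> 0" using indep_ls k unfolding pairwise_indep_def by blast
    then show False using meet_unique[OF c k(4,5)] meet_in_line[OF c] P(1) det_l[OF k(1,2) \<open>k \<noteq> k'\<close>] by blast
  qed
  then show "line l \<inter> multiple_points ls = {}" by blast
qed

section \<open>A logarithmic derivation of degree five of the first arrangement\<close>

definition poly_of :: "(int \<times> nat \<times> nat \<times> nat) list \<Rightarrow> poly3"
  where "poly_of xs = (\<Sum>(c, i, j, k)\<leftarrow>xs. const3 (of_int c) * (poly_x ^ i * poly_y ^ j * poly_z ^ k))"

lemma eval3_poly_of: "eval3 (poly_of xs) (x, y, z) = (\<Sum>(c, i, j, k)\<leftarrow>xs. of_int c * (x ^ i * y ^ j * z ^ k))"
  by (induction xs) (auto simp: poly_of_def ev.eval_in_add ev.eval_in_mult ev.eval_in_power)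

lemma homogeneous3_poly_of:
  "list_all (\<lambda>(c, i, j, k). i + j + k = d) xs \<Longrightarrow> homogeneous3 d (poly_of xs)"
proof (induction xs)
  case (Cons a xs)
  obtain c i j k where a: "a = (c, i, j, k)" by (cases a)
  have "homogeneous3 (1 * i + 1 * j + 1 * k) (poly_x ^ i * poly_y ^ j * poly_z ^ k)"
    by (intro homogeneous3_mult homogeneous3_power homogeneous3_vars)
  then show ?case using Cons by (auto simp: a poly_of_def intro!: homogeneous3_add homogeneous3_const3_mult)
qed (simp add: poly_of_def)

text \<open>The derivation \<open>(0, rho_b, rho_c)\<close> was found by solving the linear system that expresses tangency to
  the nine lines; for \<^const>\<open>arr_A'\<close> that system has no such solution.\<close>

definition rho_b :: poly3
  where "rho_b = poly_of [(1, 4, 1, 0), (- 5, 3, 2, 0), (- 48, 3, 1, 1), (5, 2, 3, 0), (- 57, 2, 2, 1), (- 30, 2, 1, 2), (- 5, 1, 4, 0), (- 84, 1, 3, 1), (61, 1, 2, 2), (248, 1, 1, 3), (4, 0, 5, 0), (75, 0, 4, 1), (- 9, 0, 3, 2), (- 143, 0, 2, 3), (- 27, 0, 1, 4)]"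

definition rho_c :: poly3
  where "rho_c = poly_of [(7, 5, 0, 0), (41, 4, 1, 0), (13, 4, 0, 1), (27, 3, 2, 0), (- 26, 3, 1, 1), (- 114, 3, 0, 2), (- 75, 2, 3, 0), (- 11, 2, 2, 1), (52, 2, 1, 2), (2, 2, 0, 3), (- 16, 1, 4, 0), (30, 1, 3, 1), (73, 1, 2, 2), (26, 1, 1, 3), (107, 1, 0, 4), (16, 0, 5, 0), (9, 0, 3, 2), (- 17, 0, 2, 3), (- 93, 0, 1, 4), (- 15, 0, 0, 5)]"

lemma eval3_rho_b: "eval3 rho_b (x, y, z) = x ^ 4 * y + (- 5) * x ^ 3 * y ^ 2 + (- 48) * x ^ 3 * y * z + 5 * x ^ 2 * y ^ 3 + (- 57) * x ^ 2 * y ^ 2 * z + (- 30) * x ^ 2 * y * z ^ 2 + (- 5) * x * y ^ 4 + (- 84) * x * y ^ 3 * z + 61 * x * y ^ 2 * z ^ 2 + 248 * x * y * z ^ 3 + 4 * y ^ 5 + 75 * y ^ 4 * z + (- 9) * y ^ 3 * z ^ 2 + (- 143) * y ^ 2 * z ^ 3 + (- 27) * y * z ^ 4"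
  unfolding rho_b_def eval3_poly_of by simp

lemma eval3_rho_c: "eval3 rho_c (x, y, z) = 7 * x ^ 5 + 41 * x ^ 4 * y + 13 * x ^ 4 * z + 27 * x ^ 3 * y ^ 2 + (- 26) * x ^ 3 * y * z + (- 114) * x ^ 3 * z ^ 2 + (- 75) * x ^ 2 * y ^ 3 + (- 11) * x ^ 2 * y ^ 2 * z + 52 * x ^ 2 * y * z ^ 2 + 2 * x ^ 2 * z ^ 3 + (- 16) * x * y ^ 4 + 30 * x * y ^ 3 * z + 73 * x * y ^ 2 * z ^ 2 + 26 * x * y * z ^ 3 + 107 * x * z ^ 4 + 16 * y ^ 5 + 9 * y ^ 3 * z ^ 2 + (- 17) * y ^ 2 * z ^ 3 + (- 93) * y * z ^ 4 + (- 15) * z ^ 5"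
  unfolding rho_c_def eval3_poly_of by simp

text \<open>Each hypothesis parametrises one line with integer coefficients, which turns tangency
  into a polynomial identity. On 3x + 2y + 3z = 0 no variable can be eliminated over the integers,
  hence the parameter \<open>w\<close>. The line x = 0 is absent because the first component of the
  derivation is zero.\<close>

lemma rho_parametrized:
  fixes x y z :: complex
  defines "b \<equiv> eval3 rho_b (x, y, z)" and "c \<equiv> eval3 rho_c (x, y, z)"
  shows "y = 0 \<Longrightarrow> b = 0"
    "x = y + z \<Longrightarrow> b + c = 0"
    "x = y - z \<Longrightarrow> c - b = 0"
    "y = 2 * z - 2 * x \<Longrightarrow> b - 2 * c = 0"
    "x = 3 * z - 3 * y \<Longrightarrow> b - c = 0"
    "x = 2 * w - z \<Longrightarrow> y = - 3 * w \<Longrightarrow> 2 * b + 3 * c = 0"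
    "x = - 5 * y - 5 * z \<Longrightarrow> b + c = 0"
    "z = 7 * x - 4 * y \<Longrightarrow> 4 * b + c = 0"
  by (simp_all only: b_def c_def eval3_rho_b eval3_rho_c) (simp_all add: algebra_simps eval_nat_numeral)

lemma rho_lines:
  assumes "(k1, k2, k3) \<in> set arr_A" "dot3 (k1, k2, k3) (x, y, z) = 0"
  shows "k2 * eval3 rho_b (x, y, z) + k3 * eval3 rho_c (x, y, z) = 0"
proof -
  let ?b = "eval3 rho_b (x, y, z)" and ?c = "eval3 rho_c (x, y, z)" and ?w = "(x + z) / 2"
  have "y = dot3 (0, 1, 0) (x, y, z)"
    "x = dot3 (1, -1, -1) (x, y, z) + (y + z)"
    "x = dot3 (1, -1, 1) (x, y, z) + (y - z)"
    "y = dot3 (2, 1, -2) (x, y, z) + (2 * z - 2 * x)"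
    "x = dot3 (1, 3, -3) (x, y, z) + (3 * z - 3 * y)"
    "y = dot3 (3, 2, 3) (x, y, z) / 2 + - 3 * ?w"
    "x = dot3 (1, 5, 5) (x, y, z) + (- 5 * y - 5 * z)"
    "z = - dot3 (7, -4, -1) (x, y, z) + (7 * x - 4 * y)"
    by (simp_all add: dot3_def field_simps)
  note eqs = this
  have "dot3 (0, 1, 0) (x, y, z) = 0 \<Longrightarrow> ?b = 0"
    "dot3 (1, -1, -1) (x, y, z) = 0 \<Longrightarrow> ?c = - ?b"
    "dot3 (1, -1, 1) (x, y, z) = 0 \<Longrightarrow> ?c - ?b = 0"
    "dot3 (2, 1, -2) (x, y, z) = 0 \<Longrightarrow> ?b - 2 * ?c = 0"
    "dot3 (1, 3, -3) (x, y, z) = 0 \<Longrightarrow> ?b - ?c = 0"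
    "dot3 (3, 2, 3) (x, y, z) = 0 \<Longrightarrow> 2 * ?b + 3 * ?c = 0"
    "dot3 (1, 5, 5) (x, y, z) = 0 \<Longrightarrow> ?c = - ?b"
    "dot3 (7, -4, -1) (x, y, z) = 0 \<Longrightarrow> ?c = - (4 * ?b)"
  proof goal_cases
    case 1 then show ?case using eqs(1) by (intro rho_parametrized) simp
  next
    case 2
    then have "?b + ?c = 0" using eqs(2) by (intro rho_parametrized(2)) simp
    then show ?case by (simp only: add_eq_0_iff)
  next
    case 3 then show ?case using eqs(3) by (intro rho_parametrized(3)) simp
  next
    case 4 then show ?case using eqs(4) by (intro rho_parametrized(4)) simp
  next
    case 5 then show ?case using eqs(5) by (intro rho_parametrized(5)) simp
  next
    case 6
    then have "y = - 3 * ?w" using eqs(6) by simp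
    then show ?case by (intro rho_parametrized(6)[of x ?w z y]) (simp_all add: field_simps)
  next
    case 7
    then have "?b + ?c = 0" using eqs(7) by (intro rho_parametrized(7)) simp
    then show ?case by (simp only: add_eq_0_iff)
  next
    case 8
    then have "4 * ?b + ?c = 0" using eqs(8) by (intro rho_parametrized(8)) simp
    then show ?case by (simp only: add_eq_0_iff)
  qed
  then show ?thesis
    using assms unfolding arr_A_def by (auto simp: algebra_simps)
qed

lemma rho_logder: "(0, rho_b, rho_c) \<in> logder (rev arr_A) 5"
proof -
  have "homogeneous3 5 rho_b" "homogeneous3 5 rho_c"
    unfolding rho_b_def rho_c_def by (rule homogeneous3_poly_of, simp)+
  moreover have "eval3 (der (0, rho_b, rho_c) (linear_form k)) v = 0" if "k \<in> set arr_A" "dot3 k v = 0" for k v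
  proof -
    obtain x y z where v: "v = (x, y, z)" by (cases v)
    obtain k1 k2 k3 where k: "k = (k1, k2, k3)" by (cases k)
    have "eval3 (der (0, rho_b, rho_c) (linear_form k)) v = k2 * eval3 rho_b v + k3 * eval3 rho_c v"
      by (simp add: k der_linear_form ev.eval_in_add ev.eval_in_mult)
    then show ?thesis using that rho_lines unfolding v k by simp
  qed
  ultimately show ?thesis by (simp add: logder_def tforms_iff del: split_paired_All)
qed

lemma rho_c_nonzero: "rho_c \<noteq> 0"
proof
  assume "rho_c = 0"
  then have "eval3 rho_c (1, 0, 0) = 0" by simp
  then show False by (simp add: rho_c_def eval3_poly_of)
qed

section \<open>Generic lines\<close>

lemma dot3_commute: "dot3 a b = dot3 b a"
  by (cases a; cases b) (simp add: dot3_def mult.commute)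

text \<open>As a form in the added line it vanishes exactly when that line passes through an
  intersection point of two of the nine.\<close>

definition gen_poly :: "vec3 list \<Rightarrow> poly3"
  where "gen_poly ls = (\<Prod>(i, j)\<leftarrow>pairs9. linear_form (cross3 (ls ! i) (ls ! j)))"

text \<open>The values \<open>V\<close> as forms of degree six on the dual plane.\<close>

definition W :: "vec3 list \<Rightarrow> nat \<Rightarrow> nat \<Rightarrow> poly3"
  where "W ls q a = (\<Prod>i\<leftarrow>avoiding q. linear_form (cross3 (ls ! a) (ls ! i)))"

text \<open>The obstruction to solving the relations between the triple points along the closed walk through
  the lines \<open>0, 3, 1, 2\<close>, as a form in the added line. For \<^const>\<open>arr_A\<close> it vanishes identically.\<close>

definition cycle_poly :: "vec3 list \<Rightarrow> poly3"
  where "cycle_poly ls = W ls 1 0 * W ls 3 3 * W ls 2 1 * W ls 0 2 - W ls 0 0 * W ls 1 3 * W ls 3 1 * W ls 2 2"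

lemma eval3_gen_poly: "eval3 (gen_poly ls) l \<noteq> 0 \<longleftrightarrow> (\<forall>i j. i < j \<longrightarrow> j < 9 \<longrightarrow> det3 l (ls ! i) (ls ! j) \<noteq> 0)"
proof -
  have "eval3 (gen_poly ls) l = (\<Prod>(i, j)\<leftarrow>pairs9. det3 (ls ! i) (ls ! j) l)"
    using det3_rotate
    by (simp add: gen_poly_def ev.eval_in_prod_list o_def case_prod_unfold eval3_linear_form det3_def dot3_commute)
  also have "\<dots> \<noteq> 0 \<longleftrightarrow> (\<forall>i j. (i, j) \<in> set pairs9 \<longrightarrow> det3 (ls ! i) (ls ! j) l \<noteq> 0)"
    by (auto simp: prod_list_zero_iff image_iff)
  finally show ?thesis unfolding set_pairs9 using det3_rotate by metis
qed

lemma homogeneous3_gen_poly: "homogeneous3 (length pairs9) (gen_poly ls)"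
proof -
  have "homogeneous3 (length (map (\<lambda>(i, j). linear_form (cross3 (ls ! i) (ls ! j))) pairs9)) (gen_poly ls)"
    unfolding gen_poly_def by (rule homogeneous3_prod_list) auto
  then show ?thesis by simp
qed

lemma homogeneous3_W: "q < 4 \<Longrightarrow> homogeneous3 6 (W ls q a)"
proof -
  assume "q < 4"
  then have "q = 0 \<or> q = 1 \<or> q = 2 \<or> q = 3" by linarith
  then have "length (avoiding q) = 6" by (elim disjE; simp add: avoiding_def)
  moreover have "homogeneous3 (length (map (\<lambda>i. linear_form (cross3 (ls ! a) (ls ! i))) (avoiding q))) (W ls q a)"
    unfolding W_def by (rule homogeneous3_prod_list) auto
  ultimately show ?thesis by simp
qed

lemma homogeneous3_cycle_poly: "homogeneous3 24 (cycle_poly ls)"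
proof -
  have "homogeneous3 (6 + 6 + 6 + 6) (cycle_poly ls)"
    unfolding cycle_poly_def by (intro homogeneous3_diff homogeneous3_mult homogeneous3_W) simp_all
  then show ?thesis by simp
qed

lemma eval3_W: "eval3 (W ls q a) l = (\<Prod>i\<leftarrow>avoiding q. det3 l (ls ! a) (ls ! i))"
proof -
  have "dot3 (cross3 k m) l = det3 l k m" for k m by (simp add: det3_def dot3_commute)
  then show ?thesis by (simp add: W_def ev.eval_in_prod_list o_def eval3_linear_form)
qed

lemma (in six_triple_points) cycle_poly_V:
  "eval3 (cycle_poly ls) l = V 1 0 * V 3 3 * V 2 1 * V 0 2 - V 0 0 * V 1 3 * V 3 1 * V 2 2"
  by (simp add: cycle_poly_def ev.eval_in_diff ev.eval_in_mult eval3_W V_def)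

text \<open>The singleton \<open>{g}\<close> matches the shape required by
  \<open>zariski_closed\<close>.\<close>

definition zero_locus :: "poly3 \<Rightarrow> point set"
  where "zero_locus g = {P \<in> proj_plane. \<forall>p\<in>P. \<forall>h\<in>{g}. eval3 h p = 0}"

lemma zariski_closed_zero_locus: "homogeneous3 d g \<Longrightarrow> zariski_closed (zero_locus g)"
  unfolding zariski_closed_def zero_locus_def by blast

lemma zero_locus_iff:
  assumes "homogeneous3 d g" "v \<noteq> 0"
  shows "proj_point v \<in> zero_locus g \<longleftrightarrow> eval3 g v = 0"
proof -
  have "proj_point v \<in> proj_plane" using assms(2) unfolding proj_plane_def zero_prod_def by blast
  moreover have "(\<forall>p\<in>proj_point v. eval3 g p = 0) \<longleftrightarrow> eval3 g v = 0"
    using self_in_proj_point[of v] unfolding proj_point_smult3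
    by (auto simp only: eval3_homogeneous[OF assms(1)] mult_zero_right)
  ultimately show ?thesis by (simp add: zero_locus_def)
qed

lemma zero_locus_proper:
  assumes "homogeneous3 d g" "v \<noteq> 0" "eval3 g v \<noteq> 0"
  shows "zero_locus g \<noteq> proj_plane"
proof -
  have "proj_point v \<in> proj_plane" using assms(2) unfolding proj_plane_def zero_prod_def by blast
  then show ?thesis using zero_locus_iff[OF assms(1,2)] assms(3) by blast
qed

definition iW :: "ivec list \<Rightarrow> ivec \<Rightarrow> nat \<Rightarrow> nat \<Rightarrow> int"
  where "iW L l q a = prod_list (map (\<lambda>i. idet l (L ! a) (L ! i)) (avoiding q))"

text \<open>The line x + y + 2z = 0 shows that neither exceptional locus is the whole dual plane;
  the last value is where the second arrangement differs from the first.\<close>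

lemma witness_lines:
  "list_all (\<lambda>(i, j). idet (1, 1, 2) (iarr ! i) (iarr ! j) \<noteq> 0) pairs9"
  "list_all (\<lambda>(i, j). idet (1, 1, 2) (iarr' ! i) (iarr' ! j) \<noteq> 0) pairs9"
  "iW iarr' (1, 1, 2) 1 0 * iW iarr' (1, 1, 2) 3 3 * iW iarr' (1, 1, 2) 2 1 * iW iarr' (1, 1, 2) 0 2
    - iW iarr' (1, 1, 2) 0 0 * iW iarr' (1, 1, 2) 1 3 * iW iarr' (1, 1, 2) 3 1 * iW iarr' (1, 1, 2) 2 2 \<noteq> 0"
  by (simp_all add: pairs9_def iarr_def iarr'_def icross_def idet_def iW_def avoiding_def upt_0_numeral)


lemma eval3_gen_poly_cv:
  assumes "length L = 9" "list_all (\<lambda>(i, j). idet m (L ! i) (L ! j) \<noteq> 0) pairs9"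
  shows "eval3 (gen_poly (map cv L)) (cv m) \<noteq> 0"
  unfolding eval3_gen_poly
proof (intro allI impI)
  fix i j :: nat assume ij: "i < j" "j < 9"
  then have "(i, j) \<in> set pairs9" by (simp add: set_pairs9)
  then have "idet m (L ! i) (L ! j) \<noteq> 0" using assms(2) unfolding list_all_iff by blast
  then show "det3 (cv m) (map cv L ! i) (map cv L ! j) \<noteq> 0" using ij assms(1) by (simp add: det3_cv)
qed

lemma eval3_W_cv:
  assumes "length L = 9" "q < 4" "a < 9"
  shows "eval3 (W (map cv L) q a) (cv m) = of_int (iW L m q a)"
proof -
  have *: "(\<Prod>i\<leftarrow>xs. det3 (cv m) (map cv L ! a) (map cv L ! i)) = of_int (\<Prod>i\<leftarrow>xs. idet m (L ! a) (L ! i))"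
    if "\<forall>i\<in>set xs. i < 9" for xs
    using that assms by (induction xs) (simp_all add: det3_cv)
  have "q = 0 \<or> q = 1 \<or> q = 2 \<or> q = 3" using assms(2) by linarith
  then have "\<forall>i\<in>set (avoiding q). i < 9" by (elim disjE; simp add: avoiding_def)
  from *[OF this] show ?thesis by (simp add: eval3_W iW_def)
qed

definition exc_A :: "point set" where "exc_A = zero_locus (gen_poly arr_A)"
text \<open>Here the line must also avoid the cycle obstruction; the product describes the union of
  both loci by one form.\<close>

definition exc_A' :: "point set" where "exc_A' = zero_locus (gen_poly arr_A' * cycle_poly arr_A')"

lemma homogeneous3_exc_A': "homogeneous3 (length pairs9 + 24) (gen_poly arr_A' * cycle_poly arr_A')"
  by (intro homogeneous3_mult homogeneous3_gen_poly homogeneous3_cycle_poly)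

lemma zariski_closed_exc: "zariski_closed exc_A" "zariski_closed exc_A'"
  unfolding exc_A_def exc_A'_def
  using zariski_closed_zero_locus homogeneous3_gen_poly homogeneous3_exc_A' by blast+

lemma length_iarr: "length iarr = 9" "length iarr' = 9"
  by (simp_all add: iarr_def iarr'_def)

lemma witness_nonzero: "cv (1, 1, 2) \<noteq> 0"
  by (simp add: cv_eq_0)

lemma witness_gen:
  "eval3 (gen_poly arr_A) (cv (1, 1, 2)) \<noteq> 0"
  "eval3 (gen_poly arr_A' * cycle_poly arr_A') (cv (1, 1, 2)) \<noteq> 0"
proof -
  show "eval3 (gen_poly arr_A) (cv (1, 1, 2)) \<noteq> 0"
    unfolding arr_cv by (rule eval3_gen_poly_cv[OF length_iarr(1) witness_lines(1)])
  have "eval3 (gen_poly arr_A') (cv (1, 1, 2)) \<noteq> 0"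
    unfolding arr_cv by (rule eval3_gen_poly_cv[OF length_iarr(2) witness_lines(2)])
  moreover have "eval3 (cycle_poly arr_A') (cv (1, 1, 2)) = of_int (iW iarr' (1, 1, 2) 1 0 * iW iarr' (1, 1, 2) 3 3 * iW iarr' (1, 1, 2) 2 1 * iW iarr' (1, 1, 2) 0 2
    - iW iarr' (1, 1, 2) 0 0 * iW iarr' (1, 1, 2) 1 3 * iW iarr' (1, 1, 2) 3 1 * iW iarr' (1, 1, 2) 2 2)"
    unfolding arr_cv cycle_poly_def
    by (simp add: ev.eval_in_diff ev.eval_in_mult eval3_W_cv length_iarr)
  then have "eval3 (cycle_poly arr_A') (cv (1, 1, 2)) \<noteq> 0"
    using witness_lines(3) unfolding of_int_eq_0_iff[where 'a = complex, symmetric] by metis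
  ultimately show "eval3 (gen_poly arr_A' * cycle_poly arr_A') (cv (1, 1, 2)) \<noteq> 0"
    by (simp add: ev.eval_in_mult)
qed

lemma proper_exc: "exc_A \<noteq> proj_plane" "exc_A' \<noteq> proj_plane"
  unfolding exc_A_def exc_A'_def
  using zero_locus_proper homogeneous3_gen_poly homogeneous3_exc_A' witness_nonzero witness_gen by blast+

lemma admissible_linesI:
  assumes "admissible L" "ls = map cv L" "eval3 (gen_poly ls) l \<noteq> 0"
  shows "admissible_lines L ls l"
  using assms unfolding admissible_lines_def eval3_gen_poly by blast

lemma outside_exc:
  assumes "l \<noteq> 0"
  shows "proj_point l \<notin> exc_A \<Longrightarrow> admissible_lines iarr arr_A l"
    "proj_point l \<notin> exc_A' \<Longrightarrow> admissible_lines iarr' arr_A' l"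
    "proj_point l \<notin> exc_A' \<Longrightarrow> eval3 (cycle_poly arr_A') l \<noteq> 0"
proof -
  show "admissible_lines iarr arr_A l" if "proj_point l \<notin> exc_A"
    using that zero_locus_iff[OF homogeneous3_gen_poly assms, of arr_A]
    unfolding exc_A_def by (intro admissible_linesI admissible_iarr arr_cv) blast
  have "eval3 (gen_poly arr_A') l \<noteq> 0 \<and> eval3 (cycle_poly arr_A') l \<noteq> 0" if "proj_point l \<notin> exc_A'"
    using that zero_locus_iff[OF homogeneous3_exc_A' assms] unfolding exc_A'_def by (simp add: ev.eval_in_mult)
  then show "proj_point l \<notin> exc_A' \<Longrightarrow> admissible_lines iarr' arr_A' l"
    "proj_point l \<notin> exc_A' \<Longrightarrow> eval3 (cycle_poly arr_A') l \<noteq> 0"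
    by (blast intro: admissible_linesI admissible_iarr arr_cv)+
qed

lemma thresholds_A:
  assumes "admissible_lines iarr arr_A l"
  shows "st (defining_poly (arr_A @ [l])) = 16"
    "smooth_form 10 fs \<Longrightarrow> ct fs (defining_poly (arr_A @ [l])) = 14"
proof -
  interpret admissible_lines iarr arr_A l by fact
  show "st (defining_poly (arr_A @ [l])) = 16" unfolding defining_poly_snoc by (rule st_f)
  have h: "homogeneous3 10 f" using hom_f by simp
  have "syz f (Suc 5) \<noteq> {0}" using syz_6_nonzero[OF rho_logder rho_c_nonzero] by simp
  then show "ct fs (defining_poly (arr_A @ [l])) = 14" if "smooth_form 10 fs"
    using ct_eqI[OF h that syz_5] unfolding defining_poly_snoc by simp
qed

lemma thresholds_A':
  assumes "admissible_lines iarr' arr_A' l" "eval3 (cycle_poly arr_A') l \<noteq> 0"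
  shows "st (defining_poly (arr_A' @ [l])) = 16"
    "smooth_form 10 fs \<Longrightarrow> ct fs (defining_poly (arr_A' @ [l])) = 15"
proof -
  interpret admissible_lines iarr' arr_A' l by fact
  show "st (defining_poly (arr_A' @ [l])) = 16" unfolding defining_poly_snoc by (rule st_f)
  have h: "homogeneous3 10 f" using hom_f by simp
  have z: "syz f 6 = {0}" using assms(2) unfolding cycle_poly_V by (intro syz_6) simp
  have "syz f (Suc 6) \<noteq> {0}" using syz_7_nonzero by simp
  then show "ct fs (defining_poly (arr_A' @ [l])) = 15" if "smooth_form 10 fs"
    using ct_eqI[OF h that z] unfolding defining_poly_snoc by simp
qed

lemma outside_witness: "proj_point (cv (1, 1, 2)) \<notin> exc_A" "proj_point (cv (1, 1, 2)) \<notin> exc_A'"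
  unfolding exc_A_def exc_A'_def
  using zero_locus_iff[OF homogeneous3_gen_poly witness_nonzero] zero_locus_iff[OF homogeneous3_exc_A' witness_nonzero] witness_gen
  by blast+

theorem mainTheorem2:
  shows "(\<exists>ls ls'. line_arrangement ls \<and> line_arrangement ls' \<and> isomorphic_lattices ls ls' \<and>
      (\<forall>fs fs'. smooth_form (length ls) fs \<and> smooth_form (length ls') fs' \<longrightarrow>
        ct fs (defining_poly ls) + st (defining_poly ls)
          \<noteq> ct fs' (defining_poly ls') + st (defining_poly ls')))
    \<and> line_arrangement arr_A \<and> line_arrangement arr_A'
    \<and> (\<exists>Z Z'. zariski_closed Z \<and> Z \<noteq> proj_plane \<and> zariski_closed Z' \<and> Z' \<noteq> proj_plane \<and>
      (\<forall>l l'. l \<noteq> (0, 0, 0) \<and> proj_point l \<notin> Z \<and> l' \<noteq> (0, 0, 0) \<and> proj_point l' \<notin> Z' \<longrightarrow>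
        line l \<notin> line ` set arr_A \<and> line l \<inter> multiple_points arr_A = {} \<and>
        line l' \<notin> line ` set arr_A' \<and> line l' \<inter> multiple_points arr_A' = {} \<and>
        isomorphic_lattices (arr_A @ [l]) (arr_A' @ [l']) \<and>
        (\<forall>fs. smooth_form 10 fs \<longrightarrow>
          ct fs (defining_poly (arr_A @ [l])) = 14 \<and>
          st (defining_poly (arr_A @ [l])) = 16 \<and>
          ct fs (defining_poly (arr_A' @ [l'])) = 15 \<and>
          st (defining_poly (arr_A' @ [l'])) = 16)))"
proof (intro conjI)
  \<comment> \<open>One explicit line outside both loci is added to both arrangements, which gives a
    concrete pair with isomorphic lattices and sums 30 and 31.\<close>
  let ?w = "cv (1, 1, 2)"
  have w: "admissible_lines iarr arr_A ?w" "admissible_lines iarr' arr_A' ?w"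
    "eval3 (cycle_poly arr_A') ?w \<noteq> 0"
    using outside_exc[OF witness_nonzero] outside_witness by blast+
  interpret A: admissible_lines iarr arr_A ?w by (rule w)
  interpret A': admissible_lines iarr' arr_A' ?w by (rule w)
  show "line_arrangement arr_A" "line_arrangement arr_A'"
    using pairwise_indep_line_arrangement[OF A.indep_ls] pairwise_indep_line_arrangement[OF A'.indep_ls]
    by (simp_all add: arr_A_def arr_A'_def)
  have len: "length (arr_A @ [?w]) = 10" "length (arr_A' @ [?w]) = 10" by (simp_all add: arr_A_def arr_A'_def)
  have "ct fs (defining_poly (arr_A @ [?w])) + st (defining_poly (arr_A @ [?w]))
      \<noteq> ct fs' (defining_poly (arr_A' @ [?w])) + st (defining_poly (arr_A' @ [?w]))"
    if "smooth_form 10 fs" "smooth_form 10 fs'" for fs fs'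
    using thresholds_A[OF w(1)] thresholds_A'[OF w(2,3)] that by simp
  moreover have "line_arrangement (arr_A @ [?w])" "line_arrangement (arr_A' @ [?w])"
    by (rule pairwise_indep_line_arrangement, rule A.indep_snoc A'.indep_snoc, simp)+
  moreover have "isomorphic_lattices (arr_A @ [?w]) (arr_A' @ [?w])" by (rule isomorphic_lattices_snoc[OF w(1,2)])
  ultimately show "\<exists>ls ls'. line_arrangement ls \<and> line_arrangement ls' \<and> isomorphic_lattices ls ls' \<and>
      (\<forall>fs fs'. smooth_form (length ls) fs \<and> smooth_form (length ls') fs' \<longrightarrow>
        ct fs (defining_poly ls) + st (defining_poly ls)
          \<noteq> ct fs' (defining_poly ls') + st (defining_poly ls'))"
    using len by metis
  have main: "line l \<notin> line ` set arr_A \<and> line l \<inter> multiple_points arr_A = {} \<and>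
        line l' \<notin> line ` set arr_A' \<and> line l' \<inter> multiple_points arr_A' = {} \<and>
        isomorphic_lattices (arr_A @ [l]) (arr_A' @ [l']) \<and>
        (\<forall>fs. smooth_form 10 fs \<longrightarrow>
          ct fs (defining_poly (arr_A @ [l])) = 14 \<and>
          st (defining_poly (arr_A @ [l])) = 16 \<and>
          ct fs (defining_poly (arr_A' @ [l'])) = 15 \<and>
          st (defining_poly (arr_A' @ [l'])) = 16)"
    if "l \<noteq> (0, 0, 0)" "proj_point l \<notin> exc_A" "l' \<noteq> (0, 0, 0)" "proj_point l' \<notin> exc_A'" for l l'
  proof -
    have nz: "l \<noteq> 0" "l' \<noteq> 0" using that by (simp_all add: zero_prod_def)
    have B: "admissible_lines iarr arr_A l" "admissible_lines iarr' arr_A' l'" "eval3 (cycle_poly arr_A') l' \<noteq> 0"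
      using outside_exc[OF nz(1)] outside_exc[OF nz(2)] that by blast+
    show ?thesis
      using admissible_lines.line_generic[OF B(1)] admissible_lines.line_generic[OF B(2)]
        isomorphic_lattices_snoc[OF B(1,2)] thresholds_A[OF B(1)] thresholds_A'[OF B(2,3)] by blast
  qed
  show "\<exists>Z Z'. zariski_closed Z \<and> Z \<noteq> proj_plane \<and> zariski_closed Z' \<and> Z' \<noteq> proj_plane \<and>
      (\<forall>l l'. l \<noteq> (0, 0, 0) \<and> proj_point l \<notin> Z \<and> l' \<noteq> (0, 0, 0) \<and> proj_point l' \<notin> Z' \<longrightarrow>
        line l \<notin> line ` set arr_A \<and> line l \<inter> multiple_points arr_A = {} \<and>
        line l' \<notin> line ` set arr_A' \<and> line l' \<inter> multiple_points arr_A' = {} \<and>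
        isomorphic_lattices (arr_A @ [l]) (arr_A' @ [l']) \<and>
        (\<forall>fs. smooth_form 10 fs \<longrightarrow>
          ct fs (defining_poly (arr_A @ [l])) = 14 \<and>
          st (defining_poly (arr_A @ [l])) = 16 \<and>
          ct fs (defining_poly (arr_A' @ [l'])) = 15 \<and>
          st (defining_poly (arr_A' @ [l'])) = 16))"
    by (intro exI[of _ exc_A] exI[of _ exc_A'] conjI[OF zariski_closed_exc(1)] conjI[OF proper_exc(1)]
      conjI[OF zariski_closed_exc(2)] conjI[OF proper_exc(2)] allI impI) (elim conjE, rule main)
qed

end
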